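(* Assume the setting in the context (domain $\Omega$, mesh $\mathcal{T}_h$, space $V_{hp}$, DG bilinear form $\mathcal{A}$ of SIPG or LDG type with penalty parameter $\alpha\ge1$, chosen large enough for SIPG so that $\mathcal{A}$ is coercive, subspaces $V_{hp}^B,V_{hp}^C$ and the Oswald operator $\mathsf{Q}_h:V_{hp}\to V_{hp}^C$). Then for every $v\in V_{hp}$, $$\mathcal{A}(v-\mathsf{Q}_h v,v-\mathsf{Q}_h v)+\mathcal{A}(\mathsf{Q}_h v,\mathsf{Q}_h v)\lesssim \mathcal{A}(v,v),$$ and consequently the splitting $V_{hp}=V_{hp}^B+V_{hp}^C$ is stable, i.e. $$\inf_{\substack{v^B\in V_{hp}^B,\ v^C\in V_{hp}^C\\ v^B+v^C=v}}\big[\mathcal{A}(v^B,v^B)+\mathcal{A}(v^C,v^C)\big]\lesssim \mathcal{A}(v,v)\qquad\forall v\in V_{hp},$$ where the hidden constants are independent of the mesh size $h$, the polynomial degree $p$ and the penalty coefficient $\alpha$.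
   Context: $\Omega\subset\mathbb{R}^d$, $d\in\{2,3\}$, is a convex polygonal/polyhedral domain; $\mathcal{T}_h$ is a conforming, quasi-uniform, shape-regular partition of $\Omega$ into elements $\kappa$ of diameter $h_\kappa$, each the affine image $\mathsf{F}_\kappa(\hat\kappa)$ of the reference hypercube $\hat\kappa=(-1,1)^d$; $h=\max h_\kappa$. Polynomial degree $p\ge2$; $V_{hp}=\{v\in L^2(\Omega): v\circ\mathsf{F}_\kappa\in\mathbb{Q}^p(\hat\kappa)\ \forall\kappa\}$, with $\mathbb{Q}^p$ the tensor-product polynomials of degree $\le p$ in each variable. Faces: $\mathcal{F}_h^I$ interior faces, $\mathcal{F}_h^B$ boundary faces, $\mathcal{F}_h=\mathcal{F}_h^I\cup\mathcal{F}_h^B$. For $F\in\mathcal{F}_h^I$ shared by $\kappa^\pm$ with outward normals $\mathbf{n}_{F,\kappa^\pm}$: $[\![v]\!]=v^+\mathbf{n}_{F,\kappa^+}+v^-\mathbf{n}_{F,\kappa^-}$, $\{v\}=(v^++v^-)/2$, $[\![\boldsymbol\tau]\!]=\boldsymbol\tau^+\cdot\mathbf{n}_{F,\kappa^+}+\boldsymbol\tau^-\cdot\mathbf{n}_{F,\kappa^-}$, $\{\boldsymbol\tau\}=(\boldsymbol\tau^++\boldsymbol\tau^-)/2$; on $F\in\mathcal{F}_h^B$, $[\![v]\!]=v\mathbf{n}_F$ (outward normal), $\{\boldsymbol\tau\}=\boldsymbol\tau$. Liftings: for $F\in\mathcal{F}_h$, $r_F:[L^2(F)]^d\to[V_{hp}]^d$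 with $\int_\Omega r_F(\boldsymbol\tau)\cdot\boldsymbol\eta\,dx=-\int_F\boldsymbol\tau\cdot\{\boldsymbol\eta\}\,ds$ for all $\boldsymbol\eta\in[V_{hp}]^d$; for $F\in\mathcal{F}_h^I$, $l_F:L^2(F)\to[V_{hp}]^d$ with $\int_\Omega l_F(v)\cdot\boldsymbol\eta\,dx=-\int_F v[\![\boldsymbol\eta]\!]\,ds$; $\mathcal{R}=\sum_{F\in\mathcal{F}_h}r_F$, $\mathcal{L}=\sum_{F\in\mathcal{F}_h^I}l_F$. Penalty: $\sigma|_F=\alpha p^2/\min(h_{\kappa^+},h_{\kappa^-})$ on $F\in\mathcal{F}_h^I$, $\sigma|_F=\alpha p^2/h_\kappa$ on $F\in\mathcal{F}_h^B$, with $\alpha\ge1$. DG form: with $G(u):=\mathcal{R}([\![u]\!])+\mathcal{L}(\boldsymbol\beta\cdot[\![u]\!])$, $\mathcal{A}(u,v)=\sum_\kappa\int_\kappa\nabla u\cdot\nabla v+\sum_\kappa\int_\kappa\nabla u\cdot G(v)+\sum_\kappa\int_\kappa G(u)\cdot\nabla v+\sum_{F\in\mathcal{F}_h}\int_F\sigma[\![u]\!]\cdot[\![v]\!]+\theta\int_\Omega G(u)\cdot G(v)$, where SIPG: $\theta=0$, $\boldsymbol\beta=\mathbf{0}$, with $\alpha$ large enough for coercivity; LDG: $\theta=1$, $\boldsymbol\beta\in\mathbb{R}^d$ uniformly bounded (possibly zero). Nodes: for each $\kappa$, $\mathcal{N}(\kappa)$ is the set of $(p+1)^d$ mapped tensor-product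 Gauss–Legendre–Lobatto nodes, $\mathcal{N}_I(\kappa)$ those in the interior of $\kappa$, $\mathcal{N}_B(\kappa)$ those on $\partial\kappa$. Subspaces: $V_{hp}^B=\{v\in V_{hp}: v|_\kappa(\xi)=0\ \forall\xi\in\mathcal{N}_I(\kappa),\ \forall\kappa\}$; $V_{hp}^C=\{v\in C^0(\overline\Omega): v\circ\mathsf{F}_\kappa\in\mathbb{Q}^p(\hat\kappa)\ \forall\kappa,\ v|_{\partial\Omega}=0\}$. Oswald operator: $\mathsf{Q}_h v\in V_{hp}^C$ is defined by its nodal values: for each node $\xi$, $\mathsf{Q}_hv(\xi)=0$ if $\xi\in\partial\Omega$, and otherwise $\mathsf{Q}_hv(\xi)$ is the average of $v|_{\kappa'}(\xi)$ over all $\kappa'\in\mathcal{T}_h$ with $\xi\in\overline{\kappa'}$. Note $v-\mathsf{Q}_hv\in V_{hp}^B$. *)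

theory Defs
  imports "HOL-Analysis.Analysis"
begin

(* An element kappa is encoded by its affine map F_kappa(x) = A x + b, i.e. by the pair (A, b).
   A DG function assigns to each element its local polynomial (defined on the whole space),
   so that traces from both sides of a face are available. *)

type_synonym 'n elt = "(real^'n^'n) \<times> (real^'n)"
type_synonym 'n dgfun = "'n elt \<Rightarrow> real^'n \<Rightarrow> real"
type_synonym 'n dgvec = "'n elt \<Rightarrow> real^'n \<Rightarrow> real^'n"

definition emap :: "'n::finite elt \<Rightarrow> real^'n \<Rightarrow> real^'n" where
  "emap K x = fst K *v x + snd K"

definition ref_cube :: "(real^'n::finite) set" where
  "ref_cube = {x. \<forall>i. -1 \<le> x$i \<and> x$i \<le> 1}"

(* closure of the element kappa = F_kappa((-1,1)^d) *)
definition elem :: "'n::finite elt \<Rightarrow> (real^'n) set" where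
  "elem K = emap K ` ref_cube"

definition hsize :: "'n::finite elt \<Rightarrow> real" where
  "hsize K = diameter (elem K)"

definition inradius :: "'n::finite elt \<Rightarrow> real" where
  "inradius K = Sup {r. \<exists>c. ball c r \<subseteq> elem K}"

definition admissible_mesh :: "(real^'n::finite) set \<Rightarrow> 'n elt set \<Rightarrow> real \<Rightarrow> real \<Rightarrow> bool" where
  "admissible_mesh \<Omega> T csr cqu \<longleftrightarrow>
     (CARD('n) = 2 \<or> CARD('n) = 3) \<and>
     open \<Omega> \<and> connected \<Omega> \<and> convex \<Omega> \<and> bounded \<Omega> \<and> \<Omega> \<noteq> {} \<and>
     finite T \<and> T \<noteq> {} \<and>
     (\<forall>K\<in>T. invertible (fst K)) \<and>
     closure \<Omega> = (\<Union>K\<in>T. elem K) \<and>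
     (\<forall>K\<in>T. \<forall>K'\<in>T. K \<noteq> K' \<longrightarrow> interior (elem K) \<inter> interior (elem K') = {}) \<and>
     (\<forall>K\<in>T. \<forall>K'\<in>T. (elem K \<inter> elem K') face_of elem K \<and> (elem K \<inter> elem K') face_of elem K') \<and>
     (\<forall>K\<in>T. hsize K \<le> csr * inradius K) \<and>
     (\<forall>K\<in>T. (MAX K'\<in>T. hsize K') \<le> cqu * hsize K)"

definition Qp_ref :: "nat \<Rightarrow> (real^'n::finite \<Rightarrow> real) set" where
  "Qp_ref p = {q. \<exists>c. q = (\<lambda>x. \<Sum>m\<in>{m::'n \<Rightarrow> nat. \<forall>i. m i \<le> p}. c m * (\<Prod>i\<in>UNIV. (x$i) ^ (m i)))}"

definition Vhp :: "'n::finite elt set \<Rightarrow> nat \<Rightarrow> 'n dgfun set" where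
  "Vhp T p = {v. (\<forall>K\<in>T. (v K \<circ> emap K) \<in> Qp_ref p) \<and> (\<forall>K. K \<notin> T \<longrightarrow> v K = (\<lambda>_. 0))}"

definition VhpVec :: "'n::finite elt set \<Rightarrow> nat \<Rightarrow> 'n dgvec set" where
  "VhpVec T p = {w. \<forall>i. (\<lambda>K x. w K x $ i) \<in> Vhp T p}"

definition grad :: "(real^'n::finite \<Rightarrow> real) \<Rightarrow> real^'n \<Rightarrow> real^'n" where
  "grad f x = (\<chi> i. frechet_derivative f (at x) (axis i 1))"

definition int_faces :: "'n::finite elt set \<Rightarrow> (real^'n) set set" where
  "int_faces T = {F. \<exists>K\<in>T. \<exists>K'\<in>T. K \<noteq> K' \<and> F = elem K \<inter> elem K' \<and> F facet_of elem K}"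

definition bdry_faces :: "(real^'n::finite) set \<Rightarrow> 'n elt set \<Rightarrow> (real^'n) set set" where
  "bdry_faces \<Omega> T = {F. \<exists>K\<in>T. F facet_of elem K \<and> F \<subseteq> frontier \<Omega>}"

definition all_faces :: "(real^'n::finite) set \<Rightarrow> 'n elt set \<Rightarrow> (real^'n) set set" where
  "all_faces \<Omega> T = int_faces T \<union> bdry_faces \<Omega> T"

(* the elements having F as a face (two for interior faces, one for boundary faces) *)
definition nbrs :: "'n::finite elt set \<Rightarrow> (real^'n) set \<Rightarrow> 'n elt set" where
  "nbrs T F = {K\<in>T. F \<subseteq> elem K}"

definition onormal :: "'n::finite elt \<Rightarrow> (real^'n) set \<Rightarrow> real^'n" where
  "onormal K F = (THE n. norm n = 1 \<and> (\<forall>x\<in>F. \<forall>y\<in>elem K. inner n (y - x) \<le> 0))"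

(* surface integral over a face F = F_K({y in [-1,1]^d. y_j = s}), computed via the
   reference facet; the (d-1)-dimensional area scaling of the facet with normal e_j under
   y -> A y + b is |det A| * |A^{-T} e_j| (Nanson's formula); the factor 1/2 compensates
   the integration over y_j in [-1,1] of an integrand independent of y_j. *)
definition face_integral :: "'n::finite elt set \<Rightarrow> (real^'n) set \<Rightarrow> (real^'n \<Rightarrow> real) \<Rightarrow> real" where
  "face_integral T F g =
     (case (SOME (K, j, s). K \<in> T \<and> (s = 1 \<or> s = -1) \<and> F = emap K ` {y\<in>ref_cube. y$j = s}) of
       (K, j, s) \<Rightarrow>
         \<bar>det (fst K)\<bar> * norm (matrix_inv (transpose (fst K)) *v axis j 1) / 2 *
         integral ref_cube (\<lambda>y. g (emap K (\<chi> i. if i = j then s else y$i))))"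

definition jump :: "'n::finite elt set \<Rightarrow> 'n dgfun \<Rightarrow> (real^'n) set \<Rightarrow> real^'n \<Rightarrow> real^'n" where
  "jump T v F x = (\<Sum>K\<in>nbrs T F. v K x *\<^sub>R onormal K F)"

definition avgv :: "'n::finite elt set \<Rightarrow> 'n dgvec \<Rightarrow> (real^'n) set \<Rightarrow> real^'n \<Rightarrow> real^'n" where
  "avgv T w F x = (\<Sum>K\<in>nbrs T F. w K x) /\<^sub>R real (card (nbrs T F))"

definition jumpv :: "'n::finite elt set \<Rightarrow> 'n dgvec \<Rightarrow> (real^'n) set \<Rightarrow> real^'n \<Rightarrow> real" where
  "jumpv T w F x = (\<Sum>K\<in>nbrs T F. inner (w K x) (onormal K F))"

definition vol_int :: "'n::finite elt set \<Rightarrow> 'n dgvec \<Rightarrow> 'n dgvec \<Rightarrow> real" where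
  "vol_int T f g = (\<Sum>K\<in>T. integral (elem K) (\<lambda>x. inner (f K x) (g K x)))"

definition rlift :: "'n::finite elt set \<Rightarrow> nat \<Rightarrow> (real^'n) set \<Rightarrow> (real^'n \<Rightarrow> real^'n) \<Rightarrow> 'n dgvec" where
  "rlift T p F \<tau> = (THE w. w \<in> VhpVec T p \<and>
      (\<forall>\<eta>\<in>VhpVec T p. vol_int T w \<eta> = - face_integral T F (\<lambda>x. inner (\<tau> x) (avgv T \<eta> F x))))"

definition llift :: "'n::finite elt set \<Rightarrow> nat \<Rightarrow> (real^'n) set \<Rightarrow> (real^'n \<Rightarrow> real) \<Rightarrow> 'n dgvec" where
  "llift T p F \<phi> = (THE w. w \<in> VhpVec T p \<and>
      (\<forall>\<eta>\<in>VhpVec T p. vol_int T w \<eta> = - face_integral T F (\<lambda>x. \<phi> x * jumpv T \<eta> F x)))"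

definition Glift :: "(real^'n::finite) set \<Rightarrow> 'n elt set \<Rightarrow> nat \<Rightarrow> real^'n \<Rightarrow> 'n dgfun \<Rightarrow> 'n dgvec" where
  "Glift \<Omega> T p \<beta> u = (\<lambda>K x.
      (\<Sum>F\<in>all_faces \<Omega> T. rlift T p F (jump T u F) K x)
    + (\<Sum>F\<in>int_faces T. llift T p F (\<lambda>y. inner \<beta> (jump T u F y)) K x))"

definition sigma :: "'n::finite elt set \<Rightarrow> real \<Rightarrow> nat \<Rightarrow> (real^'n) set \<Rightarrow> real" where
  "sigma T \<alpha> p F = \<alpha> * (real p)^2 / Min (hsize ` nbrs T F)"

definition dgform :: "(real^'n::finite) set \<Rightarrow> 'n elt set \<Rightarrow> nat \<Rightarrow> real \<Rightarrow> real \<Rightarrow> real^'n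
                       \<Rightarrow> 'n dgfun \<Rightarrow> 'n dgfun \<Rightarrow> real" where
  "dgform \<Omega> T p \<alpha> \<theta> \<beta> u v =
      vol_int T (\<lambda>K. grad (u K)) (\<lambda>K. grad (v K))
    + vol_int T (\<lambda>K. grad (u K)) (Glift \<Omega> T p \<beta> v)
    + vol_int T (Glift \<Omega> T p \<beta> u) (\<lambda>K. grad (v K))
    + (\<Sum>F\<in>all_faces \<Omega> T. face_integral T F (\<lambda>x. sigma T \<alpha> p F * inner (jump T u F x) (jump T v F x)))
    + \<theta> * vol_int T (Glift \<Omega> T p \<beta> u) (Glift \<Omega> T p \<beta> v)"

(* Legendre polynomials (Bonnet recursion) and Gauss-Legendre-Lobatto points:
   the roots of (1 - t^2) P_p'(t) *)
fun legendre :: "nat \<Rightarrow> real \<Rightarrow> real" where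
  "legendre 0 x = 1"
| "legendre (Suc 0) x = x"
| "legendre (Suc (Suc n)) x =
     ((2 * real n + 3) * x * legendre (Suc n) x - (real n + 1) * legendre n x) / (real n + 2)"

definition gll :: "nat \<Rightarrow> real set" where
  "gll p = {t. -1 \<le> t \<and> t \<le> 1 \<and> (1 - t^2) * deriv (legendre p) t = 0}"

definition nodes :: "'n::finite elt \<Rightarrow> nat \<Rightarrow> (real^'n) set" where
  "nodes K p = emap K ` {\<xi>. \<forall>i. \<xi>$i \<in> gll p}"

definition int_nodes :: "'n::finite elt \<Rightarrow> nat \<Rightarrow> (real^'n) set" where
  "int_nodes K p = emap K ` {\<xi>. \<forall>i. \<xi>$i \<in> gll p \<and> -1 < \<xi>$i \<and> \<xi>$i < 1}"

definition VB :: "'n::finite elt set \<Rightarrow> nat \<Rightarrow> 'n dgfun set" where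
  "VB T p = {v \<in> Vhp T p. \<forall>K\<in>T. \<forall>\<xi>\<in>int_nodes K p. v K \<xi> = 0}"

definition VC :: "(real^'n::finite) set \<Rightarrow> 'n elt set \<Rightarrow> nat \<Rightarrow> 'n dgfun set" where
  "VC \<Omega> T p = {v \<in> Vhp T p. \<exists>g. continuous_on (closure \<Omega>) g \<and>
        (\<forall>K\<in>T. \<forall>x\<in>elem K. v K x = g x) \<and> (\<forall>x\<in>frontier \<Omega>. g x = 0)}"

definition oswald :: "(real^'n::finite) set \<Rightarrow> 'n elt set \<Rightarrow> nat \<Rightarrow> 'n dgfun \<Rightarrow> 'n dgfun" where
  "oswald \<Omega> T p v = (THE w. w \<in> VC \<Omega> T p \<and>
      (\<forall>K\<in>T. \<forall>\<xi>\<in>nodes K p. w K \<xi> =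
         (if \<xi> \<in> frontier \<Omega> then 0
          else (\<Sum>K'\<in>{K'\<in>T. \<xi> \<in> elem K'}. v K' \<xi>) / real (card {K'\<in>T. \<xi> \<in> elem K'}))))"

definition dgsub :: "'n dgfun \<Rightarrow> 'n dgfun \<Rightarrow> 'n dgfun" where
  "dgsub v w = (\<lambda>K x. v K x - w K x)"

definition dgadd :: "'n dgfun \<Rightarrow> 'n dgfun \<Rightarrow> 'n dgfun" where
  "dgadd v w = (\<lambda>K x. v K x + w K x)"

end

theory Submission
  imports Defs "HOL-Computational_Algebra.Polynomial"
begin

text \<open>Write \<open>Q\<close> for the Oswald interpolant of \<open>v\<close>. At a node, \<open>v - Q\<close> is controlled by the jumps of
  \<open>v\<close> across the faces through that node, because any two elements sharing the node are linked by a chain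
  of elements with common facets through it. Gauss--Lobatto quadrature is equivalent to the
  \<open>L\<^sup>2\<close> norm uniformly in the degree, and its end weights are of order \<open>1/p\<^sup>2\<close>. Nodes carrying
  jumps lie on facets, so passing from facet quadrature to volume quadrature gains a factor
  \<open>h/p\<^sup>2\<close>, while the inverse inequality for the gradient loses \<open>p\<^sup>4/h\<^sup>2\<close>. Hence
  the gradient energy of \<open>v - Q\<close> is at most a constant times the sum over the faces of
  \<open>p\<^sup>2/h\<close> times the squared jumps, which the penalty term dominates since \<open>\<alpha> \<ge> 1\<close>.
  The discrete trace inequality bounds the liftings by the same jump term, so the form is
  equivalent to broken gradient energy plus penalty; and \<open>Q\<close> has no jumps, so \<open>v - Q\<close> and \<open>v\<close>
  have the same penalty.\<close>

section \<open>Legendre polynomials and Gauss--Lobatto quadrature\<close>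

text \<open>Uniformity drives the organisation. Every constant is built from \<open>csr\<close>,
  \<open>cqu\<close>, the dimension and the bound on \<beta>, so it can be named before a mesh is
  given. Independence of \<alpha> comes from keeping two jump terms apart:
  \<open>scaled_jumps\<close>, free of \<alpha>, bounds the liftings and the averaging error, while
  \<open>penalty\<close> dominates \<alpha> times it. For SIPG the threshold on \<alpha> absorbs the
  cross term; for LDG gradient and lifting form a complete square and no threshold occurs. Two
  obstacles remain. \<open>face_integral\<close> uses an unspecified parametrisation of a face,
  possibly from either neighbour, so traces, nodes and weights must be carried from one
  parametrisation to another. This succeeds because an affine bijection between faces of the cube is
  a signed permutation of the free coordinates, and such maps preserve the tensor-product space and
  the symmetric Gauss-Lobatto nodes and weights. The chains of facet neighbours must exist and be
  bounded in length: existence is a general position argument, with convexity of the domain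
  supplying a boundary facet at boundary nodes, and the bound is a comparison of volumes.\<close>

definition pint :: "real poly \<Rightarrow> real" where
  "pint q = integral {-1..1} (poly q)"

lemma poly_integrable: "poly (q::real poly) integrable_on {a..b}"
  by (intro integrable_continuous_interval continuous_intros)

lemma poly_fun_eqs:
  "poly (a + b) = (\<lambda>x. poly a x + poly b x)" "poly (a - b) = (\<lambda>x. poly a x - poly b x)"
  "poly (smult c a) = (\<lambda>x. c * poly a x)" "poly (- a) = (\<lambda>x. - poly a x)" "poly (0 :: real poly) = (\<lambda>x. 0)"
  for a b :: "real poly"
  by auto

lemma pint_add: "pint (a + b) = pint a + pint b"
  unfolding pint_def poly_fun_eqs by (simp add: integral_add poly_integrable)

lemma pint_diff: "pint (a - b) = pint a - pint b"
  unfolding pint_def poly_fun_eqs by (simp add: integral_diff poly_integrable)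

lemma pint_smult: "pint (smult c a) = c * pint a"
  unfolding pint_def poly_fun_eqs by simp

lemma pint_0 [simp]: "pint 0 = 0"
  unfolding pint_def poly_fun_eqs by simp

lemma pint_sum: "pint (\<Sum>i\<in>S. f i) = (\<Sum>i\<in>S. pint (f i))"
  by (induction S rule: infinite_finite_induct) (auto simp: pint_add)

lemma pint_pderiv: "pint (pderiv q) = poly q 1 - poly q (-1)"
proof -
  have "(poly (pderiv q) has_integral (poly q 1 - poly q (-1))) {-1..1}"
    by (rule fundamental_theorem_of_calculus)
       (auto intro: has_field_derivative_at_within[OF poly_DERIV]
             simp flip: has_real_derivative_iff_has_vector_derivative)
  then show ?thesis
    unfolding pint_def by (rule integral_unique)
qed

lemma pint_mono: "(\<And>x. x \<in> {-1..1} \<Longrightarrow> poly a x \<le> poly b x) \<Longrightarrow> pint a \<le> pint b"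
  unfolding pint_def by (rule integral_le) (auto simp: poly_integrable)

lemma pint_nonneg: "(\<And>x. x \<in> {-1..1} \<Longrightarrow> 0 \<le> poly a x) \<Longrightarrow> 0 \<le> pint a"
  using pint_mono[of 0 a] by simp

lemma pint_eq_0_imp:
  assumes "\<And>x. x \<in> {-1..1} \<Longrightarrow> 0 \<le> poly a x" "pint a = 0"
  shows "a = 0"
proof (rule ccontr)
  assume "a \<noteq> 0"
  then have "finite {x. poly a x = 0}" by (rule poly_roots_finite)
  moreover have "{-1..1} \<subseteq> {x. poly a x = 0}"
  proof -
    have "\<forall>x\<in>{-1..1}. poly a x = 0"
      using assms integral_eq_0_iff[of "-1" 1 "poly a"] unfolding pint_def
      by (simp add: continuous_on_poly)
    then show ?thesis by auto
  qed
  ultimately show False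
    using infinite_Icc[of "-1::real" 1] finite_subset[of "{-1..1}" "{x. poly a x = 0}"] by simp
qed

lemma pint_pos:
  assumes "\<And>x. x \<in> {-1..1} \<Longrightarrow> 0 \<le> poly a x" "a \<noteq> 0"
  shows "0 < pint a"
  using pint_nonneg[of a] pint_eq_0_imp[of a] assms by fastforce

lemma pint_parts:
  assumes "poly f 1 = 0" "poly f (-1) = 0"
  shows "pint (pderiv f * g) = - pint (f * pderiv g)"
proof -
  have "pint (pderiv (f * g)) = 0"
    using assms by (simp add: pint_pderiv)
  then show ?thesis
    by (simp add: pderiv_mult pint_add mult.commute)
qed

section \<open>Legendre polynomials: recursion, differential equation, orthogonality and inverse
  inequalities\<close>

fun leg :: "nat \<Rightarrow> real poly" where
  "leg 0 = 1"
| "leg (Suc 0) = [:0, 1:]"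
| "leg (Suc (Suc n)) = smult (1 / (real n + 2))
     (smult (2 * real n + 3) ([:0, 1:] * leg (Suc n)) - smult (real n + 1) (leg n))"

lemma poly_leg: "poly (leg n) x = legendre n x"
  by (induction n rule: leg.induct) (auto simp: field_simps)

lemma leg_rec:
  "(real n + 2) * poly (leg (Suc (Suc n))) x
     = (2 * real n + 3) * x * poly (leg (Suc n)) x - (real n + 1) * poly (leg n) x"
  by (simp add: field_simps)

lemma leg_rec_pderiv:
  "(real n + 2) * poly (pderiv (leg (Suc (Suc n)))) x
     = (2 * real n + 3) * (poly (leg (Suc n)) x + x * poly (pderiv (leg (Suc n))) x)
       - (real n + 1) * poly (pderiv (leg n)) x"
  by (simp add: pderiv_smult pderiv_diff pderiv_mult pderiv_pCons field_simps)

text \<open>The two identities need each other: the induction step uses the second to eliminate P_n'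
  from the differentiated recursion, and a combination of both to reach the second at the next
  index.\<close>

lemma leg_pderiv_relations:
  "poly (pderiv (leg (Suc n))) x = (real n + 1) * poly (leg n) x + x * poly (pderiv (leg n)) x \<and>
   x * poly (pderiv (leg (Suc n))) x - poly (pderiv (leg n)) x = (real n + 1) * poly (leg (Suc n)) x"
proof (induction n)
  case 0
  then show ?case by (simp add: pderiv_pCons)
next
  case (Suc n)
  let ?P = "\<lambda>n. poly (leg n) x" and ?D = "\<lambda>n. poly (pderiv (leg n)) x"
  have i: "?D (Suc n) = (real n + 1) * ?P n + x * ?D n"
    and ii: "x * ?D (Suc n) - ?D n = (real n + 1) * ?P (Suc n)"
    using Suc by auto
  have det_bound: "?D n = x * ?D (Suc n) - (real n + 1) * ?P (Suc n)"
    using ii by simp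
  have "(real n + 2) * ?D (Suc (Suc n)) = (real n + 2) * ((real n + 2) * ?P (Suc n) + x * ?D (Suc n))"
    unfolding leg_rec_pderiv det_bound by algebra
  then have 1: "?D (Suc (Suc n)) = (real n + 2) * ?P (Suc n) + x * ?D (Suc n)"
    by simp
  \<comment> \<open>Taking x times the second identity minus the first removes P_n'.\<close>
  have 2: "(x\<^sup>2 - 1) * ?D (Suc n) = (real n + 1) * (x * ?P (Suc n) - ?P n)"
  proof -
    have "x * (x * ?D (Suc n) - ?D n) - (?D (Suc n) - x * ?D n) = (x\<^sup>2 - 1) * ?D (Suc n)"
      by algebra
    then show ?thesis unfolding ii using i by (simp add: algebra_simps)
  qed
  have "x * ?D (Suc (Suc n)) - ?D (Suc n) = (real n + 2) * x * ?P (Suc n) + (x\<^sup>2 - 1) * ?D (Suc n)"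
    unfolding 1 by algebra
  also have "\<dots> = (real n + 2) * ?P (Suc (Suc n))"
    unfolding 2 leg_rec by algebra
  finally show ?case using 1 by (simp add: algebra_simps)
qed

abbreviation "sqm1 \<equiv> [:-1, 0, 1:] :: real poly"

lemma poly_sqm1: "poly sqm1 x = x\<^sup>2 - 1"
  by (simp add: power2_eq_square)

lemma sqm1_pderiv_leg:
  "sqm1 * pderiv (leg (Suc n)) = smult (real n + 1) ([:0, 1:] * leg (Suc n) - leg n)"
proof -
  have "(x\<^sup>2 - 1) * poly (pderiv (leg (Suc n))) x
      = (real n + 1) * (x * poly (leg (Suc n)) x - poly (leg n) x)" for x
    using leg_pderiv_relations[of n x] by algebra
  then have "poly (sqm1 * pderiv (leg (Suc n))) x = poly (smult (real n + 1) ([:0, 1:] * leg (Suc n) - leg n)) x" for x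
    unfolding poly_mult poly_sqm1 by simp
  then show ?thesis by (intro poly_ext)
qed

text \<open>Differentiating \<open>sqm1_pderiv_leg\<close> and applying the second derivative
  relation returns a multiple of P_n. The eigenvalue n (n + 1) of this Sturm-Liouville form gives
  orthogonality and the end values of P_n'.\<close>

lemma legendre_ode: "pderiv (sqm1 * pderiv (leg n)) = smult (real n * (real n + 1)) (leg n)"
proof (cases n)
  case 0
  then show ?thesis by (simp del: mult_pCons_left)
next
  case (Suc m)
  have "poly (pderiv (smult (real m + 1) ([:0, 1:] * leg (Suc m) - leg m))) x
     = (real m + 1) * (poly (leg (Suc m)) x + (x * poly (pderiv (leg (Suc m))) x - poly (pderiv (leg m)) x))" for x
    by (simp add: pderiv_smult pderiv_diff pderiv_mult pderiv_pCons del: leg.simps mult_pCons_left)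
  also have "\<dots> x = (real m + 1) * (real m + 2) * poly (leg (Suc m)) x" for x
    unfolding conjunct2[OF leg_pderiv_relations] by (simp add: algebra_simps del: leg.simps)
  finally have "pderiv (smult (real m + 1) ([:0, 1:] * leg (Suc m) - leg m)) = smult ((real m + 1) * (real m + 2)) (leg (Suc m))"
    by (intro poly_ext) (simp del: leg.simps)
  then show ?thesis
    unfolding Suc sqm1_pderiv_leg by (simp add: algebra_simps)
qed

text \<open>No boundary term appears in the integration by parts since x^2 - 1 vanishes at both
  ends. With \<open>g\<close> another Legendre polynomial the right side is symmetric in the two
  indices, which gives \<open>leg_ortho\<close>; with \<open>g\<close> an antiderivative it gives
  \<open>leg_pderiv_ortho\<close>.\<close>

lemma pint_ode:
  "real n * (real n + 1) * pint (leg n * g) = - pint (sqm1 * pderiv (leg n) * pderiv g)"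
proof -
  have "real n * (real n + 1) * pint (leg n * g) = pint (pderiv (sqm1 * pderiv (leg n)) * g)"
    unfolding legendre_ode by (simp add: pint_smult)
  also have "\<dots> = - pint (sqm1 * pderiv (leg n) * pderiv g)"
    by (rule pint_parts) (simp_all only: poly_mult poly_sqm1, simp_all)
  finally show ?thesis .
qed

text \<open>Both are eigenfunctions of the same symmetric operator, with different eigenvalues n (n
  + 1) and m (m + 1).\<close>

lemma leg_ortho:
  assumes "m \<noteq> n"
  shows "pint (leg m * leg n) = 0"
proof -
  have "real n * (real n + 1) * pint (leg n * leg m) = real m * (real m + 1) * pint (leg m * leg n)"
    unfolding pint_ode by (simp only: mult_ac)
  then have "(real n * (real n + 1) - real m * (real m + 1)) * pint (leg m * leg n) = 0"
    by (simp add: algebra_simps)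
  moreover have "real n * (real n + 1) - real m * (real m + 1) = (real n - real m) * (real n + real m + 1)"
    by algebra
  ultimately show ?thesis using assms by (auto simp: add_nonneg_eq_0_iff)
qed

lemma degree_leg: "degree (leg n) = n \<and> coeff (leg n) n > 0"
proof -
  have "degree (leg n) \<le> n \<and> coeff (leg n) n > 0"
  proof (induction n rule: leg.induct)
    case (3 n)
    have "degree (smult (2 * real n + 3) ([:0, 1:] * leg (Suc n)) - smult (real n + 1) (leg n)) \<le> Suc (Suc n)"
      by (rule degree_diff_le; rule order.trans[OF degree_smult_le])
         (use 3 degree_mult_le[of "[:0,1:]" "leg (Suc n)"] in auto)
    moreover have "coeff (leg n) (Suc (Suc n)) = 0"
      using 3 by (auto intro: coeff_eq_0)
    moreover have "coeff ([:0, 1:] * leg (Suc n)) (Suc (Suc n)) = coeff (leg (Suc n)) (Suc n)"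
      by simp
    ultimately show ?case using 3 by (auto intro: order.trans[OF degree_smult_le])
  qed auto
  then show ?thesis using le_degree[of "leg n" n] by auto
qed

lemma leg_nz [simp]: "leg n \<noteq> 0"
  using degree_leg[of n] by auto

lemma leg_expand: "degree q \<le> n \<Longrightarrow> \<exists>a. q = (\<Sum>k\<le>n. smult (a k) (leg k))"
proof (induction n arbitrary: q)
  case 0
  then obtain c where "q = [:c:]" by (metis degree_eq_zeroE le_0_eq)
  then show ?case by (intro exI[of _ "\<lambda>_. c"]) simp
next
  case (Suc n)
  let ?c = "coeff q (Suc n) / coeff (leg (Suc n)) (Suc n)"
  have "degree (q - smult ?c (leg (Suc n))) \<le> n"
  proof (rule degree_le, safe)
    fix i assume i: "n < i"
    show "coeff (q - smult ?c (leg (Suc n))) i = 0"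
    proof (cases "i = Suc n")
      case True
      then show ?thesis using degree_leg[of "Suc n"] by auto
    next
      case False
      then show ?thesis using i Suc.prems degree_leg[of "Suc n"] by (simp add: coeff_eq_0 del: leg.simps)
    qed
  qed
  then obtain a where "q - smult ?c (leg (Suc n)) = (\<Sum>k\<le>n. smult (a k) (leg k))"
    using Suc.IH by blast
  then have "q = (\<Sum>k\<le>Suc n. smult ((a(Suc n := ?c)) k) (leg k))"
    by (simp add: algebra_simps del: leg.simps)
  then show ?case by blast
qed

lemma leg_ortho_low:
  assumes "degree q < n"
  shows "pint (leg n * q) = 0"
proof -
  have "degree q \<le> n - 1" using assms by simp
  then obtain a where "q = (\<Sum>k\<le>n - 1. smult (a k) (leg k))"
    using leg_expand by blast
  then show ?thesis
    using assms by (auto simp: sum_distrib_left pint_sum pint_smult intro!: sum.neutral leg_ortho)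
qed

lemma leg_1 [simp]: "poly (leg n) 1 = 1"
  by (induction n rule: leg.induct) (auto simp: field_simps)

lemma leg_reflect: "poly (leg n) (-x) = (-1) ^ n * poly (leg n) x"
  by (induction n rule: leg.induct) (auto simp: field_simps)

text \<open>Integrating (x P_n^2)' gives 2 from the end values. The product rule turns it into the
  squared norm plus twice the integral of x P_n P_n', and x P_n' = n P_n + P_(n-1)', whose last term
  is orthogonal to P_n by degree.\<close>

lemma leg_norm: "pint (leg n * leg n) = 2 / (2 * real n + 1)"
proof (cases n)
  case 0
  have "pint (pderiv [:0, 1:]) = 2" by (subst pint_pderiv) simp
  then show ?thesis using 0 by (simp add: pderiv_pCons one_pCons)
next
  case (Suc m)
  let ?X = "[:0, 1:] :: real poly"
  have e: "?X * pderiv (leg n) - pderiv (leg m) = smult (real n) (leg n)"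
    using conjunct2[OF leg_pderiv_relations[of m]] unfolding Suc
    by (intro poly_ext) (simp add: algebra_simps del: leg.simps)
  have "pint (leg n * pderiv (leg m)) = 0"
    by (rule leg_ortho_low) (use degree_leg[of m] degree_pderiv[of "leg m"] Suc in auto)
  then have "real n * pint (leg n * leg n) = pint (leg n * (?X * pderiv (leg n)))"
    using arg_cong[OF e, of "\<lambda>q. pint (leg n * q)"]
    by (simp add: right_diff_distrib pint_diff pint_smult del: leg.simps mult_pCons_left)
  moreover have "pint (pderiv (?X * leg n * leg n)) = 2"
    unfolding pint_pderiv poly_mult by (simp add: leg_reflect[of n 1, simplified] flip: power_mult_distrib)
  moreover have "pderiv (?X * leg n * leg n) = leg n * leg n + smult 2 (leg n * (?X * pderiv (leg n)))"
    by (intro poly_ext) (simp add: pderiv_mult pderiv_pCons algebra_simps del: leg.simps)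
  ultimately have "pint (leg n * leg n) + 2 * (real n * pint (leg n * leg n)) = 2"
    by (simp only: pint_add pint_smult)
  then show ?thesis by (simp add: field_simps)
qed

text \<open>At the end points the factor x^2 - 1 removes the second derivative from the Legendre
  equation.\<close>

lemma leg_pderiv_1: "poly (pderiv (leg n)) 1 = real n * (real n + 1) / 2"
  and leg_pderiv_m1: "poly (pderiv (leg n)) (-1) = - ((-1) ^ n * (real n * (real n + 1) / 2))"
proof -
  have *: "2 * x * poly (pderiv (leg n)) x + (x\<^sup>2 - 1) * poly (pderiv (pderiv (leg n))) x
       = real n * (real n + 1) * poly (leg n) x" for x
    using arg_cong[OF legendre_ode[of n], of "\<lambda>q. poly q x"]
    unfolding pderiv_mult poly_add poly_mult poly_sqm1
    by (simp add: pderiv_pCons algebra_simps power2_eq_square del: leg.simps)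
  show "poly (pderiv (leg n)) 1 = real n * (real n + 1) / 2"
    using *[of 1] by simp
  show "poly (pderiv (leg n)) (-1) = - ((-1) ^ n * (real n * (real n + 1) / 2))"
    using *[of "-1"] leg_reflect[of n 1] by (simp add: field_simps)
qed

text \<open>Integration by parts: P_n'' has degree below n and is orthogonal to P_n, so only the
  boundary values of P_n P_n' survive.\<close>

lemma leg_pderiv_norm: "pint (pderiv (leg n) * pderiv (leg n)) = real n * (real n + 1)"
proof (cases n)
  case 0
  then show ?thesis by simp
next
  case (Suc m)
  have "pint (pderiv (leg n * pderiv (leg n))) = real n * (real n + 1)"
    unfolding pint_pderiv poly_mult leg_pderiv_1 leg_pderiv_m1
    using leg_reflect[of n 1] by (simp flip: power_mult_distrib mult.assoc)
  moreover have "pint (leg n * pderiv (pderiv (leg n))) = 0"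
    by (rule leg_ortho_low)
       (use degree_leg[of n] degree_pderiv[of "leg n"] degree_pderiv[of "pderiv (leg n)"] Suc in auto)
  ultimately show ?thesis by (simp add: pderiv_mult pint_add del: leg.simps)
qed

lemma pint_square_leg_sum:
  "pint ((\<Sum>k\<le>n. smult (a k) (leg k)) * (\<Sum>k\<le>n. smult (a k) (leg k)))
     = (\<Sum>k\<le>n. (a k)\<^sup>2 * (2 / (2 * real k + 1)))"
proof -
  have "pint ((\<Sum>k\<le>n. smult (a k) (leg k)) * (\<Sum>k\<le>n. smult (a k) (leg k)))
     = (\<Sum>j\<le>n. \<Sum>k\<le>n. a j * a k * pint (leg j * leg k))"
    by (simp add: sum_product pint_sum pint_smult mult_ac)
  also have "\<dots> = (\<Sum>j\<le>n. \<Sum>k\<le>n. if k = j then (a j)\<^sup>2 * (2 / (2 * real j + 1)) else 0)"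
    by (intro sum.cong refl) (auto simp: leg_ortho leg_norm power2_eq_square)
  finally show ?thesis by (simp add: sum.delta)
qed

text \<open>The weights 2/(2k+1) are the squared norms of the Legendre polynomials, so for a
  Legendre expansion the first factor is its squared L2 norm. The second factor becomes the constant
  of an inverse inequality, with \<open>b\<close> the values of P_k or of P_k' at a point.\<close>

lemma weighted_cauchy:
  fixes a b :: "nat \<Rightarrow> real"
  shows "(\<Sum>k\<le>n. a k * b k)\<^sup>2 \<le> (\<Sum>k\<le>n. (a k)\<^sup>2 * (2 / (2 * real k + 1))) * (\<Sum>k\<le>n. ((2 * real k + 1) / 2) * (b k)\<^sup>2)"
proof -
  have "(\<Sum>k\<le>n. a k * b k) = (\<Sum>k\<le>n. (a k * sqrt (2 / (2 * real k + 1))) * (sqrt ((2 * real k + 1) / 2) * b k))"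
  proof (intro sum.cong refl)
    fix k
    have "sqrt (2 / (2 * real k + 1)) * sqrt ((2 * real k + 1) / 2) = 1"
      by (subst real_sqrt_mult[symmetric]) simp
    then show "a k * b k = a k * sqrt (2 / (2 * real k + 1)) * (sqrt ((2 * real k + 1) / 2) * b k)"
      by (metis (no_types, lifting) mult.assoc mult.commute mult_1)
  qed
  then show ?thesis
    using Cauchy_Schwarz_ineq_sum[of "\<lambda>k. a k * sqrt (2 / (2 * real k + 1))" "\<lambda>k. sqrt ((2 * real k + 1) / 2) * b k" "{..n}"]
    by (simp add: power_mult_distrib del: real_sqrt_divide)
qed

lemma sum_odd: "(\<Sum>k\<le>n. (2 * real k + 1) / 2) = (real n + 1)\<^sup>2 / 2"
  by (induction n) (auto simp: power2_eq_square field_simps)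

text \<open>Since P_k has modulus 1 at the ends, the Cauchy-Schwarz constant is the sum of (2k+1)/2
  over k \<le> n.\<close>

lemma trace_inverse_1d:
  assumes "degree q \<le> n" "s = 1 \<or> s = -1"
  shows "(poly q s)\<^sup>2 \<le> (real n + 1)\<^sup>2 / 2 * pint (q * q)"
proof -
  obtain a where q: "q = (\<Sum>k\<le>n. smult (a k) (leg k))"
    using leg_expand[OF assms(1)] by blast
  have "(poly (leg k) s)\<^sup>2 = 1" for k
    using assms(2) leg_reflect[of k 1] by (auto simp flip: power_mult power_mult_distrib)
  then have "(\<Sum>k\<le>n. ((2 * real k + 1) / 2) * (poly (leg k) s)\<^sup>2) = (real n + 1)\<^sup>2 / 2"
    using sum_odd by simp
  then show ?thesis
    using weighted_cauchy[of a "\<lambda>k. poly (leg k) s" n]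
    unfolding q pint_square_leg_sum poly_sum poly_smult by (simp only: mult.commute)
qed

text \<open>Cauchy-Schwarz is applied pointwise and then integrated; the squared norms k (k+1) of
  P_k' enter and produce the growth n^4. The assumption n \<ge> 1 bounds n + 1 by 2n.\<close>

lemma inverse_ineq_1d:
  assumes "degree q \<le> n" "n \<ge> 1"
  shows "pint (pderiv q * pderiv q) \<le> 4 * real n ^ 4 * pint (q * q)"
proof -
  obtain a where q: "q = (\<Sum>k\<le>n. smult (a k) (leg k))"
    using leg_expand[OF assms(1)] by blast
  let ?S = "\<Sum>k\<le>n. smult ((2 * real k + 1) / 2) (pderiv (leg k) * pderiv (leg k))"
  have dq: "pderiv q = (\<Sum>k\<le>n. smult (a k) (pderiv (leg k)))"
    unfolding q by (simp add: higher_pderiv_sum[of 1, simplified] pderiv_smult)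
  have "pint (pderiv q * pderiv q) \<le> pint (smult (pint (q * q)) ?S)"
  proof (rule pint_mono)
    fix x
    show "poly (pderiv q * pderiv q) x \<le> poly (smult (pint (q * q)) ?S) x"
      using weighted_cauchy[of a "\<lambda>k. poly (pderiv (leg k)) x" n]
      unfolding q[symmetric] pint_square_leg_sum[of a n, unfolded q[symmetric], symmetric]
      by (simp add: dq poly_sum power2_eq_square)
  qed
  also have "\<dots> = pint (q * q) * (\<Sum>k\<le>n. (2 * real k + 1) / 2 * (real k * (real k + 1)))"
    by (simp add: pint_smult pint_sum leg_pderiv_norm)
  also have "\<dots> \<le> pint (q * q) * (4 * real n ^ 4)"
  proof (rule mult_left_mono)
    have "(\<Sum>k\<le>n. (2 * real k + 1) / 2 * (real k * (real k + 1)))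
        \<le> (\<Sum>k\<le>n. (2 * real k + 1) / 2 * (real n * (real n + 1)))"
      by (intro sum_mono mult_left_mono mult_mono) auto
    also have "\<dots> = (real n + 1)\<^sup>2 / 2 * (real n * (real n + 1))"
      unfolding sum_distrib_right[symmetric] sum_odd ..
    also have "\<dots> \<le> (2 * real n)\<^sup>2 / 2 * (real n * (2 * real n))"
      using assms(2) by (intro mult_mono divide_right_mono power_mono) auto
    finally show "(\<Sum>k\<le>n. (2 * real k + 1) / 2 * (real k * (real k + 1))) \<le> 4 * real n ^ 4"
      by (simp add: power2_eq_square power4_eq_xxxx)
  next
    show "0 \<le> pint (q * q)" by (rule pint_nonneg) auto
  qed
  finally show ?thesis by (simp add: mult.commute)
qed


section \<open>Gauss-Lobatto nodes and weights, exactness of the quadrature\<close>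

lemma gll_eq: "gll p = {t. -1 \<le> t \<and> t \<le> 1 \<and> (1 - t\<^sup>2) * poly (pderiv (leg p)) t = 0}"
proof -
  have "legendre p = poly (leg p)" by (simp add: poly_leg fun_eq_iff)
  then have "deriv (legendre p) t = poly (pderiv (leg p)) t" for t
    by (simp add: DERIV_imp_deriv poly_DERIV)
  then show ?thesis by (simp add: gll_def)
qed

lemma gll_bounds: "t \<in> gll p \<Longrightarrow> -1 \<le> t \<and> t \<le> 1"
  by (simp add: gll_def)

lemma gll_ends [simp]: "1 \<in> gll p" "-1 \<in> gll p"
  by (auto simp: gll_def)

lemma leg_pderiv_reflect: "poly (pderiv (leg p)) (-t) = - ((-1) ^ p * poly (pderiv (leg p)) t)"
proof -
  have "pcompose (leg p) [:0, -1:] = smult ((-1) ^ p) (leg p)"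
    by (intro poly_ext) (simp add: poly_pcompose leg_reflect)
  from arg_cong[OF this, of "\<lambda>q. poly (pderiv q) t"] show ?thesis
    by (simp add: pderiv_pcompose poly_pcompose pderiv_smult pderiv_pCons)
qed

lemma gll_uminus: "t \<in> gll p \<Longrightarrow> -t \<in> gll p"
  by (auto simp: gll_eq leg_pderiv_reflect)

text \<open>The three-term recursion would pass a common root down to P_0 = 1.\<close>

lemma leg_consecutive_no_common_root: "\<not> (poly (leg n) r = 0 \<and> poly (leg (Suc n)) r = 0)"
proof (induction n)
  case (Suc n)
  show ?case
  proof
    assume *: "poly (leg (Suc n)) r = 0 \<and> poly (leg (Suc (Suc n))) r = 0"
    then have "(real n + 1) * poly (leg n) r = 0"
      using leg_rec[of n r] by (simp del: leg.simps)
    then have "poly (leg n) r = 0" by simp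
    then show False using * Suc by blast
  qed
qed simp

text \<open>At a double root of P_p' the Legendre equation gives P_p(r) = 0, and
  \<open>sqm1_pderiv_leg\<close> then gives P_(p-1)(r) = 0, so two consecutive Legendre polynomials
  would share a root.\<close>

lemma leg_pderiv_simple_root:
  assumes "poly (pderiv (leg p)) r = 0" "poly (pderiv (pderiv (leg p))) r = 0" "p \<ge> 1"
  shows False
proof -
  obtain n where p: "p = Suc n" using assms(3) by (cases p) auto
  have "real p * (real p + 1) * poly (leg p) r = poly (pderiv (sqm1 * pderiv (leg p))) r"
    unfolding legendre_ode by simp
  also have "\<dots> = 0"
    unfolding pderiv_mult using assms by simp
  finally have 1: "poly (leg p) r = 0" using assms(3) by simp
  have "poly (sqm1 * pderiv (leg p)) r = 0"
    unfolding poly_mult using assms by simp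
  then have "poly (leg n) r = 0"
    using 1 unfolding p sqm1_pderiv_leg by (simp del: leg.simps)
  then show False
    using 1 p leg_consecutive_no_common_root[of n r] by simp
qed

lemma pderiv_surj: "\<exists>s. pderiv s = q \<and> degree s \<le> degree q + 1" for q :: "real poly"
proof -
  let ?s = "\<Sum>i\<le>degree q. monom (coeff q i / (real i + 1)) (i + 1)"
  have "pderiv ?s = (\<Sum>i\<le>degree q. monom (coeff q i) i)"
    unfolding higher_pderiv_sum[of 1, simplified]
    by (intro sum.cong refl) (simp add: pderiv_monom add.commute)
  then have "pderiv ?s = q"
    by (simp add: poly_as_sum_of_monoms)
  moreover have "degree ?s \<le> degree q + 1"
    by (intro degree_sum_le) (auto intro: order.trans[OF degree_monom_le])
  ultimately show ?thesis by blast
qed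

text \<open>Writing q as a derivative s', the Legendre equation turns the integral into a multiple
  of that of P_p s, which is zero since s has degree below p.\<close>

lemma leg_pderiv_ortho:
  assumes "degree q + 1 < p"
  shows "pint (sqm1 * pderiv (leg p) * q) = 0"
proof -
  obtain s where s: "pderiv s = q" "degree s \<le> degree q + 1"
    using pderiv_surj by blast
  then have "pint (leg p * s) = 0"
    by (intro leg_ortho_low) (use assms in simp)
  then show ?thesis using pint_ode[of p s] s by simp
qed

lemma prod_roots_factor:
  fixes f :: "real poly"
  assumes "finite R" "\<And>r. r \<in> R \<Longrightarrow> poly f r = 0"
  shows "\<exists>g. f = (\<Prod>r\<in>R. [:-r, 1:]) * g"
  using assms
proof (induction R rule: finite_induct)
  case (insert a R)
  then obtain g where g: "f = (\<Prod>r\<in>R. [:-r, 1:]) * g" by auto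
  have "poly f a = 0" using insert by auto
  moreover have "poly (\<Prod>r\<in>R. [:-r, 1:]) a \<noteq> 0"
    using insert by (auto simp: poly_prod)
  ultimately have "poly g a = 0" using g by simp
  then obtain h where "g = [:-a, 1:] * h"
    by (metis dvdE poly_eq_0_iff_dvd)
  then have "f = (\<Prod>r\<in>insert a R. [:-r, 1:]) * h"
    unfolding prod.insert[OF insert.hyps] using g by (simp only: mult_ac)
  then show ?case by blast
qed auto

lemma degree_prod_linear: "degree (\<Prod>r\<in>R. [:-r, 1:] :: real poly) = card R"
  by (cases "finite R") (simp_all add: degree_prod_eq_sum_degree)

lemma no_root_const_sign:
  assumes "\<And>x. -1 < x \<Longrightarrow> x < 1 \<Longrightarrow> poly g x \<noteq> (0::real)"
  shows "(\<forall>x. -1 < x \<and> x < 1 \<longrightarrow> 0 < poly g x) \<or> (\<forall>x. -1 < x \<and> x < 1 \<longrightarrow> poly g x < 0)"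
proof (rule ccontr)
  assume "\<not> ?thesis"
  then obtain x y where xy: "-1 < x" "x < 1" "-1 < y" "y < 1" "poly g x < 0" "poly g y > 0"
    using assms by (metis linorder_less_linear)
  have "\<exists>z. (x < z \<or> y < z) \<and> (z < x \<or> z < y) \<and> poly g z = 0"
    using poly_IVT_pos[of x y g] poly_IVT_neg[of y x g] xy by (cases "x < y"; cases "x = y") force+
  then show False using assms xy by (metis less_trans)
qed

text \<open>The sign change argument for orthogonal polynomials, applied to (x^2 - 1) P_p', which is
  orthogonal to all degrees up to p - 2: with fewer than p - 1 interior roots, its product with the
  linear factors of these roots would have constant sign and integral zero.\<close>

lemma card_gll:
  assumes "p \<ge> 1"
  shows "finite (gll p) \<and> card (gll p) = p + 1"
proof -
  let ?D = "pderiv (leg p)"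
  define R where "R = {r. -1 < r \<and> r < 1 \<and> poly ?D r = 0}"
  have D0: "?D \<noteq> 0"
    using leg_pderiv_1[of p] assms by auto
  have dD: "degree ?D = p - 1"
    using degree_leg[of p] by (simp add: degree_pderiv)
  have fin: "finite R"
    unfolding R_def by (rule finite_subset[OF _ poly_roots_finite[OF D0]]) auto
  have gR: "gll p = insert 1 (insert (-1) R)"
    by (auto simp: gll_eq R_def power2_eq_1_iff abs_square_less_1 order_less_le)
  have nR: "1 \<notin> R" "-1 \<notin> R" by (auto simp: R_def)
  obtain g where g: "?D = (\<Prod>r\<in>R. [:-r, 1:]) * g"
    using prod_roots_factor[OF fin, of ?D] by (auto simp: R_def)
  let ?q = "\<Prod>r\<in>R. [:-r, 1:] :: real poly"
  have le: "card R \<le> p - 1"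
  proof -
    have "degree ?D = degree ?q + degree g"
      using g D0 by (metis degree_mult_eq mult_eq_0_iff)
    then show ?thesis using dD degree_prod_linear by simp
  qed
  have "\<not> card R < p - 1"
  proof
    assume lt: "card R < p - 1"
    \<comment> \<open>A root of the cofactor inside the interval would also be a root in
      \<open>R\<close>, hence a double root of P_p', which is excluded.\<close>
    have "poly g x \<noteq> 0" if x: "-1 < x" "x < 1" for x
    proof
      assume gx: "poly g x = 0"
      then have "poly ?D x = 0" using g by simp
      then have "x \<in> R" using x by (simp add: R_def)
      then have "poly ?q x = 0" using fin by (auto simp: poly_prod)
      then have "poly (pderiv ?D) x = 0"
        using gx by (subst g) (simp add: pderiv_mult)
      then show False
        using leg_pderiv_simple_root[of p x] assms \<open>poly ?D x = 0\<close> by simp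
    qed
    then have sg: "(\<forall>x. -1 < x \<and> x < 1 \<longrightarrow> 0 < poly g x) \<or> (\<forall>x. -1 < x \<and> x < 1 \<longrightarrow> poly g x < 0)"
      by (rule no_root_const_sign)
    let ?f = "sqm1 * ?D * ?q"
    have f0: "pint ?f = 0"
      by (rule leg_pderiv_ortho) (use lt degree_prod_linear[of R] in simp)
    have fx: "poly ?f x = - ((1 - x\<^sup>2) * (poly ?q x)\<^sup>2 * poly g x)" for x
      by (subst g) (simp only: poly_mult poly_sqm1, simp add: power2_eq_square algebra_simps)
    have ge: "0 \<le> (1 - x\<^sup>2)" if "x \<in> {-1..1}" for x :: real
      using that abs_square_le_1[of x] by (simp add: abs_le_iff)
    have f_nz: "?f \<noteq> 0"
      using D0 fin unfolding mult_eq_0_iff by (simp add: prod_zero_iff)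
    show False
      using sg
    proof
      assume pos: "\<forall>x. -1 < x \<and> x < 1 \<longrightarrow> 0 < poly g x"
      have "- ?f = 0"
      proof (rule pint_eq_0_imp)
        fix x :: real assume x: "x \<in> {-1..1}"
        show "0 \<le> poly (- ?f) x"
        proof (cases "x = 1 \<or> x = -1")
          case True
          then show ?thesis unfolding poly_minus fx by auto
        next
          case False
          then have "0 < poly g x" using pos x by auto
          then show ?thesis unfolding poly_minus fx using ge[OF x] by simp
        qed
      qed (use f0 pint_smult[of "-1" ?f] in simp)
      then show False using f_nz by simp
    next
      assume neg: "\<forall>x. -1 < x \<and> x < 1 \<longrightarrow> poly g x < 0"
      have "?f = 0"
      proof (rule pint_eq_0_imp[OF _ f0])
        fix x :: real assume x: "x \<in> {-1..1}"
        show "0 \<le> poly ?f x"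
        proof (cases "x = 1 \<or> x = -1")
          case True
          then show ?thesis unfolding fx by auto
        next
          case False
          then have "poly g x < 0" using neg x by auto
          then show ?thesis unfolding fx using ge[OF x] by (simp add: mult_nonneg_nonpos)
        qed
      qed
      then show False using f_nz by simp
    qed
  qed
  then have "card R = p - 1" using le by simp
  then show ?thesis
    using fin nR assms unfolding gR by simp
qed

lemma finite_gll: "p \<ge> 1 \<Longrightarrow> finite (gll p)"
  using card_gll by blast

definition lagrange :: "nat \<Rightarrow> real \<Rightarrow> real poly" where
  "lagrange p \<xi> = (\<Prod>\<eta>\<in>gll p - {\<xi>}. smult (1 / (\<xi> - \<eta>)) [:-\<eta>, 1:])"

definition gll_weight :: "nat \<Rightarrow> real \<Rightarrow> real" where
  "gll_weight p \<xi> = pint (lagrange p \<xi>)"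

lemma lagrange_eval:
  assumes "p \<ge> 1" "\<xi> \<in> gll p" "\<eta> \<in> gll p"
  shows "poly (lagrange p \<xi>) \<eta> = (if \<eta> = \<xi> then 1 else 0)"
proof (cases "\<eta> = \<xi>")
  case True
  then have "poly (smult (1 / (\<xi> - x)) [:- x, 1:]) \<eta> = 1" if "x \<in> gll p - {\<xi>}" for x
    using that True by (simp add: diff_divide_distrib[symmetric])
  then show ?thesis unfolding lagrange_def poly_prod using True by (simp add: prod.neutral)
next
  case False
  then show ?thesis
    unfolding lagrange_def poly_prod using assms finite_gll
    by (auto intro!: prod_zero bexI[of _ \<eta>])
qed

lemma degree_lag:
  assumes "p \<ge> 1" "\<xi> \<in> gll p"
  shows "degree (lagrange p \<xi>) \<le> p"
proof -
  have "degree (lagrange p \<xi>) \<le> (\<Sum>\<eta>\<in>gll p - {\<xi>}. degree (smult (1 / (\<xi> - \<eta>)) [:-\<eta>, 1:]))"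
    unfolding lagrange_def
    using degree_prod_sum_le[of "gll p - {\<xi>}" "\<lambda>\<eta>. smult (1 / (\<xi> - \<eta>)) [:-\<eta>, 1:]"] finite_gll[OF assms(1)]
    unfolding o_def by blast
  also have "\<dots> \<le> (\<Sum>\<eta>\<in>gll p - {\<xi>}. 1)"
    by (intro sum_mono) (auto intro: order.trans[OF degree_smult_le])
  also have "\<dots> = p" using card_gll[OF assms(1)] assms(2) by simp
  finally show ?thesis .
qed

lemma lagrange_interp:
  assumes "p \<ge> 1" "degree q \<le> p"
  shows "q = (\<Sum>\<xi>\<in>gll p. smult (poly q \<xi>) (lagrange p \<xi>))"
proof (rule poly_eqI_degree)
  fix x assume x: "x \<in> gll p"
  have "poly (\<Sum>\<xi>\<in>gll p. smult (poly q \<xi>) (lagrange p \<xi>)) x = (\<Sum>\<xi>\<in>gll p. if \<xi> = x then poly q x else 0)"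
    unfolding poly_sum using x assms by (intro sum.cong refl) (auto simp: lagrange_eval)
  then show "poly q x = poly (\<Sum>\<xi>\<in>gll p. smult (poly q \<xi>) (lagrange p \<xi>)) x"
    using x finite_gll[OF assms(1)] by simp
next
  have "degree (\<Sum>\<xi>\<in>gll p. smult (poly q \<xi>) (lagrange p \<xi>)) \<le> p"
    using degree_lag assms finite_gll
    by (intro degree_sum_le) (auto intro: order.trans[OF degree_smult_le])
  then show "degree (\<Sum>\<xi>\<in>gll p. smult (poly q \<xi>) (lagrange p \<xi>)) < card (gll p)"
    using card_gll[OF assms(1)] by simp
qed (use card_gll assms in auto)

text \<open>Division by N = (x^2 - 1) P_p', which has degree p + 1 and vanishes at every node. The
  remainder is reproduced by Lagrange interpolation; a nonzero quotient has degree at most p - 2, so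
  N times it integrates to zero.\<close>

lemma gll_exact:
  assumes p: "p \<ge> 1" and f: "degree f \<le> 2 * p - 1"
  shows "(\<Sum>\<xi>\<in>gll p. gll_weight p \<xi> * poly f \<xi>) = pint f"
proof -
  let ?N = "sqm1 * pderiv (leg p)"
  have D0: "pderiv (leg p) \<noteq> 0" using leg_pderiv_1[of p] p by auto
  have dN: "degree ?N = p + 1"
    using D0 degree_leg[of p] p by (subst degree_mult_eq) (auto simp: degree_pderiv)
  have N0: "?N \<noteq> 0" using dN by auto
  let ?d = "f div ?N" and ?r = "f mod ?N"
  have fe: "f = ?N * ?d + ?r" by simp
  have dr: "degree ?r \<le> p"
    using degree_mod_less[OF N0, of f] dN by auto
  have z: "pint (?N * ?d) = 0"
  proof (cases "?d = 0")
    case False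
    have e: "degree (?N * ?d) = p + 1 + degree ?d"
      unfolding degree_mult_eq[OF N0 False] dN ..
    then have "degree ?r < degree (?N * ?d)" using dr by linarith
    then have "degree (?N * ?d + ?r) = degree (?N * ?d)" by (rule degree_add_eq_left)
    then have "degree f = degree (?N * ?d)" by (simp only: fe[symmetric])
    then show ?thesis
      using e f p by (intro leg_pderiv_ortho) linarith
  qed simp
  have N\<xi>: "poly ?N \<xi> = 0" if "\<xi> \<in> gll p" for \<xi>
    using that unfolding poly_mult poly_sqm1 by (auto simp: gll_eq)
  have "pint f = pint ?r"
    using z by (subst fe) (simp only: pint_add)
  also have "\<dots> = (\<Sum>\<xi>\<in>gll p. gll_weight p \<xi> * poly ?r \<xi>)"
    by (subst lagrange_interp[OF p dr]) (simp add: pint_sum pint_smult gll_weight_def mult.commute)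
  also have "\<dots> = (\<Sum>\<xi>\<in>gll p. gll_weight p \<xi> * poly f \<xi>)"
  proof (intro sum.cong refl)
    fix \<xi> assume "\<xi> \<in> gll p"
    then have "poly f \<xi> = poly ?r \<xi>"
      using N\<xi> arg_cong[OF fe, of "\<lambda>q. poly q \<xi>"]
      by (simp only: poly_add poly_mult[of ?N ?d] mult_zero_left add_0_left)
    then show "gll_weight p \<xi> * poly ?r \<xi> = gll_weight p \<xi> * poly f \<xi>" by simp
  qed
  finally show ?thesis by simp
qed

lemma pint_reflect: "pint (pcompose q [:0, -1:]) = pint q"
proof -
  have "poly (pcompose q [:0, -1:]) = (\<lambda>x. poly q (-x))" by (simp add: poly_pcompose fun_eq_iff)
  moreover have "(poly q has_integral pint q) {-1..1}"
    unfolding pint_def by (rule integrable_integral[OF poly_integrable])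
  then have "((\<lambda>x. poly q (-x)) has_integral pint q) {-1..-(-1)}"
    by (rule has_integral_reflect_lemma_real)
  ultimately show ?thesis
    unfolding pint_def[of "pcompose q [:0, -1:]"] by (simp only: integral_unique minus_minus)
qed

text \<open>The reflected Lagrange polynomial of \<xi> is 1 at -\<xi> and 0 at the other nodes, so
  by exactness its integral is the weight of -\<xi>; reflection does not change the
  integral.\<close>

lemma gll_weight_uminus:
  assumes "p \<ge> 1" "\<xi> \<in> gll p"
  shows "gll_weight p (-\<xi>) = gll_weight p \<xi>"
proof -
  let ?r = "\<lambda>q. pcompose q [:0, -1:] :: real poly"
  have pr: "pint (?r q) = pint q" for q
    by (rule pint_reflect)
  have "pint (?r (lagrange p \<xi>)) = (\<Sum>\<eta>\<in>gll p. gll_weight p \<eta> * poly (?r (lagrange p \<xi>)) \<eta>)"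
    by (rule gll_exact[symmetric]) (use degree_lag[OF assms] assms in \<open>auto simp: degree_pcompose\<close>)
  also have "\<dots> = (\<Sum>\<eta>\<in>gll p. if \<eta> = -\<xi> then gll_weight p \<eta> else 0)"
    by (intro sum.cong refl) (use assms in \<open>auto simp: poly_pcompose lagrange_eval gll_uminus\<close>)
  also have "\<dots> = gll_weight p (-\<xi>)"
    using assms gll_uminus finite_gll by simp
  finally show ?thesis by (simp add: pr gll_weight_def)
qed

lemma gll_cases: "\<xi> \<in> gll p \<Longrightarrow> \<xi> = 1 \<or> \<xi> = -1 \<or> poly (pderiv (leg p)) \<xi> = 0"
proof -
  assume "\<xi> \<in> gll p"
  then have "(1 - \<xi>) * (1 + \<xi>) * poly (pderiv (leg p)) \<xi> = 0"
    unfolding gll_eq by (simp add: power2_eq_square algebra_simps)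
  then show ?thesis by (auto simp: eq_neg_iff_add_eq_0 add.commute)
qed

text \<open>The polynomial (P_p')^2 (1 + x) has degree 2p - 1 and vanishes at every node except 1,
  so exactness isolates this weight. The bound 1 + x \<le> 2 loses a factor two against the true
  value 2/(p (p+1)) but keeps the order 1/p^2.\<close>

lemma gll_weight_one:
  assumes p: "p \<ge> 1"
  shows "0 < gll_weight p 1 \<and> gll_weight p 1 \<le> 4 / (real p * (real p + 1))"
proof -
  define D where "D = pderiv (leg p)"
  define f where "f = D * D * [:1, 1:]"
  define c where "c = real p * (real p + 1)"
  have c: "c > 0" unfolding c_def using p by simp
  have D1: "poly D 1 = c / 2" unfolding D_def c_def by (rule leg_pderiv_1)
  have D0: "D \<noteq> 0" using D1 c by auto
  have dD: "degree D = p - 1" unfolding D_def using degree_leg[of p] by (simp add: degree_pderiv)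
  have f0: "f \<noteq> 0" unfolding f_def using D0 by (intro no_zero_divisors) auto
  have fx: "poly f x = (poly D x)\<^sup>2 * (1 + x)" for x
    unfolding f_def poly_mult by (simp add: power2_eq_square)
  have "degree f \<le> 2 * p - 1"
  proof -
    have "degree f = degree (D * D) + degree [:1, 1 :: real:]"
      unfolding f_def using D0 by (intro degree_mult_eq) auto
    also have "degree (D * D) = degree D + degree D"
      using D0 by (intro degree_mult_eq)
    finally show ?thesis using dD p by simp
  qed
  then have "pint f = (\<Sum>\<xi>\<in>gll p. gll_weight p \<xi> * poly f \<xi>)"
    by (rule gll_exact[OF p, symmetric])
  also have "\<dots> = (\<Sum>\<xi>\<in>gll p. if \<xi> = 1 then gll_weight p 1 * (2 * (poly D 1)\<^sup>2) else 0)"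
  proof (intro sum.cong refl)
    fix \<xi> assume "\<xi> \<in> gll p"
    then consider "\<xi> = 1" | "\<xi> \<noteq> 1" "\<xi> = -1" | "\<xi> \<noteq> 1" "poly D \<xi> = 0"
      using gll_cases unfolding D_def by blast
    then show "gll_weight p \<xi> * poly f \<xi> = (if \<xi> = 1 then gll_weight p 1 * (2 * (poly D 1)\<^sup>2) else 0)"
      unfolding fx by cases simp_all
  qed
  also have "\<dots> = gll_weight p 1 * (2 * (poly D 1)\<^sup>2)"
    using finite_gll[OF p] by simp
  finally have e: "pint f = gll_weight p 1 * (c * c / 2)"
    unfolding D1 by (simp add: power2_eq_square)
  have "0 < pint f"
    by (rule pint_pos[OF _ f0]) (simp add: fx)
  then have g1: "gll_weight p 1 > 0"
    unfolding e using c by (simp add: zero_less_mult_iff)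
  have "pint f \<le> pint (smult 2 (D * D))"
  proof (rule pint_mono)
    fix x :: real assume "x \<in> {-1..1}"
    then show "poly f x \<le> poly (smult 2 (D * D)) x"
      using mult_left_mono[of "1 + x" 2 "(poly D x)\<^sup>2"]
      unfolding fx poly_mult poly_smult by (simp add: power2_eq_square)
  qed
  also have "\<dots> = 2 * c"
    unfolding D_def pint_smult leg_pderiv_norm c_def ..
  finally have "c * (gll_weight p 1 * c) \<le> c * 4" unfolding e by (simp add: mult_ac)
  then have "gll_weight p 1 * c \<le> 4" using c by (subst (asm) mult_le_cancel_left_pos)
  then show ?thesis using g1 c unfolding c_def[symmetric] by (simp add: pos_le_divide_eq)
qed

lemma gll_weight_ends:
  assumes "p \<ge> 1" "s = 1 \<or> s = -1"
  shows "0 < gll_weight p s" "gll_weight p s \<le> 4 / (real p * (real p + 1))"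
  using gll_weight_one[OF assms(1)] gll_weight_uminus[OF assms(1) gll_ends(1)] assms(2) by auto

text \<open>For an interior node, exactness is applied to (1 - x^2) times the squared linear factors
  of the other interior nodes: this is nonnegative, not zero, and vanishes at all nodes but \<xi>.
  Its degree 2p - 2 is within reach of the quadrature.\<close>

lemma gll_weight_pos:
  assumes p: "p \<ge> 1" and \<xi>: "\<xi> \<in> gll p"
  shows "0 < gll_weight p \<xi>"
proof (cases "\<xi> = 1 \<or> \<xi> = -1")
  case True
  then show ?thesis using gll_weight_ends p by blast
next
  case False
  let ?R = "gll p - {\<xi>, 1, -1}"
  let ?q = "\<Prod>r\<in>?R. [:-r, 1:] :: real poly"
  let ?f = "- sqm1 * (?q * ?q)"
  have cR: "card ?R = p - 2"
    using False \<xi> card_gll[OF p] by (subst card_Diff_subset) auto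
  \<comment> \<open>An interior node is a third node besides 1 and -1; without p \<ge> 2 the
    truncated difference \<open>p - 2\<close> would spoil the degree count.\<close>
  have p2: "p \<ge> 2"
  proof (rule ccontr)
    assume "\<not> p \<ge> 2"
    then have "card (gll p) \<le> 2" using card_gll[OF p] by simp
    moreover have "card {\<xi>, 1, -1} \<le> card (gll p)"
      using \<xi> by (intro card_mono) (auto simp: finite_gll[OF p])
    ultimately show False using False by auto
  qed
  have q0: "?q \<noteq> 0" using finite_gll[OF p] by (simp add: prod_zero_iff)
  have "degree ?f \<le> degree (- sqm1) + (degree ?q + degree ?q)"
    by (rule order.trans[OF degree_mult_le]) (use degree_mult_le[of ?q ?q] in simp)
  then have "degree ?f \<le> 2 * p - 1"
    unfolding degree_prod_linear cR using p2 by simp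
  then have "pint ?f = (\<Sum>\<eta>\<in>gll p. gll_weight p \<eta> * poly ?f \<eta>)"
    by (rule gll_exact[OF p, symmetric])
  also have "\<dots> = (\<Sum>\<eta>\<in>gll p. if \<eta> = \<xi> then gll_weight p \<xi> * poly ?f \<xi> else 0)"
  proof (intro sum.cong refl)
    fix \<eta> assume "\<eta> \<in> gll p"
    then have "\<eta> = \<xi> \<or> \<eta> = 1 \<or> \<eta> = -1 \<or> \<eta> \<in> ?R" by auto
    moreover have "poly ?q \<eta> = 0" if "\<eta> \<in> ?R"
      using that finite_gll[OF p] unfolding poly_prod by (auto intro!: prod_zero bexI[of _ \<eta>])
    ultimately show "gll_weight p \<eta> * poly ?f \<eta> = (if \<eta> = \<xi> then gll_weight p \<xi> * poly ?f \<xi> else 0)"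
      unfolding poly_mult poly_minus poly_sqm1 by auto
  qed
  finally have e: "pint ?f = gll_weight p \<xi> * poly ?f \<xi>"
    using \<xi> finite_gll[OF p] by simp
  have nn: "0 \<le> poly ?f x" if "x \<in> {-1..1}" for x
  proof -
    have "0 \<le> (1 - x\<^sup>2) * (poly ?q x)\<^sup>2"
      using that abs_square_le_1[of x] by (intro mult_nonneg_nonneg) (auto simp: abs_le_iff)
    then show ?thesis
      unfolding poly_mult poly_minus poly_sqm1 by (simp add: power2_eq_square)
  qed
  have "?f \<noteq> 0" using q0 by (intro no_zero_divisors) auto
  then have "pint ?f > 0"
    by (intro pint_pos nn)
  moreover have "0 \<le> poly ?f \<xi>" using nn gll_bounds[OF \<xi>] by simp
  ultimately show ?thesis using e by (simp add: zero_less_mult_iff)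
qed

text \<open>The discrete squared norms of the Legendre polynomials: the quadrature is exact except for the square of the one of top degree.\<close>

definition leg_weight :: "nat \<Rightarrow> nat \<Rightarrow> real" where
  "leg_weight p k = (if k < p then 2 / (2 * real k + 1) else 2 / real p)"

text \<open>Only the top index deviates, by the factor (2p+1)/p \<le> 3. This 3, once per
  coordinate, is the whole loss in passing between quadrature and the L2 norm.\<close>

lemma leg_weight_bounds: "k \<le> p \<Longrightarrow> p \<ge> 1 \<Longrightarrow> 2 / (2 * real k + 1) \<le> leg_weight p k \<and> leg_weight p k \<le> 3 * (2 / (2 * real k + 1))"
  by (auto simp: leg_weight_def divide_le_eq le_divide_eq)

text \<open>The square of P_p has degree 2p, one too many for exactness. Subtracting (x^2 - 1)
  (P_p')^2 / p^2 cancels the leading coefficient and changes no nodal value; the integral of the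
  correction is known from the Legendre equation.\<close>

lemma gll_leg_top:
  assumes p: "p \<ge> 1"
  shows "(\<Sum>\<xi>\<in>gll p. gll_weight p \<xi> * (poly (leg p) \<xi>)\<^sup>2) = 2 / real p"
proof -
  let ?L = "leg p" and ?D = "pderiv (leg p)"
  let ?g = "smult (1 / (real p)\<^sup>2) (sqm1 * (?D * ?D))"
  let ?f = "?L * ?L - ?g"
  have D0: "?D \<noteq> 0" using leg_pderiv_1[of p] p by auto
  have dD: "degree ?D = p - 1" using degree_leg[of p] by (simp add: degree_pderiv)
  have lD: "coeff ?D (p - 1) = real p * coeff ?L p"
    using p by (simp add: coeff_pderiv)
  have dg: "degree (sqm1 * (?D * ?D)) = 2 * p"
    using D0 dD p by (simp add: degree_mult_eq del: mult_pCons_left)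
  have cg: "coeff (sqm1 * (?D * ?D)) (2 * p) = (real p * coeff ?L p)\<^sup>2"
  proof -
    have "lead_coeff (sqm1 * (?D * ?D)) = lead_coeff sqm1 * (lead_coeff ?D * lead_coeff ?D)"
      by (simp only: lead_coeff_mult)
    then show ?thesis unfolding dg dD lD by (simp add: power2_eq_square)
  qed
  have dL: "degree (?L * ?L) = 2 * p"
    using degree_leg[of p] by (simp add: degree_mult_eq)
  have cL: "coeff (?L * ?L) (2 * p) = (coeff ?L p)\<^sup>2"
    using lead_coeff_mult[of ?L ?L] degree_leg[of p] unfolding dL by (simp add: power2_eq_square)
  have "degree ?f \<le> 2 * p - 1"
  proof (rule degree_le, safe)
    fix i assume i: "2 * p - 1 < i"
    show "coeff ?f i = 0"
    proof (cases "i = 2 * p")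
      case True
      then show ?thesis using cL cg p by (simp add: power_mult_distrib del: mult_pCons_left)
    next
      case False
      then have "i > 2 * p" using i by simp
      then have "coeff (?L * ?L) i = 0" "coeff (sqm1 * (?D * ?D)) i = 0"
        using dL dg by (simp_all add: coeff_eq_0 del: mult_pCons_left)
      then show ?thesis by (simp del: mult_pCons_left)
    qed
  qed
  then have "(\<Sum>\<xi>\<in>gll p. gll_weight p \<xi> * poly ?f \<xi>) = pint ?f"
    using gll_exact p by blast
  moreover have "poly ?f \<xi> = (poly ?L \<xi>)\<^sup>2" if "\<xi> \<in> gll p" for \<xi>
  proof -
    have "poly sqm1 \<xi> * poly ?D \<xi> = 0"
      using that unfolding poly_sqm1 by (auto simp: gll_eq)
    then have "poly (sqm1 * (?D * ?D)) \<xi> = 0"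
      unfolding poly_mult by (metis mult.assoc mult_zero_left)
    then show ?thesis by (simp add: power2_eq_square del: mult_pCons_left)
  qed
  moreover have "pint ?f = 2 / real p"
  proof -
    have "pint (sqm1 * (?D * ?D)) = - (real p * (real p + 1) * pint (?L * ?L))"
      unfolding pint_ode by (simp only: mult.assoc minus_minus)
    then have "pint ?f = (2 / (2 * real p + 1)) - 1 / (real p)\<^sup>2 * - (real p * (real p + 1) * (2 / (2 * real p + 1)))"
      unfolding pint_diff pint_smult leg_norm by simp
    also have "\<dots> = 2 / real p"
      using p by (simp add: power2_eq_square divide_simps)
    finally show ?thesis .
  qed
  ultimately show ?thesis by simp
qed

lemma gll_leg_ortho:
  assumes p: "p \<ge> 1" and jk: "j \<le> p" "k \<le> p"
  shows "(\<Sum>\<xi>\<in>gll p. gll_weight p \<xi> * (poly (leg j) \<xi> * poly (leg k) \<xi>)) = (if j = k then leg_weight p j else 0)"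
proof (cases "j = p \<and> k = p")
  case True
  then show ?thesis using gll_leg_top[OF p] by (simp add: leg_weight_def power2_eq_square)
next
  case False
  have "degree (leg j * leg k) \<le> 2 * p - 1"
    using degree_leg[of j] degree_leg[of k] False jk by (simp add: degree_mult_eq) linarith
  then have "(\<Sum>\<xi>\<in>gll p. gll_weight p \<xi> * poly (leg j * leg k) \<xi>) = pint (leg j * leg k)"
    using gll_exact p by blast
  then show ?thesis
    using False jk by (auto simp: leg_ortho leg_norm leg_weight_def)
qed

section \<open>Tensor-product polynomials on the reference cube\<close>

lemma ref_cube_eq_cbox: "(ref_cube :: (real^'n::finite) set) = cbox (\<chi> i. -1) (\<chi> i. 1)"
  by (auto simp: ref_cube_def mem_box_cart)

lemma continuous_on_cube_integrable:
  fixes f :: "real^'n::finite \<Rightarrow> real"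
  assumes "continuous_on UNIV f"
  shows "f integrable_on ref_cube"
  unfolding ref_cube_eq_cbox
  by (rule integrable_continuous) (rule continuous_on_subset[OF assms], simp)

text \<open>Integration, quadrature, slicing and differentiation act on these products factor by
  factor, so facts about Q^p are reduced to one variable through them.\<close>

definition tp :: "('n::finite \<Rightarrow> real poly) \<Rightarrow> real^'n \<Rightarrow> real" where
  "tp r x = (\<Prod>i\<in>UNIV. poly (r i) (x $ i))"

lemma continuous_tp: "continuous_on UNIV (tp r)"
  unfolding tp_def by (intro continuous_intros)

lemma tp_mult: "tp r x * tp s x = tp (\<lambda>i. r i * s i) x"
  by (simp add: tp_def prod.distrib)

text \<open>Fubini for a product integrand. Each factor is cut off to [-1,1], so that the integral
  over the cube becomes one over the whole space, where Lebesgue measure is the image of a product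
  measure indexed by \<open>Basis\<close>.\<close>

lemma integral_cube_prod:
  fixes r :: "'n::finite \<Rightarrow> real poly"
  shows "integral ref_cube (tp r) = (\<Prod>i\<in>UNIV. pint (r i))"
proof -
  define g where "g i t = indicat_real {-1..1} t * poly (r i) t" for i :: 'n and t
  have g_int: "integrable lborel (g i)" for i
    unfolding g_def
    using borel_integrable_compact[of "{-1..1::real}" "poly (r i)"]
    by (simp add: continuous_on_poly set_integrable_def)
  have gI: "integral\<^sup>L lborel (g i) = pint (r i)" for i
  proof -
    have "(g i has_integral integral\<^sup>L lborel (g i)) UNIV"
      by (rule has_integral_integral_lborel[OF g_int])
    moreover have "(g i has_integral pint (r i)) UNIV"
    proof -
      have "(poly (r i) has_integral pint (r i)) {-1..1}"
        unfolding pint_def by (rule integrable_integral[OF poly_integrable])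
      then have "((\<lambda>t. if t \<in> {-1..1} then poly (r i) t else 0) has_integral pint (r i)) UNIV"
        by (subst has_integral_restrict_UNIV)
      moreover have "(\<lambda>t. if t \<in> {-1..1} then poly (r i) t else 0) = g i"
        by (auto simp: g_def indicator_def)
      ultimately show ?thesis by simp
    qed
    ultimately show ?thesis by (rule has_integral_unique)
  qed
  \<comment> \<open>The product measure is indexed by basis vectors, the factors by coordinates;
    \<open>G\<close> translates along the bijection \<open>axis i 1\<close>.\<close>
  define G where "G b = g (THE i. b = axis i (1::real))" for b :: "real^'n"
  have Gax: "G (axis i 1) = g i" for i
    unfolding G_def by (rule arg_cong[of _ _ g]) (auto simp: axis_eq_axis)
  have GB: "integrable lborel (G b)" if "b \<in> Basis" for b
    using that g_int by (auto simp: Basis_vec_def Gax)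
  have inj: "inj (\<lambda>i::'n. axis i (1::real))" by (auto simp: inj_on_def axis_eq_axis)
  have BE: "(Basis :: (real^'n) set) = range (\<lambda>i. axis i 1)" by (auto simp: Basis_vec_def)
  have pb: "(\<Prod>b\<in>Basis. h b) = (\<Prod>i\<in>UNIV. h (axis i 1))" for h :: "real^'n \<Rightarrow> real"
    unfolding BE by (subst prod.reindex[OF inj]) simp
  interpret P: product_sigma_finite "\<lambda>_::real^'n. lborel :: real measure"
    by standard
  let ?M = "\<Pi>\<^sub>M b\<in>(Basis::(real^'n) set). (lborel :: real measure)"
  let ?T = "\<lambda>f. \<Sum>b\<in>(Basis::(real^'n) set). f b *\<^sub>R b"
  have T: "?T \<in> measurable ?M borel" by measurable
  define H where "H x = (\<Prod>b\<in>Basis. G b (x \<bullet> b))" for x :: "real^'n"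
  have Gm: "G b \<in> borel_measurable borel" if "b \<in> Basis" for b
    using GB[OF that] by (simp add: borel_measurable_integrable[of lborel, simplified] borel_measurable_integrable)
  have Hm: "H \<in> borel_measurable borel"
    unfolding H_def
    by (intro borel_measurable_prod measurable_compose[OF _ Gm]) auto
  have HT: "H (?T f) = (\<Prod>b\<in>Basis. G b (f b))" for f
    unfolding H_def by (intro prod.cong refl) (simp add: inner_sum_left inner_Basis if_distrib sum.delta cong: if_cong)
  have "integrable ?M (\<lambda>f. \<Prod>b\<in>Basis. G b (f b))"
    by (rule P.product_integrable_prod) (auto intro: GB)
  then have Hi: "integrable lborel H"
    by (subst lborel_eq, subst integrable_distr_eq[OF T Hm]) (simp add: HT)
  have "integral\<^sup>L lborel H = (\<Prod>b\<in>Basis. integral\<^sup>L lborel (G b))"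
    by (subst lborel_eq, subst integral_distr[OF T Hm], subst HT)
       (rule P.product_integral_prod, auto intro: GB)
  also have "\<dots> = (\<Prod>i\<in>UNIV. pint (r i))"
    unfolding pb by (simp add: Gax gI)
  finally have "(H has_integral (\<Prod>i\<in>UNIV. pint (r i))) UNIV"
    using has_integral_integral_lborel[OF Hi] by simp
  moreover have "H = (\<lambda>x. if x \<in> ref_cube then tp r x else 0)"
  proof
    fix x
    have "H x = (\<Prod>i\<in>UNIV. indicat_real {-1..1} (x $ i) * poly (r i) (x $ i))"
      unfolding H_def pb Gax g_def by (simp add: cart_eq_inner_axis)
    also have "\<dots> = (if x \<in> ref_cube then tp r x else 0)"
      by (auto simp: ref_cube_def tp_def indicator_def intro!: prod.cong prod_zero)
    finally show "H x = (if x \<in> ref_cube then tp r x else 0)" .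
  qed
  ultimately have "(tp r has_integral (\<Prod>i\<in>UNIV. pint (r i))) ref_cube"
    by (simp add: has_integral_restrict_UNIV)
  then show ?thesis by (rule integral_unique)
qed

lemma tp_sum_expand:
  fixes t :: "'n::finite \<Rightarrow> 'k \<Rightarrow> real" and b :: "'k \<Rightarrow> real poly"
  assumes "finite S"
  shows "tp (\<lambda>i. \<Sum>k\<in>S. smult (t i k) (b k)) x
       = (\<Sum>m\<in>{m. \<forall>i. m i \<in> S}. (\<Prod>i\<in>UNIV. t i (m i)) * tp (\<lambda>i. b (m i)) x)"
proof -
  have "tp (\<lambda>i. \<Sum>k\<in>S. smult (t i k) (b k)) x = (\<Prod>i\<in>UNIV. \<Sum>k\<in>S. t i k * poly (b k) (x $ i))"
    by (simp add: tp_def poly_sum)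
  also have "\<dots> = (\<Sum>m\<in>Pi\<^sub>E UNIV (\<lambda>_. S). \<Prod>i\<in>UNIV. t i (m i) * poly (b (m i)) (x $ i))"
    using assms by (intro prod_sum_PiE) auto
  also have "Pi\<^sub>E UNIV (\<lambda>_::'n. S) = {m. \<forall>i. m i \<in> S}"
    by auto
  finally show ?thesis by (simp add: tp_def prod.distrib)
qed

lemma finite_multiindex: "finite S \<Longrightarrow> finite {m :: 'n::finite \<Rightarrow> 'k. \<forall>i. m i \<in> S}"
  using finite_PiE[of "UNIV :: 'n set" "\<lambda>_. S"] by (simp add: PiE_UNIV_domain Pi_def)

lemma finite_multiindices [simp]: "finite {m :: 'n::finite \<Rightarrow> nat. \<forall>i. m i \<le> p}"
  using finite_multiindex[of "{..p}"] by simp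

lemma Qp_ref_iff_tp:
  "q \<in> Qp_ref p \<longleftrightarrow> (\<exists>c. q = (\<lambda>x. \<Sum>m\<in>{m. \<forall>i. m i \<le> p}. c m * tp (\<lambda>i. monom 1 (m i)) x))"
  by (simp add: Qp_ref_def tp_def poly_monom)

lemma Qp_ref_0 [simp]: "(\<lambda>x. 0) \<in> Qp_ref p"
  unfolding Qp_ref_iff_tp by (rule exI[of _ "\<lambda>_. 0"]) simp

lemma Qp_ref_add: "f \<in> Qp_ref p \<Longrightarrow> g \<in> Qp_ref p \<Longrightarrow> (\<lambda>x. f x + g x) \<in> Qp_ref p"
  unfolding Qp_ref_iff_tp
proof safe
  fix c d
  show "\<exists>e. (\<lambda>x. (\<Sum>m | \<forall>i. m i \<le> p. c m * tp (\<lambda>i. monom 1 (m i)) x)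
      + (\<Sum>m | \<forall>i. m i \<le> p. d m * tp (\<lambda>i. monom 1 (m i)) x))
      = (\<lambda>x. \<Sum>m | \<forall>i. m i \<le> p. e m * tp (\<lambda>i. monom 1 (m i)) x)"
    by (rule exI[of _ "\<lambda>m. c m + d m"]) (simp add: sum.distrib distrib_right)
qed

lemma Qp_ref_cmult: "f \<in> Qp_ref p \<Longrightarrow> (\<lambda>x. a * f x) \<in> Qp_ref p"
  unfolding Qp_ref_iff_tp
proof safe
  fix c
  show "\<exists>e. (\<lambda>x. a * (\<Sum>m | \<forall>i. m i \<le> p. c m * tp (\<lambda>i. monom 1 (m i)) x))
      = (\<lambda>x. \<Sum>m | \<forall>i. m i \<le> p. e m * tp (\<lambda>i. monom 1 (m i)) x)"
    by (rule exI[of _ "\<lambda>m. a * c m"]) (simp add: sum_distrib_left mult.assoc)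
qed

lemma Qp_ref_diff: "f \<in> Qp_ref p \<Longrightarrow> g \<in> Qp_ref p \<Longrightarrow> (\<lambda>x. f x - g x) \<in> Qp_ref p"
  using Qp_ref_add[of f p "\<lambda>x. -1 * g x"] Qp_ref_cmult[of g p "-1"] by simp

lemma Qp_ref_sum: "(\<And>s. s \<in> S \<Longrightarrow> f s \<in> Qp_ref p) \<Longrightarrow> (\<lambda>x. \<Sum>s\<in>S. f s x) \<in> Qp_ref p"
  by (induction S rule: infinite_finite_induct) (auto intro: Qp_ref_add)

lemma tp_in_Qp_ref:
  assumes "\<And>i. degree (r i) \<le> p"
  shows "tp r \<in> Qp_ref p"
proof -
  have "r i = (\<Sum>k\<in>{..p}. smult (coeff (r i) k) (monom 1 k))" for i
    using poly_as_sum_of_monoms'[OF assms, of i] by (simp add: smult_monom)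
  then have "tp r x = tp (\<lambda>i. \<Sum>k\<in>{..p}. smult (coeff (r i) k) (monom 1 k)) x" for x
    by (metis (no_types, lifting) tp_def prod.cong)
  then have "tp r = (\<lambda>x. \<Sum>m | \<forall>i. m i \<le> p. (\<Prod>i\<in>UNIV. coeff (r i) (m i)) * tp (\<lambda>i. monom 1 (m i)) x)"
    by (subst (asm) tp_sum_expand) auto
  then show ?thesis
    unfolding Qp_ref_iff_tp by (intro exI[of _ "\<lambda>m. \<Prod>i\<in>UNIV. coeff (r i) (m i)"])
qed

text \<open>Not an induction: every member of Q^p is a finite combination of tensor products of
  polynomials of degree at most p, and it suffices to treat these. The multi-indices in
  \<open>S\<close> only label the terms.\<close>

lemma Qp_ref_induct:
  assumes "q \<in> Qp_ref p"
    and lin: "\<And>(S :: ('n \<Rightarrow> nat) set) c r. finite S \<Longrightarrow> (\<And>m i. m \<in> S \<Longrightarrow> degree (r m i) \<le> p) \<Longrightarrow>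
           P (\<lambda>x::real^'n::finite. \<Sum>m\<in>S. c m * tp (r m) x)"
  shows "P q"
proof -
  obtain c where "q = (\<lambda>x. \<Sum>m\<in>{m. \<forall>i. m i \<le> p}. c m * tp (\<lambda>i. monom 1 (m i)) x)"
    using assms(1) unfolding Qp_ref_iff_tp by blast
  then show ?thesis
    by (simp only:) (rule lin, auto intro: order.trans[OF degree_monom_le])
qed

lemma Qp_ref_mult:
  fixes f g :: "real^'n::finite \<Rightarrow> real"
  assumes "f \<in> Qp_ref p" "g \<in> Qp_ref q"
  shows "(\<lambda>x. f x * g x) \<in> Qp_ref (p + q)"
proof (rule Qp_ref_induct[OF assms(1)], rule Qp_ref_induct[OF assms(2)])
  fix S T :: "('n \<Rightarrow> nat) set" and c d and r s :: "('n \<Rightarrow> nat) \<Rightarrow> 'n \<Rightarrow> real poly"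
  assume S: "finite S" "\<And>m i. m \<in> S \<Longrightarrow> degree (s m i) \<le> p" and T: "finite T" "\<And>m i. m \<in> T \<Longrightarrow> degree (r m i) \<le> q"
  have "(\<Sum>m\<in>S. d m * tp (s m) x) * (\<Sum>m\<in>T. c m * tp (r m) x)
     = (\<Sum>m\<in>S. \<Sum>k\<in>T. (d m * c k) * tp (\<lambda>i. s m i * r k i) x)" for x
    unfolding sum_product tp_mult[symmetric] by (simp add: mult_ac)
  moreover have "(\<lambda>x. \<Sum>m\<in>S. \<Sum>k\<in>T. (d m * c k) * tp (\<lambda>i. s m i * r k i) x) \<in> Qp_ref (p + q)"
    by (intro Qp_ref_sum Qp_ref_cmult tp_in_Qp_ref order.trans[OF degree_mult_le] add_mono S T)
  ultimately show "(\<lambda>x. (\<Sum>m\<in>S. d m * tp (s m) x) * (\<Sum>m\<in>T. c m * tp (r m) x)) \<in> Qp_ref (p + q)"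
    by simp
qed

lemma Qp_ref_continuous: "q \<in> Qp_ref p \<Longrightarrow> continuous_on UNIV q"
  by (erule Qp_ref_induct) (intro continuous_intros continuous_tp)

lemma Qp_ref_integrable: "q \<in> Qp_ref p \<Longrightarrow> q integrable_on ref_cube"
  by (intro continuous_on_cube_integrable Qp_ref_continuous)

lemma integral_cube_sum_tp:
  "finite S \<Longrightarrow> integral ref_cube (\<lambda>x. \<Sum>s\<in>S. c s * tp (r s) x) = (\<Sum>s\<in>S. c s * (\<Prod>i\<in>UNIV. pint (r s i)))"
  by (subst integral_sum)
     (auto simp: integral_cube_prod[symmetric] intro!: continuous_on_cube_integrable continuous_intros continuous_tp)

lemma Qp_ref_leg_expand:
  fixes q :: "real^'n::finite \<Rightarrow> real"
  assumes "q \<in> Qp_ref p"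
  shows "\<exists>a. q = (\<lambda>x. \<Sum>m\<in>{m. \<forall>i. m i \<le> p}. a m * tp (\<lambda>i. leg (m i)) x)"
  using assms
proof (rule Qp_ref_induct)
  fix S :: "('n \<Rightarrow> nat) set" and c and r :: "('n \<Rightarrow> nat) \<Rightarrow> 'n \<Rightarrow> real poly"
  assume S: "finite S" "\<And>m i. m \<in> S \<Longrightarrow> degree (r m i) \<le> p"
  define t where "t m i = (SOME a. r m i = (\<Sum>k\<le>p. smult (a k) (leg k)))" for m i
  have t: "r m i = (\<Sum>k\<in>{..p}. smult (t m i k) (leg k))" if "m \<in> S" for m i
    unfolding t_def by (rule someI_ex[OF leg_expand[OF S(2)[OF that]]])
  have "tp (r m) x = (\<Sum>l\<in>{l. \<forall>i. l i \<le> p}. (\<Prod>i\<in>UNIV. t m i (l i)) * tp (\<lambda>i. leg (l i)) x)" if "m \<in> S" for m x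
  proof -
    have "r m = (\<lambda>i. \<Sum>k\<in>{..p}. smult (t m i k) (leg k))" using t[OF that] by blast
    then show ?thesis by (simp only:) (subst tp_sum_expand, auto)
  qed
  then have "(\<Sum>m\<in>S. c m * tp (r m) x)
     = (\<Sum>m\<in>S. \<Sum>l\<in>{l. \<forall>i. l i \<le> p}. c m * ((\<Prod>i\<in>UNIV. t m i (l i)) * tp (\<lambda>i. leg (l i)) x))" for x
    by (simp add: sum_distrib_left)
  also have "\<dots> x = (\<Sum>l\<in>{l. \<forall>i. l i \<le> p}. (\<Sum>m\<in>S. c m * (\<Prod>i\<in>UNIV. t m i (l i))) * tp (\<lambda>i. leg (l i)) x)" for x
    by (subst sum.swap) (simp add: sum_distrib_right mult.assoc)
  finally show "\<exists>a. (\<lambda>x. \<Sum>m\<in>S. c m * tp (r m) x) = (\<lambda>x. \<Sum>m\<in>{m. \<forall>i. m i \<le> p}. a m * tp (\<lambda>i. leg (m i)) x)"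
    by (intro exI[of _ "\<lambda>l. \<Sum>m\<in>S. c m * (\<Prod>i\<in>UNIV. t m i (l i))"] ext)
qed

text \<open>Common to the integral and the quadrature rule: both are linear and act on tensor
  products as products of a one-dimensional functional \<open>l\<close> for which the Legendre
  polynomials up to degree p are orthogonal. Pairs of multi-indices label the terms of a product of
  two expansions.\<close>

lemma tensor_functional_square:
  fixes \<Lambda> :: "(real^'n::finite \<Rightarrow> real) \<Rightarrow> real"
  assumes lin: "\<And>(S :: (('n \<Rightarrow> nat) \<times> ('n \<Rightarrow> nat)) set) c r. finite S \<Longrightarrow>
       \<Lambda> (\<lambda>x. \<Sum>s\<in>S. c s * tp (r s) x) = (\<Sum>s\<in>S. c s * (\<Prod>i\<in>UNIV. l (r s i)))"
    and orth: "\<And>j k. j \<le> p \<Longrightarrow> k \<le> p \<Longrightarrow> l (leg j * leg k) = (if j = k then g j else 0)"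
  shows "\<Lambda> (\<lambda>x. (\<Sum>m\<in>{m. \<forall>i. m i \<le> p}. a m * tp (\<lambda>i. leg (m i)) x) * (\<Sum>m\<in>{m. \<forall>i. m i \<le> p}. b m * tp (\<lambda>i. leg (m i)) x))
       = (\<Sum>m\<in>{m. \<forall>i. m i \<le> p}. a m * b m * (\<Prod>i\<in>UNIV. g (m i)))"
proof -
  let ?M = "{m :: 'n \<Rightarrow> nat. \<forall>i. m i \<le> p}"
  have "(\<Sum>m\<in>?M. a m * tp (\<lambda>i. leg (m i)) x) * (\<Sum>m\<in>?M. b m * tp (\<lambda>i. leg (m i)) x)
      = (\<Sum>s\<in>?M \<times> ?M. (a (fst s) * b (snd s)) * tp (\<lambda>i. leg (fst s i) * leg (snd s i)) x)" for x
    by (simp add: sum_product sum.cartesian_product tp_mult[symmetric] mult_ac split_beta)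
  then have "\<Lambda> (\<lambda>x. (\<Sum>m\<in>?M. a m * tp (\<lambda>i. leg (m i)) x) * (\<Sum>m\<in>?M. b m * tp (\<lambda>i. leg (m i)) x))
      = (\<Sum>s\<in>?M \<times> ?M. (a (fst s) * b (snd s)) * (\<Prod>i\<in>UNIV. l (leg (fst s i) * leg (snd s i))))"
    by (simp only:) (rule lin, simp)
  also have "\<dots> = (\<Sum>m\<in>?M. \<Sum>k\<in>?M. (a m * b k) * (\<Prod>i\<in>UNIV. l (leg (m i) * leg (k i))))"
    by (simp add: sum.cartesian_product split_beta)
  also have "\<dots> = (\<Sum>m\<in>?M. \<Sum>k\<in>?M. if k = m then a m * b m * (\<Prod>i\<in>UNIV. g (m i)) else 0)"
  proof (intro sum.cong refl)
    fix m k assume mk: "m \<in> ?M" "k \<in> ?M"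
    show "(a m * b k) * (\<Prod>i\<in>UNIV. l (leg (m i) * leg (k i))) = (if k = m then a m * b m * (\<Prod>i\<in>UNIV. g (m i)) else 0)"
    proof (cases "k = m")
      case True
      then show ?thesis using mk by (simp add: orth)
    next
      case False
      then obtain i where i: "k i \<noteq> m i" unfolding fun_eq_iff by blast
      have "m i \<le> p" "k i \<le> p" using mk by auto
      then have "l (leg (m i) * leg (k i)) = 0" using i orth[of "m i" "k i"] by simp
      then have "(\<Prod>i\<in>UNIV. l (leg (m i) * leg (k i))) = 0" by (intro prod_zero) auto
      then show ?thesis using False by simp
    qed
  qed
  finally show ?thesis by (simp add: sum.delta)
qed

lemma integral_cube_leg:
  fixes a b :: "('n::finite \<Rightarrow> nat) \<Rightarrow> real"
  shows "integral ref_cube (\<lambda>x. (\<Sum>m\<in>{m. \<forall>i. m i \<le> p}. a m * tp (\<lambda>i. leg (m i)) x) * (\<Sum>m\<in>{m. \<forall>i. m i \<le> p}. b m * tp (\<lambda>i. leg (m i)) x))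
       = (\<Sum>m\<in>{m. \<forall>i. m i \<le> p}. a m * b m * (\<Prod>i\<in>UNIV. 2 / (2 * real (m i) + 1)))"
  by (rule tensor_functional_square[where l = pint])
     (auto simp: integral_cube_sum_tp leg_ortho leg_norm)

definition gnodes :: "nat \<Rightarrow> (real^'n::finite) set" where
  "gnodes p = {\<xi>. \<forall>i. \<xi> $ i \<in> gll p}"

definition node_weight :: "nat \<Rightarrow> real^'n::finite \<Rightarrow> real" where
  "node_weight p \<xi> = (\<Prod>i\<in>UNIV. gll_weight p (\<xi> $ i))"

lemma gnodes_eq_image: "gnodes p = vec_lambda ` {m. \<forall>i. m i \<in> gll p}"
  by (auto simp: gnodes_def image_def intro: exI[of _ "vec_nth _"] vec_nth_inverse[symmetric])

lemma inj_vec_lambda: "inj vec_lambda"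
  by (metis injI vec_lambda_inverse UNIV_I)

lemma finite_gnodes: "p \<ge> 1 \<Longrightarrow> finite (gnodes p)"
  unfolding gnodes_eq_image by (intro finite_imageI finite_multiindex finite_gll)

lemma sum_gnodes: "(\<Sum>\<xi>\<in>gnodes p. f \<xi>) = (\<Sum>m\<in>{m. \<forall>i. m i \<in> gll p}. f (vec_lambda m))"
  unfolding gnodes_eq_image by (subst sum.reindex) (auto intro: inj_on_subset[OF inj_vec_lambda])

lemma node_weight_pos: "p \<ge> 1 \<Longrightarrow> \<xi> \<in> gnodes p \<Longrightarrow> 0 < node_weight p \<xi>"
  by (auto simp: node_weight_def gnodes_def intro!: prod_pos gll_weight_pos)

lemma gnodes_cube: "\<xi> \<in> gnodes p \<Longrightarrow> \<xi> \<in> ref_cube"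
  using gll_bounds by (auto simp: gnodes_def ref_cube_def)

lemma quad_tp:
  assumes "p \<ge> 1"
  shows "(\<Sum>\<xi>\<in>gnodes p. node_weight p \<xi> * tp r \<xi>) = (\<Prod>i\<in>UNIV. \<Sum>t\<in>gll p. gll_weight p t * poly (r i) t)"
proof -
  have "(\<Prod>i\<in>UNIV. \<Sum>t\<in>gll p. gll_weight p t * poly (r i) t)
     = (\<Sum>m\<in>Pi\<^sub>E UNIV (\<lambda>_. gll p). \<Prod>i\<in>UNIV. gll_weight p (m i) * poly (r i) (m i))"
    using finite_gll[OF assms] by (intro prod_sum_PiE) auto
  also have "Pi\<^sub>E UNIV (\<lambda>_::'a. gll p) = {m. \<forall>i. m i \<in> gll p}"
    by auto
  finally show ?thesis
    unfolding sum_gnodes by (simp add: node_weight_def tp_def prod.distrib)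
qed

lemma quad_leg:
  fixes a b :: "('n::finite \<Rightarrow> nat) \<Rightarrow> real"
  assumes p: "p \<ge> 1"
  shows "(\<Sum>\<xi>\<in>gnodes p. node_weight p \<xi> * ((\<Sum>m\<in>{m. \<forall>i. m i \<le> p}. a m * tp (\<lambda>i. leg (m i)) \<xi>) * (\<Sum>m\<in>{m. \<forall>i. m i \<le> p}. b m * tp (\<lambda>i. leg (m i)) \<xi>)))
       = (\<Sum>m\<in>{m. \<forall>i. m i \<le> p}. a m * b m * (\<Prod>i\<in>UNIV. leg_weight p (m i)))"
proof (rule tensor_functional_square[where l = "\<lambda>r. \<Sum>t\<in>gll p. gll_weight p t * poly r t" and \<Lambda> = "\<lambda>f. \<Sum>\<xi>\<in>gnodes p. node_weight p \<xi> * f \<xi>"])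
  fix S :: "(('n \<Rightarrow> nat) \<times> ('n \<Rightarrow> nat)) set" and c r
  assume S: "finite S"
  have "(\<Sum>\<xi>\<in>gnodes p. node_weight p \<xi> * (\<Sum>s\<in>S. c s * tp (r s) \<xi>)) = (\<Sum>s\<in>S. c s * (\<Sum>\<xi>\<in>gnodes p. node_weight p \<xi> * tp (r s) \<xi>))"
    by (simp add: sum_distrib_left mult_ac) (rule sum.swap)
  then show "(\<Sum>\<xi>\<in>gnodes p. node_weight p \<xi> * (\<Sum>s\<in>S. c s * tp (r s) \<xi>)) = (\<Sum>s\<in>S. c s * (\<Prod>i\<in>UNIV. \<Sum>t\<in>gll p. gll_weight p t * poly (r s i) t))"
    by (simp add: quad_tp[OF p])
qed (simp add: gll_leg_ortho[OF p])

text \<open>Both quadratic forms are diagonal in the tensor Legendre basis, and per coordinate the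
  ratio of the diagonal entries lies between 1 and 3.\<close>

lemma quad_equiv:
  fixes q :: "real^'n::finite \<Rightarrow> real"
  assumes q: "q \<in> Qp_ref p" and p: "p \<ge> 1"
  shows "integral ref_cube (\<lambda>x. (q x)\<^sup>2) \<le> (\<Sum>\<xi>\<in>gnodes p. node_weight p \<xi> * (q \<xi>)\<^sup>2)"
    and "(\<Sum>\<xi>\<in>gnodes p. node_weight p \<xi> * (q \<xi>)\<^sup>2) \<le> 3 ^ CARD('n) * integral ref_cube (\<lambda>x. (q x)\<^sup>2)"
proof -
  obtain a where a: "q = (\<lambda>x. \<Sum>m\<in>{m. \<forall>i. m i \<le> p}. a m * tp (\<lambda>i. leg (m i)) x)"
    using Qp_ref_leg_expand[OF q] by blast
  let ?M = "{m :: 'n \<Rightarrow> nat. \<forall>i. m i \<le> p}"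
  have I: "integral ref_cube (\<lambda>x. (q x)\<^sup>2) = (\<Sum>m\<in>?M. (a m)\<^sup>2 * (\<Prod>i\<in>UNIV. 2 / (2 * real (m i) + 1)))"
    unfolding a power2_eq_square by (rule integral_cube_leg)
  have Q: "(\<Sum>\<xi>\<in>gnodes p. node_weight p \<xi> * (q \<xi>)\<^sup>2) = (\<Sum>m\<in>?M. (a m)\<^sup>2 * (\<Prod>i\<in>UNIV. leg_weight p (m i)))"
    unfolding a power2_eq_square by (rule quad_leg[OF p])
  show "integral ref_cube (\<lambda>x. (q x)\<^sup>2) \<le> (\<Sum>\<xi>\<in>gnodes p. node_weight p \<xi> * (q \<xi>)\<^sup>2)"
    unfolding I Q using leg_weight_bounds[OF _ p] by (intro sum_mono mult_left_mono prod_mono) auto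
  have "(\<Sum>m\<in>?M. (a m)\<^sup>2 * (\<Prod>i\<in>UNIV. leg_weight p (m i))) \<le> (\<Sum>m\<in>?M. (a m)\<^sup>2 * (\<Prod>i\<in>UNIV. 3 * (2 / (2 * real (m i) + 1))))"
    by (intro sum_mono mult_left_mono prod_mono conjI leg_weight_bounds[OF _ p, THEN conjunct2]) (auto simp: leg_weight_def)
  also have "\<dots> = 3 ^ CARD('n) * (\<Sum>m\<in>?M. (a m)\<^sup>2 * (\<Prod>i\<in>UNIV. 2 / (2 * real (m i) + 1)))"
    unfolding prod.distrib by (simp add: sum_distrib_left mult_ac)
  finally show "(\<Sum>\<xi>\<in>gnodes p. node_weight p \<xi> * (q \<xi>)\<^sup>2) \<le> 3 ^ CARD('n) * integral ref_cube (\<lambda>x. (q x)\<^sup>2)"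
    unfolding I Q .
qed

text \<open>The Legendre coefficients vanish, so the function is zero on the whole space and not
  merely on the cube; the local pieces of a DG function are defined everywhere and have to be
  identified as such.\<close>

lemma Qp_ref_norm_eq_0:
  fixes q :: "real^'n::finite \<Rightarrow> real"
  assumes q: "q \<in> Qp_ref p" and z: "integral ref_cube (\<lambda>x. (q x)\<^sup>2) \<le> 0"
  shows "q = (\<lambda>x. 0)"
proof -
  let ?M = "{m :: 'n \<Rightarrow> nat. \<forall>i. m i \<le> p}"
  obtain a where a: "q = (\<lambda>x. \<Sum>m\<in>?M. a m * tp (\<lambda>i. leg (m i)) x)"
    using Qp_ref_leg_expand[OF q] by blast
  have gp: "(\<Prod>i\<in>UNIV. 2 / (2 * real (m i) + 1)) > 0" for m :: "'n \<Rightarrow> nat"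
    by (intro prod_pos) auto
  have I: "integral ref_cube (\<lambda>x. (q x)\<^sup>2) = (\<Sum>m\<in>?M. (a m)\<^sup>2 * (\<Prod>i\<in>UNIV. 2 / (2 * real (m i) + 1)))"
    unfolding a power2_eq_square by (rule integral_cube_leg)
  have nn: "0 \<le> (a m)\<^sup>2 * (\<Prod>i\<in>UNIV. 2 / (2 * real (m i) + 1))" for m
    using gp[of m] by (intro mult_nonneg_nonneg) auto
  then have "(\<Sum>m\<in>?M. (a m)\<^sup>2 * (\<Prod>i\<in>UNIV. 2 / (2 * real (m i) + 1))) = 0"
    using z unfolding I by (meson order_antisym sum_nonneg)
  then have "\<forall>m\<in>?M. (a m)\<^sup>2 * (\<Prod>i\<in>UNIV. 2 / (2 * real (m i) + 1)) = 0"
    by (subst (asm) sum_nonneg_eq_0_iff) (use nn in auto)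
  then have "a m = 0" if "m \<in> ?M" for m
    using bspec[OF _ that] gp[of m] by (auto simp: prod_zero_iff)
  then show ?thesis unfolding a by simp
qed

lemma Qp_ref_zero_at_nodes:
  assumes "q \<in> Qp_ref p" "p \<ge> 1" "\<And>\<xi>. \<xi> \<in> gnodes p \<Longrightarrow> q \<xi> = 0"
  shows "q = (\<lambda>x. 0)"
proof (rule Qp_ref_norm_eq_0[OF assms(1)])
  have "(\<Sum>\<xi>\<in>gnodes p. node_weight p \<xi> * (q \<xi>)\<^sup>2) = 0"
    using assms(3) by (intro sum.neutral) auto
  then show "integral ref_cube (\<lambda>x. (q x)\<^sup>2) \<le> 0"
    using quad_equiv(1)[OF assms(1,2)] by simp
qed

lemma Qp_ref_interpolate:
  fixes val :: "real^'n::finite \<Rightarrow> real"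
  assumes p: "p \<ge> 1"
  shows "\<exists>q\<in>Qp_ref p. \<forall>\<xi>\<in>gnodes p. q \<xi> = val \<xi>"
proof (intro bexI ballI)
  let ?q = "\<lambda>x. \<Sum>\<xi>\<in>gnodes p. val \<xi> * tp (\<lambda>i. lagrange p (\<xi> $ i)) x"
  show "?q \<in> Qp_ref p"
    by (intro Qp_ref_sum Qp_ref_cmult tp_in_Qp_ref degree_lag p) (simp add: gnodes_def)
  fix \<eta> :: "real^'n" assume \<eta>: "\<eta> \<in> gnodes p"
  have "tp (\<lambda>i. lagrange p (\<xi> $ i)) \<eta> = (if \<xi> = \<eta> then 1 else 0)" if "\<xi> \<in> gnodes p" for \<xi>
  proof (cases "\<xi> = \<eta>")
    case True
    then show ?thesis using \<eta> lagrange_eval[OF p] unfolding tp_def gnodes_def by (auto intro: prod.neutral)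
  next
    case False
    then obtain i where "\<xi> $ i \<noteq> \<eta> $ i" by (auto simp: vec_eq_iff)
    then have "poly (lagrange p (\<xi> $ i)) (\<eta> $ i) = 0" using that \<eta> lagrange_eval[OF p, of "\<xi> $ i" "\<eta> $ i"] by (simp add: gnodes_def)
    then show ?thesis using False unfolding tp_def by (auto intro!: prod_zero)
  qed
  then have "?q \<eta> = (\<Sum>\<xi>\<in>gnodes p. if \<xi> = \<eta> then val \<eta> else 0)"
    by (intro sum.cong refl) auto
  then show "?q \<eta> = val \<eta>" using \<eta> by (simp add: finite_gnodes[OF p])
qed

text \<open>In the orthogonal Legendre basis the coefficients of the representer are the values of
  \<open>l\<close> on the basis functions over their squared norms. Linearity of \<open>l\<close> is
  demanded on Q^p only.\<close>

lemma Qp_ref_riesz: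
  fixes l :: "(real^'n::finite \<Rightarrow> real) \<Rightarrow> real"
  assumes add: "\<And>f g. f \<in> Qp_ref p \<Longrightarrow> g \<in> Qp_ref p \<Longrightarrow> l (\<lambda>x. f x + g x) = l f + l g"
    and mul: "\<And>c f. f \<in> Qp_ref p \<Longrightarrow> l (\<lambda>x. c * f x) = c * l f"
  shows "\<exists>w\<in>Qp_ref p. \<forall>q\<in>Qp_ref p. integral ref_cube (\<lambda>x. w x * q x) = l q"
proof -
  let ?M = "{m :: 'n \<Rightarrow> nat. \<forall>i. m i \<le> p}"
  let ?g = "\<lambda>m::'n \<Rightarrow> nat. \<Prod>i\<in>UNIV. 2 / (2 * real (m i) + 1)"
  let ?\<phi> = "\<lambda>m::'n \<Rightarrow> nat. tp (\<lambda>i. leg (m i))"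
  have phi: "?\<phi> m \<in> Qp_ref p" if "m \<in> ?M" for m
    using that degree_leg by (intro tp_in_Qp_ref) auto
  have l_sum: "l (\<lambda>x. \<Sum>m\<in>S. b m * ?\<phi> m x) = (\<Sum>m\<in>S. b m * l (?\<phi> m))" if "S \<subseteq> ?M" for S b
  proof -
    have "finite S" using that finite_multiindices by (rule finite_subset)
    then show ?thesis using that
    proof (induction S rule: finite_induct)
      case empty
      then show ?case using mul[of "\<lambda>x. 0" 0] by simp
    next
      case (insert m S)
      have "l (\<lambda>x. b m * ?\<phi> m x + (\<Sum>k\<in>S. b k * ?\<phi> k x)) = l (\<lambda>x. b m * ?\<phi> m x) + l (\<lambda>x. \<Sum>k\<in>S. b k * ?\<phi> k x)"
        by (intro add Qp_ref_cmult Qp_ref_sum phi) (use insert in auto)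
      then show ?case using insert mul[OF phi, of m "b m"] by simp
    qed
  qed
  have gp: "?g m > 0" for m :: "'n \<Rightarrow> nat"
    by (intro prod_pos) auto
  have cancel: "g \<noteq> 0 \<Longrightarrow> x / g * a * g = a * x" for x a g :: real by simp
  let ?w = "\<lambda>x. \<Sum>m\<in>?M. (l (?\<phi> m) / ?g m) * ?\<phi> m x"
  show ?thesis
  proof (intro bexI ballI)
    show "?w \<in> Qp_ref p" by (intro Qp_ref_sum Qp_ref_cmult phi)
    fix q :: "real^'n \<Rightarrow> real" assume "q \<in> Qp_ref p"
    then obtain a where a: "q = (\<lambda>x. \<Sum>m\<in>?M. a m * ?\<phi> m x)"
      using Qp_ref_leg_expand by blast
    have "integral ref_cube (\<lambda>x. ?w x * q x) = (\<Sum>m\<in>?M. (l (?\<phi> m) / ?g m) * a m * ?g m)"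
      unfolding a by (rule integral_cube_leg)
    also have "\<dots> = (\<Sum>m\<in>?M. a m * l (?\<phi> m))"
    proof (intro sum.cong refl)
      fix m :: "'n \<Rightarrow> nat"
      have "?g m \<noteq> 0" using gp[of m] by simp
      then show "(l (?\<phi> m) / ?g m) * a m * ?g m = a m * l (?\<phi> m)"
        by (rule cancel)
    qed
    also have "\<dots> = l q" unfolding a by (rule l_sum[symmetric]) simp
    finally show "integral ref_cube (\<lambda>x. ?w x * q x) = l q" .
  qed
qed


section \<open>Slices, substitutions and facet traces on the reference cube\<close>

definition upd :: "'n::finite \<Rightarrow> real \<Rightarrow> real^'n \<Rightarrow> real^'n" where
  "upd j t y = (\<chi> i. if i = j then t else y $ i)"

lemma upd_nth [simp]: "upd j t y $ i = (if i = j then t else y $ i)"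
  by (simp add: upd_def)

lemma upd_same [simp]: "upd j (y $ j) y = y"
  by (simp add: vec_eq_iff)

lemma upd_upd [simp]: "upd j s (upd j t y) = upd j s y"
  by (simp add: vec_eq_iff)

lemma tp_upd: "tp r (upd j t y) = poly (r j) t * (\<Prod>i\<in>UNIV - {j}. poly (r i) (y $ i))"
proof -
  have "tp r (upd j t y) = poly (r j) (upd j t y $ j) * (\<Prod>i\<in>UNIV - {j}. poly (r i) (upd j t y $ i))"
    unfolding tp_def by (rule prod.remove) auto
  moreover have "(\<Prod>i\<in>UNIV - {j}. poly (r i) (upd j t y $ i)) = (\<Prod>i\<in>UNIV - {j}. poly (r i) (y $ i))"
    by (intro prod.cong) auto
  ultimately show ?thesis by simp
qed

lemma Qp_ref_slice:
  fixes q :: "real^'n::finite \<Rightarrow> real"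
  assumes "q \<in> Qp_ref p"
  shows "\<exists>r. degree r \<le> p \<and> (\<forall>t. q (upd j t y) = poly r t)"
  using assms
proof (rule Qp_ref_induct)
  fix S :: "('n \<Rightarrow> nat) set" and c and r :: "('n \<Rightarrow> nat) \<Rightarrow> 'n \<Rightarrow> real poly"
  assume S: "finite S" "\<And>m i. m \<in> S \<Longrightarrow> degree (r m i) \<le> p"
  let ?r = "\<Sum>m\<in>S. smult (c m * (\<Prod>i\<in>UNIV - {j}. poly (r m i) (y $ i))) (r m j)"
  have "degree ?r \<le> p"
    using S by (intro degree_sum_le) (auto intro: order.trans[OF degree_smult_le])
  moreover have "(\<Sum>m\<in>S. c m * tp (r m) (upd j t y)) = poly ?r t" for t
    by (simp add: poly_sum tp_upd mult_ac)
  ultimately show "\<exists>r'. degree r' \<le> p \<and> (\<forall>t. (\<Sum>m\<in>S. c m * tp (r m) (upd j t y)) = poly r' t)"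
    by blast
qed

text \<open>The slice integral stays a function on the full cube, constant in coordinate j;
  integrating it over that coordinate again doubles the value, whence the division by 2. The 1/2 in
  \<open>face_integral\<close> has the same origin.\<close>

lemma integral_slice:
  fixes f :: "real^'n::finite \<Rightarrow> real"
  assumes "f \<in> Qp_ref p"
  shows "(\<lambda>y. integral {-1..1} (\<lambda>t. f (upd j t y))) \<in> Qp_ref p
       \<and> integral ref_cube f = integral ref_cube (\<lambda>y. integral {-1..1} (\<lambda>t. f (upd j t y))) / 2"
  using assms
proof (rule Qp_ref_induct)
  fix S :: "('n \<Rightarrow> nat) set" and c and r :: "('n \<Rightarrow> nat) \<Rightarrow> 'n \<Rightarrow> real poly"
  assume S: "finite S" "\<And>m i. m \<in> S \<Longrightarrow> degree (r m i) \<le> p"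
  let ?R = "\<lambda>m. (r m)(j := [:pint (r m j):])"
  have pc: "pint [:a:] = 2 * a" for a
    using pint_pderiv[of "[:0, a:]"] by (simp add: pderiv_pCons)
  have tpR: "tp (?R m) y = pint (r m j) * (\<Prod>i\<in>UNIV - {j}. poly (r m i) (y $ i))" for m y
    using tp_upd[of "?R m" j "y $ j" y] by (simp cong: prod.cong_simp)
  have e: "integral {-1..1} (\<lambda>t. \<Sum>m\<in>S. c m * tp (r m) (upd j t y)) = (\<Sum>m\<in>S. c m * tp (?R m) y)" for y
  proof -
    have "integral {-1..1} (\<lambda>t. \<Sum>m\<in>S. c m * tp (r m) (upd j t y))
       = pint (\<Sum>m\<in>S. smult (c m * (\<Prod>i\<in>UNIV - {j}. poly (r m i) (y $ i))) (r m j))"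
      unfolding pint_def by (rule integral_cong) (simp add: poly_sum tp_upd mult_ac)
    then show ?thesis by (simp add: pint_sum pint_smult tpR mult_ac)
  qed
  have pr: "(\<Prod>i\<in>UNIV. pint (?R m i)) = 2 * (\<Prod>i\<in>UNIV. pint (r m i))" for m
    by (subst (1 2) prod.remove[of _ j]) (auto simp: pc intro!: prod.cong)
  have "(\<lambda>y. \<Sum>m\<in>S. c m * tp (?R m) y) \<in> Qp_ref p"
    using S by (intro Qp_ref_sum Qp_ref_cmult tp_in_Qp_ref) auto
  moreover have "integral ref_cube (\<lambda>y. \<Sum>m\<in>S. c m * tp (?R m) y) = 2 * integral ref_cube (\<lambda>y. \<Sum>m\<in>S. c m * tp (r m) y)"
    unfolding integral_cube_sum_tp[OF S(1)] pr by (simp add: sum_distrib_left mult_ac)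
  ultimately show "(\<lambda>y. integral {-1..1} (\<lambda>t. \<Sum>m\<in>S. c m * tp (r m) (upd j t y))) \<in> Qp_ref p
     \<and> integral ref_cube (\<lambda>x. \<Sum>m\<in>S. c m * tp (r m) x)
       = integral ref_cube (\<lambda>y. integral {-1..1} (\<lambda>t. \<Sum>m\<in>S. c m * tp (r m) (upd j t y))) / 2"
    unfolding e by simp
qed

lemma tp_subst:
  fixes r :: "'n::finite \<Rightarrow> real poly"
  assumes inj: "inj_on \<pi> (- I)"
  shows "tp r (\<chi> i. if i \<in> I then s i else e i * y $ \<pi> i)
       = (\<Prod>i\<in>I. poly (r i) (s i)) *
         tp (\<lambda>j. if j \<in> \<pi> ` (- I) then pcompose (r (inv_into (- I) \<pi> j)) [:0, e (inv_into (- I) \<pi> j):] else 1) y"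
proof -
  let ?R = "\<lambda>j. if j \<in> \<pi> ` (- I) then pcompose (r (inv_into (- I) \<pi> j)) [:0, e (inv_into (- I) \<pi> j):] else 1"
  have "tp r (\<chi> i. if i \<in> I then s i else e i * y $ \<pi> i)
     = (\<Prod>i\<in>I \<union> (- I). if i \<in> I then poly (r i) (s i) else poly (r i) (e i * y $ \<pi> i))"
    unfolding tp_def by (intro prod.cong) auto
  also have "\<dots> = (\<Prod>i\<in>I. poly (r i) (s i)) * (\<Prod>i\<in>- I. poly (r i) (e i * y $ \<pi> i))"
    by (subst prod.union_disjoint) (auto intro!: arg_cong2[of _ _ _ _ "(*)"] prod.cong)
  also have "(\<Prod>i\<in>- I. poly (r i) (e i * y $ \<pi> i)) = (\<Prod>j\<in>\<pi> ` (- I). poly (?R j) (y $ j))"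
    by (subst prod.reindex[OF inj]) (auto simp: poly_pcompose inv_into_f_f[OF inj] mult.commute intro!: prod.cong)
  also have "\<dots> = tp ?R y"
    unfolding tp_def by (rule prod.mono_neutral_left) auto
  finally show ?thesis .
qed

text \<open>General affine substitutions raise the degree in single variables and leave Q^p. Here
  each free coordinate is a multiple of one variable and, by injectivity, no variable is used twice,
  so all degrees stay at most p.\<close>

lemma Qp_ref_subst:
  fixes q :: "real^'n::finite \<Rightarrow> real"
  assumes "q \<in> Qp_ref p" "inj_on \<pi> (- I)"
  shows "(\<lambda>y. q (\<chi> i. if i \<in> I then s i else e i * y $ \<pi> i)) \<in> Qp_ref p"
  using assms(1)
proof (rule Qp_ref_induct)
  fix S :: "('n \<Rightarrow> nat) set" and c and r :: "('n \<Rightarrow> nat) \<Rightarrow> 'n \<Rightarrow> real poly"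
  assume S: "finite S" "\<And>m i. m \<in> S \<Longrightarrow> degree (r m i) \<le> p"
  show "(\<lambda>y. \<Sum>m\<in>S. c m * tp (r m) (\<chi> i. if i \<in> I then s i else e i * y $ \<pi> i)) \<in> Qp_ref p"
    unfolding tp_subst[OF assms(2)]
    using S by (intro Qp_ref_sum Qp_ref_cmult tp_in_Qp_ref)
      (auto simp: degree_pcompose intro: order.trans[OF mult_le_mono2[of _ 1]])
qed

lemma Qp_ref_upd: "q \<in> Qp_ref p \<Longrightarrow> (\<lambda>y. q (upd j s y)) \<in> Qp_ref p"
  using Qp_ref_subst[of q p id "{j}" "\<lambda>_. s" "\<lambda>_. 1"] unfolding upd_def by (simp cong: if_cong)

lemma integral_signed_perm:
  fixes q :: "real^'n::finite \<Rightarrow> real"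
  assumes "q \<in> Qp_ref p" and bij: "bij \<pi>" and e: "\<And>i. e i = 1 \<or> e i = -1"
  shows "integral ref_cube (\<lambda>y. q (\<chi> i. e i * y $ \<pi> i)) = integral ref_cube q"
  using assms(1)
proof (rule Qp_ref_induct)
  fix S :: "('n \<Rightarrow> nat) set" and c and r :: "('n \<Rightarrow> nat) \<Rightarrow> 'n \<Rightarrow> real poly"
  assume S: "finite S" "\<And>m i. m \<in> S \<Longrightarrow> degree (r m i) \<le> p"
  have inj: "inj_on \<pi> (- {})" and [simp]: "range \<pi> = UNIV" and bi: "bij (inv \<pi>)"
    using bij by (auto simp: bij_def inj_imp_surj_inv surj_imp_inj_inv)
  have t: "tp (r m) (\<chi> i. e i * y $ \<pi> i) = tp (\<lambda>j. pcompose (r m (inv \<pi> j)) [:0, e (inv \<pi> j):]) y" for m y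
    using tp_subst[OF inj, of "r m" "\<lambda>_. 0" e y] by simp
  have "pint (pcompose (r m i) [:0, e i:]) = pint (r m i)" for m i
    using e[of i] pint_reflect[of "r m i"] by (auto simp: pcompose_idR)
  then have "(\<Prod>j\<in>UNIV. pint (pcompose (r m (inv \<pi> j)) [:0, e (inv \<pi> j):])) = (\<Prod>i\<in>UNIV. pint (r m i))" for m
    using prod.reindex_bij_betw[OF bi, of "\<lambda>i. pint (r m i)"] by simp
  then show "integral ref_cube (\<lambda>y. \<Sum>m\<in>S. c m * tp (r m) (\<chi> i. e i * y $ \<pi> i)) = integral ref_cube (\<lambda>y. \<Sum>m\<in>S. c m * tp (r m) y)"
    unfolding t integral_cube_sum_tp[OF S(1)] by simp
qed

lemma Qp_ref_has_derivative:
  fixes q :: "real^'n::finite \<Rightarrow> real"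
  assumes "q \<in> Qp_ref p"
  shows "\<exists>dq. (\<forall>j. dq j \<in> Qp_ref p) \<and> (\<forall>x. (q has_derivative (\<lambda>h. \<Sum>j\<in>UNIV. dq j x * h $ j)) (at x))"
  using assms
proof (rule Qp_ref_induct)
  fix S :: "('n \<Rightarrow> nat) set" and c and r :: "('n \<Rightarrow> nat) \<Rightarrow> 'n \<Rightarrow> real poly"
  assume S: "finite S" "\<And>m i. m \<in> S \<Longrightarrow> degree (r m i) \<le> p"
  let ?dq = "\<lambda>j x. \<Sum>m\<in>S. c m * tp ((r m)(j := pderiv (r m j))) x"
  have "?dq j \<in> Qp_ref p" for j
    using S by (intro Qp_ref_sum Qp_ref_cmult tp_in_Qp_ref) (auto simp: degree_pderiv intro: order.trans[OF diff_le_self])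
  moreover have "((\<lambda>x. \<Sum>m\<in>S. c m * tp (r m) x) has_derivative (\<lambda>h. \<Sum>j\<in>UNIV. ?dq j x * h $ j)) (at x)" for x
  proof -
    have 1: "((\<lambda>x. poly s (x $ i)) has_derivative (\<lambda>h. poly (pderiv s) (x $ i) * h $ i)) (at x)" for i :: 'n and s
      using has_derivative_compose[OF bounded_linear.has_derivative[OF bounded_linear_vec_nth[of i] has_derivative_ident]
          poly_DERIV[of s "x $ i", unfolded has_field_derivative_def]]
      by simp
    have 2: "(tp s has_derivative (\<lambda>h. \<Sum>j\<in>UNIV. tp (s(j := pderiv (s j))) x * h $ j)) (at x)" for s :: "'n \<Rightarrow> real poly"
    proof -
      have "((\<lambda>x. \<Prod>i\<in>UNIV. poly (s i) (x $ i)) has_derivative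
        (\<lambda>h. \<Sum>j\<in>UNIV. (poly (pderiv (s j)) (x $ j) * h $ j) * (\<Prod>i\<in>UNIV - {j}. poly (s i) (x $ i)))) (at x)"
        by (rule has_derivative_prod) (rule 1)
      moreover have "tp (s(j := pderiv (s j))) x = poly (pderiv (s j)) (x $ j) * (\<Prod>i\<in>UNIV - {j}. poly (s i) (x $ i))" for j
        using tp_upd[of "s(j := pderiv (s j))" j "x $ j" x] by (simp cong: prod.cong_simp)
      ultimately show ?thesis by (simp add: tp_def[abs_def] mult_ac)
    qed
    have "((\<lambda>x. \<Sum>m\<in>S. c m * tp (r m) x) has_derivative
       (\<lambda>h. \<Sum>m\<in>S. c m * (\<Sum>j\<in>UNIV. tp ((r m)(j := pderiv (r m j))) x * h $ j))) (at x)"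
      by (intro has_derivative_sum has_derivative_mult_right 2)
    moreover have "(\<Sum>m\<in>S. c m * (\<Sum>j\<in>UNIV. tp ((r m)(j := pderiv (r m j))) x * h $ j)) = (\<Sum>j\<in>UNIV. ?dq j x * h $ j)" for h :: "real^'n"
      by (simp add: sum_distrib_left sum_distrib_right mult.assoc) (rule sum.swap)
    ultimately show ?thesis by simp
  qed
  ultimately show "\<exists>dq. (\<forall>j. dq j \<in> Qp_ref p) \<and> (\<forall>x. ((\<lambda>x. \<Sum>m\<in>S. c m * tp (r m) x) has_derivative (\<lambda>h. \<Sum>j\<in>UNIV. dq j x * h $ j)) (at x))"
    by (intro exI[of _ ?dq] conjI allI)
qed

text \<open>The one-dimensional trace inequality is applied on every line in direction j. The 1/2 in
  its constant cancels against the 1/2 of \<open>integral_slice\<close>.\<close>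

lemma trace_inverse_cube:
  fixes q :: "real^'n::finite \<Rightarrow> real"
  assumes q: "q \<in> Qp_ref p" and s: "s = 1 \<or> s = -1"
  shows "integral ref_cube (\<lambda>y. (q (upd j s y))\<^sup>2) \<le> (real p + 1)\<^sup>2 * integral ref_cube (\<lambda>y. (q y)\<^sup>2)"
proof -
  let ?I = "\<lambda>y. integral {-1..1} (\<lambda>t. (q (upd j t y))\<^sup>2)"
  have q2: "(\<lambda>y. (q y)\<^sup>2) \<in> Qp_ref (p + p)"
    unfolding power2_eq_square by (rule Qp_ref_mult[OF q q])
  have sl: "?I \<in> Qp_ref (p + p)" "integral ref_cube (\<lambda>y. (q y)\<^sup>2) = integral ref_cube ?I / 2"
    using integral_slice[OF q2, of j] by auto
  have "integral ref_cube (\<lambda>y. (q (upd j s y))\<^sup>2) \<le> integral ref_cube (\<lambda>y. (real p + 1)\<^sup>2 / 2 * ?I y)"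
  proof (rule integral_le)
    show "(\<lambda>y. (q (upd j s y))\<^sup>2) integrable_on ref_cube"
      by (rule Qp_ref_integrable[OF Qp_ref_upd[OF q2]])
    show "(\<lambda>y. (real p + 1)\<^sup>2 / 2 * ?I y) integrable_on ref_cube"
      by (rule Qp_ref_integrable[OF Qp_ref_cmult[OF sl(1)]])
    fix y :: "real^'n"
    obtain r where r: "degree r \<le> p" "\<And>t. q (upd j t y) = poly r t"
      using Qp_ref_slice[OF q, of j y] by blast
    have "pint (r * r) = ?I y"
      unfolding pint_def r(2) by (simp add: power2_eq_square cong: integral_cong)
    then show "(q (upd j s y))\<^sup>2 \<le> (real p + 1)\<^sup>2 / 2 * ?I y"
      using trace_inverse_1d[OF r(1) s] r(2) by simp
  qed
  also have "\<dots> = (real p + 1)\<^sup>2 * integral ref_cube (\<lambda>y. (q y)\<^sup>2)"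
    unfolding sl(2) by simp
  finally show ?thesis .
qed

text \<open>On a line in direction j the j-th partial derivative is the derivative of the slice
  polynomial, so the one-dimensional inequality applies line by line.\<close>

lemma inverse_ineq_cube:
  fixes q :: "real^'n::finite \<Rightarrow> real"
  assumes q: "q \<in> Qp_ref p" and p: "p \<ge> 1" and dq: "\<And>j. dq j \<in> Qp_ref p"
    and der: "\<And>x. (q has_derivative (\<lambda>h. \<Sum>j\<in>UNIV. dq j x * h $ j)) (at x)"
  shows "integral ref_cube (\<lambda>y. (dq j y)\<^sup>2) \<le> 4 * real p ^ 4 * integral ref_cube (\<lambda>y. (q y)\<^sup>2)"
proof -
  let ?I = "\<lambda>f y. integral {-1..1} (\<lambda>t. (f (upd j t y))\<^sup>2)"
  have sq: "(\<lambda>y. (f y)\<^sup>2) \<in> Qp_ref (p + p)" if "f \<in> Qp_ref p" for f :: "real^'n \<Rightarrow> real"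
    unfolding power2_eq_square by (rule Qp_ref_mult[OF that that])
  have sl: "?I f \<in> Qp_ref (p + p)" "integral ref_cube (\<lambda>y. (f y)\<^sup>2) = integral ref_cube (?I f) / 2"
    if "f \<in> Qp_ref p" for f :: "real^'n \<Rightarrow> real"
    using integral_slice[OF sq[OF that], of j] by auto
  have "integral ref_cube (?I (dq j)) \<le> integral ref_cube (\<lambda>y. 4 * real p ^ 4 * ?I q y)"
  proof (rule integral_le)
    show "?I (dq j) integrable_on ref_cube" by (rule Qp_ref_integrable[OF sl(1)[OF dq]])
    show "(\<lambda>y. 4 * real p ^ 4 * ?I q y) integrable_on ref_cube"
      by (rule Qp_ref_integrable[OF Qp_ref_cmult[OF sl(1)[OF q]]])
    fix y :: "real^'n"
    obtain r where r: "degree r \<le> p" "\<And>t. q (upd j t y) = poly r t"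
      using Qp_ref_slice[OF q, of j y] by blast
    have "dq j (upd j t y) = poly (pderiv r) t" for t
    proof -
      have "((\<lambda>t. upd j t y) has_derivative (\<lambda>h. h *\<^sub>R axis j 1)) (at t)"
      proof -
        have "(\<lambda>t. upd j t y) = (\<lambda>t. t *\<^sub>R axis j 1 + upd j 0 y)"
          by (auto simp: vec_eq_iff axis_def)
        then show ?thesis by (auto intro!: derivative_eq_intros)
      qed
      from has_derivative_compose[OF this der]
      have "((\<lambda>t. q (upd j t y)) has_derivative (\<lambda>h. \<Sum>i\<in>UNIV. dq i (upd j t y) * (h *\<^sub>R axis j 1) $ i)) (at t)" .
      moreover have "(\<Sum>i\<in>UNIV. dq i (upd j t y) * (h *\<^sub>R axis j 1) $ i) = dq j (upd j t y) * h" for h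
        by (simp add: axis_def if_distrib[of "\<lambda>x. _ * (_ * x)"] cong: if_cong)
      ultimately have "((\<lambda>t. poly r t) has_real_derivative dq j (upd j t y)) (at t)"
        unfolding has_field_derivative_def r(2) by simp
      then show ?thesis using poly_DERIV[of r t] by (rule DERIV_unique)
    qed
    then have "?I (dq j) y = pint (pderiv r * pderiv r)"
      unfolding pint_def by (simp add: power2_eq_square cong: integral_cong)
    moreover have "?I q y = pint (r * r)"
      unfolding pint_def r(2) by (simp add: power2_eq_square cong: integral_cong)
    ultimately show "?I (dq j) y \<le> 4 * real p ^ 4 * ?I q y"
      using inverse_ineq_1d[OF r(1) p] by simp
  qed
  then show ?thesis
    unfolding sl(2)[OF dq] sl(2)[OF q] by simp
qed

lemma node_weight_upd: "node_weight p (upd j t \<eta>) * gll_weight p (\<eta> $ j) = node_weight p \<eta> * gll_weight p t"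
proof -
  have "node_weight p (upd j t \<eta>) = gll_weight p t * (\<Prod>i\<in>UNIV - {j}. gll_weight p (\<eta> $ i))"
    unfolding node_weight_def by (subst prod.remove[of _ j]) (auto intro!: prod.cong)
  moreover have "node_weight p \<eta> = gll_weight p (\<eta> $ j) * (\<Prod>i\<in>UNIV - {j}. gll_weight p (\<eta> $ i))"
    unfolding node_weight_def by (subst prod.remove[of _ j]) auto
  ultimately show ?thesis by simp
qed

lemma sum_gll_weight: "p \<ge> 1 \<Longrightarrow> (\<Sum>t\<in>gll p. gll_weight p t) = 2"
  using gll_exact[of p 1] leg_norm[of 0] by simp

text \<open>A node is a node of the facet together with a value of coordinate j, and its weight
  factors accordingly. Summing out that coordinate gives the total weight 2, so the nodes on the
  facet carry the share \<open>gll_weight p s / 2\<close>.\<close>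

lemma face_quad:
  fixes f :: "real^'n::finite \<Rightarrow> real"
  assumes p: "p \<ge> 1" and s: "s \<in> gll p"
  shows "(\<Sum>\<xi>\<in>{\<xi>\<in>gnodes p. \<xi> $ j = s}. node_weight p \<xi> * f \<xi>) = gll_weight p s / 2 * (\<Sum>\<xi>\<in>gnodes p. node_weight p \<xi> * f (upd j s \<xi>))"
proof -
  let ?N = "{\<xi>\<in>gnodes p. \<xi> $ j = s} :: (real^'n) set"
  have "(\<Sum>\<xi>\<in>gnodes p. node_weight p \<xi> * f (upd j s \<xi>)) = (\<Sum>(t, \<eta>)\<in>gll p \<times> ?N. node_weight p (upd j t \<eta>) * f \<eta>)"
    by (rule sum.reindex_bij_witness[where i = "\<lambda>(t, \<eta>). upd j t \<eta>" and j = "\<lambda>\<xi>. (\<xi> $ j, upd j s \<xi>)"])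
       (use s in \<open>auto simp: gnodes_def vec_eq_iff\<close>)
  also have "gll_weight p s * \<dots> = (\<Sum>(t, \<eta>)\<in>gll p \<times> ?N. gll_weight p t * (node_weight p \<eta> * f \<eta>))"
    unfolding sum_distrib_left
  proof (intro sum.cong refl)
    fix x assume x: "x \<in> gll p \<times> ?N"
    obtain t \<eta> where [simp]: "x = (t, \<eta>)" by fastforce
    have "gll_weight p s * node_weight p (upd j t \<eta>) = gll_weight p t * node_weight p \<eta>"
      using node_weight_upd[of p j t \<eta>] x by (auto simp: mult.commute)
    then show "gll_weight p s * (case x of (t, \<eta>) \<Rightarrow> node_weight p (upd j t \<eta>) * f \<eta>) = (case x of (t, \<eta>) \<Rightarrow> gll_weight p t * (node_weight p \<eta> * f \<eta>))"
      by (simp add: mult.assoc[symmetric])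
  qed
  also have "\<dots> = (\<Sum>t\<in>gll p. gll_weight p t) * (\<Sum>\<eta>\<in>?N. node_weight p \<eta> * f \<eta>)"
    by (simp add: sum_product sum.cartesian_product)
  finally show ?thesis using sum_gll_weight[OF p] by simp
qed

text \<open>The end weight is at most 4/p^2: here the nodes on a facet gain their factor 1/p^2. Only
  the trace of \<open>f\<close> on the facet has to be polynomial.\<close>

lemma face_quad_bound:
  fixes f :: "real^'n::finite \<Rightarrow> real"
  assumes p: "p \<ge> 1" and s: "s = 1 \<or> s = -1" and f: "(\<lambda>y. f (upd j s y)) \<in> Qp_ref p"
  shows "(\<Sum>\<xi>\<in>{\<xi>\<in>gnodes p. \<xi> $ j = s}. node_weight p \<xi> * (f \<xi>)\<^sup>2)
       \<le> 2 * 3 ^ CARD('n) / (real p)\<^sup>2 * integral ref_cube (\<lambda>y. (f (upd j s y))\<^sup>2)"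
proof -
  have sg: "s \<in> gll p" using s by auto
  let ?Q = "\<Sum>\<xi>\<in>gnodes p. node_weight p \<xi> * (f (upd j s \<xi>))\<^sup>2"
  have Q0: "0 \<le> ?Q" using node_weight_pos[OF p] by (intro sum_nonneg mult_nonneg_nonneg) (auto intro: less_imp_le)
  have "4 / (real p * (real p + 1)) \<le> 4 / (real p)\<^sup>2"
    using p by (intro divide_left_mono) (auto simp: power2_eq_square)
  then have "gll_weight p s / 2 \<le> 2 / (real p)\<^sup>2"
    using gll_weight_ends(2)[OF p s] by simp
  then have "gll_weight p s / 2 * ?Q \<le> 2 / (real p)\<^sup>2 * ?Q"
    using Q0 by (rule mult_right_mono)
  also have "\<dots> \<le> 2 / (real p)\<^sup>2 * (3 ^ CARD('n) * integral ref_cube (\<lambda>y. (f (upd j s y))\<^sup>2))"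
    by (intro mult_left_mono quad_equiv(2)[OF f p]) simp
  finally show ?thesis
    unfolding face_quad[OF p sg] by (simp add: mult_ac)
qed

section \<open>Elements and their faces\<close>

text \<open>Extension by zero to a box reduces the claim to boxes. The maps meant are permutations
  of coordinates combined with translations.\<close>

lemma has_integral_twiddle_set:
  fixes f :: "'b::euclidean_space \<Rightarrow> real" and g :: "'a::euclidean_space \<Rightarrow> 'b"
  assumes hg: "\<And>x. h (g x) = x" and gh: "\<And>x. g (h x) = x"
    and contg: "\<And>x. continuous (at x) g"
    and g: "\<And>u v. \<exists>w z. g ` cbox u v = cbox w z"
    and h: "\<And>u v. \<exists>w z. h ` cbox u v = cbox w z"
    and r: "\<And>u v. measure lborel (g ` cbox u v) = measure lborel (cbox u v)"
    and f: "(f has_integral i) S" and S: "bounded S"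
  shows "((\<lambda>x. f (g x)) has_integral i) (h ` S)"
proof -
  obtain a b where ab: "S \<subseteq> cbox a b"
    using bounded_subset_cbox_symmetric[OF S] by blast
  have "((\<lambda>x. if x \<in> S then f x else 0) has_integral i) (cbox a b)"
    using f by (subst has_integral_restrict[OF ab])
  then have "((\<lambda>x. if g x \<in> S then f (g x) else 0) has_integral (1 / 1) *\<^sub>R i) (h ` cbox a b)"
    by (intro has_integral_twiddle[of 1 h g]) (use assms in auto)
  moreover have "(g x \<in> S) = (x \<in> h ` S)" for x
    using hg gh by (metis imageE image_eqI)
  moreover have "h ` S \<subseteq> h ` cbox a b" using ab by blast
  ultimately show ?thesis by (simp add: has_integral_restrict)
qed

text \<open>The change of variables theorem in the library is restricted to well-ordered index types,
  hence the detour through a reindexing.\<close>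

lemma reindex_cbox:
  fixes \<rho> :: "'m::finite \<Rightarrow> 'n::finite" and b u v :: "real^'n"
  assumes "bij \<rho>"
  shows "(\<lambda>x. \<chi> i. (x - b) $ \<rho> i) ` cbox u v = cbox (\<chi> i. (u - b) $ \<rho> i) (\<chi> i. (v - b) $ \<rho> i)"
    and "measure lborel ((\<lambda>x. \<chi> i. (x - b) $ \<rho> i) ` cbox u v) = measure lborel (cbox u v)"
proof -
  show e: "(\<lambda>x. \<chi> i. (x - b) $ \<rho> i) ` cbox u v = cbox (\<chi> i. (u - b) $ \<rho> i) (\<chi> i. (v - b) $ \<rho> i)"
  proof (rule set_eqI, rule iffI)
    fix z assume z: "z \<in> cbox (\<chi> i. (u - b) $ \<rho> i) (\<chi> i. (v - b) $ \<rho> i)"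
    let ?x = "\<chi> j. z $ inv \<rho> j + b $ j"
    have "z = (\<chi> i. (?x - b) $ \<rho> i)"
      using assms by (simp add: vec_eq_iff bij_is_inj)
    moreover have "?x \<in> cbox u v"
    proof -
      have "u $ j \<le> z $ inv \<rho> j + b $ j \<and> z $ inv \<rho> j + b $ j \<le> v $ j" for j
        using z surj_f_inv_f[OF bij_is_surj[OF assms], of j]
        by (auto simp: mem_box_cart dest!: spec[of _ "inv \<rho> j"])
      then show ?thesis by (simp add: mem_box_cart)
    qed
    ultimately show "z \<in> (\<lambda>x. \<chi> i. (x - b) $ \<rho> i) ` cbox u v" by blast
  qed (auto simp: mem_box_cart)
  show "measure lborel ((\<lambda>x. \<chi> i. (x - b) $ \<rho> i) ` cbox u v) = measure lborel (cbox u v)"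
  proof (cases "cbox u v = {}")
    case False
    then have "(\<lambda>x. \<chi> i. (x - b) $ \<rho> i) ` cbox u v \<noteq> {}" by blast
    then show ?thesis
      using False prod.reindex_bij_betw[OF assms, of "\<lambda>j. v $ j - u $ j"]
      unfolding e by (simp add: content_cbox_cart)
  qed simp
qed

lemma det_le:
  fixes A :: "real^'n::finite^'n"
  assumes "\<And>i j. \<bar>A $ i $ j\<bar> \<le> a"
  shows "\<bar>det A\<bar> \<le> fact CARD('n) * a ^ CARD('n)"
proof -
  have "\<bar>det A\<bar> \<le> (\<Sum>p\<in>{p. p permutes (UNIV :: 'n set)}. \<bar>of_int (sign p) * (\<Prod>i\<in>UNIV. A $ i $ p i)\<bar>)"
    unfolding det_def by (rule sum_abs)
  also have "\<dots> \<le> (\<Sum>p\<in>{p. p permutes (UNIV :: 'n set)}. a ^ CARD('n))"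
  proof (rule sum_mono)
    fix p :: "'n \<Rightarrow> 'n"
    have "\<bar>\<Prod>i\<in>UNIV. A $ i $ p i\<bar> \<le> (\<Prod>i\<in>(UNIV :: 'n set). a)"
      unfolding abs_prod by (intro prod_mono) (use assms in auto)
    then show "\<bar>of_int (sign p) * (\<Prod>i\<in>UNIV. A $ i $ p i)\<bar> \<le> a ^ CARD('n)"
      by (simp add: abs_mult sign_def)
  qed
  also have "\<dots> = fact CARD('n) * a ^ CARD('n)"
    by (simp add: card_permutations[of UNIV "CARD('n)"])
  finally show ?thesis .
qed

lemma matrix_inv_both:
  fixes A :: "real^'n::finite^'n"
  assumes "invertible A"
  shows "A ** matrix_inv A = mat 1" "matrix_inv A ** A = mat 1"
proof -
  have "A ** matrix_inv A = mat 1 \<and> matrix_inv A ** A = mat 1"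
    unfolding matrix_inv_def by (rule someI_ex) (use assms in \<open>simp add: invertible_def\<close>)
  then show "A ** matrix_inv A = mat 1" "matrix_inv A ** A = mat 1" by auto
qed

lemma matrix_mult_reindex:
  fixes \<rho> :: "'m::finite \<Rightarrow> 'n::finite" and A B :: "real^'n^'n"
  assumes "bij \<rho>"
  shows "(\<chi> i j. A $ \<rho> i $ \<rho> j) ** (\<chi> i j. B $ \<rho> i $ \<rho> j) = ((\<chi> i j. (A ** B) $ \<rho> i $ \<rho> j) :: real^'m^'m)"
proof -
  have "(\<Sum>k\<in>UNIV. A $ \<rho> i $ \<rho> k * B $ \<rho> k $ \<rho> j) = (\<Sum>k\<in>UNIV. A $ \<rho> i $ k * B $ k $ \<rho> j)" for i j
    using sum.reindex_bij_betw[OF assms, of "\<lambda>k. A $ \<rho> i $ k * B $ k $ \<rho> j"] .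
  then show ?thesis by (simp add: vec_eq_iff matrix_matrix_mult_def)
qed

text \<open>The factor c is the modulus of the determinant of the relabelled matrix. It is exported
  only through bounds by the entries of the matrix and of its inverse, the lower one because the two
  determinants multiply to 1. The element map is decomposed into relabelling, a linear map, and
  relabelling back with the translation.\<close>

lemma elem_integral_wellorder:
  fixes K :: "'n::finite elt" and \<rho> :: "'m::{finite,wellorder} \<Rightarrow> 'n"
  assumes inv: "invertible (fst K)" and \<rho>: "bij \<rho>"
  shows "\<exists>c>0. (\<forall>a. (\<forall>i j. \<bar>fst K $ i $ j\<bar> \<le> a) \<longrightarrow> c \<le> fact CARD('m) * a ^ CARD('m)) \<and>
     (\<forall>b. (\<forall>i j. \<bar>matrix_inv (fst K) $ i $ j\<bar> \<le> b) \<longrightarrow> 1 \<le> c * (fact CARD('m) * b ^ CARD('m))) \<and>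
     (\<forall>f. continuous_on UNIV f \<longrightarrow> (f has_integral c * integral ref_cube (\<lambda>y. f (emap K y))) (elem K))"
proof -
  obtain A b where K: "K = (A, b)" by fastforce
  let ?A = "(\<chi> i j. A $ \<rho> i $ \<rho> j) :: real^'m::{finite,wellorder}^'m::{finite,wellorder}"
  let ?B = "(\<chi> i j. matrix_inv A $ \<rho> i $ \<rho> j) :: real^'m::{finite,wellorder}^'m::{finite,wellorder}"
  have AB: "A ** matrix_inv A = mat 1" using inv K by (simp add: matrix_inv_both)
  have "?A ** ?B = mat 1"
    unfolding matrix_mult_reindex[OF \<rho>] AB using bij_is_inj[OF \<rho>]
    by (simp add: vec_eq_iff mat_def inj_eq)
  then have dd: "det ?A * det ?B = 1" by (metis det_I det_mul)
  define c where "c = \<bar>det ?A\<bar>"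
  have c0: "c > 0" using dd unfolding c_def by auto
  let ?R = "\<lambda>b x. (\<chi> i. (x - b) $ \<rho> i) :: real^'m::{finite,wellorder}" and ?h = "\<lambda>b z. (\<chi> j. z $ inv \<rho> j) + b :: real^'n"
  have i1: "inv \<rho> (\<rho> i) = i" for i using \<rho> by (simp add: bij_is_inj)
  have i2: "\<rho> (inv \<rho> j) = j" for j using \<rho> by (simp add: bij_is_surj surj_f_inv_f)
  have hg: "?h b (?R b x) = x" and gh: "?R b (?h b z) = z" for b x z
    by (simp_all add: vec_eq_iff i1 i2)
  have himg: "?h b ` cbox u v = cbox (?h b u) (?h b v)" for b u v
  proof -
    have e: "?h b z = (\<chi> j. (z - (\<chi> i. - b $ \<rho> i)) $ inv \<rho> j)" for z
      by (auto simp: vec_eq_iff i2)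
    show ?thesis
      unfolding e by (rule reindex_cbox(1)[OF bij_imp_bij_inv[OF \<rho>]])
  qed
  have hcont: "measure lborel (?h b ` cbox u v) = measure lborel (cbox u v)" for b u v
  proof -
    have e: "?h b z = (\<chi> j. (z - (\<chi> i. - b $ \<rho> i)) $ inv \<rho> j)" for z
      by (auto simp: vec_eq_iff i2)
    show ?thesis
      unfolding e by (rule reindex_cbox(2)[OF bij_imp_bij_inv[OF \<rho>]])
  qed
  have hex: "\<exists>w z. ?h b ` cbox u v = cbox w z" for b u v
    using himg by blast
  have Rex: "\<exists>w z. ?R b ` cbox u v = cbox w z" for b u v
    using reindex_cbox(1)[OF \<rho>] by blast
  have contR: "continuous (at x) (?R b)" and conth: "continuous (at z) (?h b)" for b x z
    unfolding isCont_def by (intro tendsto_intros vec_tendstoI; simp; intro tendsto_intros)+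
  have RA: "(\<chi> j. (?A *v z) $ inv \<rho> j) = A *v (\<chi> j. z $ inv \<rho> j)" for z
  proof -
    have "(\<Sum>l\<in>UNIV. A $ j $ \<rho> l * z $ l) = (\<Sum>k\<in>UNIV. A $ j $ k * z $ inv \<rho> k)" for j
      using sum.reindex_bij_betw[OF \<rho>, of "\<lambda>k. A $ j $ k * z $ inv \<rho> k"] by (simp add: i1)
    then show ?thesis by (simp add: vec_eq_iff matrix_vector_mult_def i2)
  qed
  have cubeimg: "?h 0 ` ref_cube = ref_cube" "?R 0 ` ref_cube = ref_cube"
    unfolding ref_cube_eq_cbox himg reindex_cbox(1)[OF \<rho>] by simp_all
  have main: "(f has_integral c * integral ref_cube (\<lambda>y. f (emap K y))) (elem K)"
    if f: "continuous_on UNIV f" for f :: "real^'n \<Rightarrow> real"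
  proof -
    let ?F = "\<lambda>z. f (?h b z)"
    have Fc: "continuous_on UNIV ?F"
      by (rule continuous_on_compose2[OF f]) (auto intro!: continuous_intros)
    \<comment> \<open>The theorem on linear images is stated for vector-valued integrands, so the
      scalar one is wrapped in \<open>real^1\<close>.\<close>
    define F1 where "F1 z = ((\<chi> i. ?F z) :: real^1)" for z
    have F11: "F1 z $ 1 = ?F z" for z by (simp add: F1_def)
    have "continuous_on UNIV (\<lambda>z. F1 (?A *v z))"
      unfolding F1_def
      by (intro continuous_on_vec_lambda continuous_on_compose2[OF Fc] matrix_vector_mult_linear_continuous_on) auto
    then have Fa: "F1 \<circ> ((*v) ?A) absolutely_integrable_on ref_cube"
      unfolding ref_cube_eq_cbox o_def
      by (intro absolutely_integrable_continuous) (auto intro: continuous_on_subset)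
    have "F1 absolutely_integrable_on ((*v) ?A) ` ref_cube"
      and I1: "integral (((*v) ?A) ` ref_cube) F1 = \<bar>det ?A\<bar> *\<^sub>R integral ref_cube (F1 \<circ> ((*v) ?A))"
      using absolutely_integrable_on_linear_image[where g = "(*v) ?A" and f = F1 and S = ref_cube]
        integral_change_of_variables_linear[where g = "(*v) ?A" and f = F1 and S = ref_cube] Fa
      by auto
    then have "?F integrable_on ((*v) ?A) ` ref_cube"
      unfolding absolutely_integrable_on_def integrable_on_1_iff F11 by blast
    moreover have "integral (((*v) ?A) ` ref_cube) ?F = c * integral ref_cube (\<lambda>z. ?F (?A *v z))"
      using arg_cong[OF I1, of "\<lambda>v. v $ 1"] unfolding integral_on_1_eq o_def F11 c_def by simp
    ultimately have 1: "(?F has_integral c * integral ref_cube (\<lambda>z. ?F (?A *v z))) (((*v) ?A) ` ref_cube)"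
      by (metis integrable_integral)
    have "(\<lambda>z. ?F (?A *v z)) = (\<lambda>z. f (emap K (?h 0 z)))"
      using RA by (simp add: emap_def K)
    moreover have "integral ref_cube (\<lambda>z. f (emap K (?h 0 z))) = integral ref_cube (\<lambda>y. f (emap K y))"
    proof (rule integral_unique)
      have "continuous_on UNIV (\<lambda>y. f (emap K y))"
        unfolding emap_def by (rule continuous_on_compose2[OF f]) (auto intro!: continuous_intros)
      then have "((\<lambda>y. f (emap K y)) has_integral integral ref_cube (\<lambda>y. f (emap K y))) ref_cube"
        by (intro integrable_integral continuous_on_cube_integrable)
      then have "((\<lambda>z. f (emap K (?h 0 z))) has_integral integral ref_cube (\<lambda>y. f (emap K y))) (?R 0 ` ref_cube)"
        by (rule has_integral_twiddle_set[OF gh hg conth hex Rex hcont])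
           (simp add: ref_cube_eq_cbox)
      then show "((\<lambda>z. f (emap K (?h 0 z))) has_integral integral ref_cube (\<lambda>y. f (emap K y))) ref_cube"
        unfolding cubeimg .
    qed
    ultimately have "(?F has_integral c * integral ref_cube (\<lambda>y. f (emap K y))) (((*v) ?A) ` ref_cube)"
      using 1 by simp
    moreover have "bounded (((*v) ?A) ` ref_cube)"
      unfolding ref_cube_eq_cbox by (intro bounded_linear_image bounded_cbox) simp
    ultimately have "((\<lambda>x. ?F (?R b x)) has_integral c * integral ref_cube (\<lambda>y. f (emap K y))) (?h b ` ((*v) ?A) ` ref_cube)"
      by (intro has_integral_twiddle_set[OF hg gh contR Rex hex reindex_cbox(2)[OF \<rho>]])
    moreover have "?h b ` ((*v) ?A) ` ref_cube = elem K"
    proof -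
      have "?h b ` ((*v) ?A) ` ref_cube = emap K ` ?h 0 ` ref_cube"
        unfolding image_image by (intro image_cong refl) (simp add: emap_def K RA)
      then show ?thesis unfolding cubeimg elem_def .
    qed
    ultimately show ?thesis unfolding hg by simp
  qed
  have "c \<le> fact CARD('m) * a ^ CARD('m)" if "\<forall>i j. \<bar>fst K $ i $ j\<bar> \<le> a" for a
    unfolding c_def by (rule det_le) (use that K in auto)
  moreover have "1 \<le> c * (fact CARD('m) * a ^ CARD('m))" if "\<forall>i j. \<bar>matrix_inv (fst K) $ i $ j\<bar> \<le> a" for a
  proof -
    have "1 = c * \<bar>det ?B\<bar>" using dd unfolding c_def by (simp flip: abs_mult)
    also have "\<dots> \<le> c * (fact CARD('m) * a ^ CARD('m))"
      by (intro mult_left_mono det_le) (use that K c0 in auto)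
    finally show ?thesis .
  qed
  ultimately show ?thesis using c0 main by blast
qed

text \<open>The types \<open>2\<close> and \<open>3\<close> are well-ordered index types of the
  right size; this is the use made of the restriction on the dimension.\<close>

lemma elem_integral:
  fixes K :: "'n::finite elt"
  assumes inv: "invertible (fst K)" and d: "CARD('n) = 2 \<or> CARD('n) = 3"
  shows "\<exists>c>0. (\<forall>a. (\<forall>i j. \<bar>fst K $ i $ j\<bar> \<le> a) \<longrightarrow> c \<le> fact CARD('n) * a ^ CARD('n)) \<and>
     (\<forall>b. (\<forall>i j. \<bar>matrix_inv (fst K) $ i $ j\<bar> \<le> b) \<longrightarrow> 1 \<le> c * (fact CARD('n) * b ^ CARD('n))) \<and>
     (\<forall>f. continuous_on UNIV f \<longrightarrow> (f has_integral c * integral ref_cube (\<lambda>y. f (emap K y))) (elem K))"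
  using d
proof
  assume c: "CARD('n) = 2"
  then have "card (UNIV :: 2 set) = card (UNIV :: 'n set)" by simp
  then obtain \<rho> :: "2 \<Rightarrow> 'n" where "bij \<rho>" using finite_same_card_bij[of "UNIV :: 2 set" "UNIV :: 'n set"] by auto
  from elem_integral_wellorder[OF inv this] show ?thesis using c by simp
next
  assume c: "CARD('n) = 3"
  then have "card (UNIV :: 3 set) = card (UNIV :: 'n set)" by simp
  then obtain \<rho> :: "3 \<Rightarrow> 'n" where "bij \<rho>" using finite_same_card_bij[of "UNIV :: 3 set" "UNIV :: 'n set"] by auto
  from elem_integral_wellorder[OF inv this] show ?thesis using c by simp
qed

definition einv :: "'n::finite elt \<Rightarrow> real^'n \<Rightarrow> real^'n" where
  "einv K x = matrix_inv (fst K) *v (x - snd K)"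

lemma einv_emap: "invertible (fst K) \<Longrightarrow> einv K (emap K y) = y"
  by (simp add: einv_def emap_def matrix_vector_mul_assoc matrix_inv_both)

lemma emap_einv: "invertible (fst K) \<Longrightarrow> emap K (einv K x) = x"
  by (simp add: einv_def emap_def matrix_vector_mul_assoc matrix_inv_both)

lemma emap_eq_iff: "invertible (fst K) \<Longrightarrow> emap K y = emap K z \<longleftrightarrow> y = z"
  by (metis einv_emap)

lemma emap_mem_elem_iff: "invertible (fst K) \<Longrightarrow> emap K y \<in> elem K \<longleftrightarrow> y \<in> ref_cube"
  unfolding elem_def by (metis einv_emap image_iff)

lemma emap_image: "emap K ` S = (+) (snd K) ` ((*v) (fst K)) ` S"
  by (simp add: image_image emap_def add.commute)

lemma inj_mult_invertible: "invertible A \<Longrightarrow> inj ((*v) (A :: real^'n::finite^'n))"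
  by (metis (no_types, lifting) injI matrix_inv_both(2) matrix_vector_mul_assoc matrix_vector_mul_lid)

lemma face_of_emap_iff:
  "invertible (fst K) \<Longrightarrow> emap K ` E face_of emap K ` S \<longleftrightarrow> E face_of S"
  unfolding emap_image by (simp add: face_of_linear_image inj_mult_invertible)

lemma interior_elem:
  assumes "invertible (fst K)"
  shows "interior (elem K) = emap K ` {y. \<forall>i. -1 < y $ i \<and> y $ i < 1}"
proof -
  have "interior (elem K) = emap K ` interior ref_cube"
    unfolding elem_def emap_image interior_translation
    by (subst interior_injective_linear_image) (auto simp: inj_mult_invertible assms)
  moreover have "interior (ref_cube :: (real^'a) set) = {y. \<forall>i. -1 < y $ i \<and> y $ i < 1}"
    unfolding ref_cube_eq_cbox by (auto simp: interior_cbox mem_box_cart)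
  ultimately show ?thesis by simp
qed

lemma polytope_elem: "polytope (elem K)"
  unfolding elem_def emap_image polytope_translation_eq ref_cube_eq_cbox
  by (intro polytope_linear_image polytope_interval) auto

lemma compact_elem: "compact (elem K)"
  by (rule polytope_imp_compact[OF polytope_elem])

lemma convex_elem: "convex (elem K)"
  by (rule polytope_imp_convex[OF polytope_elem])

lemma einv_continuous: "continuous_on S (einv K)"
  unfolding einv_def
  by (rule continuous_on_compose2[OF matrix_vector_mult_linear_continuous_on[of UNIV]]) (auto intro!: continuous_intros)

lemma interior_elem_nonempty: "invertible (fst K) \<Longrightarrow> interior (elem K) \<noteq> {}"
  by (auto simp: interior_elem intro!: exI[of _ 0])

lemma aff_dim_elem: "invertible (fst K) \<Longrightarrow> aff_dim (elem (K :: 'n::finite elt)) = int CARD('n)"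
  using aff_dim_nonempty_interior[OF interior_elem_nonempty[of K]] by simp

text \<open>One encoding for faces of all dimensions: an empty \<open>I\<close> gives the whole
  cube, a singleton a facet, and \<open>UNIV\<close> a vertex.\<close>

definition cface :: "'n::finite set \<Rightarrow> ('n \<Rightarrow> real) \<Rightarrow> (real^'n) set" where
  "cface I s = {y \<in> ref_cube. \<forall>i\<in>I. y $ i = s i}"

lemma pos_lower_bound: "finite J \<Longrightarrow> (\<And>i. i \<in> J \<Longrightarrow> f i > (0::real)) \<Longrightarrow> \<exists>t>0. \<forall>i\<in>J. t \<le> f i"
proof (induction J rule: finite_induct)
  case (insert a J)
  then obtain t where "t > 0" "\<forall>i\<in>J. t \<le> f i" by auto
  then show ?case using insert by (intro exI[of _ "min t (f a)"]) auto
qed (auto intro: exI[of _ 1])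

text \<open>\<open>I\<close> collects the coordinates that are constantly 1 or constantly -1 on the
  face. A relative interior point e has all other coordinates strictly inside (-1, 1), so the
  segment from any x of the candidate face to e can be prolonged within the cube, and the face
  property puts x into \<open>E\<close>.\<close>

lemma face_of_ref_cube:
  assumes E: "E face_of ref_cube" "E \<noteq> {}"
  shows "\<exists>I s. (\<forall>i. s i = 1 \<or> s i = -1) \<and> E = cface I s"
proof -
  define I where "I = {i. \<exists>c. (c = 1 \<or> c = -1) \<and> (\<forall>y\<in>E. y $ i = c)}"
  define s where "s i = (if \<forall>y\<in>E. y $ i = 1 then 1 else -1 :: real)" for i
  have EI: "y $ i = s i" if "y \<in> E" "i \<in> I" for y i
    using that by (auto simp: I_def s_def)
  have Ec: "convex E" "E \<subseteq> ref_cube" using E face_of_imp_convex face_of_imp_subset by blast+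
  then obtain e where e: "e \<in> rel_interior E" using E rel_interior_eq_empty by blast
  then have eE: "e \<in> E" using rel_interior_subset by blast
  have bd: "-1 \<le> y $ i \<and> y $ i \<le> 1" if "y \<in> E" for y i using that Ec by (auto simp: ref_cube_def)
  \<comment> \<open>If e attained 1 or -1 in coordinate i while some y of the face does not,
    prolonging the segment from y beyond e would leave the cube.\<close>
  have strict: "\<bar>e $ i\<bar> < 1" if i: "i \<notin> I" for i
  proof (rule ccontr)
    assume "\<not> ?thesis"
    then obtain c where c: "c = 1 \<or> c = -1" "e $ i = c" using bd[OF eE, of i] by (cases "e $ i \<ge> 0") auto
    then obtain y where y: "y \<in> E" "y $ i \<noteq> c" using i unfolding I_def by blast
    from e y(1) obtain t where t: "t > 1" "(1 - t) *\<^sub>R y + t *\<^sub>R e \<in> E"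
      using convex_rel_interior_iff[OF Ec(1) E(2)] by blast
    have "-1 \<le> (1 - t) * y $ i + t * c \<and> (1 - t) * y $ i + t * c \<le> 1"
      using bd[OF t(2), of i] c by simp
    moreover have "(1 - t) * y $ i + t * c = c + (t - 1) * (c - y $ i)" by (simp add: algebra_simps)
    ultimately have *: "-1 \<le> c + (t - 1) * (c - y $ i)" "c + (t - 1) * (c - y $ i) \<le> 1" by auto
    from c(1) show False
    proof
      assume "c = 1"
      then have "(t - 1) * (c - y $ i) > 0" using t y bd[OF y(1), of i] by (intro mult_pos_pos) auto
      then show False using * \<open>c = 1\<close> by simp
    next
      assume "c = -1"
      then have "(t - 1) * (c - y $ i) < 0" using t y bd[OF y(1), of i] by (intro mult_pos_neg) auto
      then show False using * \<open>c = -1\<close> by simp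
    qed
  qed
  have "E = cface I s"
  proof
    show "E \<subseteq> cface I s" using Ec EI by (auto simp: cface_def)
    show "cface I s \<subseteq> E"
    proof
      fix x assume x: "x \<in> cface I s"
      show "x \<in> E"
      proof (cases "x = e")
        case False
        obtain t where t: "t > 0" "\<And>i. i \<in> - I \<Longrightarrow> t \<le> (1 - \<bar>e $ i\<bar>) / 2"
          using pos_lower_bound[of "- I" "\<lambda>i. (1 - \<bar>e $ i\<bar>) / 2"] strict by force
        \<comment> \<open>The point z lies slightly beyond e as seen from x. Coordinates in
          \<open>I\<close> agree for e and x and do not move; \<open>t\<close> is small enough for
          all others.\<close>
        define z where "z = e + t *\<^sub>R (e - x)"
        have "-1 \<le> z $ i \<and> z $ i \<le> 1" for i
        proof (cases "i \<in> I")
          case True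
          then show ?thesis using x EI[OF eE] bd[OF eE, of i] by (auto simp: z_def cface_def)
        next
          case i: False
          have "\<bar>e $ i - x $ i\<bar> \<le> 2"
            using x bd[OF eE, of i] by (auto simp: cface_def ref_cube_def abs_le_iff intro: order.trans dest!: spec[of _ i])
          then have "\<bar>t * (e $ i - x $ i)\<bar> \<le> t * 2"
            using t(1) by (simp add: abs_mult)
          then show ?thesis using t(2)[of i] i by (auto simp: z_def abs_le_iff)
        qed
        then have z: "z \<in> ref_cube" by (simp add: ref_cube_def)
        have "e = (1 - t / (1 + t)) *\<^sub>R z + (t / (1 + t)) *\<^sub>R x"
        proof -
          have "(1 + t) *\<^sub>R e = z + t *\<^sub>R x" by (simp add: z_def algebra_simps)
          then have "e = (1 / (1 + t)) *\<^sub>R (z + t *\<^sub>R x)"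
            using t(1) by (metis add_pos_pos divide_self_if less_irrefl scaleR_one scaleR_scaleR times_divide_eq_left zero_less_one mult_1)
          moreover have "1 - t / (1 + t) = 1 / (1 + t)" using t(1) by (simp add: field_simps)
          ultimately show ?thesis by (simp add: scaleR_add_right)
        qed
        moreover have "z \<noteq> x"
        proof
          assume "z = x"
          then have "(1 + t) *\<^sub>R (e - x) = 0" by (simp add: z_def algebra_simps)
          then show False using t(1) False by auto
        qed
        ultimately have "e \<in> open_segment z x"
          using t(1) unfolding in_segment by (intro conjI exI[of _ "t / (1 + t)"]) auto
        then show ?thesis
          using face_ofD[OF E(1) _ z _ eE] x by (auto simp: cface_def)
      qed (use eE in simp)
    qed
  qed
  then show ?thesis by (intro exI[of _ I] exI[of _ s]) (auto simp: s_def)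
qed

lemma face_of_elem:
  assumes "invertible (fst K)" "E face_of elem K" "E \<noteq> {}"
  shows "\<exists>I s. (\<forall>i. s i = 1 \<or> s i = -1) \<and> E = emap K ` cface I s"
proof -
  have "E = emap K ` einv K ` E" using assms(1) by (simp add: image_image emap_einv)
  then have "einv K ` E face_of ref_cube"
    using assms face_of_emap_iff[of K "einv K ` E" ref_cube] by (simp add: elem_def)
  from face_of_ref_cube[OF this] show ?thesis
    using assms(3) \<open>E = emap K ` einv K ` E\<close> by (metis image_is_empty)
qed

lemma cface_single_face:
  assumes "s = 1 \<or> s = -1"
  shows "cface {j} (\<lambda>_. s) face_of ref_cube"
proof -
  have "cface {j} (\<lambda>_. s) = ref_cube \<inter> {y. axis j s \<bullet> y = 1}"
    using assms by (auto simp: cface_def inner_axis')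
  moreover have "convex (ref_cube :: (real^'a) set)" by (simp add: ref_cube_eq_cbox)
  moreover have "axis j s \<bullet> y \<le> 1" if "y \<in> ref_cube" for y
    using that assms by (auto simp: inner_axis' ref_cube_def minus_le_iff)
  ultimately show ?thesis by (simp add: face_of_Int_supporting_hyperplane_le)
qed

text \<open>The face description puts the facet inside a coordinate facet. Dimension grows strictly
  along proper faces, and between a facet and its element there is no room, so the two
  coincide.\<close>

lemma facet_of_elem:
  fixes K :: "'n::finite elt"
  assumes K: "invertible (fst K)" and F: "F facet_of elem K"
  shows "\<exists>j s. (s = 1 \<or> s = -1) \<and> F = emap K ` cface {j} (\<lambda>_. s)"
proof -
  have F': "F face_of elem K" "F \<noteq> {}" "aff_dim F = aff_dim (elem K) - 1"
    using F by (auto simp: facet_of_def)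
  obtain I s where s: "\<forall>i. s i = 1 \<or> s i = -1" and FI: "F = emap K ` cface I s"
    using face_of_elem[OF K F'(1,2)] by blast
  have "I \<noteq> {}"
  proof
    assume "I = {}"
    then have "F = elem K" using FI by (simp add: cface_def elem_def)
    then show False using F'(3) by simp
  qed
  then obtain j where j: "j \<in> I" by blast
  let ?G = "emap K ` cface {j} (\<lambda>_. s j)"
  have sj: "s j = 1 \<or> s j = -1" using s by blast
  have G: "?G face_of elem K"
    unfolding elem_def face_of_emap_iff[OF K] by (rule cface_single_face[OF sj])
  have "?G \<noteq> elem K"
  proof
    assume "?G = elem K"
    moreover have "emap K 0 \<in> elem K" by (auto simp: elem_def ref_cube_def)
    ultimately have "0 \<in> cface {j} (\<lambda>_. s j)" using K by (metis (no_types, lifting) emap_eq_iff imageE)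
    then show False using sj by (auto simp: cface_def)
  qed
  then have "aff_dim ?G < aff_dim (elem K)"
    using face_of_aff_dim_lt[OF convex_elem G] by blast
  have "F \<subseteq> ?G" unfolding FI using j by (intro image_mono) (auto simp: cface_def)
  then have "F face_of ?G" by (rule face_of_subset[OF F'(1) _ face_of_imp_subset[OF G]])
  have "F = ?G"
  proof (rule ccontr)
    assume "F \<noteq> ?G"
    then have "aff_dim F < aff_dim ?G"
      using face_of_aff_dim_lt[OF face_of_imp_convex[OF G] \<open>F face_of ?G\<close>] by blast
    then show False using \<open>aff_dim ?G < aff_dim (elem K)\<close> F'(3) by simp
  qed
  then show ?thesis using sj by blast
qed

text \<open>An affine bijection between faces of the cube maps vertices to vertices, so each free coordinate
  of the image takes only the values 1 and -1 on sign vectors; hence it depends on exactly one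
  coordinate of the argument.\<close>

lemma cface_affine_map:
  fixes M :: "real^'n::finite^'n" and c :: "real^'n"
  defines "\<Phi> \<equiv> (\<lambda>y. M *v y + c)"
  assumes inj: "inj \<Phi>" and img: "\<Phi> ` cface I s = cface I' s'"
    and s: "\<And>i. s i = 1 \<or> s i = -1" and s': "\<And>i. s' i = 1 \<or> s' i = -1"
  shows "\<exists>\<pi> e. bij_betw \<pi> (- I') (- I) \<and> (\<forall>i. e i = 1 \<or> e i = (-1::real)) \<and>
           (\<forall>y. (\<forall>i\<in>I. y $ i = s i) \<longrightarrow> \<Phi> y = (\<chi> i. if i \<in> I' then s' i else e i * y $ \<pi> i))"
proof -
  define b where "b i = c $ i + (\<Sum>j\<in>I. M $ i $ j * s j)" for i
  have sb: "\<bar>s i\<bar> \<le> 1" "\<bar>s' i\<bar> \<le> 1" for i using s[of i] s'[of i] by auto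
  have coord: "\<Phi> y $ i = b i + (\<Sum>j\<in>- I. M $ i $ j * y $ j)" if "\<forall>i\<in>I. y $ i = s i" for y i
  proof -
    have "(M *v y) $ i = (\<Sum>j\<in>I. M $ i $ j * y $ j) + (\<Sum>j\<in>- I. M $ i $ j * y $ j)"
      unfolding matrix_vector_mult_def by (simp add: sum.subset_diff[of I UNIV] Compl_eq_Diff_UNIV add.commute)
    moreover have "(\<Sum>j\<in>I. M $ i $ j * y $ j) = (\<Sum>j\<in>I. M $ i $ j * s j)"
      using that by (intro sum.cong) auto
    ultimately show ?thesis by (simp add: \<Phi>_def b_def)
  qed
  define pt where "pt f = (\<chi> i. if i \<in> I then s i else f i)" for f
  have pt_in: "pt f \<in> cface I s" if "\<And>i. \<bar>f i\<bar> \<le> 1" for f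
    using that sb by (auto simp: pt_def cface_def ref_cube_def abs_le_iff minus_le_iff)
  have pt_coord: "\<Phi> (pt f) $ i = b i + (\<Sum>j\<in>- I. M $ i $ j * f j)" if "\<And>i. \<bar>f i\<bar> \<le> 1" for f i
    using coord[of "pt f" i] by (simp add: pt_def)
  have \<Phi>_in: "\<Phi> y \<in> cface I' s'" if "y \<in> cface I s" for y using img that by blast
  have \<Phi>_bd: "\<bar>\<Phi> y $ i\<bar> \<le> 1" if "y \<in> cface I s" for y i
    using \<Phi>_in[OF that] by (auto simp: cface_def ref_cube_def abs_le_iff minus_le_iff)
  \<comment> \<open>If coordinate i of the image were strictly inside (-1, 1), the image could be
    moved both ways along that axis within the target face. The two preimages have the sign vector
    as midpoint, and a vertex is the midpoint of no proper segment.\<close>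
  have vertex: "\<Phi> (pt f) $ i = 1 \<or> \<Phi> (pt f) $ i = -1" if f: "\<And>i. f i = 1 \<or> f i = -1" and i: "i \<notin> I'" for f i
  proof (rule ccontr)
    assume no: "\<not> ?thesis"
    have f1: "\<bar>f i\<bar> \<le> 1" for i using f[of i] by auto
    let ?z = "\<Phi> (pt f)"
    have zb: "\<bar>?z $ i\<bar> < 1" using no \<Phi>_bd[OF pt_in[of f, OF f1], of i] by (auto simp: abs_if split: if_splits)
    define \<delta> where "\<delta> = 1 - \<bar>?z $ i\<bar>"
    have d: "\<delta> > 0" using zb by (simp add: \<delta>_def)
    have "?z + axis i t \<in> cface I' s'" if "\<bar>t\<bar> \<le> \<delta>" for t
      using \<Phi>_in[OF pt_in[of f, OF f1]] i that
      by (auto simp: cface_def ref_cube_def axis_def \<delta>_def)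
    then have "?z + axis i \<delta> \<in> \<Phi> ` cface I s" "?z + axis i (-\<delta>) \<in> \<Phi> ` cface I s"
      unfolding img using d by auto
    then obtain y1 y2 where y: "y1 \<in> cface I s" "y2 \<in> cface I s" "\<Phi> y1 = ?z + axis i \<delta>" "\<Phi> y2 = ?z + axis i (-\<delta>)"
      by (metis imageE)
    have "\<Phi> ((1/2) *\<^sub>R (y1 + y2)) = (1/2) *\<^sub>R (\<Phi> y1 + \<Phi> y2)"
      by (simp add: \<Phi>_def matrix_vector_mult_scaleR matrix_vector_right_distrib scaleR_add_right flip: scaleR_left.add)
    also have "\<dots> = ?z" unfolding y(3,4) by (simp add: vec_eq_iff axis_def)
    finally have mid: "(1/2) *\<^sub>R (y1 + y2) = pt f" using inj by (simp add: inj_eq)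
    have "y1 $ k = y2 $ k" for k
    proof -
      have "(y1 $ k + y2 $ k) / 2 = 1 \<or> (y1 $ k + y2 $ k) / 2 = -1"
        using arg_cong[OF mid, of "\<lambda>v. v $ k"] s[of k] f[of k] by (auto simp: pt_def split: if_splits)
      moreover have "-1 \<le> y1 $ k" "y1 $ k \<le> 1" "-1 \<le> y2 $ k" "y2 $ k \<le> 1"
        using y(1,2) by (auto simp: cface_def ref_cube_def)
      ultimately show ?thesis by auto
    qed
    then have "y1 = y2" by (simp add: vec_eq_iff)
    then have "axis i \<delta> $ i = axis i (-\<delta>) $ i" using y(3,4) by simp
    then show False using d by simp
  qed
  \<comment> \<open>Flipping coordinate j of a sign vector changes image coordinate i by
    \<open>2 * M $ i $ j\<close>, and both image values are 1 or -1.\<close>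
  have Mval: "M $ i $ j = 0 \<or> M $ i $ j = 1 \<or> M $ i $ j = -1" if i: "i \<notin> I'" and j: "j \<notin> I" for i j
  proof -
    let ?f = "\<lambda>k. 1 :: real" and ?g = "\<lambda>k. if k = j then -1 else 1 :: real"
    have "\<Phi> (pt ?f) $ i - \<Phi> (pt ?g) $ i = (\<Sum>k\<in>- I. M $ i $ k * (?f k - ?g k))"
      by (subst (1 2) pt_coord) (auto simp: sum_subtractf right_diff_distrib)
    also have "\<dots> = (\<Sum>k\<in>- I. if k = j then 2 * M $ i $ j else 0)"
      by (intro sum.cong) auto
    also have "\<dots> = 2 * M $ i $ j" using j by simp
    finally have d: "\<Phi> (pt ?f) $ i - \<Phi> (pt ?g) $ i = 2 * M $ i $ j" .
    have "\<Phi> (pt ?f) $ i = 1 \<or> \<Phi> (pt ?f) $ i = -1" "\<Phi> (pt ?g) $ i = 1 \<or> \<Phi> (pt ?g) $ i = -1"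
      by (rule vertex[OF _ i], simp)+
    then show ?thesis using d by auto
  qed
  \<comment> \<open>The sign pattern of row i, and its negative, realise the extreme values of image
    coordinate i over the face.\<close>
  have sumM: "b i + (\<Sum>j\<in>- I. \<bar>M $ i $ j\<bar>) \<le> 1" "-1 \<le> b i - (\<Sum>j\<in>- I. \<bar>M $ i $ j\<bar>)" for i
  proof -
    have *: "\<bar>sgn (M $ i $ j)\<bar> \<le> 1" "\<bar>- sgn (M $ i $ j)\<bar> \<le> 1" for j by (auto simp: sgn_if)
    have sa: "M $ i $ j * sgn (M $ i $ j) = \<bar>M $ i $ j\<bar>" "M $ i $ j * - sgn (M $ i $ j) = - \<bar>M $ i $ j\<bar>" for j
      by (auto simp: sgn_if)
    have "\<Phi> (pt (\<lambda>j. sgn (M $ i $ j))) $ i = b i + (\<Sum>j\<in>- I. \<bar>M $ i $ j\<bar>)"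
      using pt_coord[of "\<lambda>j. sgn (M $ i $ j)" i, OF *(1)] unfolding sa .
    moreover have "\<bar>\<Phi> (pt (\<lambda>j. sgn (M $ i $ j))) $ i\<bar> \<le> 1"
      by (intro \<Phi>_bd pt_in *(1))
    ultimately show "b i + (\<Sum>j\<in>- I. \<bar>M $ i $ j\<bar>) \<le> 1" by linarith
    have "\<Phi> (pt (\<lambda>j. - sgn (M $ i $ j))) $ i = b i + (\<Sum>j\<in>- I. - \<bar>M $ i $ j\<bar>)"
      using pt_coord[of "\<lambda>j. - sgn (M $ i $ j)" i, OF *(2)] unfolding sa .
    moreover have "\<bar>\<Phi> (pt (\<lambda>j. - sgn (M $ i $ j))) $ i\<bar> \<le> 1"
      by (intro \<Phi>_bd pt_in *(2))
    ultimately show "-1 \<le> b i - (\<Sum>j\<in>- I. \<bar>M $ i $ j\<bar>)"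
      unfolding sum_negf by linarith
  qed
  have tgt: "\<exists>y\<in>cface I s. \<Phi> y = z" if "z \<in> cface I' s'" for z
    using that img by (metis imageE)
  define pt' where "pt' f = (\<chi> i. if i \<in> I' then s' i else f i)" for f
  have pt'_in: "pt' f \<in> cface I' s'" if "\<And>i. \<bar>f i\<bar> \<le> 1" for f
    using that sb by (auto simp: pt'_def cface_def ref_cube_def abs_le_iff minus_le_iff)
  \<comment> \<open>A row of zeros would make coordinate i constant, contradicting surjectivity. One
    entry of modulus 1 already exhausts the bound on the row sum, so the remaining entries and the
    offset vanish.\<close>
  have ex: "\<exists>j. j \<notin> I \<and> \<bar>M $ i $ j\<bar> = 1 \<and> (\<forall>k. k \<notin> I \<longrightarrow> k \<noteq> j \<longrightarrow> M $ i $ k = 0) \<and> b i = 0" if i: "i \<notin> I'" for i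
  proof -
    have "\<exists>j. j \<notin> I \<and> M $ i $ j \<noteq> 0"
    proof (rule ccontr)
      assume "\<not> ?thesis"
      then have "(\<Sum>j\<in>- I. M $ i $ j * y $ j) = 0" for y :: "real^'n"
        by (intro sum.neutral) auto
      then have const: "\<Phi> y $ i = b i" if "y \<in> cface I s" for y
        using coord[of y i] that by (simp add: cface_def)
      obtain y z where "y \<in> cface I s" "\<Phi> y = pt' (\<lambda>_. 1)" "z \<in> cface I s" "\<Phi> z = pt' (\<lambda>_. -1)"
        using tgt[OF pt'_in[of "\<lambda>_. 1"]] tgt[OF pt'_in[of "\<lambda>_. -1"]] by auto
      then have "pt' (\<lambda>_. 1) $ i = pt' (\<lambda>_. -1) $ i" using const by metis
      then show False using i by (simp add: pt'_def)
    qed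
    then obtain j where j: "j \<notin> I" "M $ i $ j \<noteq> 0" by blast
    then have j1: "\<bar>M $ i $ j\<bar> = 1" using Mval[OF i j(1)] by auto
    have S: "(\<Sum>k\<in>- I. \<bar>M $ i $ k\<bar>) = 1 + (\<Sum>k\<in>- I - {j}. \<bar>M $ i $ k\<bar>)"
      using j(1) j1 by (subst sum.remove[of _ j]) auto
    have nn: "0 \<le> (\<Sum>k\<in>- I - {j}. \<bar>M $ i $ k\<bar>)" by (intro sum_nonneg) auto
    then have z: "(\<Sum>k\<in>- I - {j}. \<bar>M $ i $ k\<bar>) = 0" and "b i = 0"
      using sumM[of i] unfolding S by linarith+
    from z have "\<forall>k\<in>- I - {j}. \<bar>M $ i $ k\<bar> = 0" by (subst (asm) sum_nonneg_eq_0_iff) auto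
    then show ?thesis using j(1) j1 \<open>b i = 0\<close> by (intro exI[of _ j]) auto
  qed
  define \<pi> where "\<pi> i = (SOME j. j \<notin> I \<and> \<bar>M $ i $ j\<bar> = 1 \<and> (\<forall>k. k \<notin> I \<longrightarrow> k \<noteq> j \<longrightarrow> M $ i $ k = 0) \<and> b i = 0)" for i
  have \<pi>: "\<pi> i \<notin> I" "\<bar>M $ i $ \<pi> i\<bar> = 1" "\<And>k. k \<notin> I \<Longrightarrow> k \<noteq> \<pi> i \<Longrightarrow> M $ i $ k = 0" "b i = 0" if "i \<notin> I'" for i
    using someI_ex[OF ex[OF that]] unfolding \<pi>_def[symmetric] by auto
  define e where "e i = (if i \<in> I' then 1 else M $ i $ \<pi> i)" for i
  have e: "e i = 1 \<or> e i = -1" for i using \<pi>(2)[of i] by (auto simp: e_def abs_if split: if_splits)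
  have \<Phi>_eq: "\<Phi> y $ i = e i * y $ \<pi> i" if "i \<notin> I'" "\<forall>i\<in>I. y $ i = s i" for i y
  proof -
    have "\<Phi> y $ i = (\<Sum>j\<in>- I. M $ i $ j * y $ j)" using coord[OF that(2)] \<pi>(4)[OF that(1)] by simp
    also have "\<dots> = (\<Sum>j\<in>- I. if j = \<pi> i then M $ i $ j * y $ j else 0)"
      by (intro sum.cong) (use \<pi>(3)[OF that(1)] in auto)
    also have "\<dots> = e i * y $ \<pi> i" using \<pi>(1)[OF that(1)] that(1) by (simp add: e_def)
    finally show ?thesis .
  qed
  have full: "\<Phi> y = (\<chi> i. if i \<in> I' then s' i else e i * y $ \<pi> i)" if that': "\<forall>i\<in>I. y $ i = s i" for y
  proof -
    have "\<Phi> y $ i = s' i" if i: "i \<in> I'" for i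
    proof -
      have val: "\<Phi> (pt f) $ i = s' i" if "\<And>i. \<bar>f i\<bar> \<le> 1" for f
        using \<Phi>_in[OF pt_in[of f, OF that]] i by (simp add: cface_def)
      have b: "b i = s' i"
        using val[of "\<lambda>_. 0"] pt_coord[of "\<lambda>_. 0" i] by simp
      have M0: "M $ i $ j = 0" if j: "j \<notin> I" for j
      proof -
        let ?f = "\<lambda>k. if k = j then 1 else 0 :: real"
        have "\<bar>?f k\<bar> \<le> 1" for k by simp
        then have "b i + (\<Sum>k\<in>- I. M $ i $ k * ?f k) = s' i"
          using val[of ?f] pt_coord[of ?f i] by (simp only:)
        moreover have "(\<Sum>k\<in>- I. M $ i $ k * ?f k) = (\<Sum>k\<in>- I. if k = j then M $ i $ j else 0)"
          by (intro sum.cong) auto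
        ultimately show ?thesis using b j by simp
      qed
      have "(\<Sum>j\<in>- I. M $ i $ j * y $ j) = 0" by (intro sum.neutral) (simp add: M0)
      then show ?thesis using coord[OF that', of i] b by simp
    qed
    then show ?thesis
      using \<Phi>_eq[OF _ that'] by (auto simp: vec_eq_iff)
  qed
  have "inj_on \<pi> (- I')"
  proof (rule inj_onI, rule ccontr)
    fix i k assume ik: "i \<in> - I'" "k \<in> - I'" "\<pi> i = \<pi> k" "i \<noteq> k"
    have "pt' (\<lambda>l. if l = i then 1 else 0) \<in> cface I' s'" by (rule pt'_in) simp
    then obtain y where y: "y \<in> cface I s" "\<Phi> y = pt' (\<lambda>l. if l = i then 1 else 0)"
      using tgt by blast
    then have "e i * y $ \<pi> i = 1" "e k * y $ \<pi> i = 0"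
      using \<Phi>_eq[of i y] \<Phi>_eq[of k y] ik by (auto simp: pt'_def cface_def)
    then show False using e[of k] by auto
  qed
  moreover have "\<pi> ` (- I') = - I"
  proof
    show "\<pi> ` (- I') \<subseteq> - I" using \<pi>(1) by auto
    show "- I \<subseteq> \<pi> ` (- I')"
    proof (rule ccontr)
      assume "\<not> ?thesis"
      then obtain j where j: "j \<notin> I" "j \<notin> \<pi> ` (- I')" by blast
      let ?f = "\<lambda>k. 0 :: real" and ?g = "\<lambda>k. if k = j then 1 else 0 :: real"
      have in': "pt ?f \<in> cface I s" "pt ?g \<in> cface I s" by (auto intro!: pt_in)
      have "\<Phi> (pt ?f) = \<Phi> (pt ?g)"
        by (subst (1 2) full) (use j in \<open>auto simp: vec_eq_iff pt_def\<close>)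
      then have "pt ?f $ j = pt ?g $ j" using inj by (simp add: inj_eq)
      then show False using j(1) by (simp add: pt_def)
    qed
  qed
  ultimately have "bij_betw \<pi> (- I') (- I)" by (simp add: bij_betw_def)
  then show ?thesis using e full by blast
qed

text \<open>\<open>einv K'\<close> after \<open>emap K\<close> is an affine bijection between two
  faces of the cube, hence a signed permutation of the free coordinates. All transfer of traces,
  nodes and weights between elements rests on this form.\<close>

lemma common_face:
  fixes K K' :: "'n::finite elt"
  assumes K: "invertible (fst K)" and K': "invertible (fst K')"
    and img: "emap K ` cface I s = emap K' ` cface I' s'"
    and s: "\<And>i. s i = 1 \<or> s i = -1" and s': "\<And>i. s' i = 1 \<or> s' i = -1"
  shows "\<exists>\<pi> e. bij_betw \<pi> (- I') (- I) \<and> (\<forall>i. e i = 1 \<or> e i = (-1::real)) \<and>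
           (\<forall>y. (\<forall>i\<in>I. y $ i = s i) \<longrightarrow> emap K y = emap K' (\<chi> i. if i \<in> I' then s' i else e i * y $ \<pi> i))"
proof -
  let ?M = "matrix_inv (fst K') ** fst K" and ?c = "matrix_inv (fst K') *v (snd K - snd K')"
  have \<Phi>: "?M *v y + ?c = einv K' (emap K y)" for y
    by (simp add: einv_def emap_def matrix_vector_mul_assoc[symmetric] matrix_vector_right_distrib[symmetric] add_diff_eq)
  have i1: "inj (\<lambda>y. ?M *v y + ?c)"
    unfolding \<Phi> by (rule injI) (metis emap_einv[OF K'] emap_eq_iff[OF K])
  have i2: "(\<lambda>y. ?M *v y + ?c) ` cface I s = cface I' s'"
  proof -
    have "(\<lambda>y. ?M *v y + ?c) ` cface I s = einv K' ` emap K ` cface I s"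
      unfolding \<Phi> image_image ..
    then show ?thesis unfolding img by (simp add: image_image einv_emap[OF K'])
  qed
  obtain \<pi> e where pe: "bij_betw \<pi> (- I') (- I)" "\<forall>i. e i = 1 \<or> e i = (-1::real)"
     "\<forall>y. (\<forall>i\<in>I. y $ i = s i) \<longrightarrow> ?M *v y + ?c = (\<chi> i. if i \<in> I' then s' i else e i * y $ \<pi> i)"
    using cface_affine_map[OF i1 i2 s s'] by blast
  have "emap K y = emap K' (\<chi> i. if i \<in> I' then s' i else e i * y $ \<pi> i)" if "\<forall>i\<in>I. y $ i = s i" for y
    using spec[OF pe(3), of y] that emap_einv[OF K', of "emap K y"] unfolding \<Phi> by simp
  then show ?thesis using pe(1,2) by blast
qed


section \<open>Outward unit normals of facets\<close>

definition nvec :: "'n::finite elt \<Rightarrow> 'n \<Rightarrow> real^'n" where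
  "nvec K j = matrix_inv (transpose (fst K)) *v axis j 1"

definition unit_normal :: "'n::finite elt \<Rightarrow> 'n \<Rightarrow> real \<Rightarrow> real^'n" where
  "unit_normal K j s = (s / norm (nvec K j)) *\<^sub>R nvec K j"

definition fcenter :: "'n::finite \<Rightarrow> real \<Rightarrow> real^'n" where
  "fcenter j s = (\<chi> i. if i = j then s else 0)"

lemma inner_nvec:
  assumes "invertible (fst K)"
  shows "nvec K j \<bullet> (fst K *v w) = w $ j"
proof -
  have "invertible (transpose (fst K))" using assms by (simp add: transpose_invertible)
  then have "transpose (fst K) *v nvec K j = axis j 1"
    by (simp add: nvec_def matrix_vector_mul_assoc matrix_inv_both)
  then have "nvec K j v* fst K = axis j 1"
    by (simp only: transpose_matrix_vector)
  then show ?thesis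
    using dot_lmul_matrix[of "nvec K j" "fst K" w] by (simp add: inner_axis')
qed

lemma nvec_nonzero: "invertible (fst K) \<Longrightarrow> nvec K j \<noteq> 0"
  using inner_nvec[of K j "axis j 1"] by (auto simp: axis_def)

lemma norm_unit_normal: "invertible (fst K) \<Longrightarrow> s = 1 \<or> s = -1 \<Longrightarrow> norm (unit_normal K j s) = 1"
  using nvec_nonzero[of K j] by (auto simp: unit_normal_def)

lemma emap_diff: "emap K y - emap K z = fst K *v (y - z)"
  by (simp add: emap_def matrix_vector_mult_diff_distrib)

lemma fcenter_cface: "s = 1 \<or> s = -1 \<Longrightarrow> fcenter j s \<in> cface {j} (\<lambda>_. s)"
  by (auto simp: fcenter_def cface_def ref_cube_def)

lemma unit_normal_outward:
  assumes K: "invertible (fst K)" and s: "s = 1 \<or> s = -1"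
    and x: "x \<in> emap K ` cface {j} (\<lambda>_. s)" and y: "y \<in> elem K"
  shows "unit_normal K j s \<bullet> (y - x) \<le> 0"
proof -
  obtain a b where ab: "x = emap K a" "y = emap K b" "a \<in> cface {j} (\<lambda>_. s)" "b \<in> ref_cube"
    using x y unfolding elem_def by blast
  have "unit_normal K j s \<bullet> (y - x) = (s / norm (nvec K j)) * (b $ j - s)"
    unfolding unit_normal_def ab emap_diff using inner_nvec[OF K, of j "b - a"] ab(3) by (simp add: cface_def)
  moreover have "s * (b $ j - s) \<le> 0"
    using ab(4) s by (auto simp: ref_cube_def)
  ultimately show ?thesis
    by (simp add: divide_nonpos_nonneg times_divide_eq_left)
qed

text \<open>Exchanging x and y turns the inequality into orthogonality to the facet, so the pullback
  of \<open>n\<close> by the transposed matrix has only its j-th component.\<close>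

lemma tangential_normal:
  assumes K: "invertible (fst K)" and s: "s = 1 \<or> s = -1" and n: "norm n = 1"
    and t: "\<And>x y. x \<in> emap K ` cface {j} (\<lambda>_. s) \<Longrightarrow> y \<in> emap K ` cface {j} (\<lambda>_. s) \<Longrightarrow> n \<bullet> (y - x) \<le> 0"
  shows "n = unit_normal K j s \<or> n = - unit_normal K j s"
proof -
  let ?g = "transpose (fst K) *v n"
  have g: "n \<bullet> (fst K *v w) = ?g \<bullet> w" for w
    by (metis dot_lmul_matrix transpose_matrix_vector)
  have gi: "?g $ i = 0" if "i \<noteq> j" for i
  proof -
    have 1: "fcenter j s + axis i 1 \<in> cface {j} (\<lambda>_. s)" "fcenter j s + axis i (-1) \<in> cface {j} (\<lambda>_. s)"
      using that s by (auto simp: fcenter_def cface_def ref_cube_def axis_def)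
    have "n \<bullet> (emap K (fcenter j s + axis i 1) - emap K (fcenter j s)) \<le> 0"
      "n \<bullet> (emap K (fcenter j s + axis i (-1)) - emap K (fcenter j s)) \<le> 0"
      using 1 fcenter_cface[OF s] by (auto intro!: t)
    then have "?g \<bullet> axis i 1 \<le> 0" "?g \<bullet> axis i (-1) \<le> 0"
      unfolding emap_diff g by simp_all
    then show ?thesis by (simp add: inner_axis)
  qed
  have n_eq: "n = ?g $ j *\<^sub>R nvec K j"
  proof -
    have "(n - ?g $ j *\<^sub>R nvec K j) \<bullet> (fst K *v w) = 0" for w
    proof -
      have "?g \<bullet> w = (\<Sum>i\<in>UNIV. if i = j then ?g $ j * w $ j else 0)"
        unfolding inner_vec_def by (intro sum.cong) (use gi in auto)
      then show ?thesis by (simp add: inner_diff_left g inner_nvec[OF K])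
    qed
    from this[of "einv K (n - ?g $ j *\<^sub>R nvec K j + snd K)"] show ?thesis
      by (simp add: einv_def matrix_vector_mul_assoc matrix_inv_both[OF K])
  qed
  then have "\<bar>?g $ j\<bar> * norm (nvec K j) = 1" using n by (metis norm_scaleR)
  then have "?g $ j = 1 / norm (nvec K j) \<or> ?g $ j = - (1 / norm (nvec K j))"
    using nvec_nonzero[OF K, of j] by (auto simp: field_simps abs_if split: if_splits)
  then show ?thesis
    using n_eq s unfolding unit_normal_def by auto
qed

text \<open>Tangentiality leaves two unit vectors, and testing with the image of the centre of the
  cube excludes the inward one, so the definite description has a value.\<close>

lemma onormal_eq:
  assumes K: "invertible (fst K)" and s: "s = 1 \<or> s = -1"
  shows "onormal K (emap K ` cface {j} (\<lambda>_. s)) = unit_normal K j s"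
  unfolding onormal_def
proof (rule the_equality)
  let ?F = "emap K ` cface {j} (\<lambda>_. s)"
  have sub: "?F \<subseteq> elem K" by (auto simp: elem_def cface_def)
  show "norm (unit_normal K j s) = 1 \<and> (\<forall>x\<in>?F. \<forall>y\<in>elem K. inner (unit_normal K j s) (y - x) \<le> 0)"
    using norm_unit_normal[OF K s] unit_normal_outward[OF K s] by blast
  fix n assume n: "norm n = 1 \<and> (\<forall>x\<in>?F. \<forall>y\<in>elem K. inner n (y - x) \<le> 0)"
  then have "n = unit_normal K j s \<or> n = - unit_normal K j s"
    using sub by (intro tangential_normal[OF K s]) auto
  moreover have "n \<noteq> - unit_normal K j s"
  proof
    assume e: "n = - unit_normal K j s"
    have "emap K 0 \<in> elem K" by (auto simp: elem_def ref_cube_def)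
    then have "n \<bullet> (emap K 0 - emap K (fcenter j s)) \<le> 0"
      using n fcenter_cface[OF s, of j] by blast
    then have "(s / norm (nvec K j)) * s \<le> 0"
      unfolding e emap_diff unit_normal_def using inner_nvec[OF K, of j "0 - fcenter j s"]
      by (simp add: fcenter_def)
    then show False using s nvec_nonzero[OF K, of j] by (auto simp: divide_le_0_iff)
  qed
  ultimately show "n = unit_normal K j s" by blast
qed

lemma inward_interior:
  assumes K: "invertible (fst K)" and s: "s = 1 \<or> s = -1"
  shows "\<exists>t0>0. \<forall>t. 0 < t \<and> t < t0 \<longrightarrow> emap K (fcenter j s) - t *\<^sub>R unit_normal K j s \<in> interior (elem K)"
proof -
  let ?w = "matrix_inv (fst K) *v unit_normal K j s" and ?v = "norm (nvec K j)"
  have Aw: "fst K *v ?w = unit_normal K j s"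
    by (simp add: matrix_vector_mul_assoc matrix_inv_both[OF K])
  have v0: "?v > 0" using nvec_nonzero[OF K, of j] by simp
  have wj: "?w $ j = s * ?v"
  proof -
    have "?w $ j = nvec K j \<bullet> unit_normal K j s" using inner_nvec[OF K, of j ?w] unfolding Aw by simp
    also have "\<dots> = s * ?v" using v0 unfolding unit_normal_def by (simp add: dot_square_norm power2_eq_square)
    finally show ?thesis .
  qed
  \<comment> \<open>Below this bound neither the normal coordinate, moved by \<open>t * ?v\<close>,
    nor the others, moved by at most \<open>t * norm ?w\<close>, change by as much as 1, so the
    point stays strictly inside.\<close>
  let ?t0 = "1 / (1 + norm ?w + ?v)"
  have "?t0 > 0" using v0 by (simp add: add_pos_nonneg)
  moreover have "emap K (fcenter j s) - t *\<^sub>R unit_normal K j s \<in> interior (elem K)" if t: "0 < t \<and> t < ?t0" for t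
  proof -
    have t1: "t * (1 + norm ?w + ?v) < 1"
      using t v0 by (simp add: pos_less_divide_eq add_pos_nonneg)
    have "t + t * norm ?w + t * ?v < 1" using t1 by (simp add: distrib_left)
    moreover have "0 \<le> t * norm ?w" "0 \<le> t * ?v" using t by auto
    ultimately have tv: "t * ?v < 1" and tw: "t * norm ?w < 1" using t by linarith+
    have e: "emap K (fcenter j s) - t *\<^sub>R unit_normal K j s = emap K (fcenter j s - t *\<^sub>R ?w)"
      unfolding emap_def matrix_vector_mult_diff_distrib matrix_vector_mult_scaleR Aw by simp
    have "-1 < (fcenter j s - t *\<^sub>R ?w) $ i \<and> (fcenter j s - t *\<^sub>R ?w) $ i < 1" for i
    proof (cases "i = j")
      case True
      have "0 < t * ?v" using t v0 by simp
      then show ?thesis using True s tv wj by (auto simp: fcenter_def)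
    next
      case False
      have "\<bar>t * ?w $ i\<bar> \<le> t * norm ?w"
        using t component_le_norm_cart[of ?w i] by (simp add: abs_mult)
      then show ?thesis using False tw by (auto simp: fcenter_def)
    qed
    then show ?thesis unfolding e interior_elem[OF K] by blast
  qed
  ultimately show ?thesis by blast
qed

text \<open>Signed permutations fix the origin of the free coordinates, so the centre of a facet
  does not depend on its parametrisation.\<close>

lemma face_center:
  assumes K: "invertible (fst K)" and K': "invertible (fst K')"
    and F: "emap K ` cface {j} (\<lambda>_. s) = emap K' ` cface {j'} (\<lambda>_. s')"
    and s: "s = 1 \<or> s = -1" and s': "s' = 1 \<or> s' = -1"
  shows "emap K (fcenter j s) = emap K' (fcenter j' s')"
proof -
  obtain \<pi> e where pe: "bij_betw \<pi> (- {j'}) (- {j})"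
     "\<forall>y. (\<forall>i\<in>{j}. y $ i = s) \<longrightarrow> emap K y = emap K' (\<chi> i. if i \<in> {j'} then s' else e i * y $ \<pi> i)"
    using common_face[OF K K' F] s s' by blast
  have fc: "(\<chi> i. if i \<in> {j'} then s' else e i * fcenter j s $ \<pi> i) = fcenter j' s'"
    using bij_betwE[OF pe(1)] by (auto simp: fcenter_def vec_eq_iff)
  show "emap K (fcenter j s) = emap K' (fcenter j' s')"
    using spec[OF pe(2), of "fcenter j s"] unfolding fc by (simp add: fcenter_def)
qed

text \<open>With equal normals, short steps from the common facet centre against the normal would
  lie in both interiors.\<close>

lemma normals_opposite:
  assumes K: "invertible (fst K)" and K': "invertible (fst K')"
    and s: "s = 1 \<or> s = -1" and s': "s' = 1 \<or> s' = -1"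
    and F: "emap K ` cface {j} (\<lambda>_. s) = emap K' ` cface {j'} (\<lambda>_. s')"
    and disj: "interior (elem K) \<inter> interior (elem K') = {}"
  shows "unit_normal K' j' s' = - unit_normal K j s"
proof -
  have sub: "emap K' ` cface {j'} (\<lambda>_. s') \<subseteq> elem K'" by (auto simp: elem_def cface_def)
  have "unit_normal K' j' s' = unit_normal K j s \<or> unit_normal K' j' s' = - unit_normal K j s"
    by (rule tangential_normal[OF K s norm_unit_normal[OF K' s']])
       (use unit_normal_outward[OF K' s'] sub in \<open>auto simp: F\<close>)
  moreover have "unit_normal K' j' s' \<noteq> unit_normal K j s"
  proof
    assume eq: "unit_normal K' j' s' = unit_normal K j s"
    have c: "emap K (fcenter j s) = emap K' (fcenter j' s')"
      by (rule face_center[OF K K' F s s'])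
    obtain t0 where t0: "t0 > 0" "\<And>t. 0 < t \<and> t < t0 \<Longrightarrow> emap K (fcenter j s) - t *\<^sub>R unit_normal K j s \<in> interior (elem K)"
      using inward_interior[OF K s] by blast
    obtain t1 where t1: "t1 > 0" "\<And>t. 0 < t \<and> t < t1 \<Longrightarrow> emap K' (fcenter j' s') - t *\<^sub>R unit_normal K' j' s' \<in> interior (elem K')"
      using inward_interior[OF K' s'] by blast
    let ?t = "min t0 t1 / 2"
    have "0 < ?t \<and> ?t < t0" "0 < ?t \<and> ?t < t1" using t0 t1 by auto
    then show False using t0(2) t1(2) disj unfolding c eq by blast
  qed
  ultimately show ?thesis by blast
qed

section \<open>Admissible meshes\<close>

locale dg_mesh =
  fixes \<Omega> :: "(real^'n::finite) set" and T :: "'n elt set" and csr cqu :: real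
  assumes adm: "admissible_mesh \<Omega> T csr cqu"
begin

lemma dim: "CARD('n) = 2 \<or> CARD('n) = 3"
  and open_dom: "open \<Omega>" and convex_dom: "convex \<Omega>" and bounded_dom: "bounded \<Omega>" and dom_nonempty: "\<Omega> \<noteq> {}"
  and finite_T: "finite T" and T_nonempty: "T \<noteq> {}"
  and inv_all: "\<forall>K\<in>T. invertible (fst K)"
  and closure_dom: "closure \<Omega> = (\<Union>K\<in>T. elem K)"
  and disj_all: "\<forall>K\<in>T. \<forall>K'\<in>T. K \<noteq> K' \<longrightarrow> interior (elem K) \<inter> interior (elem K') = {}"
  and faces_all: "\<forall>K\<in>T. \<forall>K'\<in>T. (elem K \<inter> elem K') face_of elem K \<and> (elem K \<inter> elem K') face_of elem K'"
  and shape_all: "\<forall>K\<in>T. hsize K \<le> csr * inradius K"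
  and quasi_all: "\<forall>K\<in>T. (MAX K'\<in>T. hsize K') \<le> cqu * hsize K"
  using adm unfolding admissible_mesh_def by - (elim conjE, assumption)+

lemma inv: "K \<in> T \<Longrightarrow> invertible (fst K)"
  by (rule bspec[OF inv_all])

lemma disj: "K \<in> T \<Longrightarrow> K' \<in> T \<Longrightarrow> K \<noteq> K' \<Longrightarrow> interior (elem K) \<inter> interior (elem K') = {}"
  using disj_all by blast

lemma faces: "K \<in> T \<Longrightarrow> K' \<in> T \<Longrightarrow> (elem K \<inter> elem K') face_of elem K \<and> (elem K \<inter> elem K') face_of elem K'"
  using faces_all by blast

lemma shape: "K \<in> T \<Longrightarrow> hsize K \<le> csr * inradius K"
  by (rule bspec[OF shape_all])

lemma quasi: "K \<in> T \<Longrightarrow> (MAX K'\<in>T. hsize K') \<le> cqu * hsize K"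
  by (rule bspec[OF quasi_all])

lemma frontier_notin: "x \<in> frontier \<Omega> \<Longrightarrow> x \<notin> \<Omega>"
  by (simp add: frontier_def interior_open[OF open_dom])

lemma elem_sub: "K \<in> T \<Longrightarrow> elem K \<subseteq> closure \<Omega>"
  unfolding closure_dom by blast

lemma interior_elem_sub: "K \<in> T \<Longrightarrow> interior (elem K) \<subseteq> \<Omega>"
  using interior_mono[OF elem_sub] convex_interior_closure[OF convex_dom] interior_open[OF open_dom] by blast

lemma elem_eq_closure_interior: "K \<in> T \<Longrightarrow> elem K = closure (interior (elem K))"
  using convex_closure_interior[OF convex_elem interior_elem_nonempty[OF inv]]
    closure_closed[OF compact_imp_closed[OF compact_elem]] by blast

lemma elem_unique:
  assumes "K \<in> T" "K' \<in> T" "x \<in> interior (elem K)" "x \<in> elem K'"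
  shows "K = K'"
proof (rule ccontr)
  assume "K \<noteq> K'"
  then have d: "interior (elem K) \<inter> interior (elem K') = {}" using disj assms by blast
  have "x \<in> closure (interior (elem K'))" using assms elem_eq_closure_interior by blast
  then have "interior (elem K) \<inter> closure (interior (elem K')) \<noteq> {}" using assms by blast
  then show False using d open_Int_closure_eq_empty[OF open_interior] by blast
qed

lemma elem_not_subset:
  assumes "K \<in> T" "K' \<in> T" "K \<noteq> K'"
  shows "elem K \<inter> elem K' \<noteq> elem K"
proof
  assume e: "elem K \<inter> elem K' = elem K"
  obtain x where "x \<in> interior (elem K)" using interior_elem_nonempty[OF inv[OF assms(1)]] by blast
  moreover then have "x \<in> elem K'" using interior_subset e by blast
  ultimately show False using elem_unique assms by blast
qed

text \<open>The intersection of the elements is a common face containing \<open>F\<close>, and it is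
  a proper face of either; its dimension then leaves only \<open>F\<close> itself.\<close>

lemma facet_sharing:
  assumes K: "K \<in> T" "K' \<in> T" "K \<noteq> K'" and F: "F facet_of elem K" "F \<subseteq> elem K'"
  shows "F = elem K \<inter> elem K'" "F facet_of elem K'"
proof -
  let ?G = "elem K \<inter> elem K'"
  have F': "F face_of elem K" "aff_dim F = aff_dim (elem K) - 1" "F \<noteq> {}" using F by (auto simp: facet_of_def)
  have G: "?G face_of elem K" "?G face_of elem K'" using faces K by blast+
  have "F \<subseteq> ?G" using face_of_imp_subset[OF F'(1)] F(2) by blast
  then have FG: "F face_of ?G" by (rule face_of_subset[OF F'(1) _ Int_lower1])
  have lt: "aff_dim ?G < aff_dim (elem K)"
    by (rule face_of_aff_dim_lt[OF convex_elem G(1) elem_not_subset[OF K]])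
  show e: "F = ?G"
  proof (rule ccontr)
    assume "F \<noteq> ?G"
    then have "aff_dim F < aff_dim ?G"
      by (rule face_of_aff_dim_lt[OF face_of_imp_convex[OF G(1)] FG])
    then show False using lt F'(2) by simp
  qed
  have "aff_dim (elem K) = aff_dim (elem K')" using K by (simp add: aff_dim_elem inv)
  then show "F facet_of elem K'" using G(2) F' unfolding e facet_of_def by simp
qed

lemma facet_param:
  assumes "K \<in> T" "F facet_of elem K"
  obtains j s where "s = 1 \<or> s = -1" "F = emap K ` cface {j} (\<lambda>_. s)" "onormal K F = unit_normal K j s"
  using facet_of_elem[OF inv[OF assms(1)] assms(2)] onormal_eq[OF inv[OF assms(1)]] by metis

lemma norm_onormal: "K \<in> T \<Longrightarrow> F facet_of elem K \<Longrightarrow> norm (onormal K F) = 1"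
  by (metis facet_param norm_unit_normal inv)

lemma onormal_opposite:
  assumes K: "K \<in> T" "K' \<in> T" "K \<noteq> K'" and F: "F facet_of elem K" "F \<subseteq> elem K'"
  shows "onormal K' F = - onormal K F"
proof -
  obtain j s where js: "s = 1 \<or> s = -1" "F = emap K ` cface {j} (\<lambda>_. s)" "onormal K F = unit_normal K j s"
      by (rule facet_param[OF K(1) F(1)])
  obtain j' s' where js': "s' = 1 \<or> s' = -1" "F = emap K' ` cface {j'} (\<lambda>_. s')" "onormal K' F = unit_normal K' j' s'"
      by (rule facet_param[OF K(2) facet_sharing(2)[OF K F]])
  have "emap K ` cface {j} (\<lambda>_. s) = emap K' ` cface {j'} (\<lambda>_. s')" using js(2) js'(2) by simp
  from normals_opposite[OF inv[OF K(1)] inv[OF K(2)] js(1) js'(1) this disj[OF K]]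
  show ?thesis using js(3) js'(3) by simp
qed

text \<open>Normals of elements sharing a facet are opposite in pairs. Three unit vectors cannot be
  pairwise opposite, so there is no third neighbour.\<close>

lemma nbrs_interior:
  assumes K: "K \<in> T" "K' \<in> T" "K \<noteq> K'" and F: "F facet_of elem K" "F \<subseteq> elem K'"
  shows "nbrs T F = {K, K'}"
proof
  show "{K, K'} \<subseteq> nbrs T F"
    using K F facet_of_imp_subset[OF F(1)] by (auto simp: nbrs_def)
  show "nbrs T F \<subseteq> {K, K'}"
  proof (rule ccontr)
    assume "\<not> ?thesis"
    then obtain L where L: "L \<in> T" "F \<subseteq> elem L" "L \<noteq> K" "L \<noteq> K'" by (auto simp: nbrs_def)
    have "onormal K' F = - onormal K F" by (rule onormal_opposite[OF K F])
    moreover have "onormal L F = - onormal K F"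
      by (rule onormal_opposite[OF K(1) L(1) _ F(1) L(2)]) (use L in auto)
    moreover have "onormal L F = - onormal K' F"
      by (rule onormal_opposite[OF K(2) L(1) _ facet_sharing(2)[OF K F] L(2)]) (use L in auto)
    ultimately have "onormal K F = - onormal K F" by simp
    then have "onormal K F \<bullet> onormal K F = - (onormal K F \<bullet> onormal K F)" by (metis inner_minus_left)
    then have "onormal K F = 0" by simp
    then show False using norm_onormal[OF K(1) F(1)] by simp
  qed
qed

text \<open>A second neighbour would put points on both sides of the facet centre into the domain,
  and convexity would put the centre there too, although it lies on the frontier.\<close>

lemma nbrs_boundary:
  assumes K: "K \<in> T" and F: "F facet_of elem K" "F \<subseteq> frontier \<Omega>"
  shows "nbrs T F = {K}"
proof
  show "{K} \<subseteq> nbrs T F" using K facet_of_imp_subset[OF F(1)] by (auto simp: nbrs_def)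
  show "nbrs T F \<subseteq> {K}"
  proof (rule ccontr)
    assume "\<not> ?thesis"
    then obtain L where L: "L \<in> T" "F \<subseteq> elem L" "L \<noteq> K" by (auto simp: nbrs_def)
    obtain j s where js: "s = 1 \<or> s = -1" "F = emap K ` cface {j} (\<lambda>_. s)" "onormal K F = unit_normal K j s"
      by (rule facet_param[OF K F(1)])
    obtain j' s' where js': "s' = 1 \<or> s' = -1" "F = emap L ` cface {j'} (\<lambda>_. s')" "onormal L F = unit_normal L j' s'"
      by (rule facet_param[OF L(1) facet_sharing(2)[OF K L(1) L(3)[symmetric] F(1) L(2)]])
    have eF: "emap K ` cface {j} (\<lambda>_. s) = emap L ` cface {j'} (\<lambda>_. s')" using js(2) js'(2) by simp
    have opp: "unit_normal L j' s' = - unit_normal K j s"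
      using onormal_opposite[OF K L(1) L(3)[symmetric] F(1) L(2)] js(3) js'(3) by simp
    have c: "emap K (fcenter j s) = emap L (fcenter j' s')"
      by (rule face_center[OF inv[OF K] inv[OF L(1)] eF js(1) js'(1)])
    obtain t0 where t0: "t0 > 0" "\<And>t. 0 < t \<and> t < t0 \<Longrightarrow> emap K (fcenter j s) - t *\<^sub>R unit_normal K j s \<in> interior (elem K)"
      using inward_interior[OF inv[OF K] js(1)] by blast
    obtain t1 where t1: "t1 > 0" "\<And>t. 0 < t \<and> t < t1 \<Longrightarrow> emap L (fcenter j' s') - t *\<^sub>R unit_normal L j' s' \<in> interior (elem L)"
      using inward_interior[OF inv[OF L(1)] js'(1)] by blast
    define t where "t = min t0 t1 / 2"
    have t: "0 < t \<and> t < t0" "0 < t \<and> t < t1" using t0 t1 by (auto simp: t_def)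
    let ?f = "emap K (fcenter j s)"
    have "?f - t *\<^sub>R unit_normal K j s \<in> \<Omega>" "?f + t *\<^sub>R unit_normal K j s \<in> \<Omega>"
      using subsetD[OF interior_elem_sub[OF K] t0(2)[OF t(1)]] subsetD[OF interior_elem_sub[OF L(1)] t1(2)[OF t(2)]]
      unfolding c[symmetric] opp by simp_all
    then have "(1/2) *\<^sub>R (?f - t *\<^sub>R unit_normal K j s) + (1/2) *\<^sub>R (?f + t *\<^sub>R unit_normal K j s) \<in> \<Omega>"
      by (intro convexD[OF convex_dom]) auto
    moreover have "(1/2) *\<^sub>R (?f - t *\<^sub>R unit_normal K j s) + (1/2) *\<^sub>R (?f + t *\<^sub>R unit_normal K j s) = ?f"
      by (simp add: scaleR_diff_right scaleR_add_right flip: scaleR_left_distrib)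
    ultimately have "?f \<in> \<Omega>" by simp
    moreover have "?f \<in> frontier \<Omega>"
      using F(2) fcenter_cface[OF js(1), of j] unfolding js(2) by blast
    ultimately show False using frontier_notin by blast
  qed
qed

definition adj :: "real^'n \<Rightarrow> ('n elt \<times> 'n elt) set" where
  "adj \<xi> = {(K, K'). K \<in> T \<and> K' \<in> T \<and> \<xi> \<in> elem K \<and> \<xi> \<in> elem K' \<and> K \<noteq> K' \<and> (elem K \<inter> elem K') facet_of elem K}"

lemma adj_closure_in:
  assumes "(K, K') \<in> (adj \<xi>)\<^sup>*" "K \<in> T" "\<xi> \<in> elem K"
  shows "K' \<in> T \<and> \<xi> \<in> elem K'"
  using assms by (induction rule: rtrancl_induct) (auto simp: adj_def)

text \<open>A generic segment leaving the union of the elements reachable from \<open>K0\<close> avoids all faces of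
  codimension at least two, so it leaves through a facet; that facet must lie on the boundary.\<close>

lemma generic_exit:
  assumes K0: "K0 \<in> T" "\<xi> \<in> elem K0"
    and B: "open B" "convex B" "\<xi> \<in> B" "\<forall>K\<in>T. \<forall>G. G face_of elem K \<longrightarrow> G \<inter> B \<noteq> {} \<longrightarrow> \<xi> \<in> G"
    and W: "open W" "W \<noteq> {}" "W \<subseteq> B" "W \<inter> (\<Union>K\<in>(adj \<xi>)\<^sup>* `` {K0}. elem K) = {}"
  shows "\<exists>K1 F. (K0, K1) \<in> (adj \<xi>)\<^sup>* \<and> F facet_of elem K1 \<and> F \<subseteq> frontier \<Omega> \<and> \<xi> \<in> F \<and> B \<inter> frontier \<Omega> \<noteq> {}"
proof -
  define C where "C = (adj \<xi>)\<^sup>* `` {K0}"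
  define S where "S = (\<Union>K\<in>C. elem K)"
  have CT: "K \<in> T \<and> \<xi> \<in> elem K" if "K \<in> C" for K
    using that adj_closure_in K0 unfolding C_def by blast
  have finC: "finite C" by (rule finite_subset[OF _ finite_T]) (use CT in blast)
  have K0C: "K0 \<in> C" by (auto simp: C_def)
  have clS: "closed S" unfolding S_def
    using finC by (intro closed_UN) (auto intro: compact_imp_closed compact_elem)
  have "\<xi> \<in> closure (interior (elem K0))" using elem_eq_closure_interior K0 by blast
  then have "B \<inter> closure (interior (elem K0)) \<noteq> {}" using B by blast
  then have "B \<inter> interior (elem K0) \<noteq> {}" using open_Int_closure_eq_empty[OF B(1)] by blast
  then obtain x where x: "x \<in> B" "x \<in> interior (elem K0)" by blast
  have xS: "x \<in> interior S"
    using x(2) interior_mono[of "elem K0" S] K0C unfolding S_def by blast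
  \<comment> \<open>The faces to be avoided, of codimension at least two. Each lies in a hyperplane
    through x, and finitely many hyperplanes cannot cover the open set \<open>W\<close>, so some y
    in \<open>W\<close> avoids them all.\<close>
  define P where "P = {G. (\<exists>K\<in>T. G face_of elem K) \<and> aff_dim G \<le> int CARD('n) - 2}"
  have "{G. \<exists>K\<in>T. G face_of elem K} = (\<Union>K\<in>T. {G. G face_of elem K})" by blast
  moreover have "finite (\<Union>K\<in>T. {G. G face_of elem K})"
    by (intro finite_UN_I finite_T finite_polytope_faces polytope_elem)
  ultimately have finP: "finite P" unfolding P_def by (intro finite_subset[OF _ \<open>finite (\<Union>K\<in>T. _ K)\<close>]) blast
  have hyp: "\<exists>a b. a \<noteq> 0 \<and> insert x G \<subseteq> {y. a \<bullet> y = b}" if "G \<in> P" for G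
  proof -
    have "aff_dim (insert x G) < int (DIM(real^'n))"
      using that unfolding aff_dim_insert P_def by auto
    then obtain a b where "a \<noteq> 0" "insert x G \<subseteq> {y. a \<bullet> y = b}"
      by (rule aff_lowdim_subset_hyperplane)
    then show ?thesis by blast
  qed
  then obtain a b where ab: "\<And>G. G \<in> P \<Longrightarrow> a G \<noteq> 0 \<and> insert x G \<subseteq> {y. a G \<bullet> y = b G}"
    by metis
  have "negligible (\<Union>G\<in>P. {y. a G \<bullet> y = b G})"
    using finP ab by (intro negligible_Union) (auto intro!: negligible_hyperplane)
  then have "\<not> W \<subseteq> (\<Union>G\<in>P. {y. a G \<bullet> y = b G})"
    using open_not_negligible[OF W(1,2)] negligible_subset by blast
  then obtain y where y: "y \<in> W" "\<And>G. G \<in> P \<Longrightarrow> a G \<bullet> y \<noteq> b G" by blast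
  have seg: "closed_segment x y \<subseteq> B"
    using x(1) y(1) W(3) by (intro closed_segment_subset[OF _ _ B(2)]) auto
  have "closed_segment x y \<inter> S \<noteq> {}" using xS interior_subset by blast
  moreover have "closed_segment x y - S \<noteq> {}" using y(1) W(4) by (auto simp: S_def C_def)
  ultimately have "closed_segment x y \<inter> frontier S \<noteq> {}"
    by (intro connected_Int_frontier) (auto simp: connected_segment)
  then obtain z where z: "z \<in> closed_segment x y" "z \<in> frontier S" by blast
  have zS: "z \<in> S" using z(2) frontier_subset_closed[OF clS] by blast
  have zx: "z \<noteq> x" using z(2) xS by (auto simp: frontier_def)
  have zB: "z \<in> B" using seg z by blast
  \<comment> \<open>The hyperplane of \<open>G\<close> contains x; were it to contain z, a different
    point of the segment, it would contain y as well.\<close>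
  have zP: "z \<notin> G" if "G \<in> P" for G
  proof
    assume zG: "z \<in> G"
    obtain t where t: "z = (1 - t) *\<^sub>R x + t *\<^sub>R y" using z(1) by (auto simp: in_segment)
    have "t \<noteq> 0" using t zx by auto
    have "a G \<bullet> z = b G" "a G \<bullet> x = b G" using ab[OF that] zG by auto
    then have "t * (a G \<bullet> y) = t * b G"
      unfolding t by (simp add: inner_add_right algebra_simps)
    then show False using \<open>t \<noteq> 0\<close> y(2)[OF that] by simp
  qed
  have facetI: "G facet_of elem K" if "K \<in> T" "G face_of elem K" "z \<in> G" "G \<noteq> elem K" for G K
  proof -
    have "aff_dim G < int CARD('n)"
      using face_of_aff_dim_lt[OF convex_elem that(2,4)] aff_dim_elem[OF inv[OF that(1)]] by simp
    moreover have "\<not> aff_dim G \<le> int CARD('n) - 2"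
      using zP that unfolding P_def by blast
    ultimately have "aff_dim G = int CARD('n) - 1" by simp
    then show ?thesis
      using that aff_dim_elem[OF inv[OF that(1)]] unfolding facet_of_def by auto
  qed
  obtain K1 where K1: "K1 \<in> C" "z \<in> elem K1" using zS by (auto simp: S_def)
  have K1T: "K1 \<in> T" using CT K1 by blast
  \<comment> \<open>Inside the domain z would be a limit of points outside \<open>S\<close>, hence
    lie in an element outside \<open>C\<close>. Its intersection with \<open>K1\<close> is a facet
    through \<xi>, so that element would be reachable after all.\<close>
  have "z \<notin> \<Omega>"
  proof
    assume z\<Omega>: "z \<in> \<Omega>"
    have "z \<in> closure (- S)" using z(2) by (simp add: frontier_closures)
    then have "z \<in> closure (\<Omega> \<inter> - S)" using open_Int_closure_subset[OF open_dom] z\<Omega> by blast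
    moreover have "\<Omega> \<inter> - S \<subseteq> (\<Union>K\<in>T - C. elem K)"
      using closure_dom closure_subset[of \<Omega>] unfolding S_def by blast
    moreover have "closed (\<Union>K\<in>T - C. elem K)"
      using finite_T by (intro closed_UN) (auto intro: compact_imp_closed compact_elem)
    ultimately have "z \<in> (\<Union>K\<in>T - C. elem K)" using closure_minimal by blast
    then obtain K2 where K2: "K2 \<in> T" "K2 \<notin> C" "z \<in> elem K2" by blast
    have ne: "K1 \<noteq> K2" using K1 K2 by blast
    have "elem K1 \<inter> elem K2 facet_of elem K1"
      by (rule facetI[OF K1T]) (use faces K1T K1 K2 ne elem_not_subset in auto)
    moreover have "\<xi> \<in> elem K2"
      using B(4) K2(1) face_of_refl[OF convex_elem[of K2]] K2(3) zB by blast
    ultimately have "(K1, K2) \<in> adj \<xi>"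
      using K1T K2 ne CT[OF K1(1)] by (auto simp: adj_def)
    then have "K2 \<in> C" using K1(1) unfolding C_def by (auto intro: rtrancl_into_rtrancl)
    then show False using K2 by blast
  qed
  have zcl: "z \<in> closure \<Omega>" using K1 K1T elem_sub by blast
  have zfr: "z \<in> frontier \<Omega>" using zcl \<open>z \<notin> \<Omega>\<close> open_dom by (simp add: frontier_def interior_open)
  have zr: "z \<notin> rel_interior \<Omega>" using \<open>z \<notin> \<Omega>\<close> rel_interior_subset by blast
  \<comment> \<open>The domain is convex, so a supporting hyperplane at the exit point cuts a face
    out of \<open>K1\<close> that lies in the boundary; it contains z and is therefore a
    facet.\<close>
  obtain n where n: "n \<noteq> 0" "\<And>y. y \<in> closure \<Omega> \<Longrightarrow> n \<bullet> z \<le> n \<bullet> y" "\<And>y. y \<in> rel_interior \<Omega> \<Longrightarrow> n \<bullet> z < n \<bullet> y"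
    by (rule supporting_hyperplane_relative_frontier[OF convex_dom zcl zr]) blast
  have ri: "rel_interior \<Omega> = \<Omega>" by (rule rel_interior_open[OF open_dom])
  let ?G = "elem K1 \<inter> {w. n \<bullet> w = n \<bullet> z}"
  have "?G face_of elem K1"
    by (rule face_of_Int_supporting_hyperplane_ge[OF convex_elem]) (use n(2) elem_sub K1T in blast)
  moreover have "?G \<noteq> elem K1"
  proof
    assume "?G = elem K1"
    then have "interior (elem K1) \<subseteq> interior {w. n \<bullet> w = n \<bullet> z}" by (metis Int_lower2 interior_mono)
    then show False using interior_elem_nonempty[OF inv[OF K1T]] n(1) by simp
  qed
  moreover have "z \<in> ?G" using K1 by simp
  ultimately have "?G facet_of elem K1" by (intro facetI[OF K1T])
  moreover have "?G \<subseteq> frontier \<Omega>"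
    using elem_sub[OF K1T] n(3) unfolding ri frontier_def interior_open[OF open_dom] by force
  moreover have "\<xi> \<in> ?G"
    using B(4) K1T \<open>?G face_of elem K1\<close> \<open>z \<in> ?G\<close> zB by blast
  moreover have "(K0, K1) \<in> (adj \<xi>)\<^sup>*" using K1(1) by (simp add: C_def)
  ultimately show ?thesis using zfr zB by blast
qed

text \<open>There are finitely many faces, all closed, so those missing \<xi> keep a positive
  distance from it. Within the ball, every face met by a segment passes through \<xi>.\<close>

lemma small_ball:
  assumes "open U" "\<xi> \<in> U"
  shows "\<exists>B. open B \<and> convex B \<and> \<xi> \<in> B \<and> B \<subseteq> U \<and> (\<forall>K\<in>T. \<forall>G. G face_of elem K \<longrightarrow> G \<inter> B \<noteq> {} \<longrightarrow> \<xi> \<in> G)"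
proof -
  let ?Q = "{G. (\<exists>K\<in>T. G face_of elem K) \<and> \<xi> \<notin> G}"
  have "?Q \<subseteq> (\<Union>K\<in>T. {G. G face_of elem K})" by blast
  moreover have "finite (\<Union>K\<in>T. {G. G face_of elem K})"
    by (intro finite_UN_I finite_T finite_polytope_faces polytope_elem)
  ultimately have fin: "finite ?Q" by (rule finite_subset)
  have "closed (\<Union>?Q)"
    using fin face_of_imp_closed[OF convex_elem compact_imp_closed[OF compact_elem]]
    by (intro closed_Union) auto
  then have "open (U - \<Union>?Q)" using assms by (intro open_Diff)
  moreover have "\<xi> \<in> U - \<Union>?Q" using assms by blast
  ultimately obtain e where e: "e > 0" "ball \<xi> e \<subseteq> U - \<Union>?Q" by (rule openE)
  have "\<xi> \<in> G" if "K \<in> T" "G face_of elem K" "G \<inter> ball \<xi> e \<noteq> {}" for K G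
    using that e(2) by blast
  moreover have "ball \<xi> e \<subseteq> U" using e(2) by (rule order.trans) (rule Diff_subset)
  ultimately show ?thesis using e(1) by (intro exI[of _ "ball \<xi> e"]) simp
qed

text \<open>If \<open>K'\<close> were unreachable, its interior near \<xi> could serve as the target
  of the generic segment, and the frontier would have to meet a ball contained in the
  domain.\<close>

lemma adj_connected_interior:
  assumes \<xi>: "\<xi> \<in> \<Omega>" and K: "K \<in> T" "\<xi> \<in> elem K" and K': "K' \<in> T" "\<xi> \<in> elem K'"
  shows "(K, K') \<in> (adj \<xi>)\<^sup>*"
proof (rule ccontr)
  assume no: "(K, K') \<notin> (adj \<xi>)\<^sup>*"
  obtain B where B: "open B" "convex B" "\<xi> \<in> B" "B \<subseteq> \<Omega>" "\<forall>K\<in>T. \<forall>G. G face_of elem K \<longrightarrow> G \<inter> B \<noteq> {} \<longrightarrow> \<xi> \<in> G"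
    using small_ball[OF open_dom \<xi>] by blast
  let ?W = "B \<inter> interior (elem K')"
  have "B \<inter> closure (interior (elem K')) \<noteq> {}" using elem_eq_closure_interior K' B(3) by blast
  then have ne: "?W \<noteq> {}" using open_Int_closure_eq_empty[OF B(1)] by blast
  have W0: "?W \<inter> (\<Union>L\<in>(adj \<xi>)\<^sup>* `` {K}. elem L) = {}"
  proof (rule ccontr)
    assume "\<not> ?thesis"
    then obtain x L where "x \<in> interior (elem K')" "(K, L) \<in> (adj \<xi>)\<^sup>*" "x \<in> elem L" by auto
    then show False using elem_unique[of K' L x] adj_closure_in[of K L \<xi>] K K' no by blast
  qed
  have "open ?W" using B(1) by auto
  from generic_exit[OF K B(1,2,3) B(5) this ne Int_lower1 W0]
  have "B \<inter> frontier \<Omega> \<noteq> {}" by (elim exE conjE)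
  then show False using B(4) frontier_notin by blast
qed

text \<open>The target is the part of the ball outside the closed domain; it is nonempty because a
  convex open set is the interior of its closure.\<close>

lemma adj_connected_boundary:
  assumes \<xi>: "\<xi> \<in> frontier \<Omega>" and K: "K \<in> T" "\<xi> \<in> elem K"
  shows "\<exists>K1 F. (K, K1) \<in> (adj \<xi>)\<^sup>* \<and> K1 \<in> T \<and> F facet_of elem K1 \<and> F \<subseteq> frontier \<Omega> \<and> \<xi> \<in> F"
proof -
  obtain B where B: "open B" "convex B" "\<xi> \<in> B" "\<forall>K\<in>T. \<forall>G. G face_of elem K \<longrightarrow> G \<inter> B \<noteq> {} \<longrightarrow> \<xi> \<in> G"
    using small_ball[OF open_UNIV, of \<xi>] by blast
  let ?W = "B - closure \<Omega>"
  have W0: "?W \<inter> (\<Union>L\<in>(adj \<xi>)\<^sup>* `` {K}. elem L) = {}"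
    using elem_sub adj_closure_in K by blast
  have Wne: "?W \<noteq> {}"
  proof
    assume "?W = {}"
    then have "B \<subseteq> interior (closure \<Omega>)" using interior_maximal[OF _ B(1)] by blast
    then have "\<xi> \<in> \<Omega>" using B(3) convex_interior_closure[OF convex_dom] interior_open[OF open_dom] by blast
    then show False using \<xi> frontier_notin by blast
  qed
  have Wo: "open ?W" using B(1) by auto
  obtain K1 F where "(K, K1) \<in> (adj \<xi>)\<^sup>*" "F facet_of elem K1" "F \<subseteq> frontier \<Omega>" "\<xi> \<in> F"
    using generic_exit[OF K B(1,2,3,4) Wo Wne Diff_subset W0] by (elim exE conjE)
  then show ?thesis
    using adj_closure_in[OF _ K] by blast
qed


section \<open>Scaling: mesh size, condition of the element maps, volumes and facet areas\<close>

definition mesh_size :: real where "mesh_size = (MAX K\<in>T. hsize K)"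

lemma hsize_le: "K \<in> T \<Longrightarrow> hsize K \<le> mesh_size"
  unfolding mesh_size_def using finite_T by (intro Max_ge) auto

lemma mesh_size_le: "K \<in> T \<Longrightarrow> mesh_size \<le> cqu * hsize K"
  unfolding mesh_size_def by (rule quasi)

lemma dist_elem: "x \<in> elem K \<Longrightarrow> y \<in> elem K \<Longrightarrow> dist x y \<le> hsize K"
  unfolding hsize_def by (rule diameter_bounded_bound[OF compact_imp_bounded[OF compact_elem]])

lemma hsize_pos: "K \<in> T \<Longrightarrow> 0 < hsize K"
proof -
  assume K: "K \<in> T"
  fix j :: 'n
  have "emap K 0 \<in> elem K" "emap K (axis j 1) \<in> elem K"
    by (auto simp: emap_mem_elem_iff[OF inv[OF K]] ref_cube_def axis_def)
  moreover have "emap K 0 \<noteq> emap K (axis j 1)"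
    by (simp add: emap_eq_iff[OF inv[OF K]])
  ultimately show ?thesis using dist_elem[of "emap K 0" K "emap K (axis j 1)"] by (smt (verit) dist_pos_lt)
qed

lemma mesh_size_pos: "0 < mesh_size"
  using T_nonempty hsize_pos hsize_le by (metis equals0I less_le_trans)

lemma cqu_pos: "0 < cqu"
proof -
  obtain K where K: "K \<in> T" using T_nonempty by blast
  have "0 < cqu * hsize K" using mesh_size_pos mesh_size_le[OF K] by linarith
  then show ?thesis using hsize_pos[OF K] by (simp add: zero_less_mult_iff)
qed

text \<open>The normalised vector and its negative lie in the cube, so their images are at most one
  element diameter apart.\<close>

lemma norm_A:
  assumes K: "K \<in> T"
  shows "norm (fst K *v x) \<le> mesh_size * norm x"
proof (cases "x = 0")
  case False
  let ?y = "(1 / norm x) *\<^sub>R x"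
  have "\<bar>?y $ i\<bar> \<le> 1" for i
    using component_le_norm_cart[of ?y i] False by simp
  then have "-1 \<le> ?y $ i \<and> ?y $ i \<le> 1" "-1 \<le> (- ?y) $ i \<and> (- ?y) $ i \<le> 1" for i
    unfolding uminus_vec_def vec_lambda_beta by (smt (verit))+
  then have "?y \<in> ref_cube" "- ?y \<in> ref_cube" unfolding ref_cube_def by blast+
  then have "dist (emap K ?y) (emap K (- ?y)) \<le> hsize K"
    by (intro dist_elem) (auto simp: elem_def)
  then have "norm (fst K *v (?y - - ?y)) \<le> mesh_size"
    using hsize_le[OF K] unfolding dist_norm emap_diff by linarith
  moreover have e: "?y - - ?y = (2 / norm x) *\<^sub>R x" by (simp add: vec_eq_iff)
  ultimately have "(2 / norm x) * norm (fst K *v x) \<le> mesh_size"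
    unfolding e matrix_vector_mult_scaleR norm_scaleR by simp
  then have "2 * norm (fst K *v x) \<le> mesh_size * norm x"
    using False by (simp add: field_simps)
  then show ?thesis using norm_ge_zero[of "fst K *v x"] by linarith
qed simp

lemma A_entry: "K \<in> T \<Longrightarrow> \<bar>fst K $ i $ j\<bar> \<le> mesh_size"
proof -
  assume K: "K \<in> T"
  have "(fst K *v axis j 1) $ i = fst K $ i $ j"
    by (simp add: matrix_vector_mult_basis column_def)
  then show ?thesis
    using component_le_norm_cart[of "fst K *v axis j 1" i] norm_A[OF K, of "axis j 1"] by simp
qed

text \<open>The 8 is a 4, from a segment of half the ball radius whose preimage fits into a cube of
  width 2, times 2 for using a ball of more than half the inradius.\<close>

definition cond_bound :: real where "cond_bound = 8 * csr * cqu"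

text \<open>An inscribed ball contains a segment in each coordinate direction whose preimage stays
  in the cube, which limits the inverse matrix; shape regularity and quasi-uniformity compare the
  ball with the mesh size. Positivity of \<open>csr\<close> is recorded because it follows only from
  the presence of an element.\<close>

lemma inverse_entry:
  assumes K: "K \<in> T"
  shows "\<bar>matrix_inv (fst K) $ i $ j\<bar> \<le> cond_bound / mesh_size" and "0 < csr"
proof -
  let ?R = "{r. \<exists>c. ball c r \<subseteq> elem K}"
  \<comment> \<open>Without this bound the supremum defining \<open>inradius\<close> would carry no
    information.\<close>
  have "bdd_above ?R"
  proof (rule bdd_aboveI)
    fix r assume "r \<in> ?R"
    then obtain c where c: "ball c r \<subseteq> elem K" by blast
    show "r \<le> 2 * hsize K"
    proof (cases "r > 0")
      case True
      have "c \<in> ball c r" "c + (r / 2) *\<^sub>R axis j 1 \<in> ball c r"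
        using True by (auto simp: dist_norm)
      then have "dist c (c + (r / 2) *\<^sub>R axis j 1) \<le> hsize K" using c by (intro dist_elem) auto
      then show ?thesis using True by (simp add: dist_norm)
    next
      case False
      then show ?thesis using hsize_pos[OF K] by linarith
    qed
  qed
  moreover have zero: "0 \<in> ?R" by simp
  ultimately have r0: "0 \<le> inradius K" unfolding inradius_def by (intro cSup_upper)
  have "0 < csr * inradius K" using shape[OF K] hsize_pos[OF K] by linarith
  then have rp: "0 < inradius K" and cp: "0 < csr" using r0 by (auto simp: zero_less_mult_iff)
  show "0 < csr" by (rule cp)
  have "inradius K / 2 < Sup ?R" using rp unfolding inradius_def by simp
  then obtain r where r: "r \<in> ?R" "inradius K / 2 < r"
    using less_cSupD[of ?R "inradius K / 2"] zero by blast
  then obtain c where c: "ball c r \<subseteq> elem K" by blast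
  have r1: "r > 0" using r rp by linarith
  let ?z = "(r / 2) *\<^sub>R axis j (1::real)"
  have "c \<in> ball c r" "c + ?z \<in> ball c r" using r1 by (auto simp: dist_norm)
  then have "einv K c \<in> ref_cube" "einv K (c + ?z) \<in> ref_cube"
    using c emap_mem_elem_iff[OF inv[OF K]] emap_einv[OF inv[OF K]] by (metis subsetD)+
  then have "\<bar>(einv K (c + ?z) - einv K c) $ i\<bar> \<le> 2"
    by (auto simp: ref_cube_def abs_le_iff dest!: spec[of _ i])
  moreover have "einv K (c + ?z) - einv K c = (r / 2) *\<^sub>R (matrix_inv (fst K) *v axis j 1)"
    unfolding einv_def matrix_vector_mult_diff_distrib[symmetric] matrix_vector_mult_scaleR[symmetric] by simp
  ultimately have "\<bar>r / 2 * matrix_inv (fst K) $ i $ j\<bar> \<le> 2"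
    by (simp add: matrix_vector_mult_basis column_def)
  then have "r * \<bar>matrix_inv (fst K) $ i $ j\<bar> \<le> 4" using r1 by (simp add: abs_mult)
  moreover have "inradius K / 2 * \<bar>matrix_inv (fst K) $ i $ j\<bar> \<le> r * \<bar>matrix_inv (fst K) $ i $ j\<bar>"
    using r(2) by (intro mult_right_mono) auto
  ultimately have 1: "inradius K * \<bar>matrix_inv (fst K) $ i $ j\<bar> \<le> 8" by linarith
  have "mesh_size \<le> cqu * (csr * inradius K)"
    using mesh_size_le[OF K] mult_left_mono[OF shape[OF K], of cqu] cqu_pos by linarith
  then have "mesh_size * \<bar>matrix_inv (fst K) $ i $ j\<bar> \<le> cqu * (csr * inradius K) * \<bar>matrix_inv (fst K) $ i $ j\<bar>"
    by (intro mult_right_mono) auto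
  also have "\<dots> = cqu * csr * (inradius K * \<bar>matrix_inv (fst K) $ i $ j\<bar>)" by (simp add: mult_ac)
  also have "\<dots> \<le> cqu * csr * 8" using 1 cp cqu_pos by (intro mult_left_mono) auto
  finally show "\<bar>matrix_inv (fst K) $ i $ j\<bar> \<le> cond_bound / mesh_size"
    using mesh_size_pos by (simp add: cond_bound_def pos_le_divide_eq mult_ac)
qed

lemma cond_bound_pos: "0 < cond_bound"
  using T_nonempty inverse_entry(2) cqu_pos by (auto simp: cond_bound_def)

definition det_bound :: real where "det_bound = fact CARD('n)"

lemma det_bound_pos: "0 < det_bound" by (simp add: det_bound_def)

text \<open>The modulus of the determinant of the affine map, characterised by what is needed of it.\<close>

definition cvol :: "'n elt \<Rightarrow> real" where
  "cvol K = (SOME c. c > 0 \<and> c \<le> det_bound * mesh_size ^ CARD('n) \<and> mesh_size ^ CARD('n) \<le> c * (det_bound * cond_bound ^ CARD('n)) \<and>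
     (\<forall>f. continuous_on UNIV f \<longrightarrow> (f has_integral c * integral ref_cube (\<lambda>y. f (emap K y))) (elem K)))"

lemma cvol:
  assumes K: "K \<in> T"
  shows "cvol K > 0" "cvol K \<le> det_bound * mesh_size ^ CARD('n)" "mesh_size ^ CARD('n) \<le> cvol K * (det_bound * cond_bound ^ CARD('n))"
    "continuous_on UNIV f \<Longrightarrow> (f has_integral cvol K * integral ref_cube (\<lambda>y. f (emap K y))) (elem K)"
proof -
  obtain c where c: "c > 0" "\<forall>a. (\<forall>i j. \<bar>fst K $ i $ j\<bar> \<le> a) \<longrightarrow> c \<le> fact CARD('n) * a ^ CARD('n)"
     "\<forall>b. (\<forall>i j. \<bar>matrix_inv (fst K) $ i $ j\<bar> \<le> b) \<longrightarrow> 1 \<le> c * (fact CARD('n) * b ^ CARD('n))"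
     "\<forall>f. continuous_on UNIV f \<longrightarrow> (f has_integral c * integral ref_cube (\<lambda>y. f (emap K y))) (elem K)"
    using elem_integral[OF inv[OF K] dim] by (elim exE conjE)
  have 1: "c \<le> det_bound * mesh_size ^ CARD('n)"
    using spec[OF c(2), of mesh_size] A_entry[OF K] by (simp add: det_bound_def)
  have "1 \<le> c * (det_bound * (cond_bound / mesh_size) ^ CARD('n))"
    using spec[OF c(3), of "cond_bound / mesh_size"] inverse_entry(1)[OF K] by (simp add: det_bound_def)
  then have "1 * mesh_size ^ CARD('n) \<le> c * (det_bound * (cond_bound / mesh_size) ^ CARD('n)) * mesh_size ^ CARD('n)"
    using mesh_size_pos by (intro mult_right_mono) auto
  then have 2: "mesh_size ^ CARD('n) \<le> c * (det_bound * cond_bound ^ CARD('n))"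
    using mesh_size_pos by (simp add: power_divide)
  let ?P = "\<lambda>c. c > 0 \<and> c \<le> det_bound * mesh_size ^ CARD('n) \<and> mesh_size ^ CARD('n) \<le> c * (det_bound * cond_bound ^ CARD('n)) \<and>
     (\<forall>f. continuous_on UNIV f \<longrightarrow> (f has_integral c * integral ref_cube (\<lambda>y. f (emap K y))) (elem K))"
  have "?P (cvol K)"
    unfolding cvol_def by (rule someI[of ?P c]) (intro conjI c(1,4) 1 2)
  then show "cvol K > 0" "cvol K \<le> det_bound * mesh_size ^ CARD('n)" "mesh_size ^ CARD('n) \<le> cvol K * (det_bound * cond_bound ^ CARD('n))"
    "continuous_on UNIV f \<Longrightarrow> (f has_integral cvol K * integral ref_cube (\<lambda>y. f (emap K y))) (elem K)"
    by simp_all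
qed

definition area :: "'n elt \<Rightarrow> 'n \<Rightarrow> real" where
  "area K j = \<bar>det (fst K)\<bar> * norm (nvec K j) / 2"

text \<open>Upper bound: the squared norm of \<open>nvec\<close> is the j-th component of the
  inverse matrix applied to it. Lower bound: its pairing with the image of the j-th unit vector is
  1.\<close>

lemma norm_nvec:
  assumes K: "K \<in> T"
  shows "norm (nvec K j) \<le> real CARD('n) * cond_bound / mesh_size" "1 \<le> norm (nvec K j) * mesh_size"
proof -
  let ?v = "nvec K j"
  have v0: "norm ?v > 0" using nvec_nonzero[OF inv[OF K]] by simp
  have "?v \<bullet> (fst K *v (matrix_inv (fst K) *v ?v)) = (matrix_inv (fst K) *v ?v) $ j"
    by (rule inner_nvec[OF inv[OF K]])
  then have "(norm ?v)\<^sup>2 = (\<Sum>i\<in>UNIV. matrix_inv (fst K) $ j $ i * ?v $ i)"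
    by (simp add: matrix_vector_mul_assoc matrix_inv_both[OF inv[OF K]] dot_square_norm) (simp add: matrix_vector_mult_def)
  also have "\<dots> \<le> (\<Sum>i\<in>(UNIV::'n set). cond_bound / mesh_size * norm ?v)"
  proof (rule sum_mono)
    fix i
    have "matrix_inv (fst K) $ j $ i * ?v $ i \<le> \<bar>matrix_inv (fst K) $ j $ i\<bar> * \<bar>?v $ i\<bar>"
      by (metis abs_ge_self abs_mult)
    also have "\<dots> \<le> cond_bound / mesh_size * norm ?v"
      using inverse_entry(1)[OF K, of j i] component_le_norm_cart[of ?v i] cond_bound_pos mesh_size_pos
      by (intro mult_mono) auto
    finally show "matrix_inv (fst K) $ j $ i * ?v $ i \<le> cond_bound / mesh_size * norm ?v" .
  qed
  also have "\<dots> = (real CARD('n) * cond_bound / mesh_size) * norm ?v" by simp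
  finally show "norm ?v \<le> real CARD('n) * cond_bound / mesh_size"
    unfolding power2_eq_square by (rule mult_right_le_imp_le[OF _ v0])
  have "1 = ?v \<bullet> (fst K *v axis j 1)" using inner_nvec[OF inv[OF K], of j "axis j 1"] by simp
  also have "\<dots> \<le> norm ?v * norm (fst K *v axis j 1)" by (rule norm_cauchy_schwarz)
  also have "\<dots> \<le> norm ?v * mesh_size"
    using norm_A[OF K, of "axis j 1"] by (intro mult_left_mono) auto
  finally show "1 \<le> norm ?v * mesh_size" .
qed

definition trace_const :: real where "trace_const = det_bound\<^sup>2 * cond_bound ^ CARD('n) * (real CARD('n) * cond_bound) / 2"
definition face_const :: real where "face_const = 2 * det_bound\<^sup>2 * cond_bound ^ CARD('n)"

lemma trace_const_pos: "0 < trace_const" and face_const_pos: "0 < face_const"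
  using cond_bound_pos det_bound_pos by (auto simp: trace_const_def face_const_def)

text \<open>Both sides are compared with h^d, facets through the determinant and volumes through
  \<open>cvol\<close>. Quasi-uniformity is built into these comparisons, so \<open>K\<close> and
  \<open>L\<close> may be any two elements.\<close>

lemma area_bounds:
  assumes K: "K \<in> T" and L: "L \<in> T"
  shows "area K j * mesh_size \<le> trace_const * cvol L" "cvol L \<le> face_const * (area K j * mesh_size)" "0 < area K j"
proof -
  let ?d = "CARD('n)"
  have dle: "\<bar>det (fst K)\<bar> \<le> det_bound * mesh_size ^ ?d"
    unfolding det_bound_def by (rule det_le) (rule A_entry[OF K])
  have "\<bar>det (matrix_inv (fst K))\<bar> \<le> det_bound * (cond_bound / mesh_size) ^ ?d"
    unfolding det_bound_def by (rule det_le) (rule inverse_entry(1)[OF K])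
  moreover have "\<bar>det (fst K)\<bar> * \<bar>det (matrix_inv (fst K))\<bar> = 1"
    using matrix_inv_both(1)[OF inv[OF K]] by (metis abs_1 abs_mult det_I det_mul)
  ultimately have "1 \<le> \<bar>det (fst K)\<bar> * (det_bound * (cond_bound / mesh_size) ^ ?d)"
    by (metis abs_ge_zero mult_left_mono)
  then have "1 * mesh_size ^ ?d \<le> \<bar>det (fst K)\<bar> * (det_bound * (cond_bound / mesh_size) ^ ?d) * mesh_size ^ ?d"
    using mesh_size_pos by (intro mult_right_mono) auto
  then have dge: "mesh_size ^ ?d \<le> \<bar>det (fst K)\<bar> * (det_bound * cond_bound ^ ?d)"
    using mesh_size_pos by (simp add: power_divide)
  have dpos: "0 < \<bar>det (fst K)\<bar>"
    using inv[OF K] by (simp add: invertible_det_nz)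
  show "0 < area K j" using dpos nvec_nonzero[OF inv[OF K], of j] by (simp add: area_def)
  have "area K j * mesh_size = \<bar>det (fst K)\<bar> * (norm (nvec K j) * mesh_size / 2)" by (simp add: area_def)
  also have "\<dots> \<le> (det_bound * mesh_size ^ ?d) * (real ?d * cond_bound / 2)"
    using norm_nvec(1)[OF K, of j] mesh_size_pos det_bound_pos by (intro mult_mono[OF dle]) (auto simp: field_simps)
  also have "\<dots> \<le> (det_bound * (cvol L * (det_bound * cond_bound ^ ?d))) * (real ?d * cond_bound / 2)"
    using cvol(3)[OF L] cond_bound_pos det_bound_pos by (intro mult_right_mono mult_left_mono) auto
  finally show "area K j * mesh_size \<le> trace_const * cvol L" by (simp add: trace_const_def power2_eq_square mult_ac)
  have "cvol L \<le> det_bound * mesh_size ^ ?d" by (rule cvol(2)[OF L])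
  also have "\<dots> \<le> det_bound * (\<bar>det (fst K)\<bar> * (det_bound * cond_bound ^ ?d)) * 1"
    using mult_left_mono[OF dge, of det_bound] det_bound_pos by simp
  also have "\<dots> \<le> det_bound * (\<bar>det (fst K)\<bar> * (det_bound * cond_bound ^ ?d)) * (norm (nvec K j) * mesh_size)"
    using norm_nvec(2)[OF K, of j] det_bound_pos cond_bound_pos by (intro mult_left_mono) auto
  also have "\<dots> = face_const * (area K j * mesh_size)" by (simp add: face_const_def area_def power2_eq_square)
  finally show "cvol L \<le> face_const * (area K j * mesh_size)" .
qed

lemma pint_1: "pint 1 = 2"
  using leg_norm[of 0] by simp

lemma integral_cube_1: "integral ref_cube (\<lambda>y::real^'n. 1) = (2 :: real) ^ CARD('n)"
proof -
  have "(\<lambda>y::real^'n. 1) = tp (\<lambda>_. 1)" by (simp add: tp_def fun_eq_iff)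
  then show ?thesis by (simp add: integral_cube_prod pint_1)
qed

definition patch_bound :: real where "patch_bound = det_bound * cond_bound ^ CARD('n)"

lemma patch_bound_pos: "0 < patch_bound" using det_bound_pos cond_bound_pos by (simp add: patch_bound_def)

text \<open>The elements containing \<xi> overlap in null sets and lie in a cube of side 2h about
  \<xi>, while each has volume at least (2h)^d divided by \<open>patch_bound\<close>.\<close>

lemma card_patch:
  assumes S: "S \<subseteq> T" and \<xi>: "\<And>K. K \<in> S \<Longrightarrow> \<xi> \<in> elem K"
  shows "real (card S) \<le> patch_bound"
proof -
  let ?d = "CARD('n)"
  have fin: "finite S" by (rule finite_subset[OF S finite_T])
  have "((\<lambda>x. 1) has_integral (\<Sum>K\<in>S. cvol K * 2 ^ ?d)) (\<Union>K\<in>S. elem K)"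
  proof (rule has_integral_UN[OF fin])
    fix K assume "K \<in> S"
    then show "((\<lambda>x. 1) has_integral cvol K * 2 ^ ?d) (elem K)"
      using cvol(4)[of K "\<lambda>x. 1"] S integral_cube_1 by auto
  next
    show "pairwise (\<lambda>K L. negligible (elem K \<inter> elem L)) S"
    proof (rule pairwiseI)
      fix K L assume KL: "K \<in> S" "L \<in> S" "K \<noteq> L"
      have "elem K \<inter> elem L \<subseteq> frontier (elem K)"
        using elem_unique[of K L] KL S closure_subset[of "elem K"] unfolding frontier_def by blast
      then show "negligible (elem K \<inter> elem L)"
        using negligible_convex_frontier[OF convex_elem] negligible_subset by blast
    qed
  qed
  moreover have "((\<lambda>x. 1) has_integral (2 * mesh_size) ^ ?d) (cbox (\<xi> - (\<chi> i. mesh_size)) (\<xi> + (\<chi> i. mesh_size)))"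
  proof -
    have "measure lborel (cbox (\<xi> - (\<chi> i. mesh_size)) (\<xi> + (\<chi> i. mesh_size))) = (2 * mesh_size) ^ ?d"
      using mesh_size_pos by (subst content_cbox_cart) (auto simp: interval_ne_empty_cart)
    then show ?thesis
      using has_integral_const[of "1::real" "\<xi> - (\<chi> i. mesh_size)" "\<xi> + (\<chi> i. mesh_size)"] by simp
  qed
  moreover have "(\<Union>K\<in>S. elem K) \<subseteq> cbox (\<xi> - (\<chi> i. mesh_size)) (\<xi> + (\<chi> i. mesh_size))"
  proof
    fix x assume "x \<in> (\<Union>K\<in>S. elem K)"
    then obtain K where K: "K \<in> S" "x \<in> elem K" by blast
    then have "dist x \<xi> \<le> mesh_size" using dist_elem[OF K(2) \<xi>[OF K(1)]] hsize_le[of K] S by auto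
    then have "\<bar>x $ i - \<xi> $ i\<bar> \<le> mesh_size" for i
      using component_le_norm_cart[of "x - \<xi>" i] by (simp add: dist_norm)
    then show "x \<in> cbox (\<xi> - (\<chi> i. mesh_size)) (\<xi> + (\<chi> i. mesh_size))"
      by (auto simp: mem_box_cart abs_le_iff algebra_simps)
  qed
  ultimately have "(\<Sum>K\<in>S. cvol K * 2 ^ ?d) \<le> (2 * mesh_size) ^ ?d"
    by (intro has_integral_subset_le) auto
  then have 1: "(\<Sum>K\<in>S. cvol K) \<le> mesh_size ^ ?d"
    by (simp add: power_mult_distrib flip: sum_distrib_right)
  have "real (card S) * mesh_size ^ ?d = (\<Sum>K\<in>S. mesh_size ^ ?d)" by simp
  also have "\<dots> \<le> (\<Sum>K\<in>S. cvol K * patch_bound)"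
    using cvol(3) S by (intro sum_mono) (auto simp: patch_bound_def)
  also have "\<dots> \<le> mesh_size ^ ?d * patch_bound"
    using 1 patch_bound_pos by (simp flip: sum_distrib_right)
  finally show ?thesis using mesh_size_pos by (simp add: mult.commute)
qed

section \<open>Faces of the mesh, their neighbours and parametrisations\<close>

lemma all_faces_cases:
  assumes "F \<in> all_faces \<Omega> T"
  obtains (int) K K' where "K \<in> T" "K' \<in> T" "K \<noteq> K'" "F facet_of elem K" "F \<subseteq> elem K'" "nbrs T F = {K, K'}"
       "F \<in> int_faces T"
     | (bd) K where "K \<in> T" "F facet_of elem K" "F \<subseteq> frontier \<Omega>" "nbrs T F = {K}"
proof -
  consider "F \<in> int_faces T" | "F \<in> bdry_faces \<Omega> T" using assms by (auto simp: all_faces_def)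
  then show thesis
  proof cases
    case 1
    then obtain K K' where "K \<in> T" "K' \<in> T" "K \<noteq> K'" "F = elem K \<inter> elem K'" "F facet_of elem K"
      by (auto simp: int_faces_def)
    then show thesis using int[of K K'] nbrs_interior[of K K' F] 1 by auto
  next
    case 2
    then obtain K where "K \<in> T" "F facet_of elem K" "F \<subseteq> frontier \<Omega>"
      by (auto simp: bdry_faces_def)
    then show thesis using bd nbrs_boundary by blast
  qed
qed

lemma facet_of_nbr:
  assumes F: "F \<in> all_faces \<Omega> T" and K: "K \<in> nbrs T F"
  shows "K \<in> T" "F facet_of elem K"
proof -
  show KT: "K \<in> T" using K by (simp add: nbrs_def)
  show "F facet_of elem K"
    using F
  proof (cases rule: all_faces_cases)
    case (int L L')
    then show ?thesis
      using K facet_sharing(2)[OF int(1,2,3,4,5)] by auto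
  next
    case (bd L)
    then show ?thesis using K by auto
  qed
qed

lemma nbrs_nonempty: "F \<in> all_faces \<Omega> T \<Longrightarrow> nbrs T F \<noteq> {}"
  by (erule all_faces_cases) auto

lemma card_nbrs: "F \<in> all_faces \<Omega> T \<Longrightarrow> 1 \<le> card (nbrs T F) \<and> card (nbrs T F) \<le> 2"
  by (erule all_faces_cases) auto

lemma finite_nbrs: "finite (nbrs T F)"
  using finite_T by (simp add: nbrs_def)

lemma finite_all_faces: "finite (all_faces \<Omega> T)"
proof (rule finite_subset)
  show "all_faces \<Omega> T \<subseteq> (\<Union>K\<in>T. {F. F face_of elem K})"
    by (auto simp: all_faces_def int_faces_def bdry_faces_def facet_of_def)
  show "finite (\<Union>K\<in>T. {F. F face_of elem K})"
    by (intro finite_UN_I finite_T finite_polytope_faces polytope_elem)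
qed

text \<open>The choice inside \<open>face_integral\<close> does not involve the integrand, so one
  parametrisation serves all integrands on a face. Which neighbour it comes from stays open.\<close>

lemma face_rep:
  assumes F: "F \<in> all_faces \<Omega> T"
  shows "\<exists>K j s. K \<in> nbrs T F \<and> (s = 1 \<or> s = -1) \<and> F = emap K ` cface {j} (\<lambda>_. s) \<and>
     (\<forall>g. face_integral T F g = area K j * integral ref_cube (\<lambda>y. g (emap K (upd j s y))))"
proof -
  obtain K0 where K0: "K0 \<in> nbrs T F" using nbrs_nonempty[OF F] by blast
  obtain j0 s0 where js0: "s0 = 1 \<or> s0 = -1" "F = emap K0 ` cface {j0} (\<lambda>_. s0)"
    using facet_of_elem[OF inv[OF facet_of_nbr(1)[OF F K0]] facet_of_nbr(2)[OF F K0]] by blast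
  have cf: "cface {j} (\<lambda>_. s) = {y \<in> ref_cube. y $ j = s}" for j :: 'n and s by (auto simp: cface_def)
  let ?P = "\<lambda>(K, j, s). K \<in> T \<and> (s = 1 \<or> s = -1) \<and> F = emap K ` {y\<in>ref_cube. y$j = s}"
  have "\<exists>x. ?P x"
    using facet_of_nbr(1)[OF F K0] js0 unfolding cf by blast
  then have P: "?P (SOME x. ?P x)" by (rule someI_ex)
  obtain K j s where e: "(SOME x. ?P x) = (K, j, s)" by (rule prod_cases3)
  have Kjs: "K \<in> T" "s = 1 \<or> s = -1" "F = emap K ` {y\<in>ref_cube. y$j = s}"
    using P unfolding e by auto
  have "K \<in> nbrs T F" using Kjs by (auto simp: nbrs_def elem_def)
  moreover have "face_integral T F g = area K j * integral ref_cube (\<lambda>y. g (emap K (upd j s y)))" for g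
    unfolding face_integral_def e by (simp add: area_def nvec_def upd_def)
  ultimately show ?thesis using Kjs cf by blast
qed

lemma face_transition:
  assumes F: "F \<in> all_faces \<Omega> T" and K: "K \<in> nbrs T F" and L: "L \<in> nbrs T F"
    and s: "s = 1 \<or> s = -1" and FK: "F = emap K ` cface {j} (\<lambda>_. s)"
  obtains j' s' \<pi> e where "s' = 1 \<or> s' = -1" "F = emap L ` cface {j'} (\<lambda>_. s')"
     "bij_betw \<pi> (- {j'}) (- {j})" "\<And>i. e i = 1 \<or> e i = (-1::real)"
     "\<And>y. emap K (upd j s y) = emap L (\<chi> i. if i \<in> {j'} then s' else e i * y $ \<pi> i)"
proof -
  note KT = facet_of_nbr(1)[OF F K] and LT = facet_of_nbr(1)[OF F L]
  obtain j' s' where js': "s' = 1 \<or> s' = -1" "F = emap L ` cface {j'} (\<lambda>_. s')"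
    using facet_of_elem[OF inv[OF LT] facet_of_nbr(2)[OF F L]] by blast
  have "emap K ` cface {j} (\<lambda>_. s) = emap L ` cface {j'} (\<lambda>_. s')" using FK js' by simp
  from common_face[OF inv[OF KT] inv[OF LT] this s js'(1)]
  obtain \<pi> e where pe: "bij_betw \<pi> (- {j'}) (- {j})" "\<forall>i. e i = 1 \<or> e i = (-1::real)"
     "\<forall>y. (\<forall>i\<in>{j}. y $ i = s) \<longrightarrow> emap K y = emap L (\<chi> i. if i \<in> {j'} then s' else e i * y $ \<pi> i)"
    by (elim exE conjE)
  have "emap K (upd j s y) = emap L (\<chi> i. if i \<in> {j'} then s' else e i * y $ \<pi> i)" for y
  proof -
    have "(\<chi> i. if i \<in> {j'} then s' else e i * upd j s y $ \<pi> i) = (\<chi> i. if i \<in> {j'} then s' else e i * y $ \<pi> i)"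
      using bij_betwE[OF pe(1)] by (auto simp: vec_eq_iff)
    then show ?thesis using spec[OF pe(3), of "upd j s y"] by simp
  qed
  then show thesis using that js' pe by blast
qed

text \<open>A trace taken from \<open>L\<close> is read in a parametrisation through
  \<open>K\<close>. The signed permutation between the two keeps it in Q^p and preserves its
  integral, after which the trace inequality on the reference cube of \<open>L\<close>
  applies.\<close>

lemma trace_face:
  assumes F: "F \<in> all_faces \<Omega> T" and K: "K \<in> nbrs T F" and L: "L \<in> nbrs T F"
    and s: "s = 1 \<or> s = -1" and FK: "F = emap K ` cface {j} (\<lambda>_. s)"
    and q: "(\<lambda>y. u (emap L y)) \<in> Qp_ref p"
  shows "(\<lambda>y. u (emap K (upd j s y))) \<in> Qp_ref p"
    and "integral ref_cube (\<lambda>y. (u (emap K (upd j s y)))\<^sup>2) \<le> (real p + 1)\<^sup>2 * integral ref_cube (\<lambda>y. (u (emap L y))\<^sup>2)"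
proof -
  obtain j' s' \<pi> e where t: "s' = 1 \<or> s' = -1" "F = emap L ` cface {j'} (\<lambda>_. s')" "bij_betw \<pi> (- {j'}) (- {j})" "\<And>i. e i = 1 \<or> e i = (-1::real)"
     "\<And>y. emap K (upd j s y) = emap L (\<chi> i. if i \<in> {j'} then s' else e i * y $ \<pi> i)"
    by (rule face_transition[OF F K L s FK]) (rule that)
  show "(\<lambda>y. u (emap K (upd j s y))) \<in> Qp_ref p"
    unfolding t(5) by (rule Qp_ref_subst[OF q bij_betw_imp_inj_on[OF t(3)]])
  define \<rho> where "\<rho> = \<pi>(j' := j)"
  have im: "\<pi> ` (- {j'}) = - {j}" and inj: "inj_on \<pi> (- {j'})"
    using t(3) by (auto simp: bij_betw_def)
  have "inj \<rho>"
  proof (rule injI)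
    fix x y assume e: "\<rho> x = \<rho> y"
    have ne: "\<pi> z \<noteq> j" if "z \<noteq> j'" for z using im that by blast
    show "x = y"
      using e ne[of x] ne[of y] inj_onD[OF inj, of x y] unfolding \<rho>_def
      by (cases "x = j'"; cases "y = j'") auto
  qed
  moreover have "z \<in> range \<rho>" for z
  proof (cases "z = j")
    case True
    then have "z = \<rho> j'" by (simp add: \<rho>_def)
    then show ?thesis by blast
  next
    case False
    then have "z \<in> \<pi> ` (- {j'})" using im by blast
    then obtain x where "x \<noteq> j'" "z = \<pi> x" by blast
    then have "z = \<rho> x" by (simp add: \<rho>_def)
    then show ?thesis by blast
  qed
  ultimately have b: "bij \<rho>" by (auto simp: bij_def)
  have S: "(\<chi> i. if i \<in> {j'} then s' else e i * y $ \<pi> i) = upd j' s' (\<chi> i. e i * y $ \<rho> i)" for y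
    by (auto simp: vec_eq_iff \<rho>_def)
  have q2: "(\<lambda>y. (u (emap L (upd j' s' y)))\<^sup>2) \<in> Qp_ref (p + p)"
    unfolding power2_eq_square by (intro Qp_ref_mult Qp_ref_upd[OF q])
  have "integral ref_cube (\<lambda>y. (u (emap K (upd j s y)))\<^sup>2) = integral ref_cube (\<lambda>y. (u (emap L (upd j' s' y)))\<^sup>2)"
    unfolding t(5) S by (rule integral_signed_perm[OF q2 b t(4)])
  also have "\<dots> \<le> (real p + 1)\<^sup>2 * integral ref_cube (\<lambda>y. (u (emap L y))\<^sup>2)"
    by (rule trace_inverse_cube[OF q t(1)])
  finally show "integral ref_cube (\<lambda>y. (u (emap K (upd j s y)))\<^sup>2) \<le> (real p + 1)\<^sup>2 * integral ref_cube (\<lambda>y. (u (emap L y))\<^sup>2)" .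
qed


section \<open>Nodes and polynomials on common faces of two elements\<close>

lemma common_face_param:
  assumes K: "K \<in> T" and L: "L \<in> T" and ne: "elem K \<inter> elem L \<noteq> {}"
  obtains I s I' s' \<pi> e where "\<And>i. s i = 1 \<or> s i = (-1::real)" "\<And>i. s' i = 1 \<or> s' i = (-1::real)"
    "elem K \<inter> elem L = emap K ` cface I s" "elem K \<inter> elem L = emap L ` cface I' s'"
    "bij_betw \<pi> (- I') (- I)" "\<And>i. e i = 1 \<or> e i = (-1::real)"
    "\<And>y. (\<forall>i\<in>I. y $ i = s i) \<Longrightarrow> emap K y = emap L (\<chi> i. if i \<in> I' then s' i else e i * y $ \<pi> i)"
proof -
  obtain I s where s: "\<forall>i. s i = 1 \<or> s i = (-1::real)" "elem K \<inter> elem L = emap K ` cface I s"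
    using face_of_elem[OF inv[OF K] conjunct1[OF faces[OF K L]] ne] by blast
  obtain I' s' where s': "\<forall>i. s' i = 1 \<or> s' i = (-1::real)" "elem K \<inter> elem L = emap L ` cface I' s'"
    using face_of_elem[OF inv[OF L] conjunct2[OF faces[OF K L]] ne] by blast
  have "emap K ` cface I s = emap L ` cface I' s'" using s(2) s'(2) by simp
  from common_face[OF inv[OF K] inv[OF L] this spec[OF s(1)] spec[OF s'(1)]]
  obtain \<pi> e where "bij_betw \<pi> (- I') (- I)" "\<forall>i. e i = 1 \<or> e i = (-1::real)"
     "\<forall>y. (\<forall>i\<in>I. y $ i = s i) \<longrightarrow> emap K y = emap L (\<chi> i. if i \<in> I' then s' i else e i * y $ \<pi> i)"
    by (elim exE conjE)
  then show thesis using that[of s s' I I' \<pi> e] s s' by simp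
qed

text \<open>On free coordinates the transition permutes and changes signs, and nodes and weights are
  symmetric; frozen coordinates carry the end weight, and both parametrisations freeze equally
  many.\<close>

lemma node_transfer:
  assumes p: "p \<ge> 1" and K: "K \<in> T" and L: "L \<in> T" and y: "y \<in> gnodes p" and x: "emap K y \<in> elem L"
  shows "\<exists>z\<in>gnodes p. emap K y = emap L z \<and> node_weight p z = node_weight p y"
proof -
  have yK: "emap K y \<in> elem K" using gnodes_cube[OF y] by (simp add: elem_def)
  then have ne: "elem K \<inter> elem L \<noteq> {}" using x by blast
  obtain I s I' s' \<pi> e where s: "\<And>i. s i = 1 \<or> s i = (-1::real)" and s': "\<And>i. s' i = 1 \<or> s' i = (-1::real)"
    and E: "elem K \<inter> elem L = emap K ` cface I s" "elem K \<inter> elem L = emap L ` cface I' s'"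
    and b: "bij_betw \<pi> (- I') (- I)" and e: "\<And>i. e i = 1 \<or> e i = (-1::real)"
    and tr: "\<And>y. (\<forall>i\<in>I. y $ i = s i) \<Longrightarrow> emap K y = emap L (\<chi> i. if i \<in> I' then s' i else e i * y $ \<pi> i)"
    by (rule common_face_param[OF K L ne]) (rule that)
  have "emap K y \<in> emap K ` cface I s" using E(1) yK x by blast
  then have "y \<in> cface I s" by (auto simp: emap_eq_iff[OF inv[OF K]])
  then have yI: "\<forall>i\<in>I. y $ i = s i" by (simp add: cface_def)
  let ?z = "\<chi> i. if i \<in> I' then s' i else e i * y $ \<pi> i"
  have g: "e i * t \<in> gll p" if "t \<in> gll p" for i t using e[of i] that gll_uminus by auto
  have gs: "gll_weight p (e i * t) = gll_weight p t" if "t \<in> gll p" for i t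
    using e[of i] gll_weight_uminus[OF p that] by auto
  have g1: "gll_weight p (s i) = gll_weight p 1" "gll_weight p (s' i) = gll_weight p 1" for i
    using s[of i] s'[of i] gll_weight_uminus[OF p gll_ends(1)] by auto
  have yg: "y $ i \<in> gll p" for i using y by (simp add: gnodes_def)
  have sg: "s' i \<in> gll p" for i using s'[of i] by auto
  have z: "?z \<in> gnodes p"
    using g yg sg by (simp add: gnodes_def)
  have cc: "card (- I') = card (- I)" by (rule bij_betw_same_card[OF b])
  then have cI: "card I' = card I"
  proof -
    have "card (- J) = CARD('n) - card J" "card J \<le> CARD('n)" for J :: "'n set"
      by (simp_all add: Compl_eq_Diff_UNIV card_Diff_subset card_mono)
    then show ?thesis using cc by (metis diff_diff_cancel)
  qed
  have spl: "(\<Prod>i\<in>UNIV. f i) = (\<Prod>i\<in>J. f i) * (\<Prod>i\<in>- J. f i)" for f :: "'n \<Rightarrow> real" and J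
    by (simp add: prod.subset_diff[of J UNIV] Compl_eq_Diff_UNIV mult.commute)
  have "node_weight p ?z = (\<Prod>i\<in>I'. gll_weight p 1) * (\<Prod>i\<in>- I'. gll_weight p (y $ \<pi> i))"
    unfolding node_weight_def by (subst spl[of _ I']) (auto simp: g1 gs[OF yg] intro!: arg_cong2[of _ _ _ _ "(*)"] prod.cong)
  also have "(\<Prod>i\<in>- I'. gll_weight p (y $ \<pi> i)) = (\<Prod>i\<in>- I. gll_weight p (y $ i))"
    by (rule prod.reindex_bij_betw[OF b])
  also have "(\<Prod>i\<in>I'. gll_weight p 1) = (\<Prod>i\<in>I. gll_weight p (y $ i))"
    using yI g1 cI by simp
  also have "(\<Prod>i\<in>I. gll_weight p (y $ i)) * (\<Prod>i\<in>- I. gll_weight p (y $ i)) = node_weight p y"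
    unfolding node_weight_def by (rule spl[symmetric])
  finally have "node_weight p ?z = node_weight p y" .
  then show ?thesis using z tr[OF yI] by blast
qed

lemma cface_freeze:
  assumes "\<And>i. s i = 1 \<or> s i = (-1::real)"
  shows "y \<in> gnodes p \<Longrightarrow> (\<chi> i. if i \<in> I then s i else y $ i) \<in> gnodes p \<inter> cface I s"
proof -
  assume y: "y \<in> gnodes p"
  have sg: "s i \<in> gll p" for i using assms[of i] by auto
  have "(\<chi> i. if i \<in> I then s i else y $ i) \<in> gnodes p" using y sg by (simp add: gnodes_def)
  then show ?thesis using gnodes_cube by (simp add: cface_def)
qed

text \<open>Freezing coordinates turns the difference of the traces into a polynomial on the whole
  cube that vanishes at all its nodes. Unisolvence on the cube thus serves faces of every
  dimension.\<close>

lemma agree_on_common_face: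
  assumes p: "p \<ge> 1" and K: "K \<in> T" and L: "L \<in> T"
    and u: "(\<lambda>y. u (emap K y)) \<in> Qp_ref p" and w: "(\<lambda>y. w (emap L y)) \<in> Qp_ref p"
    and nodes: "\<And>y. y \<in> gnodes p \<Longrightarrow> emap K y \<in> elem L \<Longrightarrow> u (emap K y) = w (emap K y)"
    and x: "x \<in> elem K" "x \<in> elem L"
  shows "u x = w x"
proof -
  have ne: "elem K \<inter> elem L \<noteq> {}" using x by blast
  obtain I s I' s' \<pi> e where s: "\<And>i. s i = 1 \<or> s i = (-1::real)" and s': "\<And>i. s' i = 1 \<or> s' i = (-1::real)"
    and E: "elem K \<inter> elem L = emap K ` cface I s" "elem K \<inter> elem L = emap L ` cface I' s'"
    and b: "bij_betw \<pi> (- I') (- I)" and e: "\<And>i. e i = 1 \<or> e i = (-1::real)"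
    and tr: "\<And>y. (\<forall>i\<in>I. y $ i = s i) \<Longrightarrow> emap K y = emap L (\<chi> i. if i \<in> I' then s' i else e i * y $ \<pi> i)"
    by (rule common_face_param[OF K L ne]) (rule that)
  let ?f = "\<lambda>y. \<chi> i. if i \<in> I then s i else y $ i"
  have q1: "(\<lambda>y. u (emap K (?f y))) \<in> Qp_ref p"
    using Qp_ref_subst[OF u, of id I s "\<lambda>_. 1"] by (simp cong: if_cong)
  have f2: "emap K (?f y) = emap L (\<chi> i. if i \<in> I' then s' i else e i * y $ \<pi> i)" for y
  proof -
    have "(\<chi> i. if i \<in> I' then s' i else e i * ?f y $ \<pi> i) = (\<chi> i. if i \<in> I' then s' i else e i * y $ \<pi> i)"
      using bij_betwE[OF b] by (auto simp: vec_eq_iff)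
    then show ?thesis using tr[of "?f y"] by simp
  qed
  have q2: "(\<lambda>y. w (emap K (?f y))) \<in> Qp_ref p"
    unfolding f2 by (rule Qp_ref_subst[OF w bij_betw_imp_inj_on[OF b]])
  have "(\<lambda>y. u (emap K (?f y)) - w (emap K (?f y))) = (\<lambda>y. 0)"
  proof (rule Qp_ref_zero_at_nodes[OF Qp_ref_diff[OF q1 q2] p])
    fix y :: "real^'n" assume "y \<in> gnodes p"
    then have "?f y \<in> gnodes p \<inter> cface I s" by (rule cface_freeze[OF s])
    then have fy: "?f y \<in> gnodes p" "?f y \<in> cface I s" by simp_all
    then have "emap K (?f y) \<in> elem L" using E(1) by blast
    then show "u (emap K (?f y)) - w (emap K (?f y)) = 0" using nodes[OF fy(1)] by simp
  qed
  then have eq: "u (emap K (?f y)) = w (emap K (?f y))" for y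
    using fun_cong[of "\<lambda>y. u (emap K (?f y)) - w (emap K (?f y))" "\<lambda>y. 0" y] by simp
  obtain y where y: "y \<in> cface I s" "x = emap K y" using x E(1) by blast
  then have "?f y = y" by (auto simp: vec_eq_iff cface_def)
  then show ?thesis using eq[of y] y(2) by simp
qed

lemma zero_on_face:
  assumes p: "p \<ge> 1" and K: "K \<in> T" and u: "(\<lambda>y. u (emap K y)) \<in> Qp_ref p"
    and G: "G face_of elem K"
    and nodes: "\<And>y. y \<in> gnodes p \<Longrightarrow> emap K y \<in> G \<Longrightarrow> u (emap K y) = 0"
    and x: "x \<in> G"
  shows "u x = 0"
proof -
  have "G \<noteq> {}" using x by blast
  then obtain I s where s: "\<forall>i. s i = 1 \<or> s i = (-1::real)" and E: "G = emap K ` cface I s"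
    using face_of_elem[OF inv[OF K] G] by blast
  let ?f = "\<lambda>y. \<chi> i. if i \<in> I then s i else y $ i"
  have q1: "(\<lambda>y. u (emap K (?f y))) \<in> Qp_ref p"
    using Qp_ref_subst[OF u, of id I s "\<lambda>_. 1"] by (simp cong: if_cong)
  have "(\<lambda>y. u (emap K (?f y))) = (\<lambda>y. 0)"
  proof (rule Qp_ref_zero_at_nodes[OF q1 p])
    fix y :: "real^'n" assume "y \<in> gnodes p"
    then have "?f y \<in> gnodes p \<inter> cface I s" by (rule cface_freeze[OF spec[OF s]])
    then have fy: "?f y \<in> gnodes p" "?f y \<in> cface I s" by simp_all
    show "u (emap K (?f y)) = 0" using nodes[OF fy(1)] fy(2) E by blast
  qed
  then have eq: "u (emap K (?f y)) = 0" for y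
    using fun_cong[of "\<lambda>y. u (emap K (?f y))" "\<lambda>y. 0" y] by simp
  obtain y where y: "y \<in> cface I s" "x = emap K y" using x E by blast
  then have "?f y = y" by (auto simp: vec_eq_iff cface_def)
  then show ?thesis using eq[of y] y(2) by simp
qed

text \<open>Zero nodal values on the boundary must spread to the whole trace. The supporting
  hyperplane of the convex domain at x meets the element in a face lying entirely in the boundary,
  to which \<open>zero_on_face\<close> applies.\<close>

lemma boundary_face_at:
  assumes K: "K \<in> T" and x: "x \<in> elem K" "x \<in> frontier \<Omega>"
  shows "\<exists>G. G face_of elem K \<and> x \<in> G \<and> G \<subseteq> frontier \<Omega>"
proof -
  have xcl: "x \<in> closure \<Omega>" using elem_sub[OF K] x by blast
  have ri: "rel_interior \<Omega> = \<Omega>" by (rule rel_interior_open[OF open_dom])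
  have zr: "x \<notin> rel_interior \<Omega>" unfolding ri by (rule frontier_notin[OF x(2)])
  obtain n where n: "n \<noteq> 0" "\<And>y. y \<in> closure \<Omega> \<Longrightarrow> n \<bullet> x \<le> n \<bullet> y" "\<And>y. y \<in> rel_interior \<Omega> \<Longrightarrow> n \<bullet> x < n \<bullet> y"
    by (rule supporting_hyperplane_relative_frontier[OF convex_dom xcl zr]) blast
  let ?G = "elem K \<inter> {w. n \<bullet> w = n \<bullet> x}"
  have "?G face_of elem K"
    by (rule face_of_Int_supporting_hyperplane_ge[OF convex_elem]) (use n(2) elem_sub K in blast)
  moreover have "?G \<subseteq> frontier \<Omega>"
    using elem_sub[OF K] n(3) unfolding ri frontier_def interior_open[OF open_dom] by force
  ultimately show ?thesis using x by (intro exI[of _ ?G]) simp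
qed

section \<open>The Oswald interpolant\<close>

definition nodal_avg :: "'n dgfun \<Rightarrow> real^'n \<Rightarrow> real" where
  "nodal_avg v \<xi> = (if \<xi> \<in> frontier \<Omega> then 0
     else (\<Sum>K'\<in>{K'\<in>T. \<xi> \<in> elem K'}. v K' \<xi>) / real (card {K'\<in>T. \<xi> \<in> elem K'}))"

lemma nodes_eq: "nodes K p = emap K ` gnodes p"
  by (simp add: nodes_def gnodes_def)

lemma Vhp_comp: "v \<in> Vhp T p \<Longrightarrow> K \<in> T \<Longrightarrow> (\<lambda>y. v K (emap K y)) \<in> Qp_ref p"
  by (simp add: Vhp_def o_def)

lemma Vhp_outside: "v \<in> Vhp T p \<Longrightarrow> K \<notin> T \<Longrightarrow> v K = (\<lambda>_. 0)"
  unfolding Vhp_def by blast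

lemma Vhp_eqI:
  assumes p: "p \<ge> 1" and v: "v \<in> Vhp T p" and w: "w \<in> Vhp T p"
    and nd: "\<And>K y. K \<in> T \<Longrightarrow> y \<in> gnodes p \<Longrightarrow> v K (emap K y) = w K (emap K y)"
  shows "v = w"
proof
  fix K
  show "v K = w K"
  proof (cases "K \<in> T")
    case True
    have "(\<lambda>y. v K (emap K y) - w K (emap K y)) = (\<lambda>y. 0)"
      by (rule Qp_ref_zero_at_nodes[OF Qp_ref_diff[OF Vhp_comp[OF v True] Vhp_comp[OF w True]] p]) (simp add: nd True)
    then have "v K (emap K (einv K x)) = w K (emap K (einv K x))" for x
      using fun_cong[of "\<lambda>y. v K (emap K y) - w K (emap K y)" "\<lambda>y. 0" "einv K x"] by simp
    then show ?thesis by (simp add: emap_einv[OF inv[OF True]] fun_eq_iff)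
  qed (simp add: Vhp_outside[OF v] Vhp_outside[OF w])
qed

text \<open>Interpolation is done element by element. The nodal values depend on the point only, so
  pieces agree at shared nodes and, by unisolvence on the common face, on all of it; boundary values
  vanish likewise.\<close>

lemma oswald_exists:
  assumes p: "p \<ge> 1"
  shows "\<exists>w\<in>VC \<Omega> T p. \<forall>K\<in>T. \<forall>y\<in>gnodes p. w K (emap K y) = nodal_avg v (emap K y)"
proof -
  have "\<exists>q\<in>Qp_ref p. \<forall>y\<in>gnodes p. q y = nodal_avg v (emap K y)" for K
    by (rule Qp_ref_interpolate[OF p])
  then obtain q where q: "\<And>K. q K \<in> Qp_ref p" "\<And>K y. y \<in> gnodes p \<Longrightarrow> q K y = nodal_avg v (emap K y)"
    by metis
  define w where "w K x = (if K \<in> T then q K (einv K x) else 0)" for K x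
  have wq: "w K (emap K y) = q K y" if "K \<in> T" for K y
    using that by (simp add: w_def einv_emap[OF inv])
  have wQ: "(\<lambda>y. w K (emap K y)) \<in> Qp_ref p" if "K \<in> T" for K
    unfolding wq[OF that] using q(1)[of K] by simp
  have wV: "w \<in> Vhp T p"
    unfolding Vhp_def o_def using wQ by (auto simp: w_def)
  have agree: "w K x = w L x" if KL: "K \<in> T" "L \<in> T" "x \<in> elem K" "x \<in> elem L" for K L x
  proof (rule agree_on_common_face[OF p KL(1,2) wQ[OF KL(1)] wQ[OF KL(2)] _ KL(3,4)])
    fix y :: "real^'n" assume y: "y \<in> gnodes p" "emap K y \<in> elem L"
    obtain z where z: "z \<in> gnodes p" "emap K y = emap L z"
      using node_transfer[OF p KL(1,2) y] by (elim bexE conjE)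
    have "w K (emap K y) = nodal_avg v (emap K y)" using wq[OF KL(1)] q(2)[OF y(1)] by simp
    also have "\<dots> = w L (emap L z)" using wq[OF KL(2)] q(2)[OF z(1)] z(2) by simp
    finally show "w K (emap K y) = w L (emap K y)" using z(2) by simp
  qed
  \<comment> \<open>By \<open>agree\<close> the chosen element does not influence the value, so this
    is the single-valued function demanded by \<open>VC\<close>.\<close>
  define g where "g x = w (SOME K. K \<in> T \<and> x \<in> elem K) x" for x
  have gw: "w K x = g x" if "K \<in> T" "x \<in> elem K" for K x
  proof -
    have "(SOME K. K \<in> T \<and> x \<in> elem K) \<in> T \<and> x \<in> elem (SOME K. K \<in> T \<and> x \<in> elem K)"
      by (rule someI[of "\<lambda>K. K \<in> T \<and> x \<in> elem K" K]) (use that in blast)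
    then show ?thesis unfolding g_def using agree that by blast
  qed
  have "continuous_on (closure \<Omega>) g"
    unfolding closure_dom
  proof (rule continuous_on_closed_Union[OF finite_T])
    fix K assume K: "K \<in> T"
    show "closed (elem K)" by (rule compact_imp_closed[OF compact_elem])
    have "continuous_on (elem K) (\<lambda>x. q K (einv K x))"
      by (rule continuous_on_compose2[OF Qp_ref_continuous[OF q(1)] einv_continuous]) auto
    moreover have "g x = q K (einv K x)" if "x \<in> elem K" for x
      using gw[OF K that] K by (simp add: w_def)
    ultimately show "continuous_on (elem K) g" by (simp cong: continuous_on_cong)
  qed
  moreover have "g x = 0" if x: "x \<in> frontier \<Omega>" for x
  proof -
    have "x \<in> closure \<Omega>" using x by (simp add: frontier_def)
    then obtain K where K: "K \<in> T" "x \<in> elem K" unfolding closure_dom by blast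
    obtain G where G: "G face_of elem K" "x \<in> G" "G \<subseteq> frontier \<Omega>"
      using boundary_face_at[OF K x] by blast
    have "w K x = 0"
    proof (rule zero_on_face[OF p K(1) wQ[OF K(1)] G(1) _ G(2)])
      fix y :: "real^'n" assume y: "y \<in> gnodes p" "emap K y \<in> G"
      then have "emap K y \<in> frontier \<Omega>" using G(3) by blast
      then show "w K (emap K y) = 0" using wq[OF K(1)] q(2)[OF y(1)] by (simp add: nodal_avg_def)
    qed
    then show ?thesis using gw[OF K] by simp
  qed
  ultimately have "w \<in> VC \<Omega> T p"
    unfolding VC_def using wV gw by blast
  moreover have "w K (emap K y) = nodal_avg v (emap K y)" if "K \<in> T" "y \<in> gnodes p" for K y
    using wq[OF that(1)] q(2)[OF that(2)] by simp
  ultimately show ?thesis by blast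
qed

lemma oswald_props:
  assumes p: "p \<ge> 1"
  shows "oswald \<Omega> T p v \<in> VC \<Omega> T p"
    and "K \<in> T \<Longrightarrow> y \<in> gnodes p \<Longrightarrow> oswald \<Omega> T p v K (emap K y) = nodal_avg v (emap K y)"
proof -
  let ?P = "\<lambda>w. w \<in> VC \<Omega> T p \<and> (\<forall>K\<in>T. \<forall>\<xi>\<in>nodes K p. w K \<xi> = nodal_avg v \<xi>)"
  have e: "?P w \<longleftrightarrow> w \<in> VC \<Omega> T p \<and> (\<forall>K\<in>T. \<forall>y\<in>gnodes p. w K (emap K y) = nodal_avg v (emap K y))" for w
    by (simp add: nodes_eq)
  obtain w where w: "?P w" unfolding e using oswald_exists[OF p, of v] by blast
  have "?P (THE w. ?P w)"
  proof (rule theI[of ?P, OF w])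
    fix w' assume w': "?P w'"
    show "w' = w"
    proof (rule Vhp_eqI[OF p])
      show "w' \<in> Vhp T p" "w \<in> Vhp T p" using w w' by (auto simp: VC_def)
      fix K and y :: "real^'n" assume "K \<in> T" "y \<in> gnodes p"
      then show "w' K (emap K y) = w K (emap K y)" using w w' unfolding e by simp
    qed
  qed
  moreover have "oswald \<Omega> T p v = (THE w. ?P w)"
    unfolding oswald_def nodal_avg_def ..
  ultimately have "?P (oswald \<Omega> T p v)" by simp
  then show "oswald \<Omega> T p v \<in> VC \<Omega> T p"
    "K \<in> T \<Longrightarrow> y \<in> gnodes p \<Longrightarrow> oswald \<Omega> T p v K (emap K y) = nodal_avg v (emap K y)"
    unfolding e by blast+
qed

section \<open>Nodal averaging error in terms of jumps\<close>

lemma jump_interior: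
  assumes "K \<in> T" "K' \<in> T" "K \<noteq> K'" "F facet_of elem K" "F \<subseteq> elem K'"
  shows "jump T v F x = (v K x - v K' x) *\<^sub>R onormal K F"
  unfolding jump_def nbrs_interior[OF assms] using assms(3) onormal_opposite[OF assms]
  by (simp add: scaleR_diff_left)

lemma jump_boundary:
  assumes "K \<in> T" "F facet_of elem K" "F \<subseteq> frontier \<Omega>"
  shows "jump T v F x = v K x *\<^sub>R onormal K F"
  unfolding jump_def nbrs_boundary[OF assms] by simp

definition node_jumps :: "'n dgfun \<Rightarrow> real^'n \<Rightarrow> real" where
  "node_jumps v \<xi> = (\<Sum>F\<in>{F\<in>all_faces \<Omega> T. \<xi> \<in> F}. (norm (jump T v F \<xi>))\<^sup>2)"

lemma node_jumps_nonneg: "0 \<le> node_jumps v \<xi>"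
  unfolding node_jumps_def by (intro sum_nonneg) auto

lemma jump_le_node_jumps: "F \<in> all_faces \<Omega> T \<Longrightarrow> \<xi> \<in> F \<Longrightarrow> norm (jump T v F \<xi>) \<le> sqrt (node_jumps v \<xi>)"
  unfolding node_jumps_def using finite_all_faces
  by (intro real_le_rsqrt member_le_sum) auto

lemma adj_diff:
  assumes "(K, K') \<in> adj \<xi>"
  shows "\<bar>v K \<xi> - v K' \<xi>\<bar> \<le> sqrt (node_jumps v \<xi>)"
proof -
  let ?F = "elem K \<inter> elem K'"
  have a: "K \<in> T" "K' \<in> T" "\<xi> \<in> ?F" "K \<noteq> K'" "?F facet_of elem K" using assms by (auto simp: adj_def)
  have "?F \<in> all_faces \<Omega> T" using a by (auto simp: all_faces_def int_faces_def)
  moreover have "norm (jump T v ?F \<xi>) = \<bar>v K \<xi> - v K' \<xi>\<bar>"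
    using jump_interior[OF a(1,2,4,5)] norm_onormal[OF a(1,5)] by simp
  ultimately show ?thesis using jump_le_node_jumps[of ?F \<xi> v] a(3) by simp
qed

text \<open>A chain can be taken with at most as many steps as the relation has pairs, hence at most
  the square of the number of elements at \<xi>, and each step crosses a facet through
  \<xi>.\<close>

lemma adj_path_diff:
  assumes "(K, K') \<in> (adj \<xi>)\<^sup>*"
  shows "\<bar>v K \<xi> - v K' \<xi>\<bar> \<le> patch_bound\<^sup>2 * sqrt (node_jumps v \<xi>)"
proof -
  let ?S = "{K\<in>T. \<xi> \<in> elem K}"
  have sub: "adj \<xi> \<subseteq> ?S \<times> ?S" by (auto simp: adj_def)
  have fS: "finite ?S" using finite_T by simp
  have fin: "finite (adj \<xi>)" by (rule finite_subset[OF sub]) (use fS in simp)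
  have cS: "real (card ?S) \<le> patch_bound"
    by (rule card_patch[where \<xi> = \<xi>]) auto
  have "card (adj \<xi>) \<le> card ?S * card ?S"
    using card_mono[OF _ sub] fS by (simp add: card_cartesian_product)
  then have "real (card (adj \<xi>)) \<le> real (card ?S * card ?S)"
    by (simp only: of_nat_le_iff)
  also have "\<dots> = real (card ?S) * real (card ?S)" by simp
  also have "\<dots> \<le> patch_bound * patch_bound"
    using cS patch_bound_pos by (intro mult_mono cS) simp_all
  finally have cN: "real (card (adj \<xi>)) \<le> patch_bound\<^sup>2" by (simp add: power2_eq_square)
  have step: "\<bar>v K \<xi> - v L \<xi>\<bar> \<le> real n * sqrt (node_jumps v \<xi>)" if "(K, L) \<in> adj \<xi> ^^ n" for n L
    using that
  proof (induction n arbitrary: L)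
    case (Suc n)
    then obtain M where M: "(K, M) \<in> adj \<xi> ^^ n" "(M, L) \<in> adj \<xi>" by auto
    have "\<bar>v K \<xi> - v M \<xi>\<bar> \<le> real n * sqrt (node_jumps v \<xi>)" "\<bar>v M \<xi> - v L \<xi>\<bar> \<le> sqrt (node_jumps v \<xi>)"
      by (rule Suc.IH[OF M(1)], rule adj_diff[OF M(2)])
    then show ?case by (simp add: algebra_simps)
  qed simp
  from assms obtain n where n: "n \<le> card (adj \<xi>)" "(K, K') \<in> adj \<xi> ^^ n"
    unfolding rtrancl_finite_eq_relpow[OF fin] by blast
  have "\<bar>v K \<xi> - v K' \<xi>\<bar> \<le> real n * sqrt (node_jumps v \<xi>)" by (rule step[OF n(2)])
  also have "\<dots> \<le> patch_bound\<^sup>2 * sqrt (node_jumps v \<xi>)"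
  proof (rule mult_right_mono)
    have "real n \<le> real (card (adj \<xi>))" using n(1) by simp
    then show "real n \<le> patch_bound\<^sup>2" using cN by linarith
  qed (simp add: node_jumps_nonneg)
  finally show ?thesis .
qed

text \<open>The summand 1 accounts for the boundary facet at the end of a chain.\<close>

definition nodal_const :: real where "nodal_const = (patch_bound\<^sup>2 + 1)\<^sup>2"

lemma nodal_const_pos: "0 < nodal_const"
proof -
  have "0 < patch_bound\<^sup>2 + 1" by (simp add: add_nonneg_pos)
  then show ?thesis unfolding nodal_const_def by simp
qed

text \<open>Away from the boundary the difference is an average of differences along chains. On the
  boundary, where the nodal value is 0, a chain leads to an element with a boundary facet through
  the node, whose jump is the trace itself.\<close>

lemma nodal_difference:
  assumes K: "K \<in> T" "\<xi> \<in> elem K"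
  shows "(v K \<xi> - nodal_avg v \<xi>)\<^sup>2 \<le> nodal_const * node_jumps v \<xi>"
proof -
  let ?r = "sqrt (node_jumps v \<xi>)"
  have r: "0 \<le> ?r" using node_jumps_nonneg by simp
  have "\<bar>v K \<xi> - nodal_avg v \<xi>\<bar> \<le> (patch_bound\<^sup>2 + 1) * ?r"
  proof (cases "\<xi> \<in> frontier \<Omega>")
    case True
    obtain K1 F where K1: "(K, K1) \<in> (adj \<xi>)\<^sup>*" "K1 \<in> T" "F facet_of elem K1" "F \<subseteq> frontier \<Omega>" "\<xi> \<in> F"
      using adj_connected_boundary[OF True K] by (elim exE conjE)
    have "F \<in> all_faces \<Omega> T" using K1 by (auto simp: all_faces_def bdry_faces_def)
    then have "norm (jump T v F \<xi>) \<le> ?r" using jump_le_node_jumps K1(5) by blast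
    then have "\<bar>v K1 \<xi>\<bar> \<le> ?r"
      using jump_boundary[OF K1(2,3,4)] norm_onormal[OF K1(2,3)] by simp
    then have "\<bar>v K \<xi>\<bar> \<le> patch_bound\<^sup>2 * ?r + ?r"
      using adj_path_diff[OF K1(1), of v] by linarith
    then show ?thesis using True by (simp add: nodal_avg_def algebra_simps)
  next
    case False
    then have \<xi>: "\<xi> \<in> \<Omega>"
      using subsetD[OF elem_sub[OF K(1)] K(2)] open_dom by (simp add: frontier_def interior_open)
    let ?S = "{K\<in>T. \<xi> \<in> elem K}"
    have fS: "finite ?S" using finite_T by simp
    have KS: "K \<in> ?S" using K by simp
    have c: "real (card ?S) > 0" proof -
      have "?S \<noteq> {}" using KS by blast
      then have "card ?S > 0" using fS card_gt_0_iff by blast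
      then show ?thesis by simp
    qed
    have "v K \<xi> - nodal_avg v \<xi> = (\<Sum>L\<in>?S. v K \<xi> - v L \<xi>) / real (card ?S)"
      using False c by (simp add: nodal_avg_def sum_subtractf field_simps)
    also have "\<bar>\<dots>\<bar> \<le> (\<Sum>L\<in>?S. \<bar>v K \<xi> - v L \<xi>\<bar>) / real (card ?S)"
      using c by (simp add: abs_divide divide_right_mono sum_abs)
    also have "\<dots> \<le> (\<Sum>L\<in>?S. patch_bound\<^sup>2 * ?r) / real (card ?S)"
      using adj_path_diff adj_connected_interior[OF \<xi> K] c
      by (intro divide_right_mono sum_mono) auto
    also have "\<dots> = patch_bound\<^sup>2 * ?r" using c by simp
    also have "\<dots> \<le> (patch_bound\<^sup>2 + 1) * ?r" using r by (simp add: algebra_simps)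
    finally show ?thesis .
  qed
  then have "\<bar>v K \<xi> - nodal_avg v \<xi>\<bar>\<^sup>2 \<le> ((patch_bound\<^sup>2 + 1) * ?r)\<^sup>2"
    by (intro power_mono) auto
  then show ?thesis
    using node_jumps_nonneg[of v \<xi>] by (simp add: nodal_const_def power_mult_distrib)
qed


section \<open>Broken polynomial fields, volume integrals and gradients\<close>

lemma VhpVec_comp: "f \<in> VhpVec T p \<Longrightarrow> K \<in> T \<Longrightarrow> (\<lambda>y. f K (emap K y) $ i) \<in> Qp_ref p"
  unfolding VhpVec_def using Vhp_comp[of "\<lambda>K x. f K x $ i" p K] by simp

lemma VhpVec_outside: "f \<in> VhpVec T p \<Longrightarrow> K \<notin> T \<Longrightarrow> f K x = 0"
proof -
  assume f: "f \<in> VhpVec T p" and K: "K \<notin> T"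
  have "(\<lambda>x. f K x $ i) = (\<lambda>_. 0)" for i
    using f Vhp_outside[of "\<lambda>K x. f K x $ i" p K] K unfolding VhpVec_def by simp
  then have "f K x $ i = 0" for i using fun_cong[of "\<lambda>x. f K x $ i" "\<lambda>_. 0" x] by simp
  then show ?thesis by (simp add: vec_eq_iff)
qed

lemma VhpI:
  "(\<And>K. K \<in> T \<Longrightarrow> (\<lambda>y. v K (emap K y)) \<in> Qp_ref p) \<Longrightarrow> (\<And>K x. K \<notin> T \<Longrightarrow> v K x = 0) \<Longrightarrow> v \<in> Vhp T p"
  unfolding Vhp_def o_def by blast

lemma VhpVecI:
  assumes "\<And>K i. K \<in> T \<Longrightarrow> (\<lambda>y. f K (emap K y) $ i) \<in> Qp_ref p" "\<And>K x. K \<notin> T \<Longrightarrow> f K x = 0"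
  shows "f \<in> VhpVec T p"
  unfolding VhpVec_def by (intro CollectI allI VhpI) (simp_all add: assms)

lemma VhpVec_add: "f \<in> VhpVec T p \<Longrightarrow> g \<in> VhpVec T p \<Longrightarrow> (\<lambda>K x. f K x + g K x) \<in> VhpVec T p"
  by (rule VhpVecI) (simp_all add: VhpVec_comp VhpVec_outside Qp_ref_add)

lemma VhpVec_scale: "f \<in> VhpVec T p \<Longrightarrow> (\<lambda>K x. c *\<^sub>R f K x) \<in> VhpVec T p"
  by (rule VhpVecI) (simp_all add: VhpVec_comp VhpVec_outside Qp_ref_cmult)

lemma VhpVec_sum: "(\<And>s. s \<in> S \<Longrightarrow> f s \<in> VhpVec T p) \<Longrightarrow> (\<lambda>K x. \<Sum>s\<in>S. f s K x) \<in> VhpVec T p"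
proof (rule VhpVecI)
  fix K i assume f: "\<And>s. s \<in> S \<Longrightarrow> f s \<in> VhpVec T p" and K: "K \<in> T"
  show "(\<lambda>y. (\<Sum>s\<in>S. f s K (emap K y)) $ i) \<in> Qp_ref p"
    unfolding sum_component by (rule Qp_ref_sum) (rule VhpVec_comp[OF f K])
next
  fix K x assume f: "\<And>s. s \<in> S \<Longrightarrow> f s \<in> VhpVec T p" and K: "K \<notin> T"
  show "(\<Sum>s\<in>S. f s K x) = 0"
    by (rule sum.neutral) (simp add: VhpVec_outside[OF f K])
qed

definition ref_inner :: "'n elt \<Rightarrow> 'n dgvec \<Rightarrow> 'n dgvec \<Rightarrow> real" where
  "ref_inner K f g = integral ref_cube (\<lambda>y. f K (emap K y) \<bullet> g K (emap K y))"

lemma ref_inner_poly: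
  "f \<in> VhpVec T p \<Longrightarrow> g \<in> VhpVec T p \<Longrightarrow> K \<in> T \<Longrightarrow> (\<lambda>y. f K (emap K y) \<bullet> g K (emap K y)) \<in> Qp_ref (p + p)"
  unfolding inner_vec_def inner_real_def by (intro Qp_ref_sum Qp_ref_mult VhpVec_comp)

lemma vol_int_ref:
  assumes f: "f \<in> VhpVec T p" and g: "g \<in> VhpVec T p"
  shows "vol_int T f g = (\<Sum>K\<in>T. cvol K * ref_inner K f g)"
  unfolding vol_int_def
proof (rule sum.cong[OF refl])
  fix K assume K: "K \<in> T"
  have "continuous_on UNIV (\<lambda>x. (\<lambda>y. f K (emap K y) \<bullet> g K (emap K y)) (einv K x))"
    by (rule continuous_on_compose2[OF Qp_ref_continuous[OF ref_inner_poly[OF f g K]] einv_continuous]) auto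
  then have "continuous_on UNIV (\<lambda>x. f K x \<bullet> g K x)" by (simp add: emap_einv[OF inv[OF K]])
  from integral_unique[OF cvol(4)[OF K this]]
  show "integral (elem K) (\<lambda>x. inner (f K x) (g K x)) = cvol K * ref_inner K f g"
    by (simp add: ref_inner_def)
qed

lemma vol_int_sym: "vol_int T f g = vol_int T g f"
  by (simp add: vol_int_def inner_commute)

lemma vol_int_add:
  assumes f: "f \<in> VhpVec T p" and g: "g \<in> VhpVec T p" and h: "h \<in> VhpVec T p"
  shows "vol_int T (\<lambda>K x. f K x + g K x) h = vol_int T f h + vol_int T g h"
proof -
  have "ref_inner K (\<lambda>K x. f K x + g K x) h = ref_inner K f h + ref_inner K g h" if K: "K \<in> T" for K
    unfolding ref_inner_def inner_add_left
    by (rule integral_add[OF Qp_ref_integrable[OF ref_inner_poly[OF f h K]] Qp_ref_integrable[OF ref_inner_poly[OF g h K]]])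
  then show ?thesis
    by (simp add: vol_int_ref[OF f h] vol_int_ref[OF g h] vol_int_ref[OF VhpVec_add[OF f g] h]
        distrib_left sum.distrib)
qed

lemma vol_int_scale: "vol_int T (\<lambda>K x. c *\<^sub>R f K x) h = c * vol_int T f h"
  by (simp add: vol_int_def sum_distrib_left)

lemma vol_int_nonneg: "f \<in> VhpVec T p \<Longrightarrow> 0 \<le> vol_int T f f"
proof -
  assume f: "f \<in> VhpVec T p"
  have "0 \<le> ref_inner K f f" if K: "K \<in> T" for K
    unfolding ref_inner_def by (rule integral_nonneg[OF Qp_ref_integrable[OF ref_inner_poly[OF f f K]]]) simp
  then show ?thesis
    unfolding vol_int_ref[OF f f] using cvol(1) by (intro sum_nonneg mult_nonneg_nonneg) (simp_all add: less_imp_le)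
qed

text \<open>The squared norms of f + 2g and f - 2g are nonnegative. The weights are such that, with
  f the gradient, half of the gradient energy survives in the SIPG coercivity estimate.\<close>

lemma vol_int_young:
  assumes f: "f \<in> VhpVec T p" and g: "g \<in> VhpVec T p"
  shows "2 * \<bar>vol_int T f g\<bar> \<le> vol_int T f f / 2 + 2 * vol_int T g g"
proof -
  have e: "vol_int T (\<lambda>K x. f K x + c *\<^sub>R g K x) (\<lambda>K x. f K x + c *\<^sub>R g K x)
      = vol_int T f f + 2 * c * vol_int T f g + c\<^sup>2 * vol_int T g g" for c
  proof -
    let ?h = "\<lambda>K x. f K x + c *\<^sub>R g K x"
    have h: "?h \<in> VhpVec T p" by (intro VhpVec_add VhpVec_scale f g)
    have a: "vol_int T k ?h = vol_int T k f + c * vol_int T k g" if k: "k \<in> VhpVec T p" for k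
      unfolding vol_int_sym[of k] vol_int_add[OF f VhpVec_scale[OF g] k] vol_int_scale ..
    have "vol_int T ?h ?h = vol_int T f ?h + c * vol_int T g ?h"
      unfolding vol_int_add[OF f VhpVec_scale[OF g] h] vol_int_scale ..
    then show ?thesis
      unfolding a[OF f] a[OF g] vol_int_sym[of g f] by (simp add: algebra_simps power2_eq_square)
  qed
  have "0 \<le> vol_int T f f + 2 * 2 * vol_int T f g + 2\<^sup>2 * vol_int T g g"
    unfolding e[symmetric] by (rule vol_int_nonneg[OF VhpVec_add[OF f VhpVec_scale[OF g]]])
  moreover have "0 \<le> vol_int T f f + 2 * (-2) * vol_int T f g + (-2)\<^sup>2 * vol_int T g g"
    unfolding e[symmetric] by (rule vol_int_nonneg[OF VhpVec_add[OF f VhpVec_scale[OF g]]])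
  ultimately show ?thesis by simp
qed

lemma vol_int_add_square:
  assumes f: "f \<in> VhpVec T p" and g: "g \<in> VhpVec T p"
  shows "vol_int T (\<lambda>K x. f K x + g K x) (\<lambda>K x. f K x + g K x) = vol_int T f f + 2 * vol_int T f g + vol_int T g g"
proof -
  have h: "(\<lambda>K x. f K x + g K x) \<in> VhpVec T p" by (rule VhpVec_add[OF f g])
  show ?thesis
    unfolding vol_int_add[OF f g h] vol_int_sym[of f "\<lambda>K x. f K x + g K x"] vol_int_sym[of g "\<lambda>K x. f K x + g K x"]
      vol_int_add[OF f g f] vol_int_add[OF f g g] vol_int_sym[of g f] by simp
qed

lemma einv_has_derivative: "(einv K has_derivative (\<lambda>h. matrix_inv (fst K) *v h)) (at x)"
proof -
  have "bounded_linear ((*v) (matrix_inv (fst K)))" by (rule matrix_vector_mul_bounded_linear)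
  moreover have "((\<lambda>x. x - snd K) has_derivative (\<lambda>h. h)) (at x)"
    by (auto intro!: derivative_eq_intros)
  ultimately show ?thesis unfolding einv_def by (rule bounded_linear.has_derivative)
qed

lemma grad_eq:
  assumes u: "u \<in> Vhp T p" and K: "K \<in> T"
  obtains dq where "\<And>j. dq j \<in> Qp_ref p"
    "\<And>x. ((\<lambda>y. u K (emap K y)) has_derivative (\<lambda>h. \<Sum>j\<in>UNIV. dq j x * h $ j)) (at x)"
    "\<And>x. (u K has_derivative (\<lambda>h. \<Sum>j\<in>UNIV. dq j (einv K x) * (matrix_inv (fst K) *v h) $ j)) (at x)"
    "\<And>y i. grad (u K) (emap K y) $ i = (\<Sum>j\<in>UNIV. dq j y * matrix_inv (fst K) $ j $ i)"
proof -
  obtain dq where dq: "\<forall>j. dq j \<in> Qp_ref p"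
    "\<forall>x. ((\<lambda>y. u K (emap K y)) has_derivative (\<lambda>h. \<Sum>j\<in>UNIV. dq j x * h $ j)) (at x)"
    using Qp_ref_has_derivative[OF Vhp_comp[OF u K]] by (elim exE conjE)
  have d: "(u K has_derivative (\<lambda>h. \<Sum>j\<in>UNIV. dq j (einv K x) * (matrix_inv (fst K) *v h) $ j)) (at x)" for x
    using has_derivative_compose[OF einv_has_derivative spec[OF dq(2)], of K x]
    by (simp add: emap_einv[OF inv[OF K]])
  have "grad (u K) (emap K y) $ i = (\<Sum>j\<in>UNIV. dq j y * matrix_inv (fst K) $ j $ i)" for y i
  proof -
    have "grad (u K) (emap K y) $ i = (\<Sum>j\<in>UNIV. dq j (einv K (emap K y)) * (matrix_inv (fst K) *v axis i 1) $ j)"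
      unfolding grad_def by (simp add: frechet_derivative_at[OF d[of "emap K y"], symmetric])
    then show ?thesis
      by (simp add: einv_emap[OF inv[OF K]] matrix_vector_mult_basis column_def)
  qed
  then show thesis using that[of dq] dq d by simp
qed

lemma grad_zero: "grad (\<lambda>_. 0) x = 0"
  by (simp add: grad_def vec_eq_iff frechet_derivative_const)

lemma grad_VhpVec:
  assumes u: "u \<in> Vhp T p"
  shows "(\<lambda>K. grad (u K)) \<in> VhpVec T p"
proof (rule VhpVecI)
  fix K i assume K: "K \<in> T"
  obtain dq where dq: "\<And>j. dq j \<in> Qp_ref p"
    "\<And>y i. grad (u K) (emap K y) $ i = (\<Sum>j\<in>UNIV. dq j y * matrix_inv (fst K) $ j $ i)"
    by (rule grad_eq[OF u K]) (rule that)
  show "(\<lambda>y. grad (u K) (emap K y) $ i) \<in> Qp_ref p"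
  proof -
    have "(\<lambda>y. dq j y * matrix_inv (fst K) $ j $ i) \<in> Qp_ref p" for j
      using Qp_ref_cmult[OF dq(1)[of j], of "matrix_inv (fst K) $ j $ i"] by (simp add: mult.commute)
    then show ?thesis unfolding dq(2) by (rule Qp_ref_sum)
  qed
next
  fix K x assume "K \<notin> T"
  then show "grad (u K) x = 0" using Vhp_outside[OF u] grad_zero by simp
qed

lemma dgsub_Vhp: "u \<in> Vhp T p \<Longrightarrow> w \<in> Vhp T p \<Longrightarrow> dgsub u w \<in> Vhp T p"
  unfolding dgsub_def by (rule VhpI) (simp_all add: Vhp_comp Vhp_outside Qp_ref_diff)

lemma grad_dgsub:
  assumes u: "u \<in> Vhp T p" and w: "w \<in> Vhp T p"
  shows "grad (dgsub u w K) x = grad (u K) x - grad (w K) x"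
proof (cases "K \<in> T")
  case True
  obtain du where du: "(u K has_derivative du) (at x)" by (rule grad_eq[OF u True]) (rule that)
  obtain dw where dw: "(w K has_derivative dw) (at x)" by (rule grad_eq[OF w True]) (rule that)
  have "(dgsub u w K has_derivative (\<lambda>h. du h - dw h)) (at x)"
    unfolding dgsub_def by (rule has_derivative_diff[OF du dw])
  then show ?thesis
    unfolding grad_def by (simp add: frechet_derivative_at[OF du, symmetric] frechet_derivative_at[OF dw, symmetric]
        frechet_derivative_at[symmetric] vec_eq_iff)
next
  case False
  then show ?thesis
    using Vhp_outside[OF u False] Vhp_outside[OF w False] Vhp_outside[OF dgsub_Vhp[OF u w] False] by (simp add: grad_zero)
qed

text \<open>The 4 comes from the inverse inequality on the cube; the three factors of the dimension
  come from Cauchy-Schwarz over reference directions and from the sums over physical and reference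
  directions.\<close>

definition grad_const :: real where "grad_const = 4 * real CARD('n) ^ 3 * cond_bound\<^sup>2"

lemma grad_const_pos: "0 < grad_const" using cond_bound_pos by (simp add: grad_const_def)

lemma grad_inverse:
  assumes u: "u \<in> Vhp T p" and K: "K \<in> T" and p: "p \<ge> 1"
  shows "ref_inner K (\<lambda>K. grad (u K)) (\<lambda>K. grad (u K)) \<le> grad_const * (real p ^ 4 / mesh_size\<^sup>2) * integral ref_cube (\<lambda>y. (u K (emap K y))\<^sup>2)"
proof -
  obtain dq where dq: "\<And>j. dq j \<in> Qp_ref p"
    "\<And>x. ((\<lambda>y. u K (emap K y)) has_derivative (\<lambda>h. \<Sum>j\<in>UNIV. dq j x * h $ j)) (at x)"
    "\<And>y i. grad (u K) (emap K y) $ i = (\<Sum>j\<in>UNIV. dq j y * matrix_inv (fst K) $ j $ i)"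
    by (rule grad_eq[OF u K]) (rule that)
  let ?d = "real CARD('n)"
  let ?g = "\<lambda>y. grad (u K) (emap K y)"
  have sq: "(\<lambda>y. (dq j y)\<^sup>2) \<in> Qp_ref (p + p)" for j
    unfolding power2_eq_square by (rule Qp_ref_mult[OF dq(1) dq(1)])
  have bd: "?g y \<bullet> ?g y \<le> (?d\<^sup>2 * (cond_bound / mesh_size)\<^sup>2) * (\<Sum>j\<in>UNIV. (dq j y)\<^sup>2)" for y
  proof -
    have "(?g y $ i)\<^sup>2 \<le> (?d * (cond_bound / mesh_size)\<^sup>2) * (\<Sum>j\<in>UNIV. (dq j y)\<^sup>2)" for i
    proof -
      have "(?g y $ i)\<^sup>2 \<le> (\<Sum>j\<in>UNIV. (dq j y)\<^sup>2) * (\<Sum>j\<in>UNIV. (matrix_inv (fst K) $ j $ i)\<^sup>2)"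
        unfolding dq(3) by (rule Cauchy_Schwarz_ineq_sum)
      also have "\<dots> \<le> (\<Sum>j\<in>UNIV. (dq j y)\<^sup>2) * (\<Sum>j\<in>(UNIV::'n set). (cond_bound / mesh_size)\<^sup>2)"
      proof (intro mult_left_mono sum_mono)
        fix j
        show "(matrix_inv (fst K) $ j $ i)\<^sup>2 \<le> (cond_bound / mesh_size)\<^sup>2"
          using power_mono[OF inverse_entry(1)[OF K, of j i], of 2] by simp
      qed (simp add: sum_nonneg)
      finally show ?thesis by (simp add: mult_ac)
    qed
    then have "(\<Sum>i\<in>UNIV. (?g y $ i)\<^sup>2) \<le> (\<Sum>i\<in>(UNIV::'n set). (?d * (cond_bound / mesh_size)\<^sup>2) * (\<Sum>j\<in>UNIV. (dq j y)\<^sup>2))"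
      by (intro sum_mono)
    then show ?thesis by (simp add: inner_vec_def power2_eq_square mult_ac)
  qed
  have "ref_inner K (\<lambda>K. grad (u K)) (\<lambda>K. grad (u K)) \<le> integral ref_cube (\<lambda>y. (?d\<^sup>2 * (cond_bound / mesh_size)\<^sup>2) * (\<Sum>j\<in>UNIV. (dq j y)\<^sup>2))"
    unfolding ref_inner_def
    by (rule integral_le)
       (use bd in \<open>auto intro!: Qp_ref_integrable[OF ref_inner_poly[OF grad_VhpVec[OF u] grad_VhpVec[OF u] K]]
          Qp_ref_integrable[OF Qp_ref_cmult[OF Qp_ref_sum[OF sq]]]\<close>)
  also have "\<dots> = (?d\<^sup>2 * (cond_bound / mesh_size)\<^sup>2) * (\<Sum>j\<in>UNIV. integral ref_cube (\<lambda>y. (dq j y)\<^sup>2))"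
    by (simp add: integral_sum Qp_ref_integrable[OF sq])
  also have "\<dots> \<le> (?d\<^sup>2 * (cond_bound / mesh_size)\<^sup>2) * (\<Sum>j\<in>(UNIV::'n set). 4 * real p ^ 4 * integral ref_cube (\<lambda>y. (u K (emap K y))\<^sup>2))"
    by (intro mult_left_mono sum_mono inverse_ineq_cube[OF Vhp_comp[OF u K] p dq(1) dq(2)]) simp
  also have "\<dots> = grad_const * (real p ^ 4 / mesh_size\<^sup>2) * integral ref_cube (\<lambda>y. (u K (emap K y))\<^sup>2)"
    by (simp add: grad_const_def power_divide power2_eq_square power3_eq_cube)
  finally show ?thesis .
qed

section \<open>Jump energy of faces and gradient energy of the averaging error\<close>

definition jump_energy :: "'n dgfun \<Rightarrow> (real^'n) set \<Rightarrow> real" where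
  "jump_energy v F = face_integral T F (\<lambda>x. jump T v F x \<bullet> jump T v F x)"

lemma jump_poly:
  assumes F: "F \<in> all_faces \<Omega> T" and K: "K \<in> nbrs T F" and s: "s = 1 \<or> s = -1"
    and FK: "F = emap K ` cface {j} (\<lambda>_. s)" and v: "v \<in> Vhp T p"
  shows "(\<lambda>y. jump T v F (emap K (upd j s y)) $ i) \<in> Qp_ref p"
proof -
  have "(\<lambda>y. \<Sum>L\<in>nbrs T F. (onormal L F $ i) * v L (emap K (upd j s y))) \<in> Qp_ref p"
    using trace_face(1)[OF F K _ s FK Vhp_comp[OF v facet_of_nbr(1)[OF F]]]
    by (intro Qp_ref_sum Qp_ref_cmult)
  then show ?thesis by (simp add: jump_def mult.commute)
qed

text \<open>A node of a facet can belong to many elements, also to ones meeting the facet only in an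
  edge or a vertex, and the sum over \<open>T\<close> counts it once for each.
  \<open>node_transfer\<close> identifies these copies with equal weight and
  \<open>card_patch\<close> bounds their number.\<close>

lemma face_nodes_sum:
  assumes p: "p \<ge> 1" and F: "F \<in> all_faces \<Omega> T" and K0: "K0 \<in> nbrs T F" and s: "s = 1 \<or> s = -1"
    and FK: "F = emap K0 ` cface {j} (\<lambda>_. s)" and nn: "\<And>x. 0 \<le> \<phi> x"
  shows "(\<Sum>K\<in>T. \<Sum>y\<in>{y\<in>gnodes p. emap K y \<in> F}. node_weight p y * \<phi> (emap K y))
     \<le> patch_bound * (\<Sum>y\<in>{y\<in>gnodes p. y $ j = s}. node_weight p y * \<phi> (emap K0 y))"
proof -
  note KT = facet_of_nbr(1)[OF F K0]
  have Fsub: "F \<subseteq> elem K0" by (rule facet_of_imp_subset[OF facet_of_nbr(2)[OF F K0]])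
  have inF: "emap K0 y \<in> F \<longleftrightarrow> y \<in> ref_cube \<and> y $ j = s" for y
    unfolding FK by (auto simp: cface_def emap_eq_iff[OF inv[OF KT]])
  let ?N = "{y\<in>gnodes p. y $ j = s} :: (real^'n) set"
  have fN: "finite ?N" by (rule finite_subset[OF _ finite_gnodes[OF p]]) auto
  have per: "(\<Sum>y\<in>{y\<in>gnodes p. emap K y \<in> F}. node_weight p y * \<phi> (emap K y))
      = (\<Sum>y\<in>?N. if emap K0 y \<in> elem K then node_weight p y * \<phi> (emap K0 y) else 0)" if K: "K \<in> T" for K
  proof -
    have "(\<Sum>y\<in>{y\<in>gnodes p. emap K y \<in> F}. node_weight p y * \<phi> (emap K y))
      = (\<Sum>y\<in>{y\<in>?N. emap K0 y \<in> elem K}. node_weight p y * \<phi> (emap K0 y))"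
    \<comment> \<open>The witnesses re-express a node of \<open>K\<close> on the facet in the
      coordinates of \<open>K0\<close>, and back.\<close>
    proof (rule sum.reindex_bij_witness[where i = "\<lambda>z. einv K (emap K0 z)" and j = "\<lambda>y. einv K0 (emap K y)"])
      fix y assume y: "y \<in> {y\<in>gnodes p. emap K y \<in> F}"
      then have yg: "y \<in> gnodes p" and yF: "emap K y \<in> F" by auto
      have y0: "emap K y \<in> elem K0" using yF Fsub by blast
      obtain z where z: "z \<in> gnodes p" "emap K y = emap K0 z" "node_weight p z = node_weight p y"
        using node_transfer[OF p K KT yg y0] by (elim bexE conjE)
      have zz: "einv K0 (emap K y) = z" using z(2) einv_emap[OF inv[OF KT]] by simp
      show "einv K (emap K0 (einv K0 (emap K y))) = y"
        using zz z(2) einv_emap[OF inv[OF K], of y] by simp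
      have "z $ j = s" using yF inF[of z] z(2) by simp
      moreover have "emap K0 z \<in> elem K" using gnodes_cube[OF yg] z(2)[symmetric] by (simp add: elem_def)
      ultimately show "einv K0 (emap K y) \<in> {y\<in>?N. emap K0 y \<in> elem K}"
        unfolding zz using z(1) by simp
      show "node_weight p (einv K0 (emap K y)) * \<phi> (emap K0 (einv K0 (emap K y))) = node_weight p y * \<phi> (emap K y)"
        unfolding zz using z(2,3) by simp
    next
      fix z assume z: "z \<in> {y\<in>?N. emap K0 y \<in> elem K}"
      then have zg: "z \<in> gnodes p" "z $ j = s" "emap K0 z \<in> elem K" by auto
      obtain y where y: "y \<in> gnodes p" "emap K0 z = emap K y"
        using node_transfer[OF p KT K zg(1,3)] by (elim bexE conjE)
      have yy: "einv K (emap K0 z) = y" using y(2) einv_emap[OF inv[OF K]] by simp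
      show "einv K0 (emap K (einv K (emap K0 z))) = z"
        using yy y(2) einv_emap[OF inv[OF KT], of z] by simp
      have "emap K y \<in> F" using inF[of z] zg gnodes_cube[OF zg(1)] y(2) by simp
      then show "einv K (emap K0 z) \<in> {y\<in>gnodes p. emap K y \<in> F}"
        unfolding yy using y(1) by simp
    qed
    also have "\<dots> = (\<Sum>y\<in>?N. if emap K0 y \<in> elem K then node_weight p y * \<phi> (emap K0 y) else 0)"
      by (rule sum.inter_filter[OF fN])
    finally show ?thesis .
  qed
  have "(\<Sum>K\<in>T. \<Sum>y\<in>{y\<in>gnodes p. emap K y \<in> F}. node_weight p y * \<phi> (emap K y))
      = (\<Sum>K\<in>T. \<Sum>y\<in>?N. if emap K0 y \<in> elem K then node_weight p y * \<phi> (emap K0 y) else 0)"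
    by (rule sum.cong[OF refl per])
  also have "\<dots> = (\<Sum>y\<in>?N. \<Sum>K\<in>T. if emap K0 y \<in> elem K then node_weight p y * \<phi> (emap K0 y) else 0)"
    by (rule sum.swap)
  also have "\<dots> = (\<Sum>y\<in>?N. real (card {K\<in>T. emap K0 y \<in> elem K}) * (node_weight p y * \<phi> (emap K0 y)))"
    by (intro sum.cong refl) (simp add: sum.inter_filter[OF finite_T, symmetric])
  also have "\<dots> \<le> (\<Sum>y\<in>?N. patch_bound * (node_weight p y * \<phi> (emap K0 y)))"
  proof (intro sum_mono mult_right_mono)
    fix y assume y: "y \<in> ?N"
    show "real (card {K\<in>T. emap K0 y \<in> elem K}) \<le> patch_bound"
      by (rule card_patch[where \<xi> = "emap K0 y"]) auto
    show "0 \<le> node_weight p y * \<phi> (emap K0 y)"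
      using y node_weight_pos[OF p, of y] nn[of "emap K0 y"] by (intro mult_nonneg_nonneg) auto
  qed
  finally show ?thesis by (simp add: sum_distrib_left)
qed

definition face_scale_const :: real where "face_scale_const = det_bound * patch_bound * face_const"

lemma face_scale_const_pos: "0 < face_scale_const" using det_bound_pos patch_bound_pos face_const_pos by (simp add: face_scale_const_def)

text \<open>The prefactor on the left is the upper bound for \<open>cvol\<close>. It is at most a
  constant times \<open>area K j\<close> times the mesh size, which yields the factor h;
  \<open>face_quad_bound\<close> yields 1/p^2.\<close>

lemma face_energy:
  assumes p: "p \<ge> 1" and F: "F \<in> all_faces \<Omega> T" and v: "v \<in> Vhp T p"
  shows "(det_bound * mesh_size ^ CARD('n)) * (\<Sum>K\<in>T. \<Sum>y\<in>{y\<in>gnodes p. emap K y \<in> F}. node_weight p y * (norm (jump T v F (emap K y)))\<^sup>2)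
     \<le> (face_scale_const * patch_bound * 2 * 3 ^ CARD('n)) * (mesh_size / (real p)\<^sup>2) * jump_energy v F"
    and "0 \<le> jump_energy v F"
proof -
  obtain K j s where r: "K \<in> nbrs T F" "s = 1 \<or> s = -1" "F = emap K ` cface {j} (\<lambda>_. s)"
     "\<forall>g. face_integral T F g = area K j * integral ref_cube (\<lambda>y. g (emap K (upd j s y)))"
    using face_rep[OF F] by (elim exE conjE)
  note KT = facet_of_nbr(1)[OF F r(1)]
  let ?f = "\<lambda>i y. jump T v F (emap K y) $ i"
  let ?I = "integral ref_cube (\<lambda>y. jump T v F (emap K (upd j s y)) \<bullet> jump T v F (emap K (upd j s y)))"
  have poly: "(\<lambda>y. ?f i (upd j s y)) \<in> Qp_ref p" for i by (rule jump_poly[OF F r(1,2,3) v])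
  have sq: "(\<lambda>y. (?f i (upd j s y))\<^sup>2) integrable_on ref_cube" for i
    unfolding power2_eq_square by (rule Qp_ref_integrable[OF Qp_ref_mult[OF poly poly]])
  have jump_energy: "jump_energy v F = area K j * ?I" unfolding jump_energy_def r(4)[rule_format] ..
  have I: "?I = (\<Sum>i\<in>UNIV. integral ref_cube (\<lambda>y. (?f i (upd j s y))\<^sup>2))"
    unfolding inner_vec_def inner_real_def power2_eq_square[symmetric]
    by (rule integral_sum) (auto intro: sq)
  have I0: "0 \<le> ?I"
    unfolding I by (intro sum_nonneg integral_nonneg sq) auto
  have ap: "0 < area K j" by (rule area_bounds(3)[OF KT KT])
  show "0 \<le> jump_energy v F" unfolding jump_energy using I0 ap by simp
  have nsq: "(norm w)\<^sup>2 = (\<Sum>i\<in>UNIV. (w $ i)\<^sup>2)" for w :: "real^'n"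
    unfolding power2_norm_eq_inner inner_vec_def by (simp add: power2_eq_square)
  have "(\<Sum>y\<in>{y\<in>gnodes p. y $ j = s}. node_weight p y * (norm (jump T v F (emap K y)))\<^sup>2)
     = (\<Sum>i\<in>UNIV. \<Sum>y\<in>{y\<in>gnodes p. y $ j = s}. node_weight p y * (?f i y)\<^sup>2)"
    unfolding nsq sum_distrib_left by (rule sum.swap)
  also have "\<dots> \<le> (\<Sum>i\<in>UNIV. 2 * 3 ^ CARD('n) / (real p)\<^sup>2 * integral ref_cube (\<lambda>y. (?f i (upd j s y))\<^sup>2))"
    by (intro sum_mono face_quad_bound[OF p r(2) poly])
  also have "\<dots> = 2 * 3 ^ CARD('n) / (real p)\<^sup>2 * ?I"
    unfolding I sum_distrib_left ..
  finally have q: "(\<Sum>y\<in>{y\<in>gnodes p. y $ j = s}. node_weight p y * (norm (jump T v F (emap K y)))\<^sup>2)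
     \<le> 2 * 3 ^ CARD('n) / (real p)\<^sup>2 * ?I" .
  have "(\<Sum>K\<in>T. \<Sum>y\<in>{y\<in>gnodes p. emap K y \<in> F}. node_weight p y * (norm (jump T v F (emap K y)))\<^sup>2)
     \<le> patch_bound * (2 * 3 ^ CARD('n) / (real p)\<^sup>2 * ?I)"
    by (rule order.trans[OF face_nodes_sum[OF p F r(1,2,3), of "\<lambda>x. (norm (jump T v F x))\<^sup>2"] mult_left_mono[OF q]])
       (use patch_bound_pos in auto)
  moreover have "det_bound * mesh_size ^ CARD('n) \<le> face_scale_const * (area K j * mesh_size)"
  proof -
    have "det_bound * mesh_size ^ CARD('n) \<le> det_bound * (cvol K * patch_bound)"
      using cvol(3)[OF KT] det_bound_pos by (simp add: patch_bound_def)
    also have "\<dots> \<le> det_bound * (face_const * (area K j * mesh_size) * patch_bound)"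
      using area_bounds(2)[OF KT KT, of j] det_bound_pos patch_bound_pos by (intro mult_left_mono mult_right_mono) auto
    finally show ?thesis by (simp add: face_scale_const_def mult_ac)
  qed
  ultimately have "(det_bound * mesh_size ^ CARD('n)) * (\<Sum>K\<in>T. \<Sum>y\<in>{y\<in>gnodes p. emap K y \<in> F}. node_weight p y * (norm (jump T v F (emap K y)))\<^sup>2)
     \<le> (face_scale_const * (area K j * mesh_size)) * (patch_bound * (2 * 3 ^ CARD('n) / (real p)\<^sup>2 * ?I))"
    using face_scale_const_pos ap mesh_size_pos
    by (intro mult_mono'[where c = "\<Sum>K\<in>T. _ K"])
       (auto simp: det_bound_pos less_imp_le intro!: sum_nonneg mult_nonneg_nonneg less_imp_le[OF node_weight_pos[OF p]])
  then show "(det_bound * mesh_size ^ CARD('n)) * (\<Sum>K\<in>T. \<Sum>y\<in>{y\<in>gnodes p. emap K y \<in> F}. node_weight p y * (norm (jump T v F (emap K y)))\<^sup>2)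
     \<le> (face_scale_const * patch_bound * 2 * 3 ^ CARD('n)) * (mesh_size / (real p)\<^sup>2) * jump_energy v F"
    unfolding jump_energy by (simp add: mult_ac)
qed

definition oswald_const :: real where "oswald_const = grad_const * nodal_const * (face_scale_const * patch_bound * 2 * 3 ^ CARD('n))"

lemma oswald_const_pos: "0 < oswald_const" using grad_const_pos nodal_const_pos face_scale_const_pos patch_bound_pos by (simp add: oswald_const_def)

text \<open>Free of \<alpha>, unlike \<open>penalty\<close>, and weighted with the global mesh size.
  Averaging error and liftings are bounded by this quantity, so \<alpha> enters only through the
  comparison in \<open>penalty_lower\<close>.\<close>

definition scaled_jumps :: "nat \<Rightarrow> 'n dgfun \<Rightarrow> real" where
  "scaled_jumps p v = (real p)\<^sup>2 / mesh_size * (\<Sum>F\<in>all_faces \<Omega> T. jump_energy v F)"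

definition grad_energy :: "'n dgfun \<Rightarrow> real" where
  "grad_energy u = vol_int T (\<lambda>K. grad (u K)) (\<lambda>K. grad (u K))"

lemma oswald_energy:
  assumes p: "p \<ge> 1" and v: "v \<in> Vhp T p"
  shows "grad_energy (dgsub v (oswald \<Omega> T p v)) \<le> oswald_const * scaled_jumps p v"
proof -
  let ?w = "dgsub v (oswald \<Omega> T p v)"
  have Q: "oswald \<Omega> T p v \<in> Vhp T p" using oswald_props(1)[OF p] by (simp add: VC_def)
  have w: "?w \<in> Vhp T p" by (rule dgsub_Vhp[OF v Q])
  let ?c = "det_bound * mesh_size ^ CARD('n)" and ?g = "grad_const * (real p ^ 4 / mesh_size\<^sup>2)"
  have pull: "(\<Sum>K\<in>T. a * (b * (\<Sum>y\<in>N. f y * (B * s K y)))) = b * B * (a * (\<Sum>K\<in>T. \<Sum>y\<in>N. f y * s K y))"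
    for a b B :: real and f :: "real^'n \<Rightarrow> real" and s N
    by (simp add: sum_distrib_left mult_ac)
  have c0: "0 \<le> ?c" and g0: "0 \<le> ?g" using det_bound_pos mesh_size_pos grad_const_pos by simp_all
  have "grad_energy ?w = (\<Sum>K\<in>T. cvol K * ref_inner K (\<lambda>K. grad (?w K)) (\<lambda>K. grad (?w K)))"
    unfolding grad_energy_def by (rule vol_int_ref[OF grad_VhpVec[OF w] grad_VhpVec[OF w]])
  \<comment> \<open>Replacing \<open>cvol\<close> by an upper bound common to all elements lets this
    factor leave the sum.\<close>
  also have "\<dots> \<le> (\<Sum>K\<in>T. ?c * (?g * (\<Sum>y\<in>gnodes p. node_weight p y * (nodal_const * node_jumps v (emap K y)))))"
  proof (rule sum_mono)
    fix K assume K: "K \<in> T"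
    have "integral ref_cube (\<lambda>y. (?w K (emap K y))\<^sup>2) \<le> (\<Sum>y\<in>gnodes p. node_weight p y * (?w K (emap K y))\<^sup>2)"
      by (rule quad_equiv(1)[OF Vhp_comp[OF w K] p])
    also have "\<dots> \<le> (\<Sum>y\<in>gnodes p. node_weight p y * (nodal_const * node_jumps v (emap K y)))"
    proof (intro sum_mono mult_left_mono)
      fix y :: "real^'n" assume y: "y \<in> gnodes p"
      show "(?w K (emap K y))\<^sup>2 \<le> nodal_const * node_jumps v (emap K y)"
        using nodal_difference[OF K, of "emap K y" v] gnodes_cube[OF y]
        by (simp add: dgsub_def oswald_props(2)[OF p K y] elem_def)
      show "0 \<le> node_weight p y" using node_weight_pos[OF p y] by simp
    qed
    finally have i: "integral ref_cube (\<lambda>y. (?w K (emap K y))\<^sup>2) \<le> (\<Sum>y\<in>gnodes p. node_weight p y * (nodal_const * node_jumps v (emap K y)))" .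
    have i0: "0 \<le> (\<Sum>y\<in>gnodes p. node_weight p y * (nodal_const * node_jumps v (emap K y)))"
      using node_weight_pos[OF p] nodal_const_pos node_jumps_nonneg by (intro sum_nonneg mult_nonneg_nonneg) (auto intro: less_imp_le)
    have "ref_inner K (\<lambda>K. grad (?w K)) (\<lambda>K. grad (?w K)) \<le> ?g * (\<Sum>y\<in>gnodes p. node_weight p y * (nodal_const * node_jumps v (emap K y)))"
      by (rule order.trans[OF grad_inverse[OF w K p] mult_left_mono[OF i g0]])
    then have "cvol K * ref_inner K (\<lambda>K. grad (?w K)) (\<lambda>K. grad (?w K)) \<le> cvol K * (?g * (\<Sum>y\<in>gnodes p. node_weight p y * (nodal_const * node_jumps v (emap K y))))"
      using cvol(1)[OF K] by (intro mult_left_mono) auto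
    also have "\<dots> \<le> ?c * (?g * (\<Sum>y\<in>gnodes p. node_weight p y * (nodal_const * node_jumps v (emap K y))))"
      by (rule mult_right_mono[OF cvol(2)[OF K] mult_nonneg_nonneg[OF g0 i0]])
    finally show "cvol K * ref_inner K (\<lambda>K. grad (?w K)) (\<lambda>K. grad (?w K)) \<le> ?c * (?g * (\<Sum>y\<in>gnodes p. node_weight p y * (nodal_const * node_jumps v (emap K y))))" .
  qed
  also have "\<dots> = ?g * nodal_const * (?c * (\<Sum>K\<in>T. \<Sum>y\<in>gnodes p. node_weight p y * node_jumps v (emap K y)))"
    by (rule pull)
  \<comment> \<open>Nodal jumps are regrouped by faces, so that \<open>face_energy\<close> applies
    to one face at a time; each face collects its nodes from all elements.\<close>
  also have "(\<Sum>K\<in>T. \<Sum>y\<in>gnodes p. node_weight p y * node_jumps v (emap K y))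
     = (\<Sum>F\<in>all_faces \<Omega> T. \<Sum>K\<in>T. \<Sum>y\<in>{y\<in>gnodes p. emap K y \<in> F}. node_weight p y * (norm (jump T v F (emap K y)))\<^sup>2)"
  proof -
    have g: "node_weight p y * node_jumps v \<xi> = (\<Sum>F\<in>all_faces \<Omega> T. if \<xi> \<in> F then node_weight p y * (norm (jump T v F \<xi>))\<^sup>2 else 0)" for y \<xi>
      unfolding node_jumps_def sum_distrib_left by (rule sum.inter_filter[OF finite_all_faces])
    have "(\<Sum>K\<in>T. \<Sum>y\<in>gnodes p. node_weight p y * node_jumps v (emap K y))
      = (\<Sum>K\<in>T. \<Sum>y\<in>gnodes p. \<Sum>F\<in>all_faces \<Omega> T. if emap K y \<in> F then node_weight p y * (norm (jump T v F (emap K y)))\<^sup>2 else 0)"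
      by (simp only: g)
    also have "\<dots> = (\<Sum>K\<in>T. \<Sum>F\<in>all_faces \<Omega> T. \<Sum>y\<in>gnodes p. if emap K y \<in> F then node_weight p y * (norm (jump T v F (emap K y)))\<^sup>2 else 0)"
      by (intro sum.cong refl sum.swap)
    also have "\<dots> = (\<Sum>F\<in>all_faces \<Omega> T. \<Sum>K\<in>T. \<Sum>y\<in>gnodes p. if emap K y \<in> F then node_weight p y * (norm (jump T v F (emap K y)))\<^sup>2 else 0)"
      by (rule sum.swap)
    also have "\<dots> = (\<Sum>F\<in>all_faces \<Omega> T. \<Sum>K\<in>T. \<Sum>y\<in>{y\<in>gnodes p. emap K y \<in> F}. node_weight p y * (norm (jump T v F (emap K y)))\<^sup>2)"
      by (intro sum.cong refl sum.inter_filter[OF finite_gnodes[OF p], symmetric])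
    finally show ?thesis .
  qed
  also have "?g * nodal_const * (?c * (\<Sum>F\<in>all_faces \<Omega> T. \<Sum>K\<in>T. \<Sum>y\<in>{y\<in>gnodes p. emap K y \<in> F}. node_weight p y * (norm (jump T v F (emap K y)))\<^sup>2))
     \<le> ?g * nodal_const * (\<Sum>F\<in>all_faces \<Omega> T. (face_scale_const * patch_bound * 2 * 3 ^ CARD('n)) * (mesh_size / (real p)\<^sup>2) * jump_energy v F)"
  proof (rule mult_left_mono)
    show "0 \<le> ?g * nodal_const" by (rule mult_nonneg_nonneg[OF g0 less_imp_le[OF nodal_const_pos]])
  qed (subst sum_distrib_left, intro sum_mono face_energy(1)[OF p _ v])
  also have "\<dots> = oswald_const * scaled_jumps p v"
    using p mesh_size_pos unfolding sum_distrib_left[symmetric] scaled_jumps_def oswald_const_def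
    by (simp add: power2_eq_square power4_eq_xxxx)
  finally show ?thesis .
qed

end

section \<open>Liftings, coercivity and stability\<close>

lemma norm_sum_square_le:
  fixes f :: "'a \<Rightarrow> 'b::real_inner"
  shows "(norm (\<Sum>s\<in>S. f s))\<^sup>2 \<le> real (card S) * (\<Sum>s\<in>S. (norm (f s))\<^sup>2)"
proof -
  have "(norm (\<Sum>s\<in>S. f s))\<^sup>2 \<le> (\<Sum>s\<in>S. norm (f s) * 1)\<^sup>2"
    using norm_sum[of f S] by (intro power_mono) auto
  also have "\<dots> \<le> (\<Sum>s\<in>S. (norm (f s))\<^sup>2) * (\<Sum>s\<in>S. 1\<^sup>2)"
    by (rule Cauchy_Schwarz_ineq_sum)
  finally show ?thesis by (simp add: mult.commute)
qed

lemma young_inner: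
  fixes a b :: "'a::real_inner"
  assumes t: "t > 0"
  shows "- (a \<bullet> b) \<le> t / 2 * (a \<bullet> a) + 1 / (2 * t) * (b \<bullet> b)"
proof -
  have "0 \<le> (t *\<^sub>R a + b) \<bullet> (t *\<^sub>R a + b)" by simp
  then have "0 \<le> t\<^sup>2 * (a \<bullet> a) + 2 * t * (a \<bullet> b) + b \<bullet> b"
    by (simp add: inner_add_left inner_add_right inner_commute[of b a] power2_eq_square algebra_simps)
  then have "- (2 * t * (a \<bullet> b)) / (2 * t) \<le> (t\<^sup>2 * (a \<bullet> a) + b \<bullet> b) / (2 * t)"
    using t by (intro divide_right_mono) auto
  then show ?thesis using t by (simp add: add_divide_distrib power2_eq_square)
qed

context dg_mesh
begin

lemma vol_int_sum:
  assumes "finite S" "\<And>s. s \<in> S \<Longrightarrow> f s \<in> VhpVec T p" and h: "h \<in> VhpVec T p"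
  shows "vol_int T (\<lambda>K x. \<Sum>s\<in>S. f s K x) h = (\<Sum>s\<in>S. vol_int T (f s) h)"
  using assms(1,2)
proof (induction S rule: finite_induct)
  case empty
  show ?case by (simp add: vol_int_def)
next
  case (insert s S)
  have "vol_int T (\<lambda>K x. f s K x + (\<Sum>s\<in>S. f s K x)) h = vol_int T (f s) h + vol_int T (\<lambda>K x. \<Sum>s\<in>S. f s K x) h"
    by (rule vol_int_add[OF _ VhpVec_sum h]) (use insert.prems in auto)
  then show ?case using insert by simp
qed

section \<open>Riesz representation behind the liftings\<close>

definition single_component :: "'n elt \<Rightarrow> 'n \<Rightarrow> (real^'n \<Rightarrow> real) \<Rightarrow> 'n dgvec" where
  "single_component K i q = (\<lambda>L x. if L = K then axis i (q (einv K x)) else 0)"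

lemma single_component_VhpVec:
  assumes K: "K \<in> T" and q: "q \<in> Qp_ref p"
  shows "single_component K i q \<in> VhpVec T p"
proof (rule VhpVecI)
  fix L k assume L: "L \<in> T"
  show "(\<lambda>y. single_component K i q L (emap L y) $ k) \<in> Qp_ref p"
  proof (cases "L = K \<and> k = i")
    case True
    then have "(\<lambda>y. single_component K i q L (emap L y) $ k) = q"
      by (simp add: single_component_def einv_emap[OF inv[OF K]])
    then show ?thesis using q by simp
  next
    case False
    then have "(\<lambda>y. single_component K i q L (emap L y) $ k) = (\<lambda>_. 0)"
      by (auto simp: single_component_def axis_def)
    then show ?thesis by simp
  qed
next
  fix L x assume "L \<notin> T"
  then show "single_component K i q L x = 0" using K by (auto simp: single_component_def)
qed

text \<open>The volume inner product is a weighted sum of scalar ones over elements and components,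
  so the scalar representation on the reference cube suffices. Existence together with uniqueness is
  what evaluates the definite descriptions in \<open>rlift\<close> and \<open>llift\<close>.\<close>

lemma riesz_dgvec:
  fixes l :: "'n dgvec \<Rightarrow> real"
  assumes add: "\<And>f g. f \<in> VhpVec T p \<Longrightarrow> g \<in> VhpVec T p \<Longrightarrow> l (\<lambda>K x. f K x + g K x) = l f + l g"
    and mul: "\<And>c f. f \<in> VhpVec T p \<Longrightarrow> l (\<lambda>K x. c *\<^sub>R f K x) = c * l f"
  shows "\<exists>!w. w \<in> VhpVec T p \<and> (\<forall>\<eta>\<in>VhpVec T p. vol_int T w \<eta> = l \<eta>)"
proof -
  have z: "(\<lambda>K x. 0) \<in> VhpVec T p" by (rule VhpVecI) simp_all
  have l0: "l (\<lambda>K x. 0) = 0" using mul[OF z, of 0] by simp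
  \<comment> \<open>Additivity over finite sums is needed at two index types: elements here,
    coordinates in \<open>lsum'\<close>.\<close>
  have lsum'': "l (\<lambda>K x. \<Sum>s\<in>S. f s K x) = (\<Sum>s\<in>S. l (f s))"
    if "finite S" "\<And>s. s \<in> S \<Longrightarrow> f s \<in> VhpVec T p" for S :: "'n elt set" and f
    using that
  proof (induction S rule: finite_induct)
    case empty
    show ?case by (simp add: l0)
  next
    case (insert s S)
    have "l (\<lambda>K x. f s K x + (\<Sum>s\<in>S. f s K x)) = l (f s) + l (\<lambda>K x. \<Sum>s\<in>S. f s K x)"
      by (rule add[OF _ VhpVec_sum]) (use insert.prems in auto)
    then show ?case using insert by simp
  qed
  have lsum': "l (\<lambda>K x. \<Sum>s\<in>S. f s K x) = (\<Sum>s\<in>S. l (f s))"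
    if "finite S" "\<And>s. s \<in> S \<Longrightarrow> f s \<in> VhpVec T p" for S :: "'n set" and f
    using that
  proof (induction S rule: finite_induct)
    case empty
    show ?case by (simp add: l0)
  next
    case (insert s S)
    have "l (\<lambda>K x. f s K x + (\<Sum>s\<in>S. f s K x)) = l (f s) + l (\<lambda>K x. \<Sum>s\<in>S. f s K x)"
      by (rule add[OF _ VhpVec_sum]) (use insert.prems in auto)
    then show ?case using insert by simp
  qed
  have ex: "\<exists>w\<in>Qp_ref p. \<forall>q\<in>Qp_ref p. integral ref_cube (\<lambda>y. w y * q y) = l (single_component K i q)" if K: "K \<in> T" for K i
  proof (rule Qp_ref_riesz)
    fix f g :: "real^'n \<Rightarrow> real" assume fg: "f \<in> Qp_ref p" "g \<in> Qp_ref p"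
    have "single_component K i (\<lambda>x. f x + g x) = (\<lambda>L x. single_component K i f L x + single_component K i g L x)"
      by (auto simp: single_component_def fun_eq_iff axis_def vec_eq_iff)
    then show "l (single_component K i (\<lambda>x. f x + g x)) = l (single_component K i f) + l (single_component K i g)"
      using add[OF single_component_VhpVec[OF K fg(1), of i] single_component_VhpVec[OF K fg(2), of i]] by simp
  next
    fix c and f :: "real^'n \<Rightarrow> real" assume f: "f \<in> Qp_ref p"
    have "single_component K i (\<lambda>x. c * f x) = (\<lambda>L x. c *\<^sub>R single_component K i f L x)"
      by (auto simp: single_component_def fun_eq_iff axis_def vec_eq_iff)
    then show "l (single_component K i (\<lambda>x. c * f x)) = c * l (single_component K i f)"
      using mul[OF single_component_VhpVec[OF K f, of i]] by simp
  qed
  define W where "W K i = (SOME w. w \<in> Qp_ref p \<and> (\<forall>q\<in>Qp_ref p. integral ref_cube (\<lambda>y. w y * q y) = l (single_component K i q)))" for K i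
  have W: "W K i \<in> Qp_ref p" "\<And>q. q \<in> Qp_ref p \<Longrightarrow> integral ref_cube (\<lambda>y. W K i y * q y) = l (single_component K i q)"
    if K: "K \<in> T" for K i
    using someI_ex[of "\<lambda>w. w \<in> Qp_ref p \<and> (\<forall>q\<in>Qp_ref p. integral ref_cube (\<lambda>y. w y * q y) = l (single_component K i q))"] ex[OF K, of i]
    unfolding W_def[symmetric] Bex_def by blast+
  \<comment> \<open>The representers \<open>W\<close> live on the reference cube; dividing by
    \<open>cvol\<close> cancels the volume factor of \<open>vol_int\<close>.\<close>
  define w where "w = (\<lambda>L x. if L \<in> T then (\<chi> i. (1 / cvol L) * W L i (einv L x)) else 0)"
  have wc: "w K (emap K y) $ i = (1 / cvol K) * W K i y" if "K \<in> T" for K y i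
    using that by (simp add: w_def einv_emap[OF inv])
  have wV: "w \<in> VhpVec T p"
  proof (rule VhpVecI)
    fix K i assume K: "K \<in> T"
    show "(\<lambda>y. w K (emap K y) $ i) \<in> Qp_ref p"
      unfolding wc[OF K] by (rule Qp_ref_cmult[OF W(1)[OF K]])
  qed (simp add: w_def)
  have wl: "vol_int T w \<eta> = l \<eta>" if \<eta>: "\<eta> \<in> VhpVec T p" for \<eta>
  proof -
    let ?q = "\<lambda>K i y. \<eta> K (emap K y) $ i"
    have q: "?q K i \<in> Qp_ref p" if "K \<in> T" for K i by (rule VhpVec_comp[OF \<eta> that])
    have rk: "cvol K * ref_inner K w \<eta> = (\<Sum>i\<in>UNIV. l (single_component K i (?q K i)))" if K: "K \<in> T" for K
    proof -
      have "ref_inner K w \<eta> = integral ref_cube (\<lambda>y. \<Sum>i\<in>UNIV. (1 / cvol K) * (W K i y * ?q K i y))"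
        unfolding ref_inner_def inner_vec_def inner_real_def wc[OF K] by (simp add: mult.assoc)
      also have "\<dots> = (\<Sum>i\<in>UNIV. integral ref_cube (\<lambda>y. (1 / cvol K) * (W K i y * ?q K i y)))"
        by (rule integral_sum[OF finite Qp_ref_integrable[OF Qp_ref_cmult[OF Qp_ref_mult[OF W(1)[OF K] q[OF K]]]]])
      also have "\<dots> = (\<Sum>i\<in>UNIV. (1 / cvol K) * l (single_component K i (?q K i)))"
        by (simp add: W(2)[OF K q[OF K]])
      finally show ?thesis using cvol(1)[OF K] by (simp add: sum_distrib_left)
    qed
    \<comment> \<open>Every field is the sum of its scalar components on single elements, and on
      these \<open>l\<close> is represented by \<open>W\<close>.\<close>
    have dec: "\<eta> = (\<lambda>L x. \<Sum>K\<in>T. \<Sum>i\<in>UNIV. single_component K i (?q K i) L x)"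
    proof (intro ext)
      fix L x
      have ax: "(\<Sum>i\<in>UNIV. axis i (v $ i)) = v" for v :: "real^'n"
        by (simp add: vec_eq_iff axis_def)
      show "\<eta> L x = (\<Sum>K\<in>T. \<Sum>i\<in>UNIV. single_component K i (?q K i) L x)"
      proof (cases "L \<in> T")
        case True
        have "(\<Sum>K\<in>T. \<Sum>i\<in>UNIV. single_component K i (?q K i) L x) = (\<Sum>K\<in>T. if L = K then \<eta> L x else 0)"
        proof (rule sum.cong[OF refl])
          fix K assume K: "K \<in> T"
          show "(\<Sum>i\<in>UNIV. single_component K i (?q K i) L x) = (if L = K then \<eta> L x else 0)"
            by (cases "L = K") (simp_all add: single_component_def emap_einv[OF inv[OF K]] ax del: split_paired_All split_paired_Ex)
        qed
        then show ?thesis using True finite_T by simp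
      next
        case False
        then have "(\<Sum>K\<in>T. \<Sum>i\<in>UNIV. single_component K i (?q K i) L x) = 0"
          by (intro sum.neutral ballI) (auto simp: single_component_def)
        then show ?thesis using VhpVec_outside[OF \<eta> False] by simp
      qed
    qed
    have "vol_int T w \<eta> = (\<Sum>K\<in>T. \<Sum>i\<in>UNIV. l (single_component K i (?q K i)))"
      unfolding vol_int_ref[OF wV \<eta>] by (rule sum.cong[OF refl rk])
    also have "\<dots> = (\<Sum>K\<in>T. l (\<lambda>L x. \<Sum>i\<in>UNIV. single_component K i (?q K i) L x))"
      by (intro sum.cong refl lsum'[symmetric] single_component_VhpVec q) auto
    also have "\<dots> = l (\<lambda>L x. \<Sum>K\<in>T. \<Sum>i\<in>UNIV. single_component K i (?q K i) L x)"
      by (intro lsum''[symmetric] finite_T VhpVec_sum single_component_VhpVec q)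
    also have "\<dots> = l \<eta>" using dec by simp
    finally show ?thesis .
  qed
  show ?thesis
  proof (rule ex1I[of _ w])
    show "w \<in> VhpVec T p \<and> (\<forall>\<eta>\<in>VhpVec T p. vol_int T w \<eta> = l \<eta>)" using wV wl by blast
    fix w' assume w': "w' \<in> VhpVec T p \<and> (\<forall>\<eta>\<in>VhpVec T p. vol_int T w' \<eta> = l \<eta>)"
    then have w'V: "w' \<in> VhpVec T p" and w'l: "\<And>\<eta>. \<eta> \<in> VhpVec T p \<Longrightarrow> vol_int T w' \<eta> = l \<eta>" by auto
    let ?d = "\<lambda>K x. w' K x + (-1) *\<^sub>R w K x"
    have s: "(\<lambda>K x. (-1) *\<^sub>R w K x) \<in> VhpVec T p" by (rule VhpVec_scale[OF wV])
    have dV: "?d \<in> VhpVec T p" by (rule VhpVec_add[OF w'V s])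
    have "vol_int T ?d ?d = 0"
      unfolding vol_int_add[OF w'V s dV] vol_int_scale w'l[OF dV] wl[OF dV] by simp
    then have sum0: "(\<Sum>K\<in>T. cvol K * ref_inner K ?d ?d) = 0" unfolding vol_int_ref[OF dV dV] .
    have rnn: "0 \<le> ref_inner K ?d ?d" if K: "K \<in> T" for K
      unfolding ref_inner_def by (rule integral_nonneg[OF Qp_ref_integrable[OF ref_inner_poly[OF dV dV K]]]) simp
    have r0: "ref_inner K ?d ?d = 0" if K: "K \<in> T" for K
    proof -
      have "\<forall>K\<in>T. cvol K * ref_inner K ?d ?d = 0"
        by (rule sum_nonneg_eq_0_iff[THEN iffD1, OF finite_T _ sum0]) (rule mult_nonneg_nonneg[OF less_imp_le[OF cvol(1)] rnn])
      then show ?thesis using K cvol(1)[OF K] by auto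
    qed
    have comp0: "w' K (emap K y) $ i = w K (emap K y) $ i" if K: "K \<in> T" for K y i
    proof -
      have c: "(\<lambda>y. ?d K (emap K y) $ i) \<in> Qp_ref p" by (rule VhpVec_comp[OF dV K])
      have "integral ref_cube (\<lambda>y. (?d K (emap K y) $ i)\<^sup>2) \<le> ref_inner K ?d ?d"
        unfolding ref_inner_def
      proof (rule integral_le)
        show "(\<lambda>y. (?d K (emap K y) $ i)\<^sup>2) integrable_on ref_cube"
          unfolding power2_eq_square by (rule Qp_ref_integrable[OF Qp_ref_mult[OF c c]])
        show "(\<lambda>y. ?d K (emap K y) \<bullet> ?d K (emap K y)) integrable_on ref_cube"
          by (rule Qp_ref_integrable[OF ref_inner_poly[OF dV dV K]])
        fix y
        have "(v $ i)\<^sup>2 \<le> v \<bullet> v" for v :: "real^'n"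
          using component_le_norm_cart[of v i] power_mono[of "\<bar>v $ i\<bar>" "norm v" 2] by (simp add: power2_norm_eq_inner)
        then show "(?d K (emap K y) $ i)\<^sup>2 \<le> ?d K (emap K y) \<bullet> ?d K (emap K y)" .
      qed
      then have "(\<lambda>y. ?d K (emap K y) $ i) = (\<lambda>_. 0)"
        by (intro Qp_ref_norm_eq_0[OF c]) (simp only: r0[OF K])
      then show ?thesis using fun_cong[of "\<lambda>y. ?d K (emap K y) $ i" "\<lambda>_. 0" y] by simp
    qed
    show "w' = w"
    proof (intro ext)
      fix K x
      show "w' K x = w K x"
      proof (cases "K \<in> T")
        case True
        have "w' K (emap K (einv K x)) = w K (emap K (einv K x))"
          using comp0[OF True, of "einv K x"] by (simp add: vec_eq_iff)
        then show ?thesis by (simp only: emap_einv[OF inv[OF True]])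
      next
        case False
        then show ?thesis by (simp add: VhpVec_outside[OF w'V] VhpVec_outside[OF wV])
      qed
    qed
  qed
qed

text \<open>Polynomial in every parametrisation of the face, since \<^const>\<open>face_integral\<close> picks an unspecified one.\<close>

definition face_poly :: "nat \<Rightarrow> (real^'n) set \<Rightarrow> (real^'n \<Rightarrow> real) \<Rightarrow> bool" where
  "face_poly p F f \<longleftrightarrow> (\<forall>K j s. K \<in> nbrs T F \<and> (s = 1 \<or> s = -1) \<and> F = emap K ` cface {j} (\<lambda>_. s) \<longrightarrow>
      (\<lambda>y. f (emap K (upd j s y))) \<in> Qp_ref p)"

lemma face_poly_add: "face_poly p F f \<Longrightarrow> face_poly p F g \<Longrightarrow> face_poly p F (\<lambda>x. f x + g x)"
  unfolding face_poly_def by (intro allI impI Qp_ref_add) blast+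

lemma face_poly_cmult: "face_poly p F f \<Longrightarrow> face_poly p F (\<lambda>x. c * f x)"
  unfolding face_poly_def by (intro allI impI Qp_ref_cmult) blast

lemma face_poly_sum: "(\<And>s. s \<in> S \<Longrightarrow> face_poly p F (f s)) \<Longrightarrow> face_poly p F (\<lambda>x. \<Sum>s\<in>S. f s x)"
  unfolding face_poly_def by (intro allI impI Qp_ref_sum) blast

lemma face_poly_mult: "face_poly p F f \<Longrightarrow> face_poly q F g \<Longrightarrow> face_poly (p + q) F (\<lambda>x. f x * g x)"
  unfolding face_poly_def by (intro allI impI Qp_ref_mult) blast+

lemma face_poly_inner:
  "(\<And>i. face_poly p F (\<lambda>x. f x $ i)) \<Longrightarrow> (\<And>i. face_poly q F (\<lambda>x. g x $ i)) \<Longrightarrow> face_poly (p + q) F (\<lambda>x. f x \<bullet> g x)"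
  unfolding inner_vec_def inner_real_def by (intro face_poly_sum face_poly_mult)

lemma face_poly_trace:
  assumes F: "F \<in> all_faces \<Omega> T" and L: "L \<in> nbrs T F" and \<eta>: "\<eta> \<in> VhpVec T p"
  shows "face_poly p F (\<lambda>x. \<eta> L x $ i)"
  unfolding face_poly_def
proof (intro allI impI, elim conjE)
  fix K j s assume "K \<in> nbrs T F" "s = 1 \<or> s = -1" "F = emap K ` cface {j} (\<lambda>_. s)"
  then show "(\<lambda>y. \<eta> L (emap K (upd j s y)) $ i) \<in> Qp_ref p"
    by (intro trace_face(1)[OF F _ L _ _ VhpVec_comp[OF \<eta> facet_of_nbr(1)[OF F L]]])
qed

lemma face_poly_jump:
  assumes F: "F \<in> all_faces \<Omega> T" and v: "v \<in> Vhp T p"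
  shows "face_poly p F (\<lambda>x. jump T v F x $ i)"
  unfolding face_poly_def by (intro allI impI, elim conjE) (rule jump_poly[OF F _ _ _ v])

lemma face_poly_avgv:
  assumes F: "F \<in> all_faces \<Omega> T" and \<eta>: "\<eta> \<in> VhpVec T p"
  shows "face_poly p F (\<lambda>x. avgv T \<eta> F x $ i)"
  unfolding avgv_def vector_scaleR_component sum_component real_scaleR_def
  by (intro face_poly_cmult face_poly_sum face_poly_trace[OF F _ \<eta>])

lemma face_poly_jumpv:
  assumes F: "F \<in> all_faces \<Omega> T" and \<eta>: "\<eta> \<in> VhpVec T p"
  shows "face_poly p F (\<lambda>x. jumpv T \<eta> F x)"
proof -
  have "face_poly p F (\<lambda>x. \<Sum>K\<in>nbrs T F. \<Sum>i\<in>UNIV. onormal K F $ i * (\<eta> K x $ i))"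
    by (intro face_poly_cmult face_poly_sum face_poly_trace[OF F _ \<eta>])
  then show ?thesis by (simp add: jumpv_def inner_vec_def mult.commute)
qed

lemma face_integral_add:
  assumes F: "F \<in> all_faces \<Omega> T" and f: "face_poly p F f" and g: "face_poly q F g"
  shows "face_integral T F (\<lambda>x. f x + g x) = face_integral T F f + face_integral T F g"
proof -
  obtain K j s where r: "K \<in> nbrs T F" "s = 1 \<or> s = -1" "F = emap K ` cface {j} (\<lambda>_. s)"
     "\<forall>g. face_integral T F g = area K j * integral ref_cube (\<lambda>y. g (emap K (upd j s y)))"
    using face_rep[OF F] by (elim exE conjE)
  have "(\<lambda>y. f (emap K (upd j s y))) \<in> Qp_ref p" "(\<lambda>y. g (emap K (upd j s y))) \<in> Qp_ref q"
    using f g r(1,2,3) unfolding face_poly_def by blast+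
  then show ?thesis
    unfolding r(4)[rule_format] by (simp add: integral_add Qp_ref_integrable distrib_left)
qed

lemma face_integral_scale: "F \<in> all_faces \<Omega> T \<Longrightarrow> face_integral T F (\<lambda>x. c * f x) = c * face_integral T F f"
proof -
  assume F: "F \<in> all_faces \<Omega> T"
  obtain K j s where r: "K \<in> nbrs T F" "s = 1 \<or> s = -1" "F = emap K ` cface {j} (\<lambda>_. s)"
     "\<forall>g. face_integral T F g = area K j * integral ref_cube (\<lambda>y. g (emap K (upd j s y)))"
    using face_rep[OF F] by (elim exE conjE)
  show ?thesis unfolding r(4)[rule_format] by simp
qed

lemma face_integral_mono:
  assumes F: "F \<in> all_faces \<Omega> T" and f: "face_poly p F f" and g: "face_poly q F g" and le: "\<And>x. f x \<le> g x"
  shows "face_integral T F f \<le> face_integral T F g"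
proof -
  obtain K j s where r: "K \<in> nbrs T F" "s = 1 \<or> s = -1" "F = emap K ` cface {j} (\<lambda>_. s)"
     "\<forall>g. face_integral T F g = area K j * integral ref_cube (\<lambda>y. g (emap K (upd j s y)))"
    using face_rep[OF F] by (elim exE conjE)
  have i: "(\<lambda>y. f (emap K (upd j s y))) \<in> Qp_ref p" "(\<lambda>y. g (emap K (upd j s y))) \<in> Qp_ref q"
    using f g r(1,2,3) unfolding face_poly_def by blast+
  have "0 < area K j" by (rule area_bounds(3)[OF facet_of_nbr(1)[OF F r(1)] facet_of_nbr(1)[OF F r(1)]])
  then show ?thesis
    unfolding r(4)[rule_format]
    by (intro mult_left_mono integral_le Qp_ref_integrable[OF i(1)] Qp_ref_integrable[OF i(2)] le) simp
qed

lemma face_integral_cong: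
  assumes F: "F \<in> all_faces \<Omega> T" and eq: "\<And>x. x \<in> F \<Longrightarrow> f x = g x"
  shows "face_integral T F f = face_integral T F g"
proof -
  obtain K j s where r: "K \<in> nbrs T F" "s = 1 \<or> s = -1" "F = emap K ` cface {j} (\<lambda>_. s)"
     "\<forall>g. face_integral T F g = area K j * integral ref_cube (\<lambda>y. g (emap K (upd j s y)))"
    using face_rep[OF F] by (elim exE conjE)
  have "emap K (upd j s y) \<in> F" if "y \<in> ref_cube" for y
  proof -
    have "upd j s y \<in> cface {j} (\<lambda>_. s)" using that r(2) by (auto simp: cface_def ref_cube_def)
    then show ?thesis unfolding r(3) by (rule imageI)
  qed
  then show ?thesis
    unfolding r(4)[rule_format] by (intro arg_cong2[of _ _ _ _ "(*)"] refl integral_cong eq)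
qed

section \<open>Discrete trace inequality for vector fields\<close>

definition trace_energy :: "'n dgvec \<Rightarrow> (real^'n) set \<Rightarrow> real" where
  "trace_energy \<eta> F = (\<Sum>L\<in>nbrs T F. face_integral T F (\<lambda>x. \<eta> L x \<bullet> \<eta> L x))"

lemma trace_energy_eq:
  assumes F: "F \<in> all_faces \<Omega> T" and \<eta>: "\<eta> \<in> VhpVec T p"
  shows "trace_energy \<eta> F = face_integral T F (\<lambda>x. \<Sum>L\<in>nbrs T F. \<eta> L x \<bullet> \<eta> L x)"
proof -
  have "face_integral T F (\<lambda>x. \<Sum>L\<in>S. \<eta> L x \<bullet> \<eta> L x) = (\<Sum>L\<in>S. face_integral T F (\<lambda>x. \<eta> L x \<bullet> \<eta> L x))"
    if "finite S" "S \<subseteq> nbrs T F" for S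
    using that
  proof (induction S rule: finite_induct)
    case empty
    show ?case using face_integral_scale[OF F, of 0 "\<lambda>x. 0"] by simp
  next
    case (insert L S)
    have fp: "face_poly (p + p) F (\<lambda>x. \<eta> M x \<bullet> \<eta> M x)" if "M \<in> nbrs T F" for M
      by (intro face_poly_inner face_poly_trace[OF F that \<eta>])
    have "face_integral T F (\<lambda>x. \<eta> L x \<bullet> \<eta> L x + (\<Sum>L\<in>S. \<eta> L x \<bullet> \<eta> L x))
       = face_integral T F (\<lambda>x. \<eta> L x \<bullet> \<eta> L x) + face_integral T F (\<lambda>x. \<Sum>L\<in>S. \<eta> L x \<bullet> \<eta> L x)"
      by (rule face_integral_add[OF F fp face_poly_sum[OF fp]]) (use insert.prems in auto)
    then show ?case using insert by simp
  qed
  from this[OF finite_nbrs subset_refl] show ?thesis by (simp add: trace_energy_def)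
qed

text \<open>The trace inequality on the cube contributes (p+1)^2 \<le> 4 p^2, and the ratio of facet
  scale to volume contributes 1/h.\<close>

lemma face_trace_energy:
  assumes F: "F \<in> all_faces \<Omega> T" and L: "L \<in> nbrs T F" and \<eta>: "\<eta> \<in> VhpVec T p" and p: "p \<ge> 1"
  shows "face_integral T F (\<lambda>x. \<eta> L x \<bullet> \<eta> L x) \<le> 4 * trace_const * ((real p)\<^sup>2 / mesh_size) * (cvol L * ref_inner L \<eta> \<eta>)"
proof -
  obtain K j s where r: "K \<in> nbrs T F" "s = 1 \<or> s = -1" "F = emap K ` cface {j} (\<lambda>_. s)"
     "\<forall>g. face_integral T F g = area K j * integral ref_cube (\<lambda>y. g (emap K (upd j s y)))"
    using face_rep[OF F] by (elim exE conjE)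
  note KT = facet_of_nbr(1)[OF F r(1)] and LT = facet_of_nbr(1)[OF F L]
  have c: "(\<lambda>y. \<eta> L (emap L y) $ i) \<in> Qp_ref p" for i by (rule VhpVec_comp[OF \<eta> LT])
  have tr: "(\<lambda>y. \<eta> L (emap K (upd j s y)) $ i) \<in> Qp_ref p" for i
    by (rule trace_face(1)[OF F r(1) L r(2,3) c])
  have sq1: "(\<lambda>y. (\<eta> L (emap K (upd j s y)) $ i)\<^sup>2) integrable_on ref_cube" for i
    unfolding power2_eq_square by (rule Qp_ref_integrable[OF Qp_ref_mult[OF tr tr]])
  have sq2: "(\<lambda>y. (\<eta> L (emap L y) $ i)\<^sup>2) integrable_on ref_cube" for i
    unfolding power2_eq_square by (rule Qp_ref_integrable[OF Qp_ref_mult[OF c c]])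
  have "integral ref_cube (\<lambda>y. \<eta> L (emap K (upd j s y)) \<bullet> \<eta> L (emap K (upd j s y)))
      = (\<Sum>i\<in>UNIV. integral ref_cube (\<lambda>y. (\<eta> L (emap K (upd j s y)) $ i)\<^sup>2))"
    unfolding inner_vec_def inner_real_def power2_eq_square[symmetric] by (rule integral_sum) (auto intro: sq1)
  also have "\<dots> \<le> (\<Sum>i\<in>UNIV. (real p + 1)\<^sup>2 * integral ref_cube (\<lambda>y. (\<eta> L (emap L y) $ i)\<^sup>2))"
    by (intro sum_mono trace_face(2)[OF F r(1) L r(2,3) c])
  also have "\<dots> = (real p + 1)\<^sup>2 * ref_inner L \<eta> \<eta>"
  proof -
    have "ref_inner L \<eta> \<eta> = (\<Sum>i\<in>UNIV. integral ref_cube (\<lambda>y. (\<eta> L (emap L y) $ i)\<^sup>2))"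
      unfolding ref_inner_def inner_vec_def inner_real_def power2_eq_square[symmetric] by (rule integral_sum) (auto intro: sq2)
    then show ?thesis by (simp add: sum_distrib_left)
  qed
  finally have t: "integral ref_cube (\<lambda>y. \<eta> L (emap K (upd j s y)) \<bullet> \<eta> L (emap K (upd j s y))) \<le> (real p + 1)\<^sup>2 * ref_inner L \<eta> \<eta>" .
  have rnn: "0 \<le> ref_inner L \<eta> \<eta>"
    unfolding ref_inner_def by (rule integral_nonneg[OF Qp_ref_integrable[OF ref_inner_poly[OF \<eta> \<eta> LT]]]) simp
  have pp: "(real p + 1)\<^sup>2 \<le> 4 * (real p)\<^sup>2"
  proof -
    have "(real p + 1)\<^sup>2 \<le> (2 * real p)\<^sup>2" using p by (intro power_mono) auto
    then show ?thesis by (simp add: power_mult_distrib)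
  qed
  have ap: "0 < area K j" "area K j \<le> trace_const * cvol L / mesh_size"
    using area_bounds(1,3)[OF KT LT, of j] mesh_size_pos by (simp_all add: pos_le_divide_eq)
  have "face_integral T F (\<lambda>x. \<eta> L x \<bullet> \<eta> L x) \<le> area K j * ((real p + 1)\<^sup>2 * ref_inner L \<eta> \<eta>)"
    unfolding r(4)[rule_format] using t ap(1) by (intro mult_left_mono) auto
  also have "\<dots> \<le> (trace_const * cvol L / mesh_size) * ((4 * (real p)\<^sup>2) * ref_inner L \<eta> \<eta>)"
    using ap rnn pp trace_const_pos cvol(1)[OF LT] mesh_size_pos by (intro mult_mono mult_right_mono) (auto intro: mult_nonneg_nonneg)
  finally show ?thesis by (simp add: mult_ac)
qed

text \<open>An element has at most two facets per coordinate direction, each with the constant 4 of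
  \<open>face_trace_energy\<close>; hence 8 times the dimension.\<close>

lemma trace_energy_sum_bound:
  assumes \<eta>: "\<eta> \<in> VhpVec T p" and p: "p \<ge> 1"
  shows "(\<Sum>F\<in>all_faces \<Omega> T. trace_energy \<eta> F) \<le> 8 * real CARD('n) * trace_const * ((real p)\<^sup>2 / mesh_size) * vol_int T \<eta> \<eta>"
proof -
  let ?X = "\<lambda>L. 4 * trace_const * ((real p)\<^sup>2 / mesh_size) * (cvol L * ref_inner L \<eta> \<eta>)"
  have X0: "0 \<le> ?X L" if L: "L \<in> T" for L
  proof -
    have "0 \<le> ref_inner L \<eta> \<eta>"
      unfolding ref_inner_def by (rule integral_nonneg[OF Qp_ref_integrable[OF ref_inner_poly[OF \<eta> \<eta> L]]]) simp
    then show ?thesis using trace_const_pos mesh_size_pos cvol(1)[OF L] by (intro mult_nonneg_nonneg) auto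
  qed
  have cardF: "card {F\<in>all_faces \<Omega> T. L \<in> nbrs T F} \<le> 2 * CARD('n)" if L: "L \<in> T" for L
  proof -
    let ?S = "(\<lambda>(j, s). emap L ` cface {j} (\<lambda>_. s)) ` ((UNIV :: 'n set) \<times> {1, -1 :: real})"
    have "{F\<in>all_faces \<Omega> T. L \<in> nbrs T F} \<subseteq> ?S"
    proof
      fix F assume "F \<in> {F\<in>all_faces \<Omega> T. L \<in> nbrs T F}"
      then have "F facet_of elem L" using facet_of_nbr(2) by simp
      then obtain j s where "s = 1 \<or> s = -1" "F = emap L ` cface {j} (\<lambda>_. s)"
        by (elim facet_of_elem[OF inv[OF L], elim_format] exE conjE)
      then show "F \<in> ?S" by (intro image_eqI[of _ _ "(j, s)"]) auto
    qed
    then have "card {F\<in>all_faces \<Omega> T. L \<in> nbrs T F} \<le> card ?S" by (intro card_mono) auto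
    also have "\<dots> \<le> card ((UNIV :: 'n set) \<times> {1, -1 :: real})" by (rule card_image_le) simp
    finally show ?thesis by (simp add: card_cartesian_product)
  qed
  have "(\<Sum>F\<in>all_faces \<Omega> T. trace_energy \<eta> F) \<le> (\<Sum>F\<in>all_faces \<Omega> T. \<Sum>L\<in>nbrs T F. ?X L)"
    unfolding trace_energy_def by (intro sum_mono face_trace_energy[OF _ _ \<eta> p])
  also have "\<dots> = (\<Sum>F\<in>all_faces \<Omega> T. \<Sum>L\<in>T. if L \<in> nbrs T F then ?X L else 0)"
  proof (rule sum.cong[OF refl])
    fix F
    have "nbrs T F = {L\<in>T. L \<in> nbrs T F}" by (auto simp: nbrs_def)
    then have "(\<Sum>L\<in>nbrs T F. ?X L) = (\<Sum>L\<in>{L\<in>T. L \<in> nbrs T F}. ?X L)" by simp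
    also have "\<dots> = (\<Sum>L\<in>T. if L \<in> nbrs T F then ?X L else 0)" by (rule sum.inter_filter[OF finite_T])
    finally show "(\<Sum>L\<in>nbrs T F. ?X L) = (\<Sum>L\<in>T. if L \<in> nbrs T F then ?X L else 0)" .
  qed
  also have "\<dots> = (\<Sum>L\<in>T. \<Sum>F\<in>all_faces \<Omega> T. if L \<in> nbrs T F then ?X L else 0)" by (rule sum.swap)
  also have "\<dots> = (\<Sum>L\<in>T. real (card {F\<in>all_faces \<Omega> T. L \<in> nbrs T F}) * ?X L)"
    by (intro sum.cong refl) (simp add: sum.inter_filter[OF finite_all_faces, symmetric])
  also have "\<dots> \<le> (\<Sum>L\<in>T. real (2 * CARD('n)) * ?X L)"
    by (intro sum_mono mult_right_mono X0) (simp only: of_nat_le_iff cardF)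
  also have "\<dots> = 8 * real CARD('n) * trace_const * ((real p)\<^sup>2 / mesh_size) * vol_int T \<eta> \<eta>"
    unfolding vol_int_ref[OF \<eta> \<eta>] sum_distrib_left by (rule sum.cong[OF refl]) simp
  finally show ?thesis .
qed

lemma avgv_square: "F \<in> all_faces \<Omega> T \<Longrightarrow> avgv T \<eta> F x \<bullet> avgv T \<eta> F x \<le> (\<Sum>L\<in>nbrs T F. \<eta> L x \<bullet> \<eta> L x)"
proof -
  assume F: "F \<in> all_faces \<Omega> T"
  let ?c = "real (card (nbrs T F))" and ?S = "\<Sum>L\<in>nbrs T F. \<eta> L x \<bullet> \<eta> L x"
  have c: "1 \<le> ?c" using card_nbrs[OF F] by simp
  have S0: "0 \<le> ?S" by (intro sum_nonneg) simp
  have "avgv T \<eta> F x \<bullet> avgv T \<eta> F x = (norm (\<Sum>L\<in>nbrs T F. \<eta> L x))\<^sup>2 / ?c\<^sup>2"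
    unfolding avgv_def by (simp add: dot_square_norm power_divide field_simps)
  also have "\<dots> \<le> (?c * ?S) / ?c\<^sup>2"
    using norm_sum_square_le[of "\<lambda>L. \<eta> L x" "nbrs T F"]
    by (intro divide_right_mono) (simp_all add: power2_norm_eq_inner)
  also have "\<dots> = ?S / ?c" using c by (simp add: power2_eq_square)
  also have "\<dots> \<le> ?S" using c S0 by (simp add: divide_le_eq mult_left_mono[of 1 ?c ?S, simplified])
  finally show ?thesis .
qed

lemma jumpv_square:
  assumes F: "F \<in> all_faces \<Omega> T"
  shows "jumpv T \<eta> F x * jumpv T \<eta> F x \<le> 2 * (\<Sum>L\<in>nbrs T F. \<eta> L x \<bullet> \<eta> L x)"
proof -
  let ?S = "\<Sum>L\<in>nbrs T F. \<eta> L x \<bullet> \<eta> L x"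
  have "(norm (\<Sum>L\<in>nbrs T F. \<eta> L x \<bullet> onormal L F))\<^sup>2 \<le> real (card (nbrs T F)) * (\<Sum>L\<in>nbrs T F. (norm (\<eta> L x \<bullet> onormal L F))\<^sup>2)"
    by (rule norm_sum_square_le)
  also have "\<dots> \<le> 2 * ?S"
  proof (intro mult_mono sum_mono sum_nonneg)
    fix L assume L: "L \<in> nbrs T F"
    have "norm (\<eta> L x \<bullet> onormal L F) \<le> norm (\<eta> L x)"
      using Cauchy_Schwarz_ineq2[of "\<eta> L x" "onormal L F"] norm_onormal[OF facet_of_nbr[OF F L]] by simp
    then have "(norm (\<eta> L x \<bullet> onormal L F))\<^sup>2 \<le> (norm (\<eta> L x))\<^sup>2" by (intro power_mono) auto
    then show "(norm (\<eta> L x \<bullet> onormal L F))\<^sup>2 \<le> \<eta> L x \<bullet> \<eta> L x" by (simp add: power2_norm_eq_inner)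
  qed (use card_nbrs[OF F] in auto)
  finally show ?thesis by (simp add: jumpv_def power2_eq_square)
qed

section \<open>Bounds for the lifting operators\<close>

definition rlift_rhs :: "'n dgfun \<Rightarrow> (real^'n) set \<Rightarrow> 'n dgvec \<Rightarrow> real" where
  "rlift_rhs u F \<eta> = - face_integral T F (\<lambda>x. inner (jump T u F x) (avgv T \<eta> F x))"

definition llift_rhs :: "real^'n \<Rightarrow> 'n dgfun \<Rightarrow> (real^'n) set \<Rightarrow> 'n dgvec \<Rightarrow> real" where
  "llift_rhs \<beta> u F \<eta> = - face_integral T F (\<lambda>x. inner \<beta> (jump T u F x) * jumpv T \<eta> F x)"

lemma face_poly_beta_jump:
  assumes F: "F \<in> all_faces \<Omega> T" and u: "u \<in> Vhp T p"
  shows "face_poly p F (\<lambda>x. \<beta> \<bullet> jump T u F x)"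
  unfolding inner_vec_def inner_real_def by (intro face_poly_sum face_poly_cmult face_poly_jump[OF F u])

text \<open>The functional is linear in the test field because all integrands are polynomial along
  the face and hence integrable, so \<open>riesz_dgvec\<close> provides its unique
  representer.\<close>

lemma rlift_spec:
  assumes F: "F \<in> all_faces \<Omega> T" and u: "u \<in> Vhp T p"
  shows "rlift T p F (jump T u F) \<in> VhpVec T p"
    and "\<eta> \<in> VhpVec T p \<Longrightarrow> vol_int T (rlift T p F (jump T u F)) \<eta> = rlift_rhs u F \<eta>"
proof -
  have "\<exists>!w. w \<in> VhpVec T p \<and> (\<forall>\<eta>\<in>VhpVec T p. vol_int T w \<eta> = rlift_rhs u F \<eta>)"
  proof (rule riesz_dgvec)
    fix f g assume f: "f \<in> VhpVec T p" and g: "g \<in> VhpVec T p"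
    have e: "avgv T (\<lambda>K x. f K x + g K x) F x = avgv T f F x + avgv T g F x" for x
      by (simp add: avgv_def sum.distrib scaleR_add_right)
    show "rlift_rhs u F (\<lambda>K x. f K x + g K x) = rlift_rhs u F f + rlift_rhs u F g"
      unfolding rlift_rhs_def e inner_add_right
      by (subst face_integral_add[OF F face_poly_inner[OF face_poly_jump[OF F u] face_poly_avgv[OF F f]]
            face_poly_inner[OF face_poly_jump[OF F u] face_poly_avgv[OF F g]]]) simp
  next
    fix c f assume f: "f \<in> VhpVec T p"
    have e: "avgv T (\<lambda>K x. c *\<^sub>R f K x) F x = c *\<^sub>R avgv T f F x" for x
      by (simp add: avgv_def scaleR_sum_right[symmetric])
    show "rlift_rhs u F (\<lambda>K x. c *\<^sub>R f K x) = c * rlift_rhs u F f"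
      unfolding rlift_rhs_def e inner_scaleR_right face_integral_scale[OF F] by simp
  qed
  from theI'[OF this] have "rlift T p F (jump T u F) \<in> VhpVec T p \<and> (\<forall>\<eta>\<in>VhpVec T p. vol_int T (rlift T p F (jump T u F)) \<eta> = rlift_rhs u F \<eta>)"
    unfolding rlift_def rlift_rhs_def .
  then show "rlift T p F (jump T u F) \<in> VhpVec T p"
    and "\<eta> \<in> VhpVec T p \<Longrightarrow> vol_int T (rlift T p F (jump T u F)) \<eta> = rlift_rhs u F \<eta>" by blast+
qed

lemma llift_spec:
  assumes F: "F \<in> all_faces \<Omega> T" and u: "u \<in> Vhp T p"
  shows "llift T p F (\<lambda>y. inner \<beta> (jump T u F y)) \<in> VhpVec T p"
    and "\<eta> \<in> VhpVec T p \<Longrightarrow> vol_int T (llift T p F (\<lambda>y. inner \<beta> (jump T u F y))) \<eta> = llift_rhs \<beta> u F \<eta>"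
proof -
  have "\<exists>!w. w \<in> VhpVec T p \<and> (\<forall>\<eta>\<in>VhpVec T p. vol_int T w \<eta> = llift_rhs \<beta> u F \<eta>)"
  proof (rule riesz_dgvec)
    fix f g assume f: "f \<in> VhpVec T p" and g: "g \<in> VhpVec T p"
    have e: "jumpv T (\<lambda>K x. f K x + g K x) F x = jumpv T f F x + jumpv T g F x" for x
      by (simp add: jumpv_def sum.distrib inner_add_left)
    show "llift_rhs \<beta> u F (\<lambda>K x. f K x + g K x) = llift_rhs \<beta> u F f + llift_rhs \<beta> u F g"
      unfolding llift_rhs_def e distrib_left
      by (subst face_integral_add[OF F face_poly_mult[OF face_poly_beta_jump[OF F u] face_poly_jumpv[OF F f]]
            face_poly_mult[OF face_poly_beta_jump[OF F u] face_poly_jumpv[OF F g]]]) simp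
  next
    fix c f assume f: "f \<in> VhpVec T p"
    have e: "jumpv T (\<lambda>K x. c *\<^sub>R f K x) F x = c * jumpv T f F x" for x
      by (simp add: jumpv_def sum_distrib_left)
    show "llift_rhs \<beta> u F (\<lambda>K x. c *\<^sub>R f K x) = c * llift_rhs \<beta> u F f"
      unfolding llift_rhs_def e mult.left_commute[of _ c] face_integral_scale[OF F] by simp
  qed
  from theI'[OF this] have "llift T p F (\<lambda>y. inner \<beta> (jump T u F y)) \<in> VhpVec T p \<and>
      (\<forall>\<eta>\<in>VhpVec T p. vol_int T (llift T p F (\<lambda>y. inner \<beta> (jump T u F y))) \<eta> = llift_rhs \<beta> u F \<eta>)"
    unfolding llift_def llift_rhs_def .
  then show "llift T p F (\<lambda>y. inner \<beta> (jump T u F y)) \<in> VhpVec T p"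
    and "\<eta> \<in> VhpVec T p \<Longrightarrow> vol_int T (llift T p F (\<lambda>y. inner \<beta> (jump T u F y))) \<eta> = llift_rhs \<beta> u F \<eta>" by blast+
qed

lemma int_faces_sub: "int_faces T \<subseteq> all_faces \<Omega> T"
  by (simp add: all_faces_def)

lemma Glift_spec:
  assumes u: "u \<in> Vhp T p"
  shows "Glift \<Omega> T p \<beta> u \<in> VhpVec T p"
    and "\<eta> \<in> VhpVec T p \<Longrightarrow> vol_int T (Glift \<Omega> T p \<beta> u) \<eta> = (\<Sum>F\<in>all_faces \<Omega> T. rlift_rhs u F \<eta>) + (\<Sum>F\<in>int_faces T. llift_rhs \<beta> u F \<eta>)"
proof -
  have fi: "finite (int_faces T)" by (rule finite_subset[OF int_faces_sub finite_all_faces])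
  have R: "(\<lambda>K x. \<Sum>F\<in>all_faces \<Omega> T. rlift T p F (jump T u F) K x) \<in> VhpVec T p"
    by (rule VhpVec_sum[OF rlift_spec(1)[OF _ u]])
  have L: "(\<lambda>K x. \<Sum>F\<in>int_faces T. llift T p F (\<lambda>y. inner \<beta> (jump T u F y)) K x) \<in> VhpVec T p"
    by (rule VhpVec_sum[OF llift_spec(1)[OF subsetD[OF int_faces_sub] u]])
  show "Glift \<Omega> T p \<beta> u \<in> VhpVec T p" unfolding Glift_def by (rule VhpVec_add[OF R L])
  assume \<eta>: "\<eta> \<in> VhpVec T p"
  have 1: "vol_int T (\<lambda>K x. \<Sum>F\<in>all_faces \<Omega> T. rlift T p F (jump T u F) K x) \<eta> = (\<Sum>F\<in>all_faces \<Omega> T. rlift_rhs u F \<eta>)"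
    by (rule trans[OF vol_int_sum[OF finite_all_faces rlift_spec(1)[OF _ u] \<eta>] sum.cong[OF refl rlift_spec(2)[OF _ u \<eta>]]])
  have 2: "vol_int T (\<lambda>K x. \<Sum>F\<in>int_faces T. llift T p F (\<lambda>y. inner \<beta> (jump T u F y)) K x) \<eta> = (\<Sum>F\<in>int_faces T. llift_rhs \<beta> u F \<eta>)"
    by (rule trans[OF vol_int_sum[OF fi llift_spec(1)[OF subsetD[OF int_faces_sub] u] \<eta>]
          sum.cong[OF refl llift_spec(2)[OF subsetD[OF int_faces_sub] u \<eta>]]])
  show "vol_int T (Glift \<Omega> T p \<beta> u) \<eta> = (\<Sum>F\<in>all_faces \<Omega> T. rlift_rhs u F \<eta>) + (\<Sum>F\<in>int_faces T. llift_rhs \<beta> u F \<eta>)"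
    unfolding Glift_def vol_int_add[OF R L \<eta>] 1 2 ..
qed

text \<open>The Young parameter t remains free so that \<open>Glift_bound\<close> can fix it for all
  faces at once.\<close>

lemma rlift_rhs_bound:
  assumes F: "F \<in> all_faces \<Omega> T" and u: "u \<in> Vhp T p" and \<eta>: "\<eta> \<in> VhpVec T p" and t: "t > 0"
  shows "rlift_rhs u F \<eta> \<le> t / 2 * jump_energy u F + 1 / (2 * t) * trace_energy \<eta> F"
proof -
  have pj: "face_poly (p + p) F (\<lambda>x. jump T u F x \<bullet> jump T u F x)"
    by (rule face_poly_inner[OF face_poly_jump[OF F u] face_poly_jump[OF F u]])
  have pe: "face_poly (p + p) F (\<lambda>x. \<Sum>L\<in>nbrs T F. \<eta> L x \<bullet> \<eta> L x)"
    by (rule face_poly_sum[OF face_poly_inner[OF face_poly_trace[OF F _ \<eta>] face_poly_trace[OF F _ \<eta>]]])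
  have pa: "face_poly (p + p) F (\<lambda>x. jump T u F x \<bullet> avgv T \<eta> F x)"
    by (rule face_poly_inner[OF face_poly_jump[OF F u] face_poly_avgv[OF F \<eta>]])
  have "rlift_rhs u F \<eta> = face_integral T F (\<lambda>x. (-1) * (jump T u F x \<bullet> avgv T \<eta> F x))"
    unfolding rlift_rhs_def face_integral_scale[OF F] by simp
  also have "\<dots> \<le> face_integral T F (\<lambda>x. t / 2 * (jump T u F x \<bullet> jump T u F x) + 1 / (2 * t) * (\<Sum>L\<in>nbrs T F. \<eta> L x \<bullet> \<eta> L x))"
  proof (rule face_integral_mono[OF F face_poly_cmult[OF pa] face_poly_add[OF face_poly_cmult[OF pj] face_poly_cmult[OF pe]]])
    fix x
    have "(-1) * (jump T u F x \<bullet> avgv T \<eta> F x) \<le> t / 2 * (jump T u F x \<bullet> jump T u F x) + 1 / (2 * t) * (avgv T \<eta> F x \<bullet> avgv T \<eta> F x)"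
      using young_inner[OF t, of "jump T u F x" "avgv T \<eta> F x"] by simp
    also have "\<dots> \<le> t / 2 * (jump T u F x \<bullet> jump T u F x) + 1 / (2 * t) * (\<Sum>L\<in>nbrs T F. \<eta> L x \<bullet> \<eta> L x)"
      using t by (intro add_left_mono mult_left_mono avgv_square[OF F]) auto
    finally show "(-1) * (jump T u F x \<bullet> avgv T \<eta> F x) \<le> t / 2 * (jump T u F x \<bullet> jump T u F x) + 1 / (2 * t) * (\<Sum>L\<in>nbrs T F. \<eta> L x \<bullet> \<eta> L x)" .
  qed
  also have "\<dots> = t / 2 * jump_energy u F + 1 / (2 * t) * trace_energy \<eta> F"
    unfolding face_integral_add[OF F face_poly_cmult[OF pj] face_poly_cmult[OF pe]] face_integral_scale[OF F] jump_energy_def trace_energy_eq[OF F \<eta>] ..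
  finally show ?thesis .
qed

lemma llift_rhs_bound:
  assumes F: "F \<in> all_faces \<Omega> T" and u: "u \<in> Vhp T p" and \<eta>: "\<eta> \<in> VhpVec T p" and t: "t > 0" and B: "norm \<beta> \<le> B"
  shows "llift_rhs \<beta> u F \<eta> \<le> t / 2 * (B\<^sup>2 * jump_energy u F) + 1 / (2 * t) * (2 * trace_energy \<eta> F)"
proof -
  have pj: "face_poly (p + p) F (\<lambda>x. jump T u F x \<bullet> jump T u F x)"
    by (rule face_poly_inner[OF face_poly_jump[OF F u] face_poly_jump[OF F u]])
  have pe: "face_poly (p + p) F (\<lambda>x. \<Sum>L\<in>nbrs T F. \<eta> L x \<bullet> \<eta> L x)"
    by (rule face_poly_sum[OF face_poly_inner[OF face_poly_trace[OF F _ \<eta>] face_poly_trace[OF F _ \<eta>]]])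
  have pa: "face_poly (p + p) F (\<lambda>x. (\<beta> \<bullet> jump T u F x) * jumpv T \<eta> F x)"
    by (rule face_poly_mult[OF face_poly_beta_jump[OF F u] face_poly_jumpv[OF F \<eta>]])
  have "llift_rhs \<beta> u F \<eta> = face_integral T F (\<lambda>x. (-1) * ((\<beta> \<bullet> jump T u F x) * jumpv T \<eta> F x))"
    unfolding llift_rhs_def face_integral_scale[OF F] by simp
  also have "\<dots> \<le> face_integral T F (\<lambda>x. (t / 2 * B\<^sup>2) * (jump T u F x \<bullet> jump T u F x) + (1 / (2 * t) * 2) * (\<Sum>L\<in>nbrs T F. \<eta> L x \<bullet> \<eta> L x))"
  proof (rule face_integral_mono[OF F face_poly_cmult[OF pa] face_poly_add[OF face_poly_cmult[OF pj] face_poly_cmult[OF pe]]])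
    fix x
    let ?a = "\<beta> \<bullet> jump T u F x" and ?b = "jumpv T \<eta> F x" and ?S = "\<Sum>L\<in>nbrs T F. \<eta> L x \<bullet> \<eta> L x"
    have "\<bar>?a\<bar> \<le> B * norm (jump T u F x)"
      by (rule order.trans[OF Cauchy_Schwarz_ineq2 mult_right_mono[OF B]]) simp
    then have "\<bar>?a\<bar>\<^sup>2 \<le> (B * norm (jump T u F x))\<^sup>2" by (intro power_mono) auto
    then have a: "?a * ?a \<le> B\<^sup>2 * (jump T u F x \<bullet> jump T u F x)"
      by (simp add: power_mult_distrib power2_norm_eq_inner power2_eq_square[of ?a])
    have "(-1) * (?a * ?b) \<le> t / 2 * (?a * ?a) + 1 / (2 * t) * (?b * ?b)"
      using young_inner[OF t, of ?a ?b] by simp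
    also have "\<dots> \<le> t / 2 * (B\<^sup>2 * (jump T u F x \<bullet> jump T u F x)) + 1 / (2 * t) * (2 * ?S)"
      using t a jumpv_square[OF F, of \<eta> x] by (intro add_mono mult_left_mono) auto
    also have "\<dots> = (t / 2 * B\<^sup>2) * (jump T u F x \<bullet> jump T u F x) + (1 / (2 * t) * 2) * ?S"
      by (simp only: mult.assoc)
    finally show "(-1) * (?a * ?b) \<le> (t / 2 * B\<^sup>2) * (jump T u F x \<bullet> jump T u F x) + (1 / (2 * t) * 2) * ?S" .
  qed
  also have "\<dots> = t / 2 * (B\<^sup>2 * jump_energy u F) + 1 / (2 * t) * (2 * trace_energy \<eta> F)"
    unfolding face_integral_add[OF F face_poly_cmult[OF pj] face_poly_cmult[OF pe]] face_integral_scale[OF F] jump_energy_def trace_energy_eq[OF F \<eta>] by (simp only: mult.assoc)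
  finally show ?thesis .
qed

lemma trace_energy_nonneg:
  assumes F: "F \<in> all_faces \<Omega> T" and \<eta>: "\<eta> \<in> VhpVec T p"
  shows "0 \<le> trace_energy \<eta> F"
proof -
  have pe: "face_poly (p + p) F (\<lambda>x. \<Sum>L\<in>nbrs T F. \<eta> L x \<bullet> \<eta> L x)"
    by (rule face_poly_sum[OF face_poly_inner[OF face_poly_trace[OF F _ \<eta>] face_poly_trace[OF F _ \<eta>]]])
  have "0 = face_integral T F (\<lambda>x. 0 * (\<Sum>L\<in>nbrs T F. \<eta> L x \<bullet> \<eta> L x))" unfolding face_integral_scale[OF F] by simp
  also have "\<dots> \<le> trace_energy \<eta> F"
    unfolding trace_energy_eq[OF F \<eta>] by (rule face_integral_mono[OF F face_poly_cmult[OF pe] pe]) (simp add: sum_nonneg)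
  finally show ?thesis .
qed

definition lift_const :: "real \<Rightarrow> real" where "lift_const B = 24 * real CARD('n) * trace_const * (1 + B\<^sup>2)"

lemma lift_const_pos: "0 < lift_const B"
proof -
  have "0 < 1 + B\<^sup>2" by (simp add: add_pos_nonneg)
  then show ?thesis using trace_const_pos by (simp add: lift_const_def)
qed

text \<open>The lifting is tested with itself. Its squared norm returns on the right through the
  traces and is absorbed by the choice of the Young parameter, leaving only jumps.\<close>

lemma Glift_bound:
  assumes u: "u \<in> Vhp T p" and p: "p \<ge> 1" and B: "norm \<beta> \<le> B"
  shows "vol_int T (Glift \<Omega> T p \<beta> u) (Glift \<Omega> T p \<beta> u) \<le> lift_const B * scaled_jumps p u"
proof -
  let ?G = "Glift \<Omega> T p \<beta> u"
  have G: "?G \<in> VhpVec T p" by (rule Glift_spec(1)[OF u])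
  let ?X = "vol_int T ?G ?G" and ?J = "\<Sum>F\<in>all_faces \<Omega> T. jump_energy u F" and ?E = "\<Sum>F\<in>all_faces \<Omega> T. trace_energy ?G F"
  define m where "m = real CARD('n) * trace_const * ((real p)\<^sup>2 / mesh_size)"
  \<comment> \<open>The trace energy enters three times, once from the averages and twice from the
    normal jumps, and is at most 8m times the squared norm; t = 24m makes 3/(2t) times 8m equal to
    1/2.\<close>
  define t where "t = 24 * m"
  have m: "0 < m" unfolding m_def using trace_const_pos mesh_size_pos p by (intro mult_pos_pos divide_pos_pos) auto
  have t: "0 < t" using m by (simp add: t_def)
  have J0: "0 \<le> jump_energy u F" if "F \<in> all_faces \<Omega> T" for F by (rule face_energy(2)[OF p that u])
  have l2nn: "0 \<le> t / 2 * (B\<^sup>2 * jump_energy u F) + 1 / (2 * t) * (2 * trace_energy ?G F)" if F: "F \<in> all_faces \<Omega> T" for F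
    using t J0[OF F] trace_energy_nonneg[OF F G] by (intro add_nonneg_nonneg mult_nonneg_nonneg) auto
  have "?X = (\<Sum>F\<in>all_faces \<Omega> T. rlift_rhs u F ?G) + (\<Sum>F\<in>int_faces T. llift_rhs \<beta> u F ?G)"
    by (rule Glift_spec(2)[OF u G])
  also have "(\<Sum>F\<in>all_faces \<Omega> T. rlift_rhs u F ?G) \<le> (\<Sum>F\<in>all_faces \<Omega> T. t / 2 * jump_energy u F + 1 / (2 * t) * trace_energy ?G F)"
    by (intro sum_mono rlift_rhs_bound[OF _ u G t])
  also have "(\<Sum>F\<in>int_faces T. llift_rhs \<beta> u F ?G) \<le> (\<Sum>F\<in>int_faces T. t / 2 * (B\<^sup>2 * jump_energy u F) + 1 / (2 * t) * (2 * trace_energy ?G F))"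
    by (intro sum_mono llift_rhs_bound[OF subsetD[OF int_faces_sub] u G t B])
  also have "(\<Sum>F\<in>int_faces T. t / 2 * (B\<^sup>2 * jump_energy u F) + 1 / (2 * t) * (2 * trace_energy ?G F))
     \<le> (\<Sum>F\<in>all_faces \<Omega> T. t / 2 * (B\<^sup>2 * jump_energy u F) + 1 / (2 * t) * (2 * trace_energy ?G F))"
    by (rule sum_mono2[OF finite_all_faces int_faces_sub]) (use l2nn in auto)
  finally have "?X \<le> (\<Sum>F\<in>all_faces \<Omega> T. t / 2 * jump_energy u F + 1 / (2 * t) * trace_energy ?G F)
     + (\<Sum>F\<in>all_faces \<Omega> T. t / 2 * (B\<^sup>2 * jump_energy u F) + 1 / (2 * t) * (2 * trace_energy ?G F))" by simp
  also have "\<dots> = t / 2 * (1 + B\<^sup>2) * ?J + 3 / (2 * t) * ?E"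
    unfolding sum.distrib sum_distrib_left[symmetric] by (simp add: field_simps)
  also have "3 / (2 * t) * ?E \<le> 3 / (2 * t) * (8 * m * ?X)"
    using trace_energy_sum_bound[OF G p] t by (intro mult_left_mono) (auto simp: m_def mult_ac)
  also have "3 / (2 * t) * (8 * m * ?X) = ?X / 2"
    using m by (simp add: t_def)
  finally have "?X \<le> t * (1 + B\<^sup>2) * ?J" by simp
  also have "\<dots> = lift_const B * scaled_jumps p u"
    by (simp add: t_def m_def lift_const_def scaled_jumps_def mult_ac)
  finally show ?thesis .
qed


section \<open>The form compared with gradient energy plus penalty\<close>

definition penalty :: "real \<Rightarrow> nat \<Rightarrow> 'n dgfun \<Rightarrow> real" where
  "penalty \<alpha> p u = (\<Sum>F\<in>all_faces \<Omega> T. face_integral T F (\<lambda>x. sigma T \<alpha> p F * (jump T u F x \<bullet> jump T u F x)))"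

text \<open>The penalty divides by the smallest size among the elements at the face, which is at
  most the mesh size.\<close>

lemma penalty_lower:
  assumes u: "u \<in> Vhp T p" and p: "p \<ge> 1" and \<alpha>: "\<alpha> \<ge> 1"
  shows "\<alpha> * scaled_jumps p u \<le> penalty \<alpha> p u"
proof -
  have "\<alpha> * scaled_jumps p u = (\<Sum>F\<in>all_faces \<Omega> T. (\<alpha> * (real p)\<^sup>2 / mesh_size) * jump_energy u F)"
    unfolding sum_distrib_left[symmetric] by (simp add: scaled_jumps_def)
  also have "\<dots> \<le> penalty \<alpha> p u"
    unfolding penalty_def
  proof (rule sum_mono)
    fix F assume F: "F \<in> all_faces \<Omega> T"
    have m: "Min (hsize ` nbrs T F) \<in> hsize ` nbrs T F"
      by (rule Min_in) (simp_all add: finite_nbrs nbrs_nonempty[OF F])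
    then obtain L where L: "L \<in> nbrs T F" "Min (hsize ` nbrs T F) = hsize L" by (elim imageE)
    note LT = facet_of_nbr(1)[OF F L(1)]
    have "\<alpha> * (real p)\<^sup>2 / mesh_size \<le> sigma T \<alpha> p F"
      unfolding sigma_def L(2) using hsize_le[OF LT] hsize_pos[OF LT] \<alpha> by (intro divide_left_mono) auto
    then have "(\<alpha> * (real p)\<^sup>2 / mesh_size) * jump_energy u F \<le> sigma T \<alpha> p F * jump_energy u F"
      by (rule mult_right_mono[OF _ face_energy(2)[OF p F u]])
    then show "(\<alpha> * (real p)\<^sup>2 / mesh_size) * jump_energy u F \<le> face_integral T F (\<lambda>x. sigma T \<alpha> p F * (jump T u F x \<bullet> jump T u F x))"
      unfolding face_integral_scale[OF F] jump_energy_def .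
  qed
  finally show ?thesis .
qed

lemma scaled_jumps_nonneg: "u \<in> Vhp T p \<Longrightarrow> p \<ge> 1 \<Longrightarrow> 0 \<le> scaled_jumps p u"
  unfolding scaled_jumps_def using face_energy(2) mesh_size_pos by (intro mult_nonneg_nonneg sum_nonneg) auto

lemma grad_energy_nonneg: "u \<in> Vhp T p \<Longrightarrow> 0 \<le> grad_energy u"
  unfolding grad_energy_def by (rule vol_int_nonneg[OF grad_VhpVec])

lemma dgform_diag:
  "dgform \<Omega> T p \<alpha> \<theta> \<beta> u u = grad_energy u + 2 * vol_int T (\<lambda>K. grad (u K)) (Glift \<Omega> T p \<beta> u) + penalty \<alpha> p u
     + \<theta> * vol_int T (Glift \<Omega> T p \<beta> u) (Glift \<Omega> T p \<beta> u)"
  unfolding dgform_def grad_energy_def penalty_def vol_int_sym[of "Glift \<Omega> T p \<beta> u" "\<lambda>K. grad (u K)"] by simp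

text \<open>The first bound keeps \<alpha> on the left, so that a threshold on \<alpha> makes the
  lifting small against the penalty, as SIPG requires. The second, without \<alpha>, is what LDG and
  the upper bound use.\<close>

lemma energy_ingredients:
  assumes u: "u \<in> Vhp T p" and p: "p \<ge> 1" and \<alpha>: "\<alpha> \<ge> 1" and B: "norm \<beta> \<le> B"
  shows "\<alpha> * vol_int T (Glift \<Omega> T p \<beta> u) (Glift \<Omega> T p \<beta> u) \<le> lift_const B * penalty \<alpha> p u"
    and "vol_int T (Glift \<Omega> T p \<beta> u) (Glift \<Omega> T p \<beta> u) \<le> lift_const B * penalty \<alpha> p u"
    and "0 \<le> vol_int T (Glift \<Omega> T p \<beta> u) (Glift \<Omega> T p \<beta> u)"
    and "2 * \<bar>vol_int T (\<lambda>K. grad (u K)) (Glift \<Omega> T p \<beta> u)\<bar>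
       \<le> grad_energy u / 2 + 2 * vol_int T (Glift \<Omega> T p \<beta> u) (Glift \<Omega> T p \<beta> u)"
    and "scaled_jumps p u \<le> penalty \<alpha> p u" and "0 \<le> penalty \<alpha> p u"
proof -
  let ?g = "vol_int T (Glift \<Omega> T p \<beta> u) (Glift \<Omega> T p \<beta> u)"
  note G = Glift_spec(1)[OF u, of \<beta>] and PJ0 = scaled_jumps_nonneg[OF u p] and S = penalty_lower[OF u p \<alpha>]
  show g0: "0 \<le> ?g" by (rule vol_int_nonneg[OF G])
  have gb: "?g \<le> lift_const B * scaled_jumps p u" by (rule Glift_bound[OF u p B])
  have "\<alpha> * ?g \<le> \<alpha> * (lift_const B * scaled_jumps p u)" using gb \<alpha> by (intro mult_left_mono) auto
  also have "\<dots> = lift_const B * (\<alpha> * scaled_jumps p u)" by (simp only: mult.left_commute)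
  also have "\<dots> \<le> lift_const B * penalty \<alpha> p u" by (rule mult_left_mono[OF S less_imp_le[OF lift_const_pos]])
  finally show ag: "\<alpha> * ?g \<le> lift_const B * penalty \<alpha> p u" .
  have "1 * ?g \<le> \<alpha> * ?g" by (rule mult_right_mono[OF \<alpha> g0])
  with ag show "?g \<le> lift_const B * penalty \<alpha> p u" by simp
  show "2 * \<bar>vol_int T (\<lambda>K. grad (u K)) (Glift \<Omega> T p \<beta> u)\<bar> \<le> grad_energy u / 2 + 2 * ?g"
    unfolding grad_energy_def by (rule vol_int_young[OF grad_VhpVec[OF u] G])
  have "1 * scaled_jumps p u \<le> \<alpha> * scaled_jumps p u" by (rule mult_right_mono[OF \<alpha> PJ0])
  with S show "scaled_jumps p u \<le> penalty \<alpha> p u" by simp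
  with PJ0 show "0 \<le> penalty \<alpha> p u" by simp
qed

text \<open>For SIPG the threshold bounds four squared lifting norms by the penalty, so the cross
  term takes at most half of the gradient energy and half of the penalty. For LDG the form is the
  squared norm of gradient plus lifting, plus the penalty; the gradient is recovered by removing the
  lifting, which the penalty controls. Nonnegativity serves the infimum and the enlargement of
  constants.\<close>

lemma coercive:
  assumes u: "u \<in> Vhp T p" and p: "p \<ge> 1" and \<alpha>: "\<alpha> \<ge> 1" and B: "norm \<beta> \<le> B"
    and \<theta>: "\<theta> = 0 \<and> 4 * lift_const B \<le> \<alpha> \<or> \<theta> = 1"
  shows "grad_energy u + penalty \<alpha> p u \<le> (2 * lift_const B + 2) * dgform \<Omega> T p \<alpha> \<theta> \<beta> u u" and "0 \<le> dgform \<Omega> T p \<alpha> \<theta> \<beta> u u"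
proof -
  let ?g = "vol_int T (Glift \<Omega> T p \<beta> u) (Glift \<Omega> T p \<beta> u)" and ?A = "dgform \<Omega> T p \<alpha> \<theta> \<beta> u u"
    and ?I = "vol_int T (\<lambda>K. grad (u K)) (Glift \<Omega> T p \<beta> u)"
  note E = energy_ingredients[OF u p \<alpha> B] and D0 = grad_energy_nonneg[OF u] and c0 = lift_const_pos[of B]
  have "grad_energy u + penalty \<alpha> p u \<le> (2 * lift_const B + 2) * ?A \<and> 0 \<le> ?A"
    using \<theta>
  proof (elim disjE conjE)
    assume \<theta>: "\<theta> = 0" and a: "4 * lift_const B \<le> \<alpha>"
    have "4 * lift_const B * ?g \<le> \<alpha> * ?g" by (rule mult_right_mono[OF a E(3)])
    then have "lift_const B * (4 * ?g) \<le> lift_const B * penalty \<alpha> p u" using E(1) by (simp add: mult_ac)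
    then have "4 * ?g \<le> penalty \<alpha> p u" using c0 by (simp only: mult_le_cancel_left_pos)
    then have A: "grad_energy u + penalty \<alpha> p u \<le> 2 * ?A"
      unfolding dgform_diag \<theta> using E(4) by (simp add: abs_le_iff abs_if split: if_splits)
    then have A0: "0 \<le> ?A" using D0 E(6) by linarith
    have "2 * ?A \<le> (2 * lift_const B + 2) * ?A" using c0 by (intro mult_right_mono A0) simp
    with A A0 show ?thesis by linarith
  next
    assume \<theta>: "\<theta> = 1"
    let ?N = "grad_energy u + 2 * ?I + ?g"
    have A: "?A = ?N + penalty \<alpha> p u" unfolding dgform_diag \<theta> by simp
    have N0: "0 \<le> ?N"
      using vol_int_nonneg[OF VhpVec_add[OF grad_VhpVec[OF u] Glift_spec(1)[OF u, of \<beta>]]]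
      unfolding vol_int_add_square[OF grad_VhpVec[OF u] Glift_spec(1)[OF u, of \<beta>]] grad_energy_def .
    have "grad_energy u \<le> 2 * ?N + 2 * ?g" using E(4) by (simp add: abs_if split: if_splits)
    then have "grad_energy u + penalty \<alpha> p u \<le> 2 * ?N + 2 * (lift_const B * penalty \<alpha> p u) + penalty \<alpha> p u" using E(2) by linarith
    also have "\<dots> \<le> (2 * lift_const B + 2) * ?N + (2 * lift_const B + 2) * penalty \<alpha> p u"
      using mult_nonneg_nonneg[OF less_imp_le[OF c0] N0] E(6) by (simp add: algebra_simps)
    finally have "grad_energy u + penalty \<alpha> p u \<le> (2 * lift_const B + 2) * ?A" unfolding A distrib_left .
    moreover have "0 \<le> ?A" unfolding A using N0 E(6) by (rule add_nonneg_nonneg)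
    ultimately show ?thesis ..
  qed
  then show "grad_energy u + penalty \<alpha> p u \<le> (2 * lift_const B + 2) * ?A" "0 \<le> ?A" by simp_all
qed

text \<open>The cross term contributes two squared lifting norms and the \<theta>-term one, hence
  the 3 before \<open>lift_const B\<close>.\<close>

lemma dgform_upper:
  assumes u: "u \<in> Vhp T p" and p: "p \<ge> 1" and \<alpha>: "\<alpha> \<ge> 1" and B: "norm \<beta> \<le> B" and \<theta>: "0 \<le> \<theta>" "\<theta> \<le> 1"
  shows "dgform \<Omega> T p \<alpha> \<theta> \<beta> u u \<le> 3 / 2 * grad_energy u + (3 * lift_const B + 1) * penalty \<alpha> p u"
proof -
  note E = energy_ingredients[OF u p \<alpha> B]
  have "\<theta> * vol_int T (Glift \<Omega> T p \<beta> u) (Glift \<Omega> T p \<beta> u) \<le> 1 * vol_int T (Glift \<Omega> T p \<beta> u) (Glift \<Omega> T p \<beta> u)"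
    by (rule mult_right_mono[OF \<theta>(2) E(3)])
  then show ?thesis
    unfolding dgform_diag distrib_right using E(2,4) by (simp add: abs_if split: if_splits)
qed

section \<open>Stability of the splitting\<close>

lemma jump_VC:
  assumes Q: "Q \<in> VC \<Omega> T p" and F: "F \<in> all_faces \<Omega> T" and x: "x \<in> F"
  shows "jump T Q F x = 0"
proof -
  from Q obtain g where g: "\<And>K x. K \<in> T \<Longrightarrow> x \<in> elem K \<Longrightarrow> Q K x = g x" "\<And>x. x \<in> frontier \<Omega> \<Longrightarrow> g x = 0"
    unfolding VC_def mem_Collect_eq by (elim conjE exE) simp
  show ?thesis
  proof (cases rule: all_faces_cases[OF F])
    case (1 K K')
    have "x \<in> elem K" "x \<in> elem K'" using x facet_of_imp_subset[OF 1(4)] 1(5) by blast+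
    then show ?thesis using jump_interior[OF 1(1-5), of Q x] g(1)[OF 1(1)] g(1)[OF 1(2)] by simp
  next
    case (2 K)
    have "x \<in> elem K" "x \<in> frontier \<Omega>" using x facet_of_imp_subset[OF 2(2)] 2(3) by blast+
    then show ?thesis using jump_boundary[OF 2(1-3), of Q x] g(1)[OF 2(1)] g(2) by simp
  qed
qed

lemma penalty_VC: "Q \<in> VC \<Omega> T p \<Longrightarrow> penalty \<alpha> p Q = 0"
proof -
  assume Q: "Q \<in> VC \<Omega> T p"
  have "face_integral T F (\<lambda>x. sigma T \<alpha> p F * (jump T Q F x \<bullet> jump T Q F x)) = 0" if F: "F \<in> all_faces \<Omega> T" for F
    using face_integral_cong[OF F, of "\<lambda>x. sigma T \<alpha> p F * (jump T Q F x \<bullet> jump T Q F x)" "\<lambda>x. 0 * 0"] jump_VC[OF Q F]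
      face_integral_scale[OF F, of 0 "\<lambda>_. 0"] by simp
  then show ?thesis by (simp add: penalty_def)
qed

text \<open>A conforming function has no jumps on any face, so the penalty is unchanged exactly and
  no dependence on \<alpha> can arise here.\<close>

lemma penalty_dgsub_VC: "Q \<in> VC \<Omega> T p \<Longrightarrow> penalty \<alpha> p (dgsub v Q) = penalty \<alpha> p v"
  unfolding penalty_def
proof (rule sum.cong[OF refl])
  fix F assume Q: "Q \<in> VC \<Omega> T p" and F: "F \<in> all_faces \<Omega> T"
  show "face_integral T F (\<lambda>x. sigma T \<alpha> p F * (jump T (dgsub v Q) F x \<bullet> jump T (dgsub v Q) F x))
      = face_integral T F (\<lambda>x. sigma T \<alpha> p F * (jump T v F x \<bullet> jump T v F x))"
  proof (rule face_integral_cong[OF F])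
    fix x assume x: "x \<in> F"
    have "jump T (dgsub v Q) F x = jump T v F x - jump T Q F x"
      by (simp add: jump_def dgsub_def scaleR_diff_left sum_subtractf)
    then show "sigma T \<alpha> p F * (jump T (dgsub v Q) F x \<bullet> jump T (dgsub v Q) F x) = sigma T \<alpha> p F * (jump T v F x \<bullet> jump T v F x)"
      using jump_VC[OF Q F x] by simp
  qed
qed

lemma grad_energy_dgsub:
  assumes v: "v \<in> Vhp T p" and w: "w \<in> Vhp T p"
  shows "grad_energy (dgsub v w) \<le> 3 / 2 * grad_energy v + 3 * grad_energy w"
proof -
  note gv = grad_VhpVec[OF v] and gw = grad_VhpVec[OF w]
  let ?f = "\<lambda>K. grad (v K)" and ?g = "\<lambda>K x. (-1) *\<^sub>R grad (w K) x"
  have "(\<lambda>K. grad (dgsub v w K)) = (\<lambda>K x. ?f K x + ?g K x)"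
    by (intro ext) (simp add: grad_dgsub[OF v w])
  then have "grad_energy (dgsub v w) = grad_energy v + 2 * vol_int T ?f ?g + vol_int T ?g ?g"
    unfolding grad_energy_def using vol_int_add_square[OF gv VhpVec_scale[OF gw, of "-1"]] by simp
  also have "vol_int T ?g ?g = grad_energy w"
    by (simp add: grad_energy_def vol_int_def)
  also have "2 * vol_int T ?f ?g \<le> grad_energy v / 2 + 2 * grad_energy w"
    using vol_int_young[OF gv VhpVec_scale[OF gw, of "-1"]] \<open>vol_int T ?g ?g = grad_energy w\<close> unfolding grad_energy_def by simp
  finally show ?thesis by simp
qed

text \<open>The first factor collects the upper bounds for both parts of the splitting, the second
  is the coercivity constant.\<close>

definition split_const :: "real \<Rightarrow> real" where
  "split_const B = (6 * oswald_const + 3 * lift_const B + 4) * (2 * lift_const B + 2)"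

lemma oswald_stable:
  assumes v: "v \<in> Vhp T p" and p: "p \<ge> 1" and \<alpha>: "\<alpha> \<ge> 1" and B: "norm \<beta> \<le> B"
    and \<theta>: "\<theta> = 0 \<and> 4 * lift_const B \<le> \<alpha> \<or> \<theta> = 1"
  shows "dgform \<Omega> T p \<alpha> \<theta> \<beta> (dgsub v (oswald \<Omega> T p v)) (dgsub v (oswald \<Omega> T p v))
     + dgform \<Omega> T p \<alpha> \<theta> \<beta> (oswald \<Omega> T p v) (oswald \<Omega> T p v) \<le> split_const B * dgform \<Omega> T p \<alpha> \<theta> \<beta> v v"
proof -
  let ?Q = "oswald \<Omega> T p v"
  let ?w = "dgsub v ?Q"
  have QC: "?Q \<in> VC \<Omega> T p" by (rule oswald_props(1)[OF p])
  then have Q: "?Q \<in> Vhp T p" by (simp add: VC_def)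
  have w: "?w \<in> Vhp T p" by (rule dgsub_Vhp[OF v Q])
  have th: "0 \<le> \<theta>" "\<theta> \<le> 1" using \<theta> by auto
  \<comment> \<open>Seen as v minus the averaging error, the interpolant inherits a gradient bound
    without an analysis of its own.\<close>
  have "?Q = dgsub v ?w" by (simp add: dgsub_def)
  then have DQ: "grad_energy ?Q \<le> 3 / 2 * grad_energy v + 3 * grad_energy ?w" using grad_energy_dgsub[OF v w] by simp
  have "oswald_const * scaled_jumps p v \<le> oswald_const * penalty \<alpha> p v"
    by (rule mult_left_mono[OF energy_ingredients(5)[OF v p \<alpha> B] less_imp_le[OF oswald_const_pos]])
  then have Dw: "grad_energy ?w \<le> oswald_const * penalty \<alpha> p v" using oswald_energy[OF p v] by linarith
  have uw: "dgform \<Omega> T p \<alpha> \<theta> \<beta> ?w ?w \<le> 3 / 2 * grad_energy ?w + (3 * lift_const B + 1) * penalty \<alpha> p v"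
    using dgform_upper[OF w p \<alpha> B th] unfolding penalty_dgsub_VC[OF QC] .
  have uQ: "dgform \<Omega> T p \<alpha> \<theta> \<beta> ?Q ?Q \<le> 3 / 2 * grad_energy ?Q"
    using dgform_upper[OF Q p \<alpha> B th] unfolding penalty_VC[OF QC] by simp
  have D0: "0 \<le> grad_energy v" and S0: "0 \<le> penalty \<alpha> p v"
    by (rule grad_energy_nonneg[OF v], rule energy_ingredients(6)[OF v p \<alpha> B])
  \<comment> \<open>The 6 is 3/2 from \<open>?w\<close> plus 3/2 times 3 from \<open>?Q\<close>; the
    9/4 is 3/2 times 3/2.\<close>
  have "dgform \<Omega> T p \<alpha> \<theta> \<beta> ?w ?w + dgform \<Omega> T p \<alpha> \<theta> \<beta> ?Q ?Q
     \<le> 6 * (oswald_const * penalty \<alpha> p v) + 9 / 4 * grad_energy v + (3 * lift_const B + 1) * penalty \<alpha> p v"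
    using uw uQ DQ Dw by linarith
  also have "\<dots> \<le> (6 * oswald_const + 3 * lift_const B + 4) * grad_energy v + (6 * oswald_const + 3 * lift_const B + 4) * penalty \<alpha> p v"
    using D0 S0 mult_nonneg_nonneg[OF less_imp_le[OF oswald_const_pos] D0] mult_nonneg_nonneg[OF less_imp_le[OF lift_const_pos[of B]] D0]
    by (simp add: algebra_simps)
  also have "\<dots> = (6 * oswald_const + 3 * lift_const B + 4) * (grad_energy v + penalty \<alpha> p v)" by (simp only: distrib_left)
  also have "\<dots> \<le> (6 * oswald_const + 3 * lift_const B + 4) * ((2 * lift_const B + 2) * dgform \<Omega> T p \<alpha> \<theta> \<beta> v v)"
    using coercive(1)[OF v p \<alpha> B \<theta>] oswald_const_pos lift_const_pos[of B] by (intro mult_left_mono) auto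
  finally show ?thesis by (simp only: split_const_def mult.assoc)
qed

text \<open>At a node interior to an element only that element contributes to the average, and the
  node is off the boundary, so averaging changes nothing there.\<close>

lemma dgsub_oswald_VB:
  assumes v: "v \<in> Vhp T p" and p: "p \<ge> 1"
  shows "dgsub v (oswald \<Omega> T p v) \<in> VB T p"
proof -
  let ?Q = "oswald \<Omega> T p v"
  have "?Q \<in> VC \<Omega> T p" by (rule oswald_props(1)[OF p])
  then have Q: "?Q \<in> Vhp T p" by (simp add: VC_def)
  have "dgsub v ?Q K \<xi> = 0" if K: "K \<in> T" and x: "\<xi> \<in> int_nodes K p" for K \<xi>
  proof -
    from x obtain y where y: "\<xi> = emap K y" "y \<in> gnodes p" "\<forall>i. -1 < y $ i \<and> y $ i < 1"
      unfolding int_nodes_def gnodes_def by (elim imageE) simp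
    have int: "\<xi> \<in> interior (elem K)" unfolding interior_elem[OF inv[OF K]] y(1) using y(3) by simp
    then have "\<xi> \<in> \<Omega>" using interior_elem_sub[OF K] by blast
    then have nf: "\<xi> \<notin> frontier \<Omega>" using frontier_notin[of \<xi>] by fast
    have "{K'\<in>T. \<xi> \<in> elem K'} = {K}"
    proof (intro equalityI subsetI)
      fix K' assume "K' \<in> {K'\<in>T. \<xi> \<in> elem K'}"
      then show "K' \<in> {K}" using elem_unique[OF K _ int, of K'] by simp
    qed (use K int interior_subset in auto)
    then have "nodal_avg v \<xi> = v K \<xi>" using nf by (simp add: nodal_avg_def)
    then show ?thesis using oswald_props(2)[OF p K y(2), of v] y(1) by (simp add: dgsub_def)
  qed
  then show ?thesis using dgsub_Vhp[OF v Q] unfolding VB_def by blast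
qed

lemma splitting_stable:
  assumes v: "v \<in> Vhp T p" and p: "p \<ge> 1" and \<alpha>: "\<alpha> \<ge> 1" and B: "norm \<beta> \<le> B"
    and \<theta>: "\<theta> = 0 \<and> 4 * lift_const B \<le> \<alpha> \<or> \<theta> = 1"
  shows "Inf {dgform \<Omega> T p \<alpha> \<theta> \<beta> vB vB + dgform \<Omega> T p \<alpha> \<theta> \<beta> vC vC | vB vC.
           vB \<in> VB T p \<and> vC \<in> VC \<Omega> T p \<and> dgadd vB vC = v} \<le> split_const B * dgform \<Omega> T p \<alpha> \<theta> \<beta> v v" (is "Inf ?S \<le> _")
proof -
  let ?Q = "oswald \<Omega> T p v"
  have "dgadd (dgsub v ?Q) ?Q = v" by (simp add: dgadd_def dgsub_def)
  then have m: "dgform \<Omega> T p \<alpha> \<theta> \<beta> (dgsub v ?Q) (dgsub v ?Q) + dgform \<Omega> T p \<alpha> \<theta> \<beta> ?Q ?Q \<in> ?S"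
    using dgsub_oswald_VB[OF v p] oswald_props(1)[OF p, of v] by blast
  \<comment> \<open>The infimum lies below a member only for a set bounded below; coercivity
    supplies the bound 0.\<close>
  have b: "bdd_below ?S"
  proof (rule bdd_belowI[of _ 0])
    fix z assume "z \<in> ?S"
    then obtain vB vC where z: "z = dgform \<Omega> T p \<alpha> \<theta> \<beta> vB vB + dgform \<Omega> T p \<alpha> \<theta> \<beta> vC vC" "vB \<in> VB T p" "vC \<in> VC \<Omega> T p"
      by blast
    then have "vB \<in> Vhp T p" "vC \<in> Vhp T p" by (simp_all add: VB_def VC_def)
    then show "0 \<le> z" unfolding z(1) by (intro add_nonneg_nonneg coercive(2)[OF _ p \<alpha> B \<theta>])
  qed
  show ?thesis by (rule order.trans[OF cInf_lower[OF m b] oswald_stable[OF v p \<alpha> B \<theta>]])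
qed

end

theorem theorem4p3:
  fixes csr cqu B\<beta> \<theta> :: real
  assumes "\<theta> = 0 \<or> \<theta> = 1"
  shows "\<exists>\<alpha>0\<ge>1. \<exists>C>0. \<forall>(\<Omega>::(real^'n::finite) set) T p \<alpha> \<beta> v.
     admissible_mesh \<Omega> T csr cqu \<and> p \<ge> 2 \<and> \<alpha> \<ge> 1 \<and>
     (if \<theta> = 0 then \<beta> = 0 \<and> \<alpha> \<ge> \<alpha>0 else norm \<beta> \<le> B\<beta>) \<and>
     v \<in> Vhp T p \<longrightarrow>
       dgform \<Omega> T p \<alpha> \<theta> \<beta> (dgsub v (oswald \<Omega> T p v)) (dgsub v (oswald \<Omega> T p v))
         + dgform \<Omega> T p \<alpha> \<theta> \<beta> (oswald \<Omega> T p v) (oswald \<Omega> T p v)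
         \<le> C * dgform \<Omega> T p \<alpha> \<theta> \<beta> v v
     \<and> Inf {dgform \<Omega> T p \<alpha> \<theta> \<beta> vB vB + dgform \<Omega> T p \<alpha> \<theta> \<beta> vC vC | vB vC.
              vB \<in> VB T p \<and> vC \<in> VC \<Omega> T p \<and> dgadd vB vC = v}
         \<le> C * dgform \<Omega> T p \<alpha> \<theta> \<beta> v v"
proof -
  \<comment> \<open>Outside the locale these constants are terms in \<open>csr\<close>,
    \<open>cqu\<close>, the index type and the bound on \<beta> alone, which is what allows them to
    be chosen before mesh, degree and \<alpha>.\<close>
  let ?lift_const = "dg_mesh.lift_const TYPE('n) csr cqu \<bar>B\<beta>\<bar>" and ?split_const = "dg_mesh.split_const TYPE('n) csr cqu \<bar>B\<beta>\<bar>"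
  \<comment> \<open>The maxima with 1 provide a threshold of at least 1 and a positive constant.
    Enlarging the constant is harmless because the form is nonnegative at v.\<close>
  let ?a = "max 1 (4 * ?lift_const)" and ?C = "max 1 ?split_const"
  have main: "dgform \<Omega> T p \<alpha> \<theta> \<beta> (dgsub v (oswald \<Omega> T p v)) (dgsub v (oswald \<Omega> T p v))
         + dgform \<Omega> T p \<alpha> \<theta> \<beta> (oswald \<Omega> T p v) (oswald \<Omega> T p v)
         \<le> ?C * dgform \<Omega> T p \<alpha> \<theta> \<beta> v v
     \<and> Inf {dgform \<Omega> T p \<alpha> \<theta> \<beta> vB vB + dgform \<Omega> T p \<alpha> \<theta> \<beta> vC vC | vB vC.
              vB \<in> VB T p \<and> vC \<in> VC \<Omega> T p \<and> dgadd vB vC = v}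
         \<le> ?C * dgform \<Omega> T p \<alpha> \<theta> \<beta> v v"
    if adm: "admissible_mesh \<Omega> T csr cqu" and p2: "p \<ge> 2" and \<alpha>: "\<alpha> \<ge> 1"
      and par: "if \<theta> = 0 then \<beta> = 0 \<and> \<alpha> \<ge> ?a else norm \<beta> \<le> B\<beta>" and v: "v \<in> Vhp T p"
    for \<Omega> :: "(real^'n) set" and T p \<alpha> \<beta> v
  proof -
    interpret dg_mesh \<Omega> T csr cqu by unfold_locales (rule adm)
    have p: "p \<ge> 1" using p2 by simp
    \<comment> \<open>The modulus is taken because for \<theta> = 0 nothing is known about the sign
      of \<open>B\<beta>\<close>, and \<beta> = 0 must still satisfy the bound.\<close>
    have B: "norm \<beta> \<le> \<bar>B\<beta>\<bar>" using par by (simp split: if_splits)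
    have \<theta>: "\<theta> = 0 \<and> 4 * ?lift_const \<le> \<alpha> \<or> \<theta> = 1" using par assms by auto
    have "?split_const * dgform \<Omega> T p \<alpha> \<theta> \<beta> v v \<le> ?C * dgform \<Omega> T p \<alpha> \<theta> \<beta> v v"
      by (rule mult_right_mono[OF max.cobounded2 coercive(2)[OF v p \<alpha> B \<theta>]])
    then show ?thesis
      by (intro conjI order.trans[OF oswald_stable[OF v p \<alpha> B \<theta>]] order.trans[OF splitting_stable[OF v p \<alpha> B \<theta>]])
  qed
  show ?thesis
    by (rule exI[of _ ?a], rule conjI[OF _ exI[of _ ?C]], simp, rule conjI, simp) (use main in blast)
qed

end
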